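(* Let $a,b\in\mathbb R$ with $2a(a+b)=1$, let $\mathcal V=\mathcal V^{ia}_{(b)}$, and let $X_1,\dots,X_n$ be fields in the OPE family $\mathcal F_{(b)}$. In the $(\mathbb H,\infty)$-uniformization (that is, $D=\mathbb H$, $q=\infty$, all fields evaluated in the identity chart of $\mathbb H$), for distinct points $z,z_1,\dots,z_n\in\mathbb H$, $$\frac1{2a^2}\,\partial_z^2\,\mathbf E[\mathcal V(z)X_1(z_1)\cdots X_n(z_n)]=\mathbf E\big[\mathcal V(z)\,\mathcal L^+_{v_z}[X_1(z_1)\cdots X_n(z_n)]\big]+\mathbf E\big[\mathcal L^-_{v_{\bar z}}[\mathcal V(z)X_1(z_1)\cdots X_n(z_n)]\big],$$ where $v_z(\zeta)=1/(z-\zeta)$ and $v_{\bar z}(\zeta)=1/(\bar z-\zeta)$.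
   Context: Correlation functionals. Let $D=\mathbb H$, $G(\zeta,z)=\log|(\zeta-\bar z)/(\zeta-z)|$, and let $\Phi_{(0)}$ be the (formal) Gaussian free field. Functionals are finite linear combinations of commutative Wick products $\odot$ of $1$, of $\partial^j\bar\partial^k\Phi_{(0)}(z)$ and of $e^{\odot\alpha\Phi_{(0)}(z)}=\sum_n\alpha^n\Phi_{(0)}^{\odot n}(z)/n!$; the points $z$ are the nodes. $\mathbf E$ is linear, $\mathbf E[1]=1$, and $\mathbf E$ of a Wick product of one or more derivatives of $\Phi_{(0)}$ is $0$. The product of functionals with disjoint node sets is given by Wick's formula: the sum over all partial pairings of the factors with no pair inside one functional, of the product of pair expectations $\mathbf E[\partial^j\bar\partial^k\Phi_{(0)}(\zeta)\partial^l\bar\partial^m\Phi_{(0)}(z)]=2\,\partial_\zeta^j\bar\partial_\zeta^k\partial_z^l\bar\partial_z^mG(\zeta,z)$ times the Wick product of unpaired factors. Equalities and limits are understood in correlations with functionals having other nodes. Fields. A non-random conformal field assigns to each local chart $\phi$ a smooth function $(f\|\phi)$. A Fock space field is a linear combination, with non-random conformal fields as coefficients, of Wick products of derivatives (in local charts) and Wick exponentials of $\Phi_{(0)}$; its value $(X\|\phi)(z)$ is a functional. The operator product expansion of $X$ and $Y$ is the asymptotic expansion of $X(\zeta)Y(z)$ as $\zeta\to z$ (in correlations, same chart at both points, in powers of $\zeta-z$, $\bar\zeta-\bar z$, $|\zeta-z|$ and of $\log|\zeta-z|$); the OPE product $X*Y$ is the coefficient of $1$ (when defined). For holomorphic $X$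 the expansion is a Laurent series in $\zeta-z$. Modified free field. With $w:(\mathbb H,\infty)\to(\mathbb H,\infty)$ conformal, written as $w\circ\phi^{-1}$ in a chart $\phi$ (so $\arg w'=0$ in the identity chart for $w=\mathrm{id}$, but not in other charts), put $\Phi_{(b)}=\Phi_{(0)}-2b\arg w'$. $\mathcal F_{(b)}$ is the algebra over $\mathbb C$ spanned by the generators $1$, $\partial^j\bar\partial^k\Phi_{(b)}$, $\partial^j\bar\partial^ke^{*\alpha\Phi_{(b)}}$ ($\alpha\in\mathbb C$) under OPE multiplication. The vertex field is $\mathcal V^\alpha_{(b)}=e^{*\alpha\Phi_{(b)}}=\sum_n\frac{\alpha^n}{n!}\Phi_{(b)}^{*n}=e^{-2\alpha b\arg w'}C^{\alpha^2}e^{\odot\alpha\Phi_{(0)}}$ with $C=|(w-\overline w)/w'|$. Lie derivatives. A vector field is a $(-1,0)$-differential. For a vector field $v$ holomorphic near the nodes, with local flow $\psi_t$, $\mathcal L_v[X_1(z_1)\cdots X_n(z_n)]=\frac d{dt}|_{t=0}\prod_j(X_j\,\|\,\phi_j\circ\psi_{-t})(z_j)$, where $\phi_j$ is the chart used at the $j$-th node. Its $\mathbb C$-linear and antilinear parts in $v$ are $\mathcal L_v^\pm=\frac12(\mathcal L_v\mp i\mathcal L_{iv})$. The expression $\mathcal L^-_{v_{\bar z}}[\mathcal V(z)X_1(z_1)\cdots X_n(z_n)]$ is obtained by acting with the fixed vector field $v_{\bar z}$, which is holomorphic in $\mathbb H$, on all nodes including $z$; $\mathcal L^+_{v_z}$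 acts only at the nodes $z_1,\dots,z_n$. *)

theory Defs
  imports "HOL-Analysis.Analysis" "HOL-Library.Multiset"
begin

definition dz :: "(complex \<Rightarrow> complex) \<Rightarrow> complex \<Rightarrow> complex" where
  "dz f z = (frechet_derivative f (at z) 1 - \<i> * frechet_derivative f (at z) \<i>) / 2"

definition dzbar :: "(complex \<Rightarrow> complex) \<Rightarrow> complex \<Rightarrow> complex" where
  "dzbar f z = (frechet_derivative f (at z) 1 + \<i> * frechet_derivative f (at z) \<i>) / 2"

text \<open>A local chart \<open>\<phi> : U \<rightarrow> \<phi>(U)\<close>, with U an open subset of the upper half-plane, is encoded by its
  inverse \<open>par = \<phi>\<inverse>\<close> together with a branch \<open>lg\<close> of the logarithm of the derivative of \<open>\<phi>\<inverse>\<close>. The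
  branch is part of the data because the modified free field involves the argument of this
  derivative, which is multivalued in a general chart. No domain is recorded: \<open>chart_at c z\<close> says
  that c is a chart near the coordinate z, and the set of all such z is open. For a field X, the
  value \<open>(X \<parallel> \<phi>)(z)\<close> is \<open>X c z\<close>, where z is a coordinate and \<open>par c z\<close> is the node.\<close>

record chart =
  par :: "complex \<Rightarrow> complex"
  lg :: "complex \<Rightarrow> complex"

definition chart_at :: "chart \<Rightarrow> complex \<Rightarrow> bool" where
  "chart_at c z \<longleftrightarrow> par c analytic_on {z} \<and> lg c analytic_on {z} \<and> Im (par c z) > 0 \<and>
     (\<forall>\<^sub>F u in nhds z. exp (lg c u) = deriv (par c) u)"

definition id_chart :: chart where
  "id_chart = \<lparr>par = (\<lambda>z. z), lg = (\<lambda>z. 0)\<rparr>"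

text \<open>\<open>Factor j k h z\<close> stands for \<open>\<partial>\<^sup>j \<partial>bar\<^sup>k (\<Phi>\<^sub>0 \<circ> h)(z)\<close>, a derivative in the local chart \<open>h\<inverse>\<close>;
  its node is \<open>h z\<close>.\<close>

datatype factor = Factor nat nat "complex \<Rightarrow> complex" complex

definition green :: "complex \<Rightarrow> complex \<Rightarrow> real" where
  "green \<zeta> z = ln (cmod ((\<zeta> - cnj z) / (\<zeta> - z)))"

fun pair_expectation :: "factor \<Rightarrow> factor \<Rightarrow> complex" where
  "pair_expectation (Factor j k h \<zeta>) (Factor l m g z) =
     2 * (dz ^^ j) ((dzbar ^^ k) (\<lambda>u. (dz ^^ l) ((dzbar ^^ m)
           (\<lambda>v. of_real (green (h u) (g v)))) z)) \<zeta>"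

text \<open>A functional is a formal power series in commuting factors: the coefficient of a finite
  multiset of factors multiplies their Wick product. Series are needed only to accommodate the
  Wick exponentials.\<close>

type_synonym functional = "factor multiset \<Rightarrow> complex"

definition wick_one :: functional where
  "wick_one M = (if M = {#} then 1 else 0)"

definition wick_factor :: "factor \<Rightarrow> functional" where
  "wick_factor p M = (if M = {#p#} then 1 else 0)"

definition wick_prod :: "functional \<Rightarrow> functional \<Rightarrow> functional" where
  "wick_prod F G M = (\<Sum>A\<in>{A. A \<subseteq># M}. F A * G (M - A))"

text \<open>\<open>\<Sum>n. \<alpha>\<^sup>n p\<^sup>n / n!\<close>\<close>

definition wick_exp :: "complex \<Rightarrow> factor \<Rightarrow> functional" where
  "wick_exp \<alpha> p M = (if M = replicate_mset (size M) p then \<alpha> ^ size M / fact (size M) else 0)"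

inductive_set functionals :: "complex set \<Rightarrow> functional set" for S where
  one: "wick_one \<in> functionals S"
| factor: "h analytic_on {z} \<Longrightarrow> deriv h z \<noteq> 0 \<Longrightarrow> Im (h z) > 0 \<Longrightarrow> h z \<in> S
    \<Longrightarrow> wick_factor (Factor j k h z) \<in> functionals S"
| exp: "h analytic_on {z} \<Longrightarrow> deriv h z \<noteq> 0 \<Longrightarrow> Im (h z) > 0 \<Longrightarrow> h z \<in> S
    \<Longrightarrow> wick_exp \<alpha> (Factor 0 0 h z) \<in> functionals S"
| wick: "F \<in> functionals S \<Longrightarrow> G \<in> functionals S \<Longrightarrow> wick_prod F G \<in> functionals S"
| add: "F \<in> functionals S \<Longrightarrow> G \<in> functionals S \<Longrightarrow> (\<lambda>M. F M + G M) \<in> functionals S"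
| scale: "F \<in> functionals S \<Longrightarrow> (\<lambda>M. k * F M) \<in> functionals S"

text \<open>Sum over all complete pairings of tagged factors without a pair of equal tags, organised by
  the partner of the first factor. The tag of a factor tells which functional it comes from.\<close>

function pairing_sum :: "(nat \<times> factor) list \<Rightarrow> complex" where
  "pairing_sum [] = 1"
| "pairing_sum ((i, p) # xs) =
     (\<Sum>k \<in> {k. k < length xs \<and> fst (xs ! k) \<noteq> i}.
        pair_expectation p (snd (xs ! k)) * pairing_sum (take k xs @ drop (Suc k) xs))"
  by pat_completeness auto
termination by (relation "Wellfounded.measure length") auto

text \<open>The expectation of a product of Wick monomials \<open>M\<^sub>0, M\<^sub>1, \<dots>\<close>: in Wick's formula only the
  complete pairings survive, because the expectation of a nonempty Wick product vanishes.
  The order of the factors inside a monomial is immaterial.\<close>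

definition monomial_corr :: "factor multiset list \<Rightarrow> complex" where
  "monomial_corr Ms = pairing_sum (concat
     (map (\<lambda>i. map (Pair i) (SOME ps. mset ps = Ms ! i)) [0..<length Ms]))"

text \<open>\<open>corr [F\<^sub>1, \<dots>, F\<^sub>n]\<close> is the expectation of the product of the functionals \<open>F\<^sub>1, \<dots>, F\<^sub>n\<close>,
  meaningful when their node sets are disjoint.\<close>

definition corr :: "functional list \<Rightarrow> complex" where
  "corr Fs = (\<Sum>\<^sub>\<infinity>Ms\<in>{Ms. length Ms = length Fs}.
     (\<Prod>i<length Fs. (Fs ! i) (Ms ! i)) * monomial_corr Ms)"

type_synonym conf_field = "chart \<Rightarrow> complex \<Rightarrow> functional"

definition nonrandom_field :: "(chart \<Rightarrow> complex \<Rightarrow> complex) \<Rightarrow> bool" where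
  "nonrandom_field f \<longleftrightarrow>
     (\<forall>c z j k. chart_at c z \<longrightarrow> (dz ^^ j) ((dzbar ^^ k) (f c)) differentiable (at z))"

inductive fock_field :: "conf_field \<Rightarrow> bool" where
  one: "fock_field (\<lambda>c z. wick_one)"
| derivative: "fock_field (\<lambda>c z. wick_factor (Factor j k (par c) z))"
| exp: "fock_field (\<lambda>c z. wick_exp \<alpha> (Factor 0 0 (par c) z))"
| wick: "fock_field X \<Longrightarrow> fock_field Y \<Longrightarrow> fock_field (\<lambda>c z. wick_prod (X c z) (Y c z))"
| add: "fock_field X \<Longrightarrow> fock_field Y \<Longrightarrow> fock_field (\<lambda>c z M. X c z M + Y c z M)"
| coefficient: "nonrandom_field f \<Longrightarrow> fock_field X \<Longrightarrow> fock_field (\<lambda>c z M. f c z * X c z M)"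

text \<open>\<open>is_field_deriv j k X Y\<close>: \<open>Y = \<partial>\<^sup>j \<partial>bar\<^sup>k X\<close> in every chart, within correlations.\<close>

definition is_field_deriv :: "nat \<Rightarrow> nat \<Rightarrow> conf_field \<Rightarrow> conf_field \<Rightarrow> bool" where
  "is_field_deriv j k X Y \<longleftrightarrow> fock_field Y \<and>
     (\<forall>c z F. chart_at c z \<longrightarrow> F \<in> functionals (- {par c z}) \<longrightarrow>
        corr [Y c z, F] = (dz ^^ j) ((dzbar ^^ k) (\<lambda>u. corr [X c u, F])) z)"

text \<open>The index \<open>(m, s, k)\<close> stands for \<open>x\<^sup>m |x|\<^sup>s (log |x|)\<^sup>k\<close>. Powers of the conjugate of x are covered,
  as \<open>cnj x\<^sup>n = |x|\<^sup>2\<^sup>n x\<^sup>-\<^sup>n\<close>; leaving them out makes the system linearly independent, so that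
  coefficients are well defined and the coefficient of 1 is the one of index \<open>(0, 0, 0)\<close>.\<close>

type_synonym ope_index = "int \<times> complex \<times> nat"

fun ope_term :: "ope_index \<Rightarrow> complex \<Rightarrow> complex" where
  "ope_term (m, s, k) x = x powi m * of_real (cmod x) powr s * of_real (ln (cmod x)) ^ k"

fun ope_order :: "ope_index \<Rightarrow> real" where
  "ope_order (m, s, k) = of_int m + Re s"

definition ope_indices :: "(ope_index \<Rightarrow> conf_field) \<Rightarrow> real \<Rightarrow> ope_index set" where
  "ope_indices C N = {i. C i \<noteq> (\<lambda>c z M. 0) \<and> ope_order i \<le> N}"

definition has_ope :: "conf_field \<Rightarrow> conf_field \<Rightarrow> (ope_index \<Rightarrow> conf_field) \<Rightarrow> bool" where
  "has_ope X Y C \<longleftrightarrow> (\<forall>i. fock_field (C i)) \<and> (\<forall>N. finite (ope_indices C N)) \<and>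
     (\<forall>c z F N. chart_at c z \<longrightarrow> F \<in> functionals (- {par c z}) \<longrightarrow>
        ((\<lambda>\<zeta>. (corr [X c \<zeta>, Y c z, F]
                 - (\<Sum>i\<in>ope_indices C N. corr [C i c z, F] * ope_term i (\<zeta> - z)))
               / of_real (cmod (\<zeta> - z) powr N)) \<longlongrightarrow> 0) (at z))"

text \<open>The OPE product is determined up to equality within correlations, hence a relation:
  Z represents \<open>X * Y\<close>.\<close>

definition is_ope_product :: "conf_field \<Rightarrow> conf_field \<Rightarrow> conf_field \<Rightarrow> bool" where
  "is_ope_product X Y Z \<longleftrightarrow> (\<exists>C. has_ope X Y C \<and> C (0, 0, 0) = Z)"

text \<open>The conformal map w from the upper half-plane to itself fixing infinity is taken to be the
  identity; any other choice, \<open>w(z) = r z + s\<close> with \<open>r > 0\<close>, gives the same fields. In a chart c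
  it is therefore written as \<open>par c\<close>, and \<open>arg w' = Im (lg c)\<close>.\<close>

definition modified_gff :: "real \<Rightarrow> conf_field" where
  "modified_gff b c z M =
     wick_factor (Factor 0 0 (par c) z) M - of_real (2 * b * Im (lg c z)) * wick_one M"

definition conf_radius :: "chart \<Rightarrow> complex \<Rightarrow> real" where
  "conf_radius c z = cmod ((par c z - cnj (par c z)) / deriv (par c) z)"

text \<open>The OPE exponential \<open>\<Sum>n. \<alpha>\<^sup>n \<Phi>\<^sup>*\<^sup>n / n!\<close> of the modified free field, written as
  \<open>exp (- 2 \<alpha> b arg w') C^(\<alpha>\<^sup>2)\<close> times the Wick exponential, where \<open>C = |(w - cnj w) / w'|\<close>.\<close>

definition vertex :: "real \<Rightarrow> complex \<Rightarrow> conf_field" where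
  "vertex b \<alpha> c z M = exp (- 2 * \<alpha> * of_real b * of_real (Im (lg c z)))
     * of_real (conf_radius c z) powr (\<alpha>\<^sup>2) * wick_exp \<alpha> (Factor 0 0 (par c) z) M"

inductive_set ope_family :: "real \<Rightarrow> conf_field set" for b where
  one: "(\<lambda>c z. wick_one) \<in> ope_family b"
| gff: "is_field_deriv j k (modified_gff b) Y \<Longrightarrow> Y \<in> ope_family b"
| vertex: "is_field_deriv j k (vertex b \<alpha>) Y \<Longrightarrow> Y \<in> ope_family b"
| add: "X \<in> ope_family b \<Longrightarrow> Y \<in> ope_family b \<Longrightarrow> (\<lambda>c z M. X c z M + Y c z M) \<in> ope_family b"
| scale: "X \<in> ope_family b \<Longrightarrow> (\<lambda>c z M. k * X c z M) \<in> ope_family b"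
| ope: "X \<in> ope_family b \<Longrightarrow> Y \<in> ope_family b \<Longrightarrow> is_ope_product X Y Z \<Longrightarrow> Z \<in> ope_family b"

text \<open>Vector fields are given in the identity chart of the upper half-plane.\<close>

definition local_flow ::
    "(complex \<Rightarrow> complex) \<Rightarrow> complex set \<Rightarrow> (real \<Rightarrow> complex \<Rightarrow> complex) \<Rightarrow> bool" where
  "local_flow v S \<psi> \<longleftrightarrow> (\<exists>\<epsilon>>0. \<exists>U V. open U \<and> S \<subseteq> U \<and> open V \<and> v holomorphic_on V \<and>
     (\<forall>p\<in>U. \<psi> 0 p = p \<and>
        (\<forall>t. \<bar>t\<bar> < \<epsilon> \<longrightarrow> \<psi> t p \<in> V \<and> ((\<lambda>s. \<psi> s p) has_vector_derivative v (\<psi> t p)) (at t))))"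

text \<open>The chart \<open>\<phi> \<circ> \<psi>\<^sub>-\<^sub>t\<close>, whose inverse is \<open>\<psi>\<^sub>t \<circ> \<phi>\<inverse>\<close>. For small t the principal logarithm gives the
  branch that depends continuously on t and is unchanged at \<open>t = 0\<close>.\<close>

definition flow_chart :: "(real \<Rightarrow> complex \<Rightarrow> complex) \<Rightarrow> real \<Rightarrow> chart \<Rightarrow> chart" where
  "flow_chart \<psi> t c =
     \<lparr>par = \<psi> t \<circ> par c, lg = (\<lambda>z. lg c z + Ln (deriv (\<psi> t) (par c z)))\<rparr>"

text \<open>A string \<open>X\<^sub>1(z\<^sub>1) \<cdots> X\<^sub>n(z\<^sub>n)\<close>, each field being evaluated in its own chart, is a list of
  triples. \<open>lie_corr v Fs xs\<close> is the expectation of the product of the functionals Fs with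
  \<open>\<L>\<^sub>v xs\<close>; the functionals Fs are not acted upon.\<close>

type_synonym field_string = "(conf_field \<times> chart \<times> complex) list"

definition lie_corr :: "(complex \<Rightarrow> complex) \<Rightarrow> functional list \<Rightarrow> field_string \<Rightarrow> complex" where
  "lie_corr v Fs xs = (THE D. \<exists>\<psi>. local_flow v ((\<lambda>(X, c, z). par c z) ` set xs) \<psi> \<and>
     ((\<lambda>t. corr (Fs @ map (\<lambda>(X, c, z). X (flow_chart \<psi> t c) z) xs))
        has_vector_derivative D) (at 0))"

definition lie_plus_corr :: "(complex \<Rightarrow> complex) \<Rightarrow> functional list \<Rightarrow> field_string \<Rightarrow> complex" where
  "lie_plus_corr v Fs xs = (lie_corr v Fs xs - \<i> * lie_corr (\<lambda>\<zeta>. \<i> * v \<zeta>) Fs xs) / 2"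

definition lie_minus_corr :: "(complex \<Rightarrow> complex) \<Rightarrow> functional list \<Rightarrow> field_string \<Rightarrow> complex" where
  "lie_minus_corr v Fs xs = (lie_corr v Fs xs + \<i> * lie_corr (\<lambda>\<zeta>. \<i> * v \<zeta>) Fs xs) / 2"

end

theory Submission
 imports Defs "HOL-Complex_Analysis.Complex_Analysis"
begin

text \<open>OPE coefficients are unique, so within correlations every field of the OPE family is a combination,
 with coefficients that do not depend on the chart, of derivatives of \<open>\<Phi>\<^sub>(\<^sub>b\<^sub>)\<close> times its exponential,
 normal ordered in the chart. Correlations of such fields are Gaussian expectations. Under
 \<open>\<L>\<^sup>+\<close> of \<open>1/(z - \<zeta>)\<close> plus \<open>\<L>\<^sup>-\<close> of \<open>1/(cnj z - \<zeta>)\<close> the covariances of the derivatives change at rate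
 \<open>- A x * A y\<close>, where A is made from \<open>a(u) = 1/(z - u) - 1/(z - cnj u)\<close>, and their means at a rate
 proportional to b. Gaussian integration by parts of \<open>\<partial>\<^sup>2\<close> of the vertex field produces the same terms,
 with equal coefficients exactly if \<open>2 a (a + b) = 1\<close>.\<close>

section \<open>Contractions and Gaussian moments\<close>

text \<open>Obstacles. OPE coefficients are known only through correlations, in one chart at a time.
  So \<open>expands\<close> fixes the coefficient lists before chart, point and test functional, and
  an identity tested against a single Wick term is carried into longer correlations by merging all
  other functionals into one (\<open>merge_rest\<close>). Normal ordering needs the covariance
  without its logarithm to be smooth across the diagonal; this is shown only in the charts that the
  two vector fields produce, where the difference is explicit.

  Origin of a and of the constants. The function a(u) is minus the covariance of the z-derivative of
  the field at z with the field at u. The conjugate of the second vector field has its pole at z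
  again, so the two halves of the variation combine into partial fractions with poles at z only, and
  these factor. In the comparison with the second derivative of the vertex field, the terms
  quadratic in a need only \<open>al\<^sup>2 = - a\<^sup>2\<close>. Those with the covariance of the
  second derivative need \<open>al = 2 a\<^sup>2 (\<i> b + al)\<close>, which for
  \<open>al = \<i> a\<close> is the condition on a and b.\<close>

lemma sum_mset_remove_swap:
 fixes f :: "'a => 'a => 'b::comm_monoid_add"
 shows "(SUM x:#M. SUM y:#M - {#x#}. f x y) = (SUM y:#M. SUM x:#M - {#y#}. f x y)"
proof (induction M)
 case (add a M)
 have 1: "(SUM x:#M. SUM y:#add_mset a M - {#x#}. f x y)
   = (SUM x:#M. f x a) + (SUM x:#M. SUM y:#M - {#x#}. f x y)"
 proof -
  have "(SUM x:#M. SUM y:#add_mset a M - {#x#}. f x y) = (SUM x:#M. f x a + (SUM y:#M - {#x#}. f x y))"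
   by (intro arg_cong[where f=sum_mset] image_mset_cong) simp
  thus ?thesis by (simp add: sum_mset.distrib)
 qed
 have 2: "(SUM y:#M. SUM x:#add_mset a M - {#y#}. f x y)
   = (SUM y:#M. f a y) + (SUM y:#M. SUM x:#M - {#y#}. f x y)"
 proof -
  have "(SUM y:#M. SUM x:#add_mset a M - {#y#}. f x y) = (SUM y:#M. f a y + (SUM x:#M - {#y#}. f x y))"
   by (intro arg_cong[where f=sum_mset] image_mset_cong) simp
  thus ?thesis by (simp add: sum_mset.distrib)
 qed
 show ?case using add by (simp add: 1 2 add_ac)
qed simp

text \<open>\<open>contract C m M ph\<close> sums ph of the unused elements of M over all ways of removing some
 elements x with weight \<open>m x\<close> and some unordered pairs with weight \<open>C x y\<close>.\<close>

function contract :: "('a => 'a => complex) => ('a => complex) => 'a multiset => ('a multiset => complex) => complex" where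
 "contract C m M ph = (if M = {#} then ph {#} else
   let x = SOME x. x :# M in
    contract C m (M - {#x#}) (%A. ph (add_mset x A)) + m x * contract C m (M - {#x#}) ph
    + (SUM y:set_mset (M - {#x#}). of_nat (count (M - {#x#}) y) * C x y * contract C m (M - {#x#} - {#y#}) ph))" by pat_completeness auto
termination
proof (relation "Wellfounded.measure (%(_, _, M, _). size M)", goal_cases)
 case (2 G m M f x)
 hence "x :# M" by (metis multiset_nonemptyE someI)
 thus ?case by (simp add: size_Diff1_less)
next
 case (3 G m M f x)
 hence "x :# M" by (metis multiset_nonemptyE someI)
 thus ?case by (simp add: size_Diff1_less)
next
 case (4 G m M f x y)
 hence "x :# M" by (metis multiset_nonemptyE someI)
 thus ?case by (simp only: in_measure case_prod_conv)
   (metis (no_types, lifting) case_prod_conv diff_subset_eq_self in_measure order_le_less_trans size_Diff1_less size_mset_mono)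
qed simp

declare contract.simps [simp del]

lemma sum_mset_conv_sum:
 fixes f :: "'a => complex"
 shows "(SUM y:#M. f y) = (SUM y:set_mset M. of_nat (count M y) * f y)"
proof (induction M)
 case (add a M)
 show ?case
 proof (cases "a :# M")
  case True
  have *: "set_mset (add_mset a M) = insert a (set_mset M)" by simp
  have "(SUM y:set_mset (add_mset a M). of_nat (count (add_mset a M) y) * f y)
    = (SUM y:set_mset M. (of_nat (count M y) * f y) + (if y = a then f a else 0))"
   using True by (auto intro!: sum.cong simp: algebra_simps insert_absorb)
  thus ?thesis using add True by (simp add: sum.distrib)
 next
  case False
  hence "(SUM y:set_mset (add_mset a M). of_nat (count (add_mset a M) y) * f y)
    = f a + (SUM y:set_mset M. of_nat (count (add_mset a M) y) * f y)" by (simp add: not_in_iff)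
  also have "(SUM y:set_mset M. of_nat (count (add_mset a M) y) * f y) = (SUM y:set_mset M. of_nat (count M y) * f y)"
   using False by (intro sum.cong) auto
  finally show ?thesis using add by simp
 qed
qed simp

lemma contract_empty [simp]: "contract C m {#} f = f {#}" by (simp add: contract.simps)

definition contract_step where
 "contract_step C m x M f = contract C m M (%A. f (add_mset x A)) + m x * contract C m M f
    + (SUM y:#M. C x y * contract C m (M - {#y#}) f)"

lemma sum_mset_cong: "(!!x. x :# M ==> f x = g x) ==> (SUM x:#M. f x) = (SUM x:#M. g x)" by (metis image_mset_cong)

text \<open>Eliminating x and then z produces the terms listed in \<open>*\<close>. They are
  symmetric in x and z apart from the sum over a partner y of x and a partner w of z, which
  \<open>sum_mset_remove_swap\<close> exchanges, and the pair formed by x and z themselves, where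
  symmetry of \<open>Ga\<close> enters.\<close>

lemma contract_step_commute:
 assumes sym: "!!x y. Ga x y = Ga y x"
  and IH: "!!x M' f. size M' <= size M ==> contract Ga m (add_mset x M') f = contract_step Ga m x M' f"
 shows "contract_step Ga m x (add_mset z M) f = contract_step Ga m z (add_mset x M) f"
proof -
 let ?C = "contract Ga m"
 have *: "contract_step Ga m x (add_mset z M) f =
   ?C M (%A. f (add_mset x (add_mset z A))) + m z * ?C M (%A. f (add_mset x A))
    + (SUM y:#M. Ga z y * ?C (M - {#y#}) (%A. f (add_mset x A)))
    + m x * (?C M (%A. f (add_mset z A)) + m z * ?C M f
    + (SUM y:#M. Ga z y * ?C (M - {#y#}) f)) + Ga x z * ?C M f
    + (SUM y:#M. Ga x y * ?C (M - {#y#}) (%A. f (add_mset z A)))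
    + m z * (SUM y:#M. Ga x y * ?C (M - {#y#}) f)
    + (SUM y:#M. SUM w:#M - {#y#}. Ga x y * Ga z w * ?C (M - {#y#} - {#w#}) f)"
  for x z
 proof -
  have "(SUM y:#M. Ga x y * ?C (add_mset z M - {#y#}) f)
    = (SUM y:#M. Ga x y * ?C (M - {#y#}) (%A. f (add_mset z A))
      + m z * (Ga x y * ?C (M - {#y#}) f)
      + (SUM w:#M - {#y#}. Ga x y * Ga z w * ?C (M - {#y#} - {#w#}) f))"
  proof (rule sum_mset_cong)
   fix y assume "y :# M"
   hence "add_mset z M - {#y#} = add_mset z (M - {#y#})" by simp
   thus "Ga x y * ?C (add_mset z M - {#y#}) f =
      Ga x y * ?C (M - {#y#}) (%A. f (add_mset z A))
      + m z * (Ga x y * ?C (M - {#y#}) f)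
      + (SUM w:#M - {#y#}. Ga x y * Ga z w * ?C (M - {#y#} - {#w#}) f)"
    by (simp add: IH size_mset_mono contract_step_def distrib_left sum_mset_distrib_left mult.assoc mult.left_commute)
  qed
  moreover have "contract_step Ga m x (add_mset z M) f =
   contract_step Ga m z M (%A. f (add_mset x A)) + m x * contract_step Ga m z M f
    + (Ga x z * ?C M f + (SUM y:#M. Ga x y * ?C (add_mset z M - {#y#}) f))" by (simp add: contract_step_def[of Ga m x] IH)
  ultimately show ?thesis by (simp only: contract_step_def sum_mset.distrib sum_mset_distrib_left distrib_left add.assoc)
 qed
 have "(SUM y:#M. SUM w:#M - {#y#}. Ga x y * Ga z w * ?C (M - {#y#} - {#w#}) f)
   = (SUM y:#M. SUM w:#M - {#y#}. Ga z y * Ga x w * ?C (M - {#y#} - {#w#}) f)"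
  using sum_mset_remove_swap[of "%y w. Ga x y * Ga z w * ?C (M - {#y#} - {#w#}) f" M] by (simp add: mult_ac diff_diff_add add_mset_commute)
 thus ?thesis unfolding * by (simp add: algebra_simps sym[of z x] add_mset_commute[of x z])
qed

lemma contract_SOME:
 assumes "M ~= {#}"
 shows "EX x M'. M = add_mset x M' & contract C m M f = contract_step C m x M' f"
proof -
 have "(SOME x. x :# M) :# M" using assms by (metis multiset_nonemptyE someI)
 hence "M = add_mset (SOME x. x :# M) (M - {#SOME x. x :# M#})" by simp
 moreover have "contract C m M f = contract_step C m (SOME x. x :# M) (M - {#SOME x. x :# M#}) f"
  using assms by (subst contract.simps) (simp add: contract_step_def sum_mset_conv_sum Let_def mult.assoc)
 ultimately show ?thesis by blast
qed

text \<open>The recursion of \<open>contract\<close> eliminates the element chosen by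
  \<open>SOME\<close>. By strong induction on the size the choice does not matter: any other element
  is eliminated second and then brought to the front by
  \<open>contract_step_commute\<close>.\<close>

lemma contract_add_mset':
 assumes sym: "!!x y. C x y = C y x"
 shows "contract C m (add_mset z M) f = contract_step C m z M f"
proof (induction "size M" arbitrary: z M f rule: less_induct)
 case less
 obtain x M' where x: "add_mset z M = add_mset x M'"
  "contract C m (add_mset z M) f = contract_step C m x M' f"
  using contract_SOME[of "add_mset z M"] by (metis multi_self_add_other_not_self empty_not_add_mset)
 show ?case
 proof (cases "x = z")
  case True thus ?thesis using x by simp
 next
  case False
  then obtain N where N: "M = add_mset x N" "M' = add_mset z N" using x(1) by (metis add_eq_conv_ex)
  show ?thesis unfolding x(2) unfolding N by (rule contract_step_commute[OF sym less, symmetric]) (auto simp: N)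
 qed
qed

lemmas contract_add_mset = contract_add_mset'[unfolded contract_step_def]

definition symm :: "('a => 'a => complex) => bool" where
 "symm C \<longleftrightarrow> (ALL x y. C x y = C y x)"

lemma contract_add:
 assumes "symm C"
 shows "contract C m (add_mset z M) f = contract C m M (%A. f (add_mset z A)) + m z * contract C m M f
    + (SUM y:#M. C z y * contract C m (M - {#y#}) f)" by (rule contract_add_mset) (insert assms, auto simp: symm_def)

text \<open>Pairing removes two elements at once, so the hypothesis must reach all smaller multisets
  and not only the immediate predecessor.\<close>

lemma multiset_size_induct [case_names empty add]:
 assumes "P {#}" "!!x M. (!!N. size N <= size M ==> P N) ==> P (add_mset x M)"
 shows "P M"
proof (induction "size M" arbitrary: M rule: less_induct)
 case less
 show ?case
 proof (cases M)
  case (add x N)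
  thus ?thesis using assms(2)[of N x] less by simp
 qed (use assms in auto)
qed

lemma size_diff1_le [simp]: "size (M - {#y#}) <= size M" by (simp add: size_mset_mono)

lemma contract_linear:
 assumes "symm C"
 shows "contract C m M (%A. c * f A + d * psi A) = c * contract C m M f + d * contract C m M psi"
proof (induction M arbitrary: f psi rule: multiset_size_induct)
 case (add x M)
 have "(SUM y:#M. C x y * contract C m (M - {#y#}) (%A. c * f A + d * psi A))
  = (SUM y:#M. c * (C x y * contract C m (M - {#y#}) f) + d * (C x y * contract C m (M - {#y#}) psi))"
  by (intro sum_mset_cong) (simp add: add algebra_simps)
 thus ?case by (simp add: contract_add[OF assms] add sum_mset.distrib flip: sum_mset_distrib_left)
    (simp add: algebra_simps)
qed simp

lemma contract_zero: "symm C ==> contract C m M (%A. 0) = 0" using contract_linear[of C m M 0 "%_. 0" 0 "%_. 0"] by simp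

lemma contract_plus: "symm C ==> contract C m M (%A. f A + psi A) = contract C m M f + contract C m M psi"
 using contract_linear[of C m M 1 f 1 psi] by simp

lemma contract_scale: "symm C ==> contract C m M (%A. c * f A) = c * contract C m M f" using contract_linear[of C m M c f 0 f] by simp

lemma contract_sum_mset:
 "symm C ==> contract C m M (%A. SUM z:#Z. f z A) = (SUM z:#Z. contract C m M (f z))" by (induction Z) (simp_all add: contract_zero contract_plus)

text \<open>Choosing an unpaired element to delete and choosing the elements removed by
  \<open>contract\<close> can be done in either order. In Gaussian terms, a derivation with constant
  coefficients commutes with the heat operator that performs the contractions.\<close>

lemma contract_derivation:
 assumes "symm Ga"
 shows "contract Ga m M (%A. SUM w:#A. a w * ph (A - {#w#})) = (SUM w:#M. a w * contract Ga m (M - {#w#}) ph)"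
proof (induction M arbitrary: ph rule: multiset_size_induct)
 let ?C = "contract Ga m"
 case (add x M)
 have e: "(SUM w:#add_mset x A. a w * ph (add_mset x A - {#w#}))
   = a x * ph A + (SUM w:#A. a w * ph (add_mset x (A - {#w#})))" for A by (simp, intro sum_mset_cong) simp
 have "(SUM w:#M. a w * ?C (add_mset x M - {#w#}) ph)
   = (SUM w:#M. a w * ?C (M - {#w#}) (%A. ph (add_mset x A)) + m x * (a w * ?C (M - {#w#}) ph)
     + (SUM y:#M - {#w#}. a w * Ga x y * ?C (M - {#w#} - {#y#}) ph))"
  by (intro sum_mset_cong) (simp add: contract_add[OF assms] sum_mset_distrib_left distrib_left mult_ac)
 moreover have "(SUM w:#M. SUM y:#M - {#w#}. a w * Ga x y * ?C (M - {#w#} - {#y#}) ph)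
   = (SUM y:#M. SUM w:#M - {#y#}. a w * Ga x y * ?C (M - {#y#} - {#w#}) ph)"
  by (subst sum_mset_remove_swap) (simp add: diff_diff_add add_mset_commute)
 moreover have "(SUM y:#M. Ga x y * (SUM w:#M - {#y#}. a w * ?C (M - {#y#} - {#w#}) ph))
   = (SUM y:#M. SUM w:#M - {#y#}. a w * Ga x y * ?C (M - {#y#} - {#w#}) ph)" by (simp add: sum_mset_distrib_left mult_ac)
 moreover have "?C M (%A. SUM w:#A. a w * ph (add_mset x (A - {#w#})))
   = (SUM w:#M. a w * ?C (M - {#w#}) (%A. ph (add_mset x A)))" by (rule add) simp
 ultimately show ?case
  unfolding contract_add[OF assms] e contract_plus[OF assms] contract_scale[OF assms] by (simp add: add sum_mset.distrib flip: sum_mset_distrib_left)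
qed simp

text \<open>The moment of a product of Gaussian variables with means m and covariances C.\<close>

definition moment :: "('a => 'a => complex) => ('a => complex) => 'a multiset => complex" where
 "moment C m M = contract C m M (%A. if A = {#} then 1 else 0)"

lemma moment_empty [simp]: "moment C m {#} = 1" by (simp add: moment_def)

text \<open>Gaussian integration by parts, the recursion on which the later computations with
  moments rest. The branch of \<open>contract\<close> in which x survives vanishes because the test
  function is supported on the empty multiset.\<close>

lemma moment_add:
 "symm C ==> moment C m (add_mset x M) = m x * moment C m M + (SUM y:#M. C x y * moment C m (M - {#y#}))"
 by (simp add: moment_def contract_add contract_zero)

lemma contract_cong:
 assumes "symm C" "symm C'" "!!x y. x :# M ==> y :# M ==> C x y = C' x y" "!!x. x :# M ==> m x = m' x"
  "!!A. A <=# M ==> f A = f' A"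
 shows "contract C m M f = contract C' m' M f'" using assms(3-)
proof (induction M arbitrary: f f' rule: multiset_size_induct)
 case (add x M)
 have sub: "A <=# add_mset x M" if "A <=# M" for A using that by (metis add_mset_add_single mset_subset_eq_add_left subset_mset.order_trans)
 have sub2: "A <=# add_mset x M" if "A <=# M - {#y#}" for A y using that sub by (meson diff_subset_eq_self subset_mset.order_trans)
 have 1: "contract C m M (%A. f (add_mset x A)) = contract C' m' M (%A. f' (add_mset x A))" by (rule add(1)) (use add(2-) in auto)
 have 2: "contract C m M f = contract C' m' M f'" by (rule add(1)) (use add(2-) sub in auto)
 have 3: "contract C m (M - {#y#}) f = contract C' m' (M - {#y#}) f'" for y by (rule add(1)) (use add(2-) sub2 in \<open>auto dest: in_diffD\<close>)
 show ?case unfolding contract_add[OF assms(1)] contract_add[OF assms(2)] 1 2 3 using add(2,3) by (simp cong: sum_mset_cong)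
qed auto

lemma moment_cong:
 assumes "symm C" "symm C'" "!!x y. x :# M ==> y :# M ==> C x y = C' x y" "!!x. x :# M ==> m x = m' x"
 shows "moment C m M = moment C' m' M" unfolding moment_def by (rule contract_cong) (use assms in auto)

lemma moment_image:
 assumes "symm C"
 shows "moment C m (image_mset f M) = moment (%x y. C (f x) (f y)) (%x. m (f x)) M"
proof (induction M rule: multiset_size_induct)
 case (add x M)
 have s: "symm (%x y. C (f x) (f y))" using assms by (simp add: symm_def)
 have "(SUM y:#M. C (f x) (f y) * moment C m (image_mset f M - {#f y#}))
   = (SUM y:#M. C (f x) (f y) * moment (%x y. C (f x) (f y)) (%x. m (f x)) (M - {#y#}))"
 proof (intro sum_mset_cong)
  fix y assume "y :# M"
  hence "image_mset f M - {#f y#} = image_mset f (M - {#y#})" by (simp add: image_mset_Diff)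
  thus "C (f x) (f y) * moment C m (image_mset f M - {#f y#})
    = C (f x) (f y) * moment (%x y. C (f x) (f y)) (%x. m (f x)) (M - {#y#})" by (simp add: add)
 qed
 thus ?case by (simp add: moment_add[OF assms] moment_add[OF s] add image_mset.compositionality comp_def)
qed simp

text \<open>The sum of two independent Gaussian families has the sums of the means and covariances.
  Z consists of variables that have no part in the second family.\<close>

lemma moment_contract:
 assumes "symm C" "symm C'" "!!x z. z :# Z ==> C' x z = 0" "!!z. z :# Z ==> m z = 0"
 shows "contract C' m P (%M. moment C mu (M + Z)) = moment (%x y. C x y + C' x y) (%x. mu x + m x) (P + Z)" using assms(3,4)
proof (induction P arbitrary: Z rule: multiset_size_induct)
 case empty
 have s: "symm (%x y. C x y + C' x y)" using assms by (simp add: symm_def)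
 show ?case by (auto intro!: moment_cong s assms empty simp: empty)
next
 case (add x P)
 have s: "symm (%x y. C x y + C' x y)" using assms by (simp add: symm_def)
 \<comment> \<open>Integration by parts for the first family, the partners of x being sorted into
   survivors in A and variables in Z.\<close>
 have e: "moment C mu (add_mset x A + Z) = mu x * moment C mu (A + Z)
   + (SUM w:#A. C x w * moment C mu ((A - {#w#}) + Z)) + (SUM z:#Z. C x z * moment C mu (A + (Z - {#z#})))" for A
 proof -
  have "(SUM w:#A. C x w * moment C mu (A + Z - {#w#})) = (SUM w:#A. C x w * moment C mu ((A - {#w#}) + Z))" by (intro sum_mset_cong) simp
  moreover have "(SUM z:#Z. C x z * moment C mu (A + Z - {#z#})) = (SUM z:#Z. C x z * moment C mu (A + (Z - {#z#})))" by (intro sum_mset_cong) simp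
  ultimately show ?thesis by (simp add: moment_add[OF assms(1)] add_ac)
 qed
 let ?M = "moment (%x y. C x y + C' x y) (%x. mu x + m x)"
 have IH: "contract C' m Q (%M. moment C mu (M + Z')) = ?M (Q + Z')" if "size Q <= size P" "Z' <=# Z" for Q Z'
  using add that by (meson mset_subset_eqD)
 have r: "(SUM y:#P + Z. (C x y + C' x y) * ?M (P + Z - {#y#})) =
   (SUM y:#P. C x y * ?M ((P - {#y#}) + Z)) + (SUM y:#P. C' x y * ?M ((P - {#y#}) + Z))
   + (SUM y:#Z. C x y * ?M (P + (Z - {#y#})))"
 proof -
  have "(SUM y:#P. (C x y + C' x y) * ?M (P + Z - {#y#})) = (SUM y:#P. C x y * ?M ((P - {#y#}) + Z) + C' x y * ?M ((P - {#y#}) + Z))"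
   by (intro sum_mset_cong) (simp add: algebra_simps)
  moreover have "(SUM y:#Z. (C x y + C' x y) * ?M (P + Z - {#y#})) = (SUM y:#Z. C x y * ?M (P + (Z - {#y#})))"
   by (intro sum_mset_cong) (simp add: add)
  ultimately show ?thesis by (simp add: sum_mset.distrib)
 qed
 have z1: "(SUM z:#Z. contract C' m P (%A. C x z * moment C mu (A + (Z - {#z#}))))
   = (SUM y:#Z. C x y * ?M (P + (Z - {#y#})))" by (simp add: contract_scale[OF assms(2)] IH)
 have z2: "contract C' m P (%A. SUM w:#A. C x w * moment C mu ((A - {#w#}) + Z))
   = (SUM y:#P. C x y * ?M ((P - {#y#}) + Z))" by (simp only: contract_derivation[OF assms(2), where ph = "%A. moment C mu (A + Z)"]) (simp add: IH)
 have "add_mset x P + Z = add_mset x (P + Z)" by simp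
 thus ?case unfolding contract_add[OF assms(2)] e contract_plus[OF assms(2)] contract_scale[OF assms(2)]
   contract_sum_mset[OF assms(2)] z1 z2 by (simp only: moment_add[OF s] r) (simp add: IH algebra_simps)
qed

lemma has_derivative_sum_mset [derivative_intros]:
 fixes f :: "'i => 'a::real_normed_vector => complex"
 assumes "!!i. i :# I ==> (f i has_derivative f' i) F"
 shows "((%x. SUM i:#I. f i x) has_derivative (%x. SUM i:#I. f' i x)) F" using assms by (induction I) (auto intro!: derivative_eq_intros)

text \<open>The first-order change of a moment when covariances and means receive increments. The
  pairs are ordered, hence the division by 2.\<close>

definition moment_deriv ::
  "('a => 'a => complex) => ('a => complex) => 'a multiset => ('a => 'a => complex) => ('a => complex) => complex" where
 "moment_deriv C m M dGa dmu = (SUM x:#M. dmu x * moment C m (M - {#x#}))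
   + (SUM x:#M. SUM y:#M - {#x#}. dGa x y * moment C m (M - {#x#} - {#y#})) / 2"

lemma sum_mset_remove_swap':
 fixes f :: "'a => 'a => 'a multiset => 'b::comm_monoid_add"
 shows "(SUM x:#M. SUM y:#M - {#x#}. f x y (M - {#x#} - {#y#})) = (SUM y:#M. SUM x:#M - {#y#}. f x y (M - {#y#} - {#x#}))"
proof -
 have "M - {#x#} - {#y#} = M - {#y#} - {#x#}" for x y by (simp add: add_mset_commute)
 thus ?thesis using sum_mset_remove_swap[of "%x y. f x y (M - {#x#} - {#y#})" M] by (simp only:)
qed

text \<open>Leibniz's rule for the recursion \<open>moment_add\<close>. The pairs containing x lose
  the factor 1/2, since x can be either member of an ordered pair.\<close>

lemma moment_deriv_add:
 assumes "symm C" "symm dGa"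
 shows "moment_deriv C m (add_mset x M) dGa dmu = dmu x * moment C m M + m x * moment_deriv C m M dGa dmu
   + (SUM y:#M. dGa x y * moment C m (M - {#y#}) + C x y * moment_deriv C m (M - {#y#}) dGa dmu)"
proof -
 define H where "H = moment C m"
 have H: "H (add_mset x M) = m x * H M + (SUM y:#M. C x y * H (M - {#y#}))" for x M unfolding H_def using moment_add[OF assms(1)] by blast
 \<comment> \<open>In T and U the element x is already paired; the increment then falls on the mean
   of another element (T) or on the covariance of two others (U).\<close>
 define T where "T = (SUM y:#M. SUM w:#M - {#y#}. dmu w * C x y * H (M - {#y#} - {#w#}))"
 define U where "U = (SUM u:#M. SUM y:#M - {#u#}. SUM w:#M - {#u#} - {#y#}. dGa y w * C x u * H (M - {#u#} - {#y#} - {#w#}))"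
 have a: "(SUM w:#M. dmu w * H (add_mset x M - {#w#})) = m x * (SUM w:#M. dmu w * H (M - {#w#})) + T"
 proof -
  have "(SUM w:#M. dmu w * H (add_mset x M - {#w#})) =
   (SUM w:#M. m x * (dmu w * H (M - {#w#})) + (SUM y:#M - {#w#}. dmu w * C x y * H (M - {#w#} - {#y#})))"
   by (intro sum_mset_cong)
    (simp add: H sum_mset_distrib_left distrib_left mult_ac)
  also have "\<dots> = m x * (SUM w:#M. dmu w * H (M - {#w#})) + T"
   unfolding sum_mset.distrib T_def sum_mset_distrib_left[symmetric] by (subst sum_mset_remove_swap') (rule refl)
  finally show ?thesis .
 qed
 have b1: "(SUM y:#add_mset x M - {#w#}. dGa w y * H (add_mset x M - {#w#} - {#y#})) =
   dGa x w * H (M - {#w#}) + (m x * (SUM y:#M - {#w#}. dGa w y * H (M - {#w#} - {#y#}))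
     + (SUM u:#M - {#w#}. SUM y:#M - {#w#} - {#u#}. dGa w y * C x u * H (M - {#w#} - {#u#} - {#y#})))"
  if w: "w :# M" for w
 proof -
  define N where "N = M - {#w#}"
  have N: "add_mset x M - {#w#} = add_mset x N" using w by (simp add: N_def)
  have "(SUM y:#N. dGa w y * H (add_mset x N - {#y#})) =
    (SUM y:#N. m x * (dGa w y * H (N - {#y#})) + (SUM u:#N - {#y#}. dGa w y * C x u * H (N - {#y#} - {#u#})))"
   by (intro sum_mset_cong) (simp add: H sum_mset_distrib_left distrib_left mult_ac)
  also have "\<dots> = m x * (SUM y:#N. dGa w y * H (N - {#y#})) +
     (SUM u:#N. SUM y:#N - {#u#}. dGa w y * C x u * H (N - {#u#} - {#y#}))"
   unfolding sum_mset.distrib sum_mset_distrib_left[symmetric] by (subst sum_mset_remove_swap') (rule refl)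
  finally show ?thesis unfolding N N_def[symmetric] using assms(2) by (simp add: symm_def)
 qed
 have b: "(SUM w:#M. SUM y:#add_mset x M - {#w#}. dGa w y * H (add_mset x M - {#w#} - {#y#}))
   = (SUM w:#M. dGa x w * H (M - {#w#})) + (m x * (SUM w:#M. SUM y:#M - {#w#}. dGa w y * H (M - {#w#} - {#y#})) + U)"
 proof -
  have "(SUM w:#M. SUM y:#add_mset x M - {#w#}. dGa w y * H (add_mset x M - {#w#} - {#y#}))
   = (SUM w:#M. dGa x w * H (M - {#w#}) + (m x * (SUM y:#M - {#w#}. dGa w y * H (M - {#w#} - {#y#}))
     + (SUM u:#M - {#w#}. SUM y:#M - {#w#} - {#u#}. dGa w y * C x u * H (M - {#w#} - {#u#} - {#y#}))))" by (intro sum_mset_cong b1)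
  thus ?thesis
   unfolding U_def sum_mset.distrib sum_mset_distrib_left[symmetric] by (subst sum_mset_remove_swap'[where f = "%u w N. SUM y:#N. dGa w y * C x u * H (N - {#y#})"])
 qed
 have c: "(SUM y:#M. C x y * moment_deriv C m (M - {#y#}) dGa dmu) = T + U / 2"
 proof -
  have "(SUM y:#M. C x y * moment_deriv C m (M - {#y#}) dGa dmu) =
    (SUM y:#M. (SUM w:#M - {#y#}. dmu w * C x y * H (M - {#y#} - {#w#})) +
     1/2 * (SUM v:#M - {#y#}. SUM w:#M - {#y#} - {#v#}. dGa v w * C x y * H (M - {#y#} - {#v#} - {#w#})))"
   unfolding moment_deriv_def H_def[symmetric] by (intro sum_mset_cong) (simp add: distrib_left sum_mset_distrib_left mult_ac)
  thus ?thesis unfolding T_def U_def sum_mset.distrib sum_mset_distrib_left[symmetric] by simp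
 qed
 have d: "moment_deriv C m (add_mset x M) dGa dmu = dmu x * H M + (SUM w:#M. dmu w * H (add_mset x M - {#w#}))
   + ((SUM w:#M. dGa x w * H (M - {#w#})) + (SUM w:#M. SUM y:#add_mset x M - {#w#}. dGa w y * H (add_mset x M - {#w#} - {#y#}))) / 2"
  unfolding moment_deriv_def H_def[symmetric] by simp
 show ?thesis unfolding d a b sum_mset.distrib c unfolding moment_deriv_def H_def[symmetric] by algebra
qed

lemma moment_has_derivative:
 assumes s: "!!w. symm (C w)" "!!h. symm (%x y. C' x y h)"
  and "!!x y. x :# M ==> y :# M ==> ((%w. C w x y) has_derivative C' x y) (at w0)"
  and "!!x. x :# M ==> ((%w. m w x) has_derivative m' x) (at w0)"
 shows "((%w. moment (C w) (m w) M) has_derivative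
   (%h. moment_deriv (C w0) (m w0) M (%x y. C' x y h) (%x. m' x h))) (at w0)"
 using assms(3,4)
proof (induction M rule: multiset_size_induct)
 case empty
 thus ?case by (simp add: moment_deriv_def)
next
 case (add x M)
 have 1: "((%w. moment (C w) (m w) M) has_derivative
   (%h. moment_deriv (C w0) (m w0) M (%x y. C' x y h) (%x. m' x h))) (at w0)"
  by (rule add(1)) (use add(2,3) in auto)
 have 2: "((%w. moment (C w) (m w) (M - {#y#})) has_derivative
   (%h. moment_deriv (C w0) (m w0) (M - {#y#}) (%x y. C' x y h) (%x. m' x h))) (at w0)" for y
  by (rule add(1)) (use add(2,3) in \<open>auto dest: in_diffD\<close>)
 have 3: "((%w. SUM y:#M. C w x y * moment (C w) (m w) (M - {#y#})) has_derivative
   (%h. SUM y:#M. C w0 x y * moment_deriv (C w0) (m w0) (M - {#y#}) (%x y. C' x y h) (%x. m' x h)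
     + C' x y h * moment (C w0) (m w0) (M - {#y#}))) (at w0)" by (intro has_derivative_sum_mset has_derivative_mult add(2) 2) auto
 have 4: "((%w. m w x) has_derivative m' x) (at w0)" by (rule add(3)) simp
 show ?case unfolding moment_add[OF s(1)] moment_deriv_add[OF s] using has_derivative_add[OF has_derivative_mult[OF 4 1] 3] by (simp add: add_ac)
qed

text \<open>Linear forms are lists of weighted variables, so that the exponents of several
  exponentials are combined by appending; repeated variables are allowed.\<close>

definition lin :: "('a => complex) => (complex * 'a) list => complex" where
 "lin f ls = (SUM (al, p)<-ls. al * f p)"

lemma lin_Nil [simp]: "lin f [] = 0"
 and lin_Cons [simp]: "lin f ((al, p) # ls) = al * f p + lin f ls"
 and lin_append [simp]: "lin f (ls @ ls') = lin f ls + lin f ls'" by (simp_all add: lin_def)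

lemma lin_plus: "lin (%x. f x + g x) ls = lin f ls + lin g ls" by (induction ls) (auto simp: algebra_simps)

lemma lin_scale: "lin (%x. c * f x) ls = c * lin f ls" by (induction ls) (auto simp: algebra_simps)

lemma lin_zero [simp]: "lin (%x. 0) ls = 0" by (induction ls) auto

lemma lin_cong: "(!!x. x : snd ` set ls ==> f x = g x) ==> lin f ls = lin g ls" by (induction ls) auto

lemma lin_map: "lin f (map (map_prod id g) ls) = lin (%x. f (g x)) ls" by (induction ls) auto

lemma lin_swap: "lin (%x. lin (%y. f x y) ls') ls = lin (%y. lin (%x. f x y) ls) ls'" by (induction ls) (auto simp: lin_plus lin_scale)

definition bil :: "('a => 'a => complex) => (complex * 'a) list => complex" where
 "bil C ls = lin (%p. lin (C p) ls) ls"

text \<open>The Cameron-Martin shift: under the weight given by the exponential of ls a Gaussian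
  variable keeps its covariances, and its mean grows by its covariance with ls.\<close>

definition gmean :: "('a => 'a => complex) => ('a => complex) => (complex * 'a) list => 'a => complex" where
 "gmean C m ls x = m x + lin (%p. C p x) ls"

text \<open>The expectation of the product of the Gaussian variables in P and of the exponential of
 the linear combination ls of Gaussian variables.\<close>

definition gauss :: "('a => 'a => complex) => ('a => complex) => 'a multiset => (complex * 'a) list => complex" where
 "gauss C m P ls = exp (lin m ls + bil C ls / 2) * moment C (gmean C m ls) P"

lemma bil_cong: "(!!x y. x : snd ` set ls ==> y : snd ` set ls ==> C x y = C' x y) ==> bil C ls = bil C' ls"
 unfolding bil_def by (intro lin_cong) auto

lemma gauss_cong:
 assumes "symm C" "symm C'"
  "!!x y. x : set_mset P Un snd ` set ls ==> y : set_mset P Un snd ` set ls ==> C x y = C' x y"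
  "!!x. x : set_mset P Un snd ` set ls ==> m x = m' x"
 shows "gauss C m P ls = gauss C' m' P ls"
proof -
 have "lin m ls = lin m' ls" "bil C ls = bil C' ls" using assms(3,4) by (auto intro!: lin_cong bil_cong)
 moreover have "gmean C m ls x = gmean C' m' ls x" if "x :# P" for x using assms(3,4) that by (auto simp: gmean_def intro!: lin_cong)
 ultimately show ?thesis using assms by (auto simp: gauss_def intro!: moment_cong)
qed

lemma gauss_image:
 assumes "symm C"
 shows "gauss C m (image_mset f P) (map (map_prod id f) ls) = gauss (%x y. C (f x) (f y)) (%x. m (f x)) P ls"
 by (simp add: gauss_def moment_image[OF assms] lin_map bil_def gmean_def[abs_def])

text \<open>The form of \<open>moment_contract\<close> with exponentials. The exponent ls takes part
  in both families and lz only in the first, so the exponential prefactors multiply and the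
  Cameron-Martin shifts add.\<close>

lemma gauss_contract:
 assumes "symm C" "symm C'" "!!x z. z : set_mset Z Un snd ` set lz ==> C' x z = 0" "!!z. z : set_mset Z Un snd ` set lz ==> m z = 0"
 shows "exp (lin m ls + bil C' ls / 2) * contract C' (gmean C' m ls) P (%M. gauss C mu (M + Z) (ls @ lz))
   = gauss (%x y. C x y + C' x y) (%x. mu x + m x) (P + Z) (ls @ lz)"
proof -
 have z: "C' z x = 0" if "z : set_mset Z Un snd ` set lz" for z x using assms(2,3) that by (metis symm_def)
 have 1: "lin m lz = 0" "lin (C' p) lz = 0" "lin (%p. C' p x) lz = 0" for p x using assms(3,4) z lin_cong[of lz _ "%x. 0"] by auto
 have 2: "lin (%p. lin (C' p) ls) lz = 0" using z lin_cong[of lz _ "%x. 0"] lin_cong[of ls _ "%x. 0"] by auto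
 have b: "bil (%x y. C x y + C' x y) (ls @ lz) = bil C (ls @ lz) + bil C' ls" by (simp add: bil_def lin_plus 1 2)
 have g: "gmean (%x y. C x y + C' x y) (%x. mu x + m x) (ls @ lz) = (%x. gmean C mu (ls @ lz) x + gmean C' m ls x)"
  by (rule ext) (simp add: gmean_def lin_plus 1)
 have 3: "gmean C' m ls z = 0" if "z :# Z" for z using assms(3,4) that lin_cong[of ls _ "%x. 0"] by (auto simp: gmean_def)
 show ?thesis
  unfolding gauss_def contract_scale[OF assms(2)] b g by (subst moment_contract[OF assms(1,2)]) (use assms(3) 3 in \<open>auto simp: lin_plus 1 exp_add add_divide_distrib\<close>)
qed

text \<open>\<open>gmean\<close> is linear in covariance and mean jointly, so its increment is
  \<open>gmean\<close> of the increments; the rest is the product rule for prefactor and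
  moment.\<close>

definition gauss_deriv ::
  "('a => 'a => complex) => ('a => complex) => 'a multiset => (complex * 'a) list => ('a => 'a => complex) => ('a => complex) => complex" where
 "gauss_deriv C m P ls dGa dmu = exp (lin m ls + bil C ls / 2) *
   ((lin dmu ls + bil dGa ls / 2) * moment C (gmean C m ls) P + moment_deriv C (gmean C m ls) P dGa (gmean dGa dmu ls))"

lemma lin_has_derivative:
 assumes "!!x. x : snd ` set ls ==> ((%w. f w x) has_derivative f' x) F"
 shows "((%w. lin (f w) ls) has_derivative (%h. lin (%x. f' x h) ls)) F" using assms
proof (induction ls)
 case (Cons a ls)
 obtain al p where a: "a = (al, p)" by force
 have "((%w. lin (f w) ls) has_derivative (%h. lin (%x. f' x h) ls)) F" by (rule Cons(1)) (use Cons(2) in auto)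
 moreover have "((%w. al * f w p) has_derivative (%h. al * f' p h)) F"
  by (rule has_derivative_mult_right) (use Cons(2) in \<open>auto simp: a\<close>)
 ultimately show ?case unfolding a lin_Cons by (intro has_derivative_add)
qed simp

lemma gauss_has_derivative:
 assumes s: "!!w. symm (C w)" "!!h. symm (%x y. C' x y h)"
  and G: "!!x y. x : set_mset P Un snd ` set ls ==> y : set_mset P Un snd ` set ls ==> ((%w. C w x y) has_derivative C' x y) (at w0)"
  and M: "!!x. x : set_mset P Un snd ` set ls ==> ((%w. m w x) has_derivative m' x) (at w0)"
 shows "((%w. gauss (C w) (m w) P ls) has_derivative
   (%h. gauss_deriv (C w0) (m w0) P ls (%x y. C' x y h) (%x. m' x h))) (at w0)"
proof -
 have 1: "((%w. lin (m w) ls + bil (C w) ls / 2) has_derivative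
   (%h. lin (%x. m' x h) ls + bil (%x y. C' x y h) ls / 2)) (at w0)"
  unfolding bil_def divide_inverse by (intro has_derivative_add has_derivative_mult_left lin_has_derivative)
    (use G M in auto)
 have a: "((%w. exp (lin (m w) ls + bil (C w) ls / 2)) has_derivative
   (%h. exp (lin (m w0) ls + bil (C w0) ls / 2) * (lin (%x. m' x h) ls + bil (%x y. C' x y h) ls / 2))) (at w0)"
  using has_derivative_compose[OF 1, of exp "(*) (exp (lin (m w0) ls + bil (C w0) ls / 2))"] by (simp add: has_field_derivative_imp_has_derivative[OF DERIV_exp])
 have b: "((%w. moment (C w) (gmean (C w) (m w) ls) P) has_derivative
   (%h. moment_deriv (C w0) (gmean (C w0) (m w0) ls) P (%x y. C' x y h) (%x. m' x h + lin (%p. C' p x h) ls))) (at w0)"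
  by (rule moment_has_derivative[OF s])
    (insert G M, auto simp: gmean_def intro!: has_derivative_add lin_has_derivative)
 have c: "gmean (%x y. C' x y h) (%x. m' x h) ls = (%x. m' x h + lin (%p. C' p x h) ls)" for h by (simp add: gmean_def[abs_def])
 show ?thesis
  unfolding gauss_def gauss_deriv_def c by (rule has_derivative_eq_rhs[OF has_derivative_mult[OF a b]]) (simp only: ring_distribs mult.assoc add_ac)
qed

section \<open>Wick exponentials as formal series\<close>

text \<open>The coefficient of the monomial M in the exponential series of the formal linear form
  with coefficients l.\<close>

definition ecoef :: "('a => complex) => 'a multiset => complex" where
 "ecoef l M = (PROD q:set_mset M. l q ^ count M q / fact (count M q))"

lemma ecoef_empty [simp]: "ecoef l {#} = 1" by (simp add: ecoef_def)

text \<open>Read coefficient by coefficient: the exponential of a linear form is an eigenvector of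
  the derivative in q, with eigenvalue \<open>l q\<close>.\<close>

lemma ecoef_add: "of_nat (Suc (count M q)) * ecoef l (add_mset q M) = l q * ecoef l M"
proof -
 have fin: "finite (set_mset M - {q})" by simp
 have 1: "ecoef l (add_mset q M) = l q ^ Suc (count M q) / fact (Suc (count M q)) *
   (PROD p:set_mset M - {q}. l p ^ count M p / fact (count M p))"
 proof -
  have "set_mset (add_mset q M) = insert q (set_mset M - {q})" by auto
  hence "ecoef l (add_mset q M) = l q ^ Suc (count M q) / fact (Suc (count M q)) *
    (PROD p:set_mset M - {q}. l p ^ count (add_mset q M) p / fact (count (add_mset q M) p))"
   unfolding ecoef_def by (subst \<open>set_mset _ = _\<close>, subst prod.insert) auto
  also have "(PROD p:set_mset M - {q}. l p ^ count (add_mset q M) p / fact (count (add_mset q M) p))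
    = (PROD p:set_mset M - {q}. l p ^ count M p / fact (count M p))" by (intro prod.cong) auto
  finally show ?thesis .
 qed
 have 2: "ecoef l M = l q ^ count M q / fact (count M q) *
   (PROD p:set_mset M - {q}. l p ^ count M p / fact (count M p))"
 proof (cases "q :# M")
  case True
  thus ?thesis unfolding ecoef_def by (subst prod.remove[of _ q]) auto
 next
  case False
  thus ?thesis unfolding ecoef_def by (simp add: not_in_iff)
 qed
 have "of_nat (Suc n) * (l q ^ Suc n / fact (Suc n)) = l q * (l q ^ n / fact n)" for n by (simp add: divide_simps del: of_nat_Suc)
 thus ?thesis unfolding 1 2 by (simp only: mult.assoc[symmetric])
qed

lemma ecoef_remove: "of_nat (count M q) * ecoef l M = (if q :# M then l q * ecoef l (M - {#q#}) else 0)"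
 by (auto simp: not_in_iff dest!: multi_member_split simp flip: ecoef_add)

lemma finite_submultisets: "finite {A. A <=# M}"
proof (induction M)
 case (add x M)
 have "{A. A <=# add_mset x M} <= {A. A <=# M} Un add_mset x ` {A. A <=# M}"
 proof
  fix A assume A: "A : {A. A <=# add_mset x M}"
  show "A : {A. A <=# M} Un add_mset x ` {A. A <=# M}"
  proof (cases "x :# A")
   case True
   then obtain B where "A = add_mset x B" by (metis multi_member_split)
   thus ?thesis using A by auto
  next
   case False
   hence "A <=# M" using A by (auto simp: subseteq_mset_def not_in_iff) (metis le_SucI le_zero_eq zero_le)
   thus ?thesis by simp
  qed
 qed
 thus ?case using add by (meson finite_Un finite_imageI finite_subset)
qed simp

text \<open>The law exp l exp l' = exp (l + l') for formal series. The induction step differentiates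
  in q: the multiplicity of q in the whole monomial is the sum of those in A and in its complement,
  as in Leibniz's rule, and \<open>ecoef_remove\<close> reduces each part to the smaller
  monomial.\<close>

lemma ecoef_convolution:
 "(SUM A:{A. A <=# M}. ecoef l A * ecoef l' (M - A)) = ecoef (%x. l x + l' x) M"
proof (induction M)
 case (add q M)
 let ?M = "add_mset q M"
 have 1: "(SUM A:{A. A <=# ?M}. of_nat (count A q) * ecoef l A * ecoef l' (?M - A))
   = l q * (SUM B:{B. B <=# M}. ecoef l B * ecoef l' (M - B))"
 proof -
  have "(SUM A:{A. A <=# ?M}. of_nat (count A q) * ecoef l A * ecoef l' (?M - A))
   = (SUM A:{A. A <=# ?M & q :# A}. l q * ecoef l (A - {#q#}) * ecoef l' (?M - A))"
   by (rule sum.mono_neutral_cong_right) (auto simp: finite_submultisets ecoef_remove)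
  also have "\<dots> = (SUM B:{B. B <=# M}. l q * ecoef l B * ecoef l' (M - B))" by (rule sum.reindex_bij_witness[of _ "add_mset q" "%A. A - {#q#}"])
     (auto simp: subset_eq_diff_conv dest!: multi_member_split)
  finally show ?thesis by (simp add: sum_distrib_left mult_ac)
 qed
 have 2: "(SUM A:{A. A <=# ?M}. of_nat (count (?M - A) q) * ecoef l A * ecoef l' (?M - A))
   = l' q * (SUM B:{B. B <=# M}. ecoef l B * ecoef l' (M - B))"
 proof -
  have e: "of_nat (count N q) * ecoef l A * ecoef l' N = ecoef l A * (of_nat (count N q) * ecoef l' N)" for A N by simp
  have "q :# ?M - A \<longleftrightarrow> A <=# M" if "A <=# ?M" for A
  proof
   assume "q :# ?M - A"
   hence "count A q < Suc (count M q)" by (simp flip: count_greater_zero_iff)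
   thus "A <=# M" using that unfolding subseteq_mset_def by (metis count_add_mset less_Suc_eq_le)
  next
   assume "A <=# M"
   hence "count A q <= count M q" by (simp add: mset_subset_eq_count)
   thus "q :# ?M - A" by (simp flip: count_greater_zero_iff)
  qed
  moreover have "A <=# ?M" if "A <=# M" for A using that unfolding subseteq_mset_def by (metis count_add_mset le_SucI)
  ultimately have "{A. A <=# ?M & q :# ?M - A} = {B. B <=# M}" by auto
  moreover have "(SUM A:{A. A <=# ?M}. of_nat (count (?M - A) q) * ecoef l A * ecoef l' (?M - A))
   = (SUM A:{A. A <=# ?M & q :# ?M - A}. l' q * (ecoef l A * ecoef l' (?M - A - {#q#})))" unfolding e
  proof (rule sum.mono_neutral_cong_right, goal_cases)
   case (4 A)
   hence "q :# ?M - A" by simp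
   thus ?case by (simp only: ecoef_remove if_True mult.left_commute)
  next
   case 3
   have "of_nat (count (?M - A) q) * ecoef l' (?M - A) = 0" if "q ~:# ?M - A" for A using that by (simp only: ecoef_remove if_False)
   thus ?case by (metis (mono_tags, lifting) DiffD1 DiffD2 mem_Collect_eq mult_zero_right)
  qed (auto simp: finite_submultisets)
  moreover have "?M - A - {#q#} = M - A" for A by (simp add: diff_diff_add)
  ultimately show ?thesis by (simp add: sum_distrib_left)
 qed
 have "of_nat (Suc (count M q)) * (SUM A:{A. A <=# ?M}. ecoef l A * ecoef l' (?M - A))
  = (SUM A:{A. A <=# ?M}. of_nat (count A q) * ecoef l A * ecoef l' (?M - A) + of_nat (count (?M - A) q) * ecoef l A * ecoef l' (?M - A))"
 proof (unfold sum_distrib_left, rule sum.cong[OF refl], goal_cases)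
  case (1 A)
  hence "Suc (count M q) = count A q + count (?M - A) q" using mset_subset_eq_count[of A ?M q] by simp
  thus ?case by (simp only: of_nat_add ring_distribs mult.assoc)
 qed
 hence "of_nat (Suc (count M q)) * (SUM A:{A. A <=# ?M}. ecoef l A * ecoef l' (?M - A)) =
   of_nat (Suc (count M q)) * ecoef (%x. l x + l' x) ?M" unfolding sum.distrib 1 2 add ecoef_add by (simp add: algebra_simps)
 thus ?case by (metis (no_types) mult_left_cancel of_nat_neq_0)
qed simp

text \<open>The monomials of degree N in the factors of ls. There are finitely many of them, so the
  exponential series sorted by degree has finite sums as its terms.\<close>

definition supp_sets :: "(complex * 'a) list => nat => 'a multiset set" where
 "supp_sets ls N = {M. size M = N & set_mset M <= snd ` set ls}"

definition coeff_of :: "(complex * 'a) list => 'a => complex" where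
 "coeff_of ls q = lin (%p. if p = q then 1 else 0) ls"

lemma coeff_of_append: "coeff_of (ls @ ls') = (%x. coeff_of ls x + coeff_of ls' x)" by (simp add: coeff_of_def fun_eq_iff)

lemma coeff_of_zero: "q ~: snd ` set ls ==> coeff_of ls q = 0" unfolding coeff_of_def by (subst lin_cong[of ls _ "%_. 0"]) auto

lemma sum_coeff_of:
 assumes "finite S" "snd ` set ls <= S"
 shows "(SUM y:S. coeff_of ls y * h y) = lin h ls" using assms(2)
proof (induction ls)
 case (Cons a ls)
 obtain al p where a: "a = (al, p)" by force
 have "(SUM y:S. coeff_of (a # ls) y * h y) = (SUM y:S. (if y = p then al * h y else 0) + coeff_of ls y * h y)"
  by (intro sum.cong) (auto simp: coeff_of_def a algebra_simps)
 also have "\<dots> = al * h p + lin h ls" using Cons assms(1) by (simp add: sum.distrib a)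
 finally show ?case by (simp add: a)
qed (simp add: coeff_of_def)

lemma finite_supp_sets: "finite (supp_sets ls N)"
proof (induction N)
 case (Suc N)
 have "supp_sets ls (Suc N) <= (%(q, M). add_mset q M) ` ((snd ` set ls) \<times> supp_sets ls N)"
 proof
  fix M assume M: "M : supp_sets ls (Suc N)"
  then obtain q M' where "M = add_mset q M'"
   unfolding supp_sets_def by (metis (mono_tags, lifting) mem_Collect_eq multiset_cases nat.simps(3) size_empty)
  thus "M : (%(q, M). add_mset q M) ` ((snd ` set ls) \<times> supp_sets ls N)"
   using M by (intro image_eqI[of _ _ "(q, M')"]) (auto simp: supp_sets_def)
 qed
 thus ?case using Suc by (meson finite_imageI finite_SigmaI finite_set finite_subset)
next
 case 0
 have "supp_sets ls 0 = {{#}}" by (auto simp: supp_sets_def)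
 thus ?case by simp
qed

lemma supp_sets_0: "supp_sets ls 0 = {{#}}" by (auto simp: supp_sets_def)

text \<open>Marking an element y and removing it lowers the degree by one. The multiplicity of y
  cancels against the factorial in \<open>ecoef\<close> and leaves the coefficient of y.\<close>

lemma sum_supp_sets_Suc:
 fixes g :: "'a => 'a multiset => complex"
 shows "(SUM M:supp_sets ls (Suc N). ecoef (coeff_of ls) M * (SUM y:#M. g y (M - {#y#})))
  = lin (%y. SUM M:supp_sets ls N. ecoef (coeff_of ls) M * g y M) ls"
proof -
 let ?S = "snd ` set ls" and ?l = "coeff_of ls"
 have "(SUM M:supp_sets ls (Suc N). ecoef ?l M * (SUM y:#M. g y (M - {#y#})))
  = (SUM M:supp_sets ls (Suc N). SUM y:?S. (if y :# M then ?l y * (ecoef ?l (M - {#y#}) * g y (M - {#y#})) else 0))"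
 proof (rule sum.cong[OF refl])
  fix M assume M: "M : supp_sets ls (Suc N)"
  have "ecoef ?l M * (SUM y:#M. g y (M - {#y#})) = (SUM y:set_mset M. of_nat (count M y) * ecoef ?l M * g y (M - {#y#}))"
   by (simp add: sum_mset_conv_sum sum_distrib_left mult_ac)
  also have "\<dots> = (SUM y:set_mset M. ?l y * (ecoef ?l (M - {#y#}) * g y (M - {#y#})))"
   by (intro sum.cong refl) (simp add: ecoef_remove mult.assoc)
  also have "\<dots> = (SUM y:?S. (if y :# M then ?l y * (ecoef ?l (M - {#y#}) * g y (M - {#y#})) else 0))"
   using M by (intro sum.mono_neutral_cong_left) (auto simp: supp_sets_def)
  finally show "ecoef ?l M * (SUM y:#M. g y (M - {#y#})) = \<dots>" .
 qed
 also have "\<dots> = (SUM y:?S. SUM M:supp_sets ls (Suc N). (if y :# M then ?l y * (ecoef ?l (M - {#y#}) * g y (M - {#y#})) else 0))"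
  by (rule sum.swap)
 also have "\<dots> = (SUM y:?S. ?l y * (SUM M:supp_sets ls N. ecoef ?l M * g y M))"
 proof (rule sum.cong[OF refl])
  fix y assume y: "y : ?S"
  have "(SUM M:supp_sets ls (Suc N). (if y :# M then ?l y * (ecoef ?l (M - {#y#}) * g y (M - {#y#})) else 0))
   = (SUM M:{M:supp_sets ls (Suc N). y :# M}. ?l y * (ecoef ?l (M - {#y#}) * g y (M - {#y#})))"
   by (intro sum.mono_neutral_cong_right) (auto simp: finite_supp_sets)
  also have "\<dots> = (SUM M:supp_sets ls N. ?l y * (ecoef ?l M * g y M))"
   using y by (intro sum.reindex_bij_witness[of _ "add_mset y" "%M. M - {#y#}"])
    (auto simp: supp_sets_def dest!: multi_member_split)
  finally show "(SUM M:supp_sets ls (Suc N). (if y :# M then ?l y * (ecoef ?l (M - {#y#}) * g y (M - {#y#})) else 0))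
   = ?l y * (SUM M:supp_sets ls N. ecoef ?l M * g y M)" by (simp add: sum_distrib_left)
 qed
 also have "\<dots> = lin (%y. SUM M:supp_sets ls N. ecoef ?l M * g y M) ls" by (rule sum_coeff_of) auto
 finally show ?thesis .
qed

definition graded :: "('a => 'a => complex) => (complex * 'a) list => 'a multiset => nat => complex" where
 "graded C ls P N = (SUM M:supp_sets ls N. ecoef (coeff_of ls) M * moment C (%_. 0) (P + M))"

lemma graded_add:
 assumes "symm C"
 shows "graded C ls (add_mset q P) N = (SUM y:#P. C q y * graded C ls (P - {#y#}) N)
   + (case N of 0 => 0 | Suc N => lin (C q) ls * graded C ls P N)"
proof -
 let ?l = "coeff_of ls" and ?H = "moment C (%_. 0)"
 have H: "?H (add_mset q P + M) = (SUM y:#P. C q y * ?H (P - {#y#} + M)) + (SUM y:#M. C q y * ?H (P + (M - {#y#})))" for M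
 proof -
  have "(SUM y:#P. C q y * ?H (P + M - {#y#})) = (SUM y:#P. C q y * ?H (P - {#y#} + M))" by (intro sum_mset_cong) simp
  moreover have "(SUM y:#M. C q y * ?H (P + M - {#y#})) = (SUM y:#M. C q y * ?H (P + (M - {#y#})))" by (intro sum_mset_cong) simp
  ultimately show ?thesis by (simp add: moment_add[OF assms])
 qed
 have 1: "(SUM M:supp_sets ls N. ecoef ?l M * (SUM y:#P. C q y * ?H (P - {#y#} + M)))
   = (SUM y:#P. C q y * graded C ls (P - {#y#}) N)" unfolding graded_def sum_mset_conv_sum sum_distrib_left by (subst sum.swap) (simp add: mult_ac)
 have 2: "(SUM M:supp_sets ls N. ecoef ?l M * (SUM y:#M. C q y * ?H (P + (M - {#y#}))))
   = (case N of 0 => 0 | Suc N => lin (C q) ls * graded C ls P N)"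
 proof (cases N)
  case (Suc n)
  have "lin (%y. SUM M:supp_sets ls n. ecoef ?l M * (C q y * ?H (P + M))) ls = lin (%y. graded C ls P n * C q y) ls"
   by (intro lin_cong) (simp add: graded_def sum_distrib_left sum_distrib_right mult_ac)
  thus ?thesis using Suc sum_supp_sets_Suc[where g = "%y A. C q y * ?H (P + A)"] by (simp add: lin_scale)
 qed (simp add: supp_sets_0)
 show ?thesis unfolding graded_def[of _ _ "add_mset q P"] H distrib_left sum.distrib 1 2 ..
qed

lemma graded_empty_0: "graded C ls {#} 0 = 1" by (simp add: graded_def supp_sets_0)

text \<open>Euler's relation in degree N + 1: every monomial is counted once for each of its
  elements, and integration by parts of the marked element lowers the degree by two.\<close>

lemma graded_empty_Suc:
 assumes "symm C"
 shows "of_nat (Suc N) * graded C ls {#} (Suc N) = (case N of 0 => 0 | Suc n => bil C ls * graded C ls {#} n)"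
proof -
 let ?l = "coeff_of ls" and ?H = "moment C (%_. 0)"
 have "of_nat (Suc N) * graded C ls {#} (Suc N) =
  (SUM M:supp_sets ls (Suc N). ecoef ?l M * (SUM y:#M. ?H (add_mset y (M - {#y#}))))"
  unfolding graded_def sum_distrib_left
 proof (rule sum.cong[OF refl])
  fix M assume M: "M : supp_sets ls (Suc N)"
  have "(SUM y:#M. ?H (add_mset y (M - {#y#}))) = (SUM y:#M. ?H M)" by (intro sum_mset_cong) simp
  also have "\<dots> = of_nat (Suc N) * ?H M" using M by (simp add: supp_sets_def sum_mset_constant)
  finally show "of_nat (Suc N) * (ecoef ?l M * ?H ({#} + M)) = ecoef ?l M * (SUM y:#M. ?H (add_mset y (M - {#y#})))" by (simp add: mult_ac)
 qed
 also have "\<dots> = lin (%y. graded C ls {#y#} N) ls" by (subst sum_supp_sets_Suc) (simp add: graded_def)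
 also have "(%y. graded C ls {#y#} N) = (%y. (case N of 0 => 0 | Suc n => graded C ls {#} n) * lin (C y) ls)"
  by (rule ext) (auto simp: graded_add[OF assms] split: nat.split)
 finally show ?thesis by (auto simp: lin_scale bil_def split: nat.split)
qed

lemma graded_empty_even:
 assumes "symm C"
 shows "graded C ls {#} (2 * k) = (bil C ls / 2) ^ k / fact k"
  and "graded C ls {#} (Suc (2 * k)) = 0"
proof -
 have s: "graded C ls {#} (Suc (Suc n)) = bil C ls * graded C ls {#} n / of_nat (Suc (Suc n))" for n
  using graded_empty_Suc[OF assms, of "Suc n" ls] by (simp add: field_simps del: of_nat_Suc)
 show "graded C ls {#} (2 * k) = (bil C ls / 2) ^ k / fact k"
 proof (induction k)
  case (Suc k)
  have "(of_nat (Suc (Suc (2 * k))) :: complex) = 2 * of_nat (Suc k)" by simp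
  hence "graded C ls {#} (2 * Suc k) = bil C ls * ((bil C ls / 2) ^ k / fact k) / (2 * of_nat (Suc k))" using s[of "2 * k"] by (simp add: Suc)
  thus ?case by (simp add: divide_simps mult_ac del: of_nat_Suc)
 qed (simp add: graded_empty_0)
 show "graded C ls {#} (Suc (2 * k)) = 0"
 proof (induction k)
  case 0
  show ?case using graded_empty_Suc[OF assms, of 0 ls] by simp
 next
  case (Suc k)
  thus ?case using s[of "Suc (2 * k)"] by simp
 qed
qed

text \<open>For empty P the sum over degrees is the exponential series of half the variance of the
  exponent. Integration by parts then adds the factors of P one at a time on both sides.\<close>

lemma graded_sums:
 assumes "symm C"
 shows "graded C ls P sums gauss C (%_. 0) P ls"
proof (induction P rule: multiset_size_induct)
 case empty
 have "(%k. graded C ls {#} (2 * k)) sums exp (bil C ls / 2)"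
  unfolding graded_empty_even(1)[OF assms] using exp_converges[of "bil C ls / 2"]  by (simp add: scaleR_conv_of_real field_simps)
 moreover have "graded C ls {#} n = 0" if "n ~: range (%k. 2 * k)" for n
 proof -
  have "odd n" using that by (auto elim!: evenE)
  thus ?thesis using graded_empty_even(2)[OF assms] by (auto elim!: oddE)
 qed
 ultimately have "graded C ls {#} sums exp (bil C ls / 2)" by (subst (asm) sums_mono_reindex) (auto simp: strict_mono_def)
 thus ?case by (simp add: gauss_def)
next
 case (add q P)
 have "(%N. SUM y:#P. C q y * graded C ls (P - {#y#}) N) sums (SUM y:#P. C q y * gauss C (%_. 0) (P - {#y#}) ls)"
  unfolding sum_mset_conv_sum by (intro sums_sum sums_mult add) simp
 moreover have "(%N. case N of 0 => 0 | Suc N => lin (C q) ls * graded C ls P N) sums (lin (C q) ls * gauss C (%_. 0) P ls)"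
  by (subst sums_Suc_iff[symmetric, where f = "%N. case N of 0 => 0 | Suc N => lin (C q) ls * graded C ls P N", simplified]) (intro sums_mult add, simp)
 ultimately have "graded C ls (add_mset q P) sums ((SUM y:#P. C q y * gauss C (%_. 0) (P - {#y#}) ls) + lin (C q) ls * gauss C (%_. 0) P ls)"
  unfolding graded_add[OF assms, abs_def] by (rule sums_add)
 moreover have "C q = (%p. C p q)" using assms by (auto simp: symm_def)
 hence "lin (C q) ls = gmean C (%_. 0) ls q" by (simp add: gmean_def)
 ultimately show ?case by (simp add: gauss_def moment_add[OF assms] distrib_left sum_mset_distrib_left mult_ac add_ac)
qed

text \<open>A centred moment is a polynomial with nonnegative coefficients in the covariances, so
  passing to moduli gives a majorant. It is complex valued like every moment, hence the accompanying
  claim that it is real.\<close>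

lemma moment_norm_le:
 assumes "symm C"
 shows "moment (%x y. of_real (norm (C x y))) (%_. 0) M : \<real> &
   norm (moment C (%_. 0) M) <= Re (moment (%x y. of_real (norm (C x y))) (%_. 0) M)"
proof (induction M rule: multiset_size_induct)
 case (add x M)
 have s: "symm (%x y. of_real (norm (C x y)))" using assms by (auto simp: symm_def)
 let ?H = "moment (%x y. of_real (norm (C x y))) (%_. 0)"
 have "(SUM y:#M. of_real (norm (C x y)) * ?H (M - {#y#})) : \<real>" unfolding sum_mset_conv_sum using add by (intro sum_in_Reals Reals_mult) auto
 moreover have "norm (SUM y:#M. C x y * moment C (%_. 0) (M - {#y#})) <= Re (SUM y:#M. of_real (norm (C x y)) * ?H (M - {#y#}))"
  unfolding sum_mset_conv_sum Re_sum
 proof (rule sum_norm_le)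
  fix y assume "y :# M"
  have "norm (of_nat (count M y) * (C x y * moment C (%_. 0) (M - {#y#}))) <= of_nat (count M y) * (norm (C x y) * Re (?H (M - {#y#})))"
   using add[of "M - {#y#}"] by (auto simp: norm_mult intro!: mult_left_mono)
  also have "\<dots> = Re (of_nat (count M y) * (of_real (norm (C x y)) * ?H (M - {#y#})))" by simp
  finally show "norm (of_nat (count M y) * (C x y * moment C (%_. 0) (M - {#y#}))) <= \<dots>" .
 qed
 ultimately show ?case by (simp add: moment_add[OF assms] moment_add[OF s])
qed auto

lemma ecoef_norm: "ecoef (%q. of_real (norm (l q))) M = of_real (norm (ecoef l M))"
 by (simp add: ecoef_def norm_mult norm_power norm_divide flip: prod_norm)

lemma ecoef_zero:
 assumes "q :# M" "l q = 0"
 shows "ecoef l M = 0" using assms by (auto simp: ecoef_def intro!: prod_zero bexI[of _ q])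

lemma ecoef_support: "ecoef (coeff_of ls) M ~= 0 ==> M : supp_sets ls (size M)" using ecoef_zero coeff_of_zero unfolding supp_sets_def by fastforce

text \<open>With moduli in place of coefficients and covariances all terms are nonnegative. Every
  finite sum is then dominated by a sum over low degrees, which is a partial sum of the convergent
  series in \<open>graded_sums\<close>.\<close>

lemma ecoef_moment_summable:
 assumes s: "symm C"
 shows "(%M. norm (ecoef (coeff_of ls) M * moment C (%_. 0) (P + M))) summable_on UNIV"
proof -
 define C' where "C' = (%x y. of_real (norm (C x y)) :: complex)"
 \<comment> \<open>After \<open>remdups\<close> every factor occurs once, so that its coefficient in
   \<open>ls'\<close> is exactly the modulus of its total coefficient in ls and
   \<open>ecoef_norm\<close> applies.\<close>
 define ls' where "ls' = map (%q. (complex_of_real (norm (coeff_of ls q)), q)) (remdups (map snd ls))"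
 have s': "symm C'" using s by (auto simp: symm_def C'_def)
 have c1: "coeff_of (map (%q. (f q, q)) xs) q = (if q : set xs then f q else 0)" if "distinct xs" for f :: "'a => complex" and xs q
  using that by (induction xs) (auto simp: coeff_of_def)
 have c: "coeff_of ls' = (%q. of_real (norm (coeff_of ls q)))" unfolding ls'_def by (rule ext, subst c1) (auto simp: coeff_of_zero)
 have sset: "supp_sets ls' = supp_sets ls" by (auto simp: supp_sets_def fun_eq_iff ls'_def image_image)
 define g where "g M = Re (ecoef (coeff_of ls') M * moment C' (%_. 0) (P + M))" for M
 have g0: "norm (ecoef (coeff_of ls) M * moment C (%_. 0) (P + M)) <= g M" for M unfolding g_def c ecoef_norm
  using moment_norm_le[OF s, of "P + M"] by (auto simp: norm_mult C'_def intro!: mult_left_mono)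
 hence g1: "g M \<ge> 0" for M by (meson norm_ge_zero order_trans)
 have gsum: "(%N. SUM M:supp_sets ls N. g M) sums Re (gauss C' (%_. 0) P ls')"
  using sums_Re[OF graded_sums[OF s', of ls' P]] by (simp add: graded_def g_def sset)
 have "g summable_on UNIV"
 proof (rule nonneg_bdd_above_summable_on)
  show "bdd_above (sum g ` {F. F <= UNIV & finite F})"
  proof (rule bdd_aboveI2)
   fix F :: "'a multiset set" assume "F : {F. F <= UNIV & finite F}"
   hence F: "finite F" by simp
   define K where "K = Suc (Max (insert 0 (size ` F)))"
   have K: "size M < K" if "M : F" for M using that F by (auto simp: K_def less_Suc_eq_le)
   have "sum g F = sum g {M:F. g M ~= 0}" using F by (intro sum.mono_neutral_right) auto
   also have "\<dots> <= sum g (\<Union>N<K. supp_sets ls N)"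
   proof (rule sum_mono2)
    show "{M : F. g M ~= 0} <= (\<Union>N<K. supp_sets ls N)"
    proof
     fix M assume M: "M : {M : F. g M ~= 0}"
     hence "ecoef (coeff_of ls') M ~= 0" by (auto simp: g_def)
     thus "M : (\<Union>N<K. supp_sets ls N)" using ecoef_support[of ls' M] K M by (auto simp: sset)
    qed
   qed (use finite_supp_sets g1 in auto)
   also have "\<dots> = (SUM N<K. sum g (supp_sets ls N))" by (rule sum.UNION_disjoint) (auto simp: finite_supp_sets, auto simp: supp_sets_def)
   also have "\<dots> <= Re (gauss C' (%_. 0) P ls')"
    using sum_le_suminf[OF sums_summable[OF gsum], of "{..<K}"] sums_unique[OF gsum] g1 by (auto intro: sum_nonneg)
   finally show "sum g F <= Re (gauss C' (%_. 0) P ls')" .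
  qed
 qed (use g1 in auto)
 hence "(%M. norm (g M)) summable_on UNIV" using g1 by simp
 thus ?thesis by (rule Infinite_Sum.abs_summable_on_comparison_test) (use g0 g1 in auto)
qed

text \<open>Absolute summability provides a sum over all monomials; exhausting them by degree, the
  order of summation in \<open>graded_sums\<close>, identifies its value.\<close>

lemma ecoef_moment_has_sum:
 assumes s: "symm C"
 shows "((%M. ecoef (coeff_of ls) M * moment C (%_. 0) (P + M)) has_sum gauss C (%_. 0) P ls) UNIV"
proof -
 define f where "f M = ecoef (coeff_of ls) M * moment C (%_. 0) (P + M)" for M
 define U where "U = (\<Union>N. supp_sets ls N)"
 have "f summable_on UNIV" using ecoef_moment_summable[OF s, of ls P] unfolding f_def[symmetric] by (rule abs_summable_summable)
 then obtain S where S: "(f has_sum S) UNIV" by (auto simp: summable_on_def)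
 have f0: "f M = 0" if "M ~: U" for M using ecoef_support[of ls M] that by (auto simp: f_def U_def)
 have SU: "(f has_sum S) U" using S by (rule has_sum_cong_neutral[THEN iffD1, rotated -1]) (use f0 in auto)
 define F where "F K = (\<Union>N<K. supp_sets ls N)" for K
 have "filterlim F (finite_subsets_at_top U) sequentially" unfolding filterlim_finite_subsets_at_top
 proof (intro allI impI)
  fix X assume X: "finite X & X <= U"
  define K where "K = Suc (Max (insert 0 (size ` X)))"
  have K: "size M < K" if "M : X" for M using that X by (auto simp: K_def less_Suc_eq_le)
  show "\<forall>\<^sub>F y in sequentially. finite (F y) & X <= F y & F y <= U"
  proof (rule eventually_sequentiallyI[of K], intro conjI)
   fix k assume "k \<ge> K"
   show "X <= F k"
   proof
    fix M assume "M : X"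
    hence "size M < k" "M : U" using K X \<open>k \<ge> K\<close> by (auto dest: less_le_trans)
    thus "M : F k" by (auto simp: F_def U_def supp_sets_def)
   qed
  qed (auto simp: F_def U_def finite_supp_sets)
 qed
 hence "(%K. sum f (F K)) \<longlonglongrightarrow> S" using SU unfolding has_sum_def by (rule filterlim_compose[rotated])
 moreover have "sum f (F K) = (SUM N<K. graded C ls P N)" for K
  unfolding F_def graded_def f_def by (rule sum.UNION_disjoint) (auto simp: finite_supp_sets, auto simp: supp_sets_def)
 ultimately have "graded C ls P sums S" by (simp add: sums_def)
 hence "S = gauss C (%_. 0) P ls" using graded_sums[OF s] sums_unique2 by blast
 thus ?thesis using S by (simp add: f_def[abs_def])
qed

text \<open>The Wick product of the factors in P and of the Wick exponential of ls, as a formal series.\<close>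

definition wick_term :: "'a multiset => (complex * 'a) list => 'a multiset => complex" where
 "wick_term P ls M = (if P <=# M then ecoef (coeff_of ls) (M - P) else 0)"

lemma wick_term_moment:
 assumes s: "symm C"
 shows "(%M. norm (wick_term P ls M * moment C (%_. 0) M)) summable_on UNIV"
  and "((%M. wick_term P ls M * moment C (%_. 0) M) has_sum gauss C (%_. 0) P ls) UNIV"
proof -
 have inj: "inj ((+) P)" by (auto simp: inj_def)
 have r: "M : range ((+) P)" if "P <=# M" for M using that by (metis mset_subset_eq_exists_conv rangeI)
 have e: "(%M. wick_term P ls M * moment C (%_. 0) M) \<circ> (+) P = (%M. ecoef (coeff_of ls) M * moment C (%_. 0) (P + M))"
  by (auto simp: wick_term_def)
 have "(%M. norm (wick_term P ls M * moment C (%_. 0) M)) summable_on range ((+) P)"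
  using ecoef_moment_summable[OF s, of ls P] by (subst summable_on_reindex[OF inj]) (simp add: comp_def wick_term_def)
 thus "(%M. norm (wick_term P ls M * moment C (%_. 0) M)) summable_on UNIV"
  by (rule summable_on_cong_neutral[THEN iffD1, rotated -1]) (insert r, auto simp: wick_term_def)
 have "((%M. wick_term P ls M * moment C (%_. 0) M) has_sum gauss C (%_. 0) P ls) (range ((+) P))"
  using ecoef_moment_has_sum[OF s, of ls P] by (subst has_sum_reindex[OF inj]) (simp add: e)
 thus "((%M. wick_term P ls M * moment C (%_. 0) M) has_sum gauss C (%_. 0) P ls) UNIV"
  by (rule has_sum_cong_neutral[THEN iffD1, rotated -1]) (insert r, auto simp: wick_term_def)
qed

lemma wick_one_term: "wick_one = wick_term {#} []"
proof
 fix M show "wick_one M = wick_term {#} [] M"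
 proof (cases M)
  case (add q N)
  have "ecoef (coeff_of []) (add_mset q N) = 0" by (rule ecoef_zero[of q]) (auto simp: coeff_of_def)
  thus ?thesis by (simp add: wick_one_def wick_term_def add)
 qed (simp add: wick_one_def wick_term_def)
qed

lemma wick_factor_term: "wick_factor p = wick_term {#p#} []"
proof
 fix M
 show "wick_factor p M = wick_term {#p#} [] M"
 proof (cases "{#p#} <=# M")
  case True
  then obtain N where "M = add_mset p N" by (metis mset_subset_eq_exists_conv add_mset_add_single union_commute)
  thus ?thesis using fun_cong[OF wick_one_term, of N] by (auto simp: wick_factor_def wick_term_def wick_one_def)
 qed (auto simp: wick_factor_def wick_term_def)
qed

lemma wick_exp_term: "wick_exp al p = wick_term {#} [(al, p)]"
proof
 fix M
 show "wick_exp al p M = wick_term {#} [(al, p)] M"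
 proof (cases "M = replicate_mset (size M) p")
  case True
  define n where "n = size M"
  have M: "M = replicate_mset n p" using True n_def by simp
  have "ecoef (coeff_of [(al, p)]) M = al ^ n / fact n" by (cases n) (simp_all add: M ecoef_def coeff_of_def)
  thus ?thesis by (simp add: wick_exp_def wick_term_def M)
 next
  case False
  then obtain q where "q :# M" "q ~= p" by (metis set_mset_subset_singletonD subsetI singletonI insertI1)
  hence "ecoef (coeff_of [(al, p)]) M = 0" by (intro ecoef_zero[of q]) (auto simp: coeff_of_def)
  thus ?thesis using False by (simp add: wick_exp_def wick_term_def)
 qed
qed

text \<open>Multiplication of formal power series: the factors in P and Q are split off by the
  substitution A = P + B, and the exponentials combine by \<open>ecoef_convolution\<close>.\<close>

lemma wick_prod_term: "wick_prod (wick_term P ls) (wick_term Q ls') = wick_term (P + Q) (ls @ ls')"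
proof
 fix M
 have sub: "P <=# A & Q <=# M - A & A <=# M \<longleftrightarrow> P + Q <=# M & P <=# A & A - P <=# M - (P + Q)" for A
  unfolding subseteq_mset_def by (simp add: all_conj_distrib[symmetric]) (intro all_cong1, linarith)
 have "wick_prod (wick_term P ls) (wick_term Q ls') M =
   (SUM A:{A. P <=# A & Q <=# M - A & A <=# M}. ecoef (coeff_of ls) (A - P) * ecoef (coeff_of ls') (M - A - Q))"
  unfolding wick_prod_def by (rule sum.mono_neutral_cong_right) (auto simp: finite_submultisets wick_term_def)
 also have "\<dots> = wick_term (P + Q) (ls @ ls') M"
 proof (cases "P + Q <=# M")
  case True
  have "(SUM A:{A. P <=# A & Q <=# M - A & A <=# M}. ecoef (coeff_of ls) (A - P) * ecoef (coeff_of ls') (M - A - Q))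
    = (SUM B:{B. B <=# M - (P + Q)}. ecoef (coeff_of ls) B * ecoef (coeff_of ls') (M - (P + Q) - B))" unfolding sub using True
  proof (intro sum.reindex_bij_witness[of _ "%B. P + B" "%A. A - P"], goal_cases)
   case (5 A)
   hence "M - (P + Q) - (A - P) = M - A - Q"
   proof (intro multiset_eqI)
    fix x
    have "count P x <= count A x" using 5 by (auto dest: mset_subset_eq_count)
    thus "count (M - (P + Q) - (A - P)) x = count (M - A - Q) x" by simp
   qed
   thus ?case by simp
  qed auto
  thus ?thesis using True by (simp only: wick_term_def if_True coeff_of_append ecoef_convolution)
 next
  case False
  hence "{A. P <=# A & Q <=# M - A & A <=# M} = {}" using sub by auto
  thus ?thesis using False by (simp only: wick_term_def if_False sum.empty)
 qed
 finally show "wick_prod (wick_term P ls) (wick_term Q ls') M = wick_term (P + Q) (ls @ ls') M" .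
qed

fun valid_factor :: "complex set => factor => bool" where
 "valid_factor S (Factor j k h z) \<longleftrightarrow> h analytic_on {z} & deriv h z ~= 0 & Im (h z) > 0 & h z : S"

fun plain_factor :: "factor => bool" where
 "plain_factor (Factor j k h z) \<longleftrightarrow> j = 0 & k = 0"

text \<open>Exponents may contain only underived factors because \<open>functionals\<close> offers
  Wick exponentials of the field itself and not of its derivatives.\<close>

definition valid_term :: "complex set => factor multiset => (complex * factor) list => bool" where
 "valid_term S P ls \<longleftrightarrow> (ALL p:set_mset P Un snd ` set ls. valid_factor S p) & (ALL p:snd ` set ls. plain_factor p)"

inductive_set term_span :: "(factor multiset => (complex * factor) list => bool) => functional set" for V where
 tm: "V P ls ==> wick_term P ls : term_span V"
| add: "F : term_span V ==> G : term_span V ==> (%M. F M + G M) : term_span V"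
| scale: "F : term_span V ==> (%M. k * F M) : term_span V"

abbreviation wick_span :: "complex set => functional set" where
 "wick_span S \<equiv> term_span (valid_term S)"

lemma wick_prod_add_left: "wick_prod (%M. F M + G M) H = (%M. wick_prod F H M + wick_prod G H M)"
 and wick_prod_add_right: "wick_prod H (%M. F M + G M) = (%M. wick_prod H F M + wick_prod H G M)"
 and wick_prod_scale_left: "wick_prod (%M. k * F M) H = (%M. k * wick_prod F H M)"
 and wick_prod_scale_right: "wick_prod H (%M. k * F M) = (%M. k * wick_prod H F M)"
 by (simp_all add: wick_prod_def fun_eq_iff algebra_simps sum.distrib sum_distrib_left)

lemma wick_span_wick_prod:
 assumes "F : wick_span S" "G : wick_span S"
 shows "wick_prod F G : wick_span S" using assms(1)
proof induction
 case (tm P ls)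
 note PL = this
 show ?case using assms(2)
 proof induction
  case (tm Q ls')
  thus ?case using PL unfolding wick_prod_term by (intro term_span.tm) (auto simp: valid_term_def)
 qed (auto simp: wick_prod_add_right wick_prod_scale_right intro: term_span.intros)
qed (auto simp: wick_prod_add_left wick_prod_scale_left intro: term_span.intros)

text \<open>Bilinearity of the Wick product reduces products to products of terms, which
  \<open>wick_prod_term\<close> merges; conversely a term is assembled factor by factor.\<close>

lemma functionals_eq_wick_span: "functionals S = wick_span S"
proof
 show "functionals S <= wick_span S"
 proof
  fix F assume "F : functionals S"
  thus "F : wick_span S"
  proof induction
   case one
   show ?case unfolding wick_one_term by (rule term_span.tm) (simp add: valid_term_def)
  next
   case (factor h z j k)
   thus ?case unfolding wick_factor_term by (intro term_span.tm) (simp add: valid_term_def)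
  next
   case (exp h z al)
   thus ?case unfolding wick_exp_term by (intro term_span.tm) (simp add: valid_term_def)
  qed (auto intro: term_span.add term_span.scale wick_span_wick_prod)
 qed
 show "wick_span S <= functionals S"
 proof
  fix F assume "F : wick_span S"
  thus "F : functionals S"
  proof induction
   case (tm P ls)
   have e: "wick_term {#} ls : functionals S" using tm
   proof (induction ls)
    case Nil
    show ?case by (simp add: functionals.one flip: wick_one_term)
   next
    case (Cons a ls)
    obtain al h z where a: "a = (al, Factor 0 0 h z)" using Cons(2) by (cases a; cases "snd a") (auto simp: valid_term_def)
    have "wick_exp al (Factor 0 0 h z) : functionals S" using Cons(2) by (intro functionals.exp) (auto simp: valid_term_def a)
    moreover have "wick_term {#} ls : functionals S" using Cons by (auto simp: valid_term_def)
    ultimately show ?case using functionals.wick by (fastforce simp: a wick_exp_term wick_prod_term)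
   qed
   show ?case using tm
   proof (induction P)
    case (add p P)
    obtain j k h z where p: "p = Factor j k h z" by (cases p)
    have "wick_factor p : functionals S" using add(2) unfolding p by (intro functionals.factor) (auto simp: valid_term_def p)
    moreover have "wick_term P ls : functionals S" using add by (auto simp: valid_term_def)
    ultimately have "wick_prod (wick_factor p) (wick_term P ls) : functionals S" by (rule functionals.wick)
    thus ?case by (simp add: wick_factor_term wick_prod_term)
   qed (use e in simp)
  qed (auto intro: functionals.intros)
 qed
qed

section \<open>Correlations of Wick terms\<close>

text \<open>The tags decide the order of the arguments, which makes this covariance symmetric
  unconditionally; symmetry of \<open>pair_expectation\<close> itself is proved only for valid
  factors at different nodes.\<close>

fun tag_cov :: "nat * factor => nat * factor => complex" where
 "tag_cov (i, p) (j, q) = (if i < j then pair_expectation p q else if j < i then pair_expectation q p else 0)"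

lemma symm_tag_cov: "symm tag_cov" by (auto simp: symm_def)

lemma mset_take_drop:
 assumes "k < length xs"
 shows "mset (take k xs @ drop (Suc k) xs) = mset xs - {#xs ! k#}"
proof -
 have "mset xs = mset (take k xs @ xs ! k # drop (Suc k) xs)" using id_take_nth_drop[OF assms] by (rule arg_cong)
 thus ?thesis by simp
qed

lemma sum_mset_mset: "(SUM y:#mset xs. f y) = (SUM k<length xs. f (xs ! k))"
proof -
 have "(SUM y:#mset xs. f y) = sum_list (map f xs)" by (induction xs) auto
 thus ?thesis by (simp add: sum_list_sum_nth atLeast0LessThan)
qed

text \<open>Both sides expand along the first factor. Sortedness makes its tag minimal, so
  \<open>tag_cov\<close> takes its arguments in the order used by \<open>pairing_sum\<close>;
  partners with the same tag contribute nothing on either side.\<close>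

lemma pairing_sum_moment:
 "sorted (map fst xs) ==> pairing_sum xs = moment tag_cov (%_. 0) (mset xs)"
proof (induction xs rule: pairing_sum.induct)
 case (2 i p xs)
 have "moment tag_cov (%_. 0) (mset ((i, p) # xs)) = (SUM k<length xs. tag_cov (i, p) (xs ! k) * moment tag_cov (%_. 0) (mset xs - {#xs ! k#}))"
  by (simp add: moment_add[OF symm_tag_cov] sum_mset_mset)
 also have "\<dots> = (SUM k : {k. k < length xs & fst (xs ! k) ~= i}.
    pair_expectation p (snd (xs ! k)) * pairing_sum (take k xs @ drop (Suc k) xs))"
 proof (rule sum.mono_neutral_cong_right, goal_cases)
  case (4 k)
  have "i <= fst (xs ! k)" using 2(2) 4 by (simp add: nth_mem)
  hence "tag_cov (i, p) (xs ! k) = pair_expectation p (snd (xs ! k))" using 4 by (cases "xs ! k") auto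
  moreover have "sorted (map fst (take k xs @ drop (Suc k) xs))"
  proof -
   have "sorted (take k (map fst xs) @ drop (Suc k) (map fst xs))"
    using 2(2) by (intro sorted_append[THEN iffD2] conjI sorted_wrt_take sorted_wrt_drop ballI)
     (auto simp: in_set_conv_nth sorted_iff_nth_mono intro!: sorted_nth_mono)
   thus ?thesis by (simp add: take_map drop_map)
  qed
  ultimately show ?case using 2(1)[of k] 4 by (simp add: mset_take_drop del: mset_append)
 next
  case 3
  have "tag_cov (i, p) y = 0" if "fst y = i" for y using that by (cases y) simp
  thus ?case by auto
 qed auto
 finally show ?case by simp
qed simp

definition tags :: "'a multiset list => (nat * 'a) multiset" where
 "tags Ms = (SUM i<length Ms. image_mset (Pair i) (Ms ! i))"

lemma count_image_Pair: "count (image_mset (Pair i) M) (j, p) = (if i = j then count M p else 0)" by (induction M) auto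

lemma count_tags: "count (tags Ms) (i, p) = (if i < length Ms then count (Ms ! i) p else 0)" by (simp add: tags_def count_sum count_image_Pair)

lemma set_tags: "set_mset (tags Ms) = Sigma {..<length Ms} (%i. set_mset (Ms ! i))"
 by (auto simp: count_tags simp flip: count_greater_zero_iff split: if_splits)

lemma monomial_corr_moment: "monomial_corr Ms = moment tag_cov (%_. 0) (tags Ms)"
proof -
 define L where "L i = (SOME ps. mset ps = Ms ! i)" for i
 have L: "mset (L i) = Ms ! i" for i unfolding L_def by (rule someI_ex) (rule ex_mset)
 have 1: "mset (concat (map (%i. map (Pair i) (L i)) [0..<n])) = (SUM i<n. image_mset (Pair i) (Ms ! i))" for n by (induction n) (auto simp: L)
 have s0: "sorted (map (%x. n) xs)" for n :: nat and xs :: "factor list" by (induction xs) auto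
 have 2: "sorted (map fst (concat (map (%i. map (Pair i) (L i)) [0..<n])))" for n by (induction n) (auto simp: sorted_append comp_def s0)
 show ?thesis unfolding monomial_corr_def L_def[symmetric] by (subst pairing_sum_moment[OF 2]) (simp add: 1 tags_def)
qed

definition tagged_exps :: "(complex * 'a) list list => (complex * (nat * 'a)) list" where
 "tagged_exps lss = concat (map (%i. map (map_prod id (Pair i)) (lss ! i)) [0..<length lss])"

lemma coeff_of_tagged: "coeff_of (tagged_exps lss) (i, q) = (if i < length lss then coeff_of (lss ! i) q else 0)"
proof -
 have 1: "coeff_of (concat (map f xs)) x = (SUM a<-xs. coeff_of (f a) x)" for f :: "nat => (complex * (nat * 'a)) list" and xs x
  by (induction xs) (auto simp: coeff_of_append, auto simp: coeff_of_def)
 have 2: "coeff_of (map (map_prod id (Pair k)) ls) (i, q) = (if k = i then coeff_of ls q else 0)" for k and ls :: "(complex * 'a) list"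
  by (cases "k = i") (auto simp: coeff_of_def lin_map)
 show ?thesis unfolding tagged_exps_def 1 2 by (simp add: sum_list_distinct_conv_sum_set)
qed

text \<open>Monomials with different tags do not interact, so a product of series in separate slots
  is one series in the tagged factors. The multiple sum in a correlation thereby becomes a single
  one.\<close>

lemma wick_term_tags:
 assumes "length Ms = length ts"
 shows "(PROD i<length ts. wick_term (fst (ts ! i)) (snd (ts ! i)) (Ms ! i))
   = wick_term (tags (map fst ts)) (tagged_exps (map snd ts)) (tags Ms)"
proof (cases "ALL i<length ts. fst (ts ! i) <=# Ms ! i")
 case True
 have sub: "tags (map fst ts) <=# tags Ms" using True assms by (auto simp: subseteq_mset_def count_tags)
 define Ns where "Ns = map (%i. Ms ! i - fst (ts ! i)) [0..<length ts]"
 have N: "tags Ms - tags (map fst ts) = tags Ns" using assms by (auto intro!: multiset_eqI simp: count_tags Ns_def)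
 have "ecoef (coeff_of (tagged_exps (map snd ts))) (tags Ns) =
   (PROD i<length ts. PROD q:set_mset (Ns ! i). coeff_of (tagged_exps (map snd ts)) (i, q) ^ count (tags Ns) (i, q) / fact (count (tags Ns) (i, q)))"
  unfolding ecoef_def set_tags by (subst prod.Sigma) (auto simp: Ns_def intro!: prod.cong)
 also have "\<dots> = (PROD i<length ts. ecoef (coeff_of (snd (ts ! i))) (Ms ! i - fst (ts ! i)))"
  unfolding ecoef_def by (intro prod.cong refl) (auto simp: coeff_of_tagged count_tags Ns_def)
 finally show ?thesis using sub True N by (simp add: wick_term_def)
next
 case False
 then obtain i where i: "i < length ts" "\<not> fst (ts ! i) <=# Ms ! i" by blast
 then obtain x where "\<not> count (fst (ts ! i)) x <= count (Ms ! i) x" by (auto simp: subseteq_mset_def)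
 hence "\<not> count (tags (map fst ts)) (i, x) <= count (tags Ms) (i, x)" using i assms by (simp add: count_tags)
 hence "\<not> tags (map fst ts) <=# tags Ms" by (meson mset_subset_eq_count)
 moreover have "(PROD i<length ts. wick_term (fst (ts ! i)) (snd (ts ! i)) (Ms ! i)) = 0" using i by (intro prod_zero) (auto simp: wick_term_def)
 ultimately show ?thesis by (simp add: wick_term_def)
qed

lemma tags_inj: "inj_on tags {Ms. length Ms = n}"
proof (rule inj_onI, simp, rule nth_equalityI)
 fix Ms Ns :: "'a multiset list" and i
 assume "length Ms = n" "length Ns = n" "tags Ms = tags Ns" "i < length Ms"
 thus "Ms ! i = Ns ! i" by (metis count_tags multiset_eqI)
qed auto

lemma tags_surj:
 assumes "!!i p. (i, p) :# M ==> i < n"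
 shows "M : tags ` {Ms. length Ms = n}"
proof (rule image_eqI)
 let ?Ms = "map (%i. image_mset snd (filter_mset (%x. fst x = i) M)) [0..<n]"
 have c: "count (image_mset snd (filter_mset (%x. fst x = i) M)) p = count M (i, p)" for i p by (induction M) auto
 show "M = tags ?Ms"
 proof (rule multiset_eqI)
  fix x :: "nat * 'a" obtain i p where x: "x = (i, p)" by (cases x)
  show "count M x = count (tags ?Ms) x" using assms[of i p] by (cases "(i, p) :# M") (auto simp: x count_tags c not_in_iff)
 qed
qed auto

definition term_list :: "(factor multiset * (complex * factor) list) list => functional list" where
 "term_list ts = map (%(P, ls). wick_term P ls) ts"

definition corr_summand :: "functional list => factor multiset list => complex" where
 "corr_summand Fs Ms = (PROD i<length Fs. (Fs ! i) (Ms ! i)) * monomial_corr Ms"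

definition corr_summable :: "functional list => bool" where
 "corr_summable Fs \<longleftrightarrow> corr_summand Fs summable_on {Ms. length Ms = length Fs}"

text \<open>Lists of n monomials correspond through \<open>tags\<close> to monomials with all tags
  below n, and every other tagged monomial has coefficient 0. The sum defining \<open>corr\<close>
  therefore becomes the one evaluated in \<open>wick_term_moment\<close>.\<close>

lemma corr_term_list:
 shows "corr_summable (term_list ts)"
  and "corr (term_list ts) = gauss tag_cov (%_. 0) (tags (map fst ts)) (tagged_exps (map snd ts))"
proof -
 let ?P = "tags (map fst ts)" and ?l = "tagged_exps (map snd ts)"
 let ?f = "%M. wick_term ?P ?l M * moment tag_cov (%_. 0) M"
 define A where "A = {Ms :: factor multiset list. length Ms = length ts}"
 have z: "M : tags ` A" if "wick_term ?P ?l M ~= 0" for M unfolding A_def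
 proof (rule tags_surj)
  fix i p assume M: "(i, p) :# M"
  show "i < length ts"
  proof (rule ccontr)
   assume i: "\<not> i < length ts"
   hence "count ?P (i, p) = 0" "coeff_of ?l (i, p) = 0" by (simp_all add: count_tags coeff_of_tagged)
   hence "(i, p) :# M - ?P" using M by (simp flip: count_greater_zero_iff)
   hence "ecoef (coeff_of ?l) (M - ?P) = 0" using \<open>coeff_of ?l (i, p) = 0\<close> by (rule ecoef_zero)
   thus False using that by (simp add: wick_term_def split: if_splits)
  qed
 qed
 have "(?f has_sum gauss tag_cov (%_. 0) ?P ?l) UNIV" by (rule wick_term_moment(2)[OF symm_tag_cov])
 hence "(?f has_sum gauss tag_cov (%_. 0) ?P ?l) (tags ` A)" by (rule has_sum_cong_neutral[THEN iffD1, rotated -1]) (use z in auto)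
 hence "(?f \<circ> tags has_sum gauss tag_cov (%_. 0) ?P ?l) A" by (subst (asm) has_sum_reindex) (auto simp: A_def intro: tags_inj)
 moreover have "(?f \<circ> tags) Ms = corr_summand (term_list ts) Ms" if "Ms : A" for Ms
  using that wick_term_tags[of Ms ts]  by (simp add: A_def corr_summand_def monomial_corr_moment term_list_def case_prod_beta)
 ultimately have *: "(corr_summand (term_list ts) has_sum gauss tag_cov (%_. 0) ?P ?l) A" by (subst (asm) has_sum_cong) auto
 show "corr_summable (term_list ts)" using * by (auto simp: corr_summable_def summable_on_def A_def term_list_def)
 have "infsum (corr_summand (term_list ts)) A = gauss tag_cov (%_. 0) ?P ?l" by (rule infsumI[OF *])
 thus "corr (term_list ts) = gauss tag_cov (%_. 0) ?P ?l" by (simp add: corr_def corr_summand_def[abs_def] A_def term_list_def)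
qed

lemma term_span_mono: "(!!P ls. V P ls ==> W P ls) ==> F : term_span V ==> F : term_span W"
 by (rotate_tac 1, induction rule: term_span.induct) (auto intro: term_span.intros)

text \<open>Slots are resolved from left to right: in the auxiliary claim the slots ts are already
  Wick terms, while the remaining Bs are arbitrary elements of their spans.\<close>

lemma multilinear_induct [consumes 1, case_names base add scale]:
 assumes mem: "list_all2 (%F V. F : term_span V) Fs Vs"
  and base: "!!ts. list_all2 (%(P, ls) V. V P ls) ts Vs ==> Q (term_list ts)"
  and add: "!!As F G Bs. list_all2 (%F V. F : term_span V) (As @ F # Bs) Vs ==> list_all2 (%F V. F : term_span V) (As @ G # Bs) Vs
    ==> Q (As @ F # Bs) ==> Q (As @ G # Bs) ==> Q (As @ (%M. F M + G M) # Bs)"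
  and scale: "!!As F k Bs. list_all2 (%F V. F : term_span V) (As @ F # Bs) Vs
    ==> Q (As @ F # Bs) ==> Q (As @ (%M. k * F M) # Bs)"
 shows "Q Fs"
proof -
 let ?m = "%F V. F : term_span V" and ?t = "%(P, ls) V. V P ls"
 have tm: "list_all2 ?m (term_list ts) Us" if "list_all2 ?t ts Us" for ts Us
  using that unfolding term_list_def list_all2_map1  by (rule list_all2_mono) (auto intro: term_span.tm)
 have "Q (term_list ts @ Bs)" if "list_all2 ?t ts Us" "list_all2 ?m Bs Ws" "Vs = Us @ Ws" for ts Us Bs Ws using that
 proof (induction Bs arbitrary: ts Us Ws)
  case Nil
  thus ?case using base by simp
 next
  case (Cons F Bs)
  obtain W Ws' where W: "Ws = W # Ws'" "F : term_span W" "list_all2 ?m Bs Ws'" using Cons(3) by (auto simp: list_all2_Cons1)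
  have mem: "list_all2 ?m (term_list ts @ G # Bs) Vs" if "G : term_span W" for G
   unfolding Cons(4) W(1) using that W Cons(2) tm by (auto intro!: list_all2_appendI)
  show ?case using W(2)
  proof induction
   case (tm P ls)
   have "Q (term_list (ts @ [(P, ls)]) @ Bs)" by (rule Cons(1)[of _ "Us @ [W]" Ws']) (insert tm Cons W, auto intro!: list_all2_appendI)
   thus ?case by (simp add: term_list_def)
  next
   case (add F G)
   thus ?case by (intro assms(3) mem)
  next
   case (scale F k)
   thus ?case by (intro assms(4) mem)
  qed
 qed
 from this[of "[]" "[]" Fs Vs] show ?thesis using assms(1) by (simp add: term_list_def)
qed

text \<open>Isolates the slot that varies. \<open>undefined\<close> fills its place in the remaining
  product, whose index set omits that place, so the second factor is visibly the same for all
  F.\<close>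

lemma corr_summand_split:
 "corr_summand (As @ F # Bs) Ms = F (Ms ! length As) * ((PROD i:{..<Suc (length As + length Bs)} - {length As}. ((As @ undefined # Bs) ! i) (Ms ! i)) * monomial_corr Ms)"
proof -
 have "(PROD i<length (As @ F # Bs). ((As @ F # Bs) ! i) (Ms ! i)) =
   F (Ms ! length As) * (PROD i:{..<Suc (length As + length Bs)} - {length As}. ((As @ F # Bs) ! i) (Ms ! i))"
  by (subst prod.remove[of _ "length As"]) auto
 also have "(PROD i:{..<Suc (length As + length Bs)} - {length As}. ((As @ F # Bs) ! i) (Ms ! i))
   = (PROD i:{..<Suc (length As + length Bs)} - {length As}. ((As @ undefined # Bs) ! i) (Ms ! i))"
  by (intro prod.cong refl) (auto simp: nth_append nth_Cons')
 finally show ?thesis by (simp add: corr_summand_def mult_ac)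
qed

text \<open>Additivity of \<open>corr\<close> depends on this, because \<open>infsum\<close> assigns
  0 to families that are not summable.\<close>

lemma corr_summable_span:
 assumes "list_all2 (%F V. F : term_span V) Fs Vs"
 shows "corr_summable Fs" using assms
proof (induction rule: multilinear_induct)
 case (add As F G Bs)
 have "corr_summand (As @ (%M. F M + G M) # Bs) = (%Ms. corr_summand (As @ F # Bs) Ms + corr_summand (As @ G # Bs) Ms)"
  by (simp add: corr_summand_split algebra_simps fun_eq_iff)
 thus ?case using add(3,4) unfolding corr_summable_def by (auto intro!: summable_on_add)
next
 case (scale As F k Bs)
 have "corr_summand (As @ (%M. k * F M) # Bs) = (%Ms. k * corr_summand (As @ F # Bs) Ms)" by (simp add: corr_summand_split algebra_simps fun_eq_iff)
 thus ?case using scale(2) unfolding corr_summable_def by (auto intro!: summable_on_cmult_right)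
qed (rule corr_term_list)

lemma corr_conv_summand: "corr Fs = infsum (corr_summand Fs) {Ms. length Ms = length Fs}" by (simp add: corr_def corr_summand_def[abs_def])

abbreviation all_terms :: "factor multiset => (complex * factor) list => bool" where
 "all_terms \<equiv> %_ _. True"

abbreviation all_span :: "functional set" where
 "all_span \<equiv> term_span all_terms"

lemma corr_summable_all: "set Fs <= all_span ==> corr_summable Fs" by (rule corr_summable_span[of _ "replicate (length Fs) all_terms"])
   (auto simp: list_all2_conv_all_nth)

lemma corr_add:
 assumes "set As <= all_span" "set Bs <= all_span" "F : all_span" "G : all_span"
 shows "corr (As @ (%M. F M + G M) # Bs) = corr (As @ F # Bs) + corr (As @ G # Bs)"
proof -
 have "corr_summand (As @ (%M. F M + G M) # Bs) = (%Ms. corr_summand (As @ F # Bs) Ms + corr_summand (As @ G # Bs) Ms)"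
  by (simp add: corr_summand_split algebra_simps fun_eq_iff)
 moreover have "corr_summable (As @ F # Bs)" "corr_summable (As @ G # Bs)" using assms by (auto intro!: corr_summable_all)
 ultimately show ?thesis unfolding corr_conv_summand corr_summable_def by (simp add: infsum_add)
qed

lemma corr_scale: "corr (As @ (%M. k * F M) # Bs) = k * corr (As @ F # Bs)"
proof -
 have "corr_summand (As @ (%M. k * F M) # Bs) = (%Ms. k * corr_summand (As @ F # Bs) Ms)" by (simp add: corr_summand_split algebra_simps fun_eq_iff)
 thus ?thesis unfolding corr_conv_summand by (simp add: infsum_cmult_right')
qed

lemma wick_span_all: "F : term_span V ==> F : all_span" by (rule term_span_mono) auto

lemma term_span_contract:
 assumes "symm C" "!!A. A <=# P ==> W A : term_span V"
 shows "(%M. contract C m P (%A. W A M)) : term_span V" using assms(2)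
proof (induction P arbitrary: W rule: multiset_size_induct)
 case (add x P)
 have z: "(%M. 0) : term_span V" using term_span.scale[OF add(2)[of "{#}"], of 0] by simp
 have s: "(%M. SUM y:#Q. f y M) : term_span V" if "!!y. y :# Q ==> f y : term_span V" for Q :: "'a multiset" and f
  using that by (induction Q) (auto intro: z term_span.add)
 have sub: "A <=# add_mset x P" if "A <=# P" for A using that by (metis add_mset_add_single mset_subset_eq_add_left subset_mset.order_trans)
 have sub2: "A <=# add_mset x P" if "A <=# P - {#y#}" for A y using that sub by (meson diff_subset_eq_self subset_mset.order_trans)
 show ?case unfolding contract_add[OF assms(1)] by (intro term_span.add s term_span.scale add(1)) (use add(2) sub sub2 in auto)
qed auto

lemma corr_contract:
 assumes "symm C" "!!A. W A : all_span" "set As <= all_span" "set Bs <= all_span"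
 shows "corr (As @ (%M. contract C m P (%A. W A M)) # Bs) = contract C m P (%A. corr (As @ W A # Bs))" using assms(2)
proof (induction P arbitrary: W rule: multiset_size_induct)
 case (add x P)
 have z: "(%M. 0) : all_span" using term_span.scale[OF add(2)[of "{#}"], of 0] by simp
 have z': "corr (As @ (%M. 0) # Bs) = 0" using corr_scale[of As 0 "%M. 0" Bs] by simp
 have s: "(%M. SUM y:#Q. f y M) : all_span & corr (As @ (%M. SUM y:#Q. f y M) # Bs) = (SUM y:#Q. corr (As @ f y # Bs))"
  if "!!y. f y : all_span" for Q :: "'a multiset" and f using that by (induction Q) (auto simp: z z' corr_add assms intro!: term_span.add)
 have c: "(%M. contract C m Q (%A. W' A M)) : all_span" if "!!A. W' A : all_span" for Q W'
  by (rule term_span_contract[OF assms(1)]) (rule that)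
 have "corr (As @ (%M. SUM y:#P. C x y * contract C m (P - {#y#}) (%A. W A M)) # Bs)
   = (SUM y:#P. C x y * contract C m (P - {#y#}) (%A. corr (As @ W A # Bs)))"
  using s[of "%y M. C x y * contract C m (P - {#y#}) (%A. W A M)" P] c[OF add(2)] by (simp add: term_span.scale corr_scale add)
 moreover have "(%M. SUM y:#P. C x y * contract C m (P - {#y#}) (%A. W A M)) : all_span"
  using s[of "%y M. C x y * contract C m (P - {#y#}) (%A. W A M)" P] c[OF add(2)] by (simp add: term_span.scale)
 ultimately show ?case unfolding contract_add[OF assms(1)] by (simp add: corr_add assms term_span.add term_span.scale c add corr_scale)
qed auto

lemma contract_image:
 assumes "symm C"
 shows "contract C m (image_mset f M) ph = contract (%x y. C (f x) (f y)) (%x. m (f x)) M (%A. ph (image_mset f A))"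
proof (induction M arbitrary: ph rule: multiset_size_induct)
 case (add x M)
 have s: "symm (%x y. C (f x) (f y))" using assms by (simp add: symm_def)
 have "(SUM y:#M. C (f x) (f y) * contract C m (image_mset f M - {#f y#}) ph)
   = (SUM y:#M. C (f x) (f y) * contract (%x y. C (f x) (f y)) (%x. m (f x)) (M - {#y#}) (%A. ph (image_mset f A)))"
 proof (intro sum_mset_cong)
  fix y assume "y :# M"
  hence "image_mset f M - {#f y#} = image_mset f (M - {#y#})" by (simp add: image_mset_Diff)
  thus "C (f x) (f y) * contract C m (image_mset f M - {#f y#}) ph
   = C (f x) (f y) * contract (%x y. C (f x) (f y)) (%x. m (f x)) (M - {#y#}) (%A. ph (image_mset f A))" by (simp add: add)
 qed
 thus ?case by (simp add: contract_add[OF assms] contract_add[OF s] add image_mset.compositionality comp_def)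
qed simp

lemma lin_mset: "lin f ls = (SUM (al, p):#mset ls. al * f p)" by (induction ls) auto

lemma gauss_perm:
 assumes "mset ls = mset ls'"
 shows "gauss C m P ls = gauss C m P ls'"
proof -
 have "lin f ls = lin f ls'" for f by (simp add: lin_mset assms)
 thus ?thesis by (simp add: gauss_def bil_def gmean_def[abs_def])
qed

text \<open>A Wick monomial times a Wick exponential, reordered: inside the term \<open>reg_term C m P ls\<close> the
 factors behave like Gaussian variables with covariances C and means m.\<close>

definition reg_term :: "(factor => factor => complex) => (factor => complex) => factor multiset => (complex * factor) list => functional" where
 "reg_term C m P ls M = exp (lin m ls + bil C ls / 2) * contract C (gmean C m ls) P (%A. wick_term A ls M)"

lemma reg_term_in_span:
 assumes "symm C" "valid_term S P ls"
 shows "reg_term C m P ls : wick_span S"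
 unfolding reg_term_def[abs_def] using assms by (intro term_span.scale term_span_contract term_span.tm) (auto simp: valid_term_def dest: mset_subset_eqD)

lemma reg_term_in_all: "symm C ==> reg_term C m P ls : all_span"
 unfolding reg_term_def[abs_def] by (intro term_span.scale term_span_contract term_span.tm) auto

lemma reg_term_trivial: "reg_term (%_ _. 0) (%_. 0) P ls = wick_term P ls"
proof -
 have s: "symm (%_ _. 0 :: complex)" by (simp add: symm_def)
 have "contract (%_ _. 0) (%_. 0) P f = f P" for f and P :: "factor multiset"
 proof (induction P arbitrary: f)
  case (add x P)
  thus ?case by (simp add: contract_add[OF \<open>symm (%_ _. 0)\<close>] sum_mset_conv_sum s symm_def)
 qed simp
 thus ?thesis by (simp add: reg_term_def[abs_def] gmean_def[abs_def] bil_def)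
qed

section \<open>Reordered Wick terms\<close>

text \<open>The data of a \<open>reg_term\<close>. Wick's formula forbids pairs inside one
  functional; \<open>s_cov\<close> and \<open>s_mean\<close> are the covariance and mean that the
  reordering inserts there.\<close>

record slot =
 s_cov :: "factor => factor => complex"
 s_mean :: "factor => complex"
 s_poly :: "factor multiset"
 s_exp :: "(complex * factor) list"

definition slot_fun :: "slot => functional" where
 "slot_fun s = reg_term (s_cov s) (s_mean s) (s_poly s) (s_exp s)"

fun slot_cov :: "slot list => nat * factor => nat * factor => complex" where
 "slot_cov ss (i, p) (j, q) = (if i = j then if i < length ss then s_cov (ss ! i) p q else 0 else tag_cov (i, p) (j, q))"

fun slot_mean :: "slot list => nat * factor => complex" where
 "slot_mean ss (i, p) = (if i < length ss then s_mean (ss ! i) p else 0)"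

definition trivial_slot :: "factor multiset * (complex * factor) list => slot" where
 "trivial_slot t = \<lparr>s_cov = %_ _. 0, s_mean = %_. 0, s_poly = fst t, s_exp = snd t\<rparr>"

lemma symm_zero [simp]: "symm (%_ _. 0)" by (simp add: symm_def)

lemma trivial_slot_simps [simp]:
 "s_cov (trivial_slot t) = (%_ _. 0)" "s_mean (trivial_slot t) = (%_. 0)"
 "s_poly (trivial_slot t) = fst t" "s_exp (trivial_slot t) = snd t" by (simp_all add: trivial_slot_def)

lemma slot_fun_trivial: "slot_fun (trivial_slot t) = wick_term (fst t) (snd t)" by (simp add: slot_fun_def reg_term_trivial)

lemma tags_append_Cons:
 "tags (Ps @ A # Qs) = image_mset (Pair (length Ps)) A + tags (Ps @ {#} # Qs)"
 by (rule multiset_eqI, rename_tac x, case_tac x) (auto simp: count_tags count_image_Pair nth_append nth_Cons')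

lemma tagged_exps_append_Cons:
 "mset (tagged_exps (Ps @ A # Qs)) = mset (map (map_prod id (Pair (length Ps))) A @ tagged_exps (Ps @ [] # Qs))"
proof -
 define n where "n = length (Ps @ A # Qs)"
 let ?f = "%lss i. mset (map (map_prod id (Pair i)) (lss ! i)) :: (complex * (nat * 'a)) multiset"
 have 1: "mset (tagged_exps lss) = (SUM i<length lss. ?f lss i)" for lss :: "(complex * 'a) list list"
 proof -
  have "mset (concat (map (%i. map (map_prod id (Pair i)) (lss ! i)) [0..<n])) = (SUM i<n. ?f lss i)" for n by (induction n) auto
  thus ?thesis by (simp add: tagged_exps_def)
 qed
 have k: "length Ps : {..<n}" by (simp add: n_def)
 have "(SUM i<n. ?f (Ps @ A # Qs) i) = ?f (Ps @ A # Qs) (length Ps) + (SUM i:{..<n} - {length Ps}. ?f (Ps @ A # Qs) i)"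
  by (rule sum.remove[OF _ k]) simp
 also have "(SUM i:{..<n} - {length Ps}. ?f (Ps @ A # Qs) i) = (SUM i:{..<n} - {length Ps}. ?f (Ps @ [] # Qs) i)"
  by (intro sum.cong refl) (auto simp: nth_append nth_Cons')
 also have "\<dots> = (SUM i<n. ?f (Ps @ [] # Qs) i)" by (rule sum.mono_neutral_left) auto
 finally have "(SUM i<n. ?f (Ps @ A # Qs) i) = ?f (Ps @ A # Qs) (length Ps) + (SUM i<n. ?f (Ps @ [] # Qs) i)" .
 moreover have "length (Ps @ A # Qs) = n" "length (Ps @ [] # Qs) = n" by (simp_all add: n_def)
 ultimately show ?thesis by (simp only: mset_append 1 nth_append_length)
qed

lemma snd_tagged_exps: "x : snd ` set (tagged_exps lss) \<longleftrightarrow> fst x < length lss & snd x : snd ` set (lss ! fst x)"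
 by (cases x) (force simp: tagged_exps_def)

lemma symm_slot_cov: "(!!s. s : set ss ==> symm (s_cov s)) ==> symm (slot_cov ss)" by (auto simp: symm_def)

text \<open>The slots are resolved one after the other, the resolved ones standing in front as
  trivial slots. Linearity turns the reordering in the current slot into a contraction of
  correlations known by induction, and \<open>gauss_contract\<close> absorbs this contraction into
  covariance and mean.\<close>

theorem corr_slots:
 assumes "!!s. s : set ss ==> symm (s_cov s)"
 shows "corr (map slot_fun ss) = gauss (slot_cov ss) (slot_mean ss) (tags (map s_poly ss)) (tagged_exps (map s_exp ss))"
proof -
 have "corr (map slot_fun (map trivial_slot ts @ ss)) =
   gauss (slot_cov (map trivial_slot ts @ ss)) (slot_mean (map trivial_slot ts @ ss))
    (tags (map s_poly (map trivial_slot ts @ ss))) (tagged_exps (map s_exp (map trivial_slot ts @ ss)))" for ts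
  using assms
 proof (induction ss arbitrary: ts)
  case Nil
  have "map slot_fun (map trivial_slot ts) = term_list ts" by (simp add: term_list_def slot_fun_trivial case_prod_beta)
  moreover have "slot_cov (map trivial_slot ts) = tag_cov" by (auto simp: fun_eq_iff)
  moreover have "slot_mean (map trivial_slot ts) = (%_. 0)" by (auto simp: fun_eq_iff)
  ultimately show ?case by (simp add: corr_term_list(2) comp_def)
 next
  case (Cons s ss)
  define T where "T = map trivial_slot ts"
  define k where "k = length ts"
  let ?P = "s_poly s" and ?l = "s_exp s" and ?C = "s_cov s" and ?m = "s_mean s"
  \<comment> \<open>An empty slot holds position k, so the other slots keep their tags when the
    content of slot k is split off.\<close>
  define t0 where "t0 = trivial_slot ({#}, [])"
  define Z where "Z = tags (map s_poly (T @ t0 # ss))"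
  define lz where "lz = tagged_exps (map s_exp (T @ t0 # ss))"
  let ?G = "slot_cov (T @ t0 # ss)" and ?M = "slot_mean (T @ t0 # ss)" and ?I = "map (map_prod id (Pair k)) ?l"
  define C' where "C' x y = (if fst x = k & fst y = k then ?C (snd x) (snd y) else 0)" for x y
  define m' where "m' x = (if fst x = k then ?m (snd x) else 0)" for x
  have sC: "symm ?C" using Cons by simp
  have sC': "symm C'" using sC by (auto simp: symm_def C'_def)
  have kT: "length T = k" by (simp add: T_def k_def)
  have sl: "slot_cov (T @ trivial_slot (A, ?l) # ss) = ?G"
   "slot_mean (T @ trivial_slot (A, ?l) # ss) = ?M" for A by (auto simp: fun_eq_iff nth_append nth_Cons' t0_def)
  have IH: "corr (map slot_fun T @ wick_term A ?l # map slot_fun ss) =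
    gauss ?G ?M (image_mset (Pair k) A + Z) (?I @ lz)" for A
  proof -
   have "corr (map slot_fun T @ wick_term A ?l # map slot_fun ss) = corr (map slot_fun (map trivial_slot (ts @ [(A, ?l)]) @ ss))"
    by (simp add: T_def slot_fun_trivial)
   also have "\<dots> = gauss ?G ?M (tags (map s_poly (T @ trivial_slot (A, ?l) # ss)))
      (tagged_exps (map s_exp (T @ trivial_slot (A, ?l) # ss)))"
    using Cons by (subst Cons(1)) (auto simp: T_def sl[unfolded T_def])
   also have "tags (map s_poly (T @ trivial_slot (A, ?l) # ss)) = image_mset (Pair k) A + Z"
    using tags_append_Cons[of "map s_poly T" A "map s_poly ss"] by (simp add: Z_def t0_def kT)
   also have "gauss ?G ?M (image_mset (Pair k) A + Z)
      (tagged_exps (map s_exp (T @ trivial_slot (A, ?l) # ss))) =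
      gauss ?G ?M (image_mset (Pair k) A + Z) (?I @ lz)"
    using tagged_exps_append_Cons[of "map s_exp T" ?l "map s_exp ss"] by (intro gauss_perm) (simp add: lz_def t0_def kT)
   finally show ?thesis .
  qed
  have all: "set (map slot_fun T) <= all_span" "set (map slot_fun ss) <= all_span"
   using Cons(2) by (auto simp: T_def slot_fun_trivial slot_fun_def intro!: term_span.tm reg_term_in_all)
  have s0: "symm ?G" by (rule symm_slot_cov) (use Cons(2) in \<open>auto simp: T_def t0_def symm_def\<close>)
  have zZ: "fst z ~= k" if "z : set_mset Z Un snd ` set lz" for z
   using that unfolding Z_def lz_def set_tags snd_tagged_exps Un_iff by (auto simp: nth_append t0_def kT)
  have e: "lin ?m ?l = lin m' ?I" "bil ?C ?l = bil C' ?I"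
   "gmean ?C ?m ?l = (%x. gmean C' m' ?I (Pair k x))" by (simp_all add: lin_map bil_def m'_def C'_def gmean_def[abs_def])
  have C: "?C = (%x y. C' (Pair k x) (Pair k y))" by (simp add: C'_def)
  have "corr (map slot_fun (T @ s # ss)) = exp (lin ?m ?l + bil ?C ?l / 2) *
    contract ?C (gmean ?C ?m ?l) ?P (%A. corr (map slot_fun T @ wick_term A ?l # map slot_fun ss))"
   unfolding map_append list.map slot_fun_def[of s] reg_term_def[abs_def] corr_scale by (subst corr_contract[OF sC _ all]) (auto intro: term_span.tm)
  also have "\<dots> = exp (lin m' ?I + bil C' ?I / 2) *
    contract C' (gmean C' m' ?I) (image_mset (Pair k) ?P)
     (%M. gauss ?G ?M (M + Z) (?I @ lz))"
   unfolding contract_image[OF sC'] e IH C[symmetric] ..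
  also have "\<dots> = gauss (%x y. ?G x y + C' x y) (%x. ?M x + m' x)
    (image_mset (Pair k) ?P + Z) (?I @ lz)"
   by (rule gauss_contract[OF s0 sC']) (insert zZ, auto simp: C'_def m'_def)
  also have "(%x y. ?G x y + C' x y) = slot_cov (T @ s # ss)" by (auto simp: fun_eq_iff C'_def nth_append nth_Cons' kT t0_def)
  also have "(%x. ?M x + m' x) = slot_mean (T @ s # ss)" by (auto simp: fun_eq_iff m'_def nth_append nth_Cons' kT t0_def)
  also have "image_mset (Pair k) ?P + Z = tags (map s_poly (T @ s # ss))"
   using tags_append_Cons[of "map s_poly T" ?P "map s_poly ss"] by (simp add: Z_def t0_def kT)
  also have "gauss (slot_cov (T @ s # ss)) (slot_mean (T @ s # ss)) (tags (map s_poly (T @ s # ss))) (?I @ lz)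
    = gauss (slot_cov (T @ s # ss)) (slot_mean (T @ s # ss)) (tags (map s_poly (T @ s # ss))) (tagged_exps (map s_exp (T @ s # ss)))"
   using tagged_exps_append_Cons[of "map s_exp T" ?l "map s_exp ss"] by (intro gauss_perm) (simp add: lz_def t0_def kT)
  finally show ?case by (simp add: T_def)
 qed
 from this[of "[]"] show ?thesis by simp
qed

section \<open>Smooth functions and Wirtinger derivatives\<close>

abbreviation near :: "'a::topological_space => ('a => bool) => bool" where
 "near x P \<equiv> eventually P (nhds x)"

inductive smooth :: "('a::real_normed_vector => complex) => 'a => bool" where
 const: "smooth (%_. c) x"
| lin: "bounded_linear L ==> smooth L x"
| add: "smooth f x ==> smooth g x ==> smooth (%y. f y + g y) x"
| mult: "smooth f x ==> smooth g x ==> smooth (%y. f y * g y) x"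
| comp: "smooth f x ==> ph analytic_on {f x} ==> smooth (%y. ph (f y)) x"
| cong: "smooth f x ==> near x (%y. f y = g y) ==> smooth g x"

lemma has_derivative_cong_nhds:
 assumes "near x (%y. f y = g y)"
 shows "(f has_derivative D) (at x) \<longleftrightarrow> (g has_derivative D) (at x)"
proof -
 obtain S where S: "open S" "x : S" "!!y. y : S ==> f y = g y" using assms by (auto simp: eventually_nhds)
 thus ?thesis using has_derivative_transform_within_open[of f D x UNIV S g] has_derivative_transform_within_open[of g D x UNIV S f] by auto
qed

lemma analytic_has_derivative:
 "f analytic_on {z} ==> (f has_derivative (%h. deriv f z * h)) (at z)" using analytic_derivI[of f z UNIV] by (simp add: has_field_derivative_def)

lemma smooth_differentiable: "smooth f x ==> f differentiable (at x)"
proof (induction rule: smooth.induct)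
 case (lin L x)
 thus ?case using bounded_linear_imp_has_derivative differentiable_def by blast
next
 case (comp f x ph)
 then obtain D where "(f has_derivative D) (at x)" by (auto simp: differentiable_def)
 hence "((%y. ph (f y)) has_derivative (%h. deriv ph (f x) * D h)) (at x)" using has_derivative_compose analytic_has_derivative[OF comp(2)] by blast
 thus ?case by (auto simp: differentiable_def)
next
 case (cong f x g)
 thus ?case by (simp add: differentiable_def has_derivative_cong_nhds[of f g])
qed auto

lemma smooth_continuous: "smooth f x ==> isCont f x" by (intro differentiable_imp_continuous_within smooth_differentiable)

lemma analytic_at_eventually:
 assumes "f analytic_on {z}"
 shows "near z (%w. f analytic_on {w})"
proof -
 obtain s where "open s" "z : s" "f holomorphic_on s" using assms by (auto simp: analytic_at)
 thus ?thesis unfolding eventually_nhds by (intro exI[of _ s]) (auto simp: analytic_at)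
qed

lemma eventually_at_self: "eventually P (nhds x) ==> P x" by (metis eventually_nhds)

lemma near_isCont:
 assumes "isCont f x" "eventually P (nhds (f x))"
 shows "near x (%y. P (f y))"
proof -
 have "\<forall>\<^sub>F y in at x. P (f y)" using assms by (simp add: continuous_at filterlim_iff)
 thus ?thesis using eventually_at_self[OF assms(2)] by (simp add: eventually_nhds_conv_at)
qed

lemma smooth_near: "smooth f x ==> near x (%y. smooth f y)"
proof (induction rule: smooth.induct)
 case (add f x g)
 show ?case using add(3,4) by eventually_elim (rule smooth.add)
next
 case (mult f x g)
 show ?case using mult(3,4) by eventually_elim (rule smooth.mult)
next
 case (comp f x ph)
 have "near x (%y. ph analytic_on {f y})" by (rule near_isCont[OF smooth_continuous[OF comp(1)]]) (rule analytic_at_eventually[OF comp(2)])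
 with comp(3) show ?case by eventually_elim (rule smooth.comp)
next
 case (cong f x g)
 have "near x (%y. near y (%y. f y = g y))" using cong(2) by (simp add: eventually_eventually)
 with cong(3) show ?case by eventually_elim (rule smooth.cong)
qed (auto intro: always_eventually smooth.intros)

definition dd :: "'a => ('a::real_normed_vector => complex) => 'a => complex" where
 "dd e f x = frechet_derivative f (at x) e"

lemma dd_eq: "(f has_derivative D) (at x) ==> dd e f x = D e" by (simp add: dd_def flip: frechet_derivative_at)

lemma dd_cong: "near x (%y. f y = g y) ==> dd e f x = dd e g x" by (simp add: dd_def frechet_derivative_def has_derivative_cong_nhds[of f g])

lemma smooth_has_derivative: "smooth f x ==> (f has_derivative (%e. dd e f x)) (at x)"
 using smooth_differentiable[of f x] by (simp add: dd_def[abs_def] frechet_derivative_works)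

lemma dd_const: "dd e (%_. c) x = 0" by (subst dd_eq[of _ "%_. 0"]) auto

lemma dd_lin: "bounded_linear L ==> dd e L x = L e" by (rule dd_eq) (rule bounded_linear_imp_has_derivative)

lemma dd_add: "smooth f x ==> smooth g x ==> dd e (%y. f y + g y) x = dd e f x + dd e g x"
 by (rule dd_eq) (intro has_derivative_add smooth_has_derivative)

lemma dd_mult: "smooth f x ==> smooth g x ==> dd e (%y. f y * g y) x = f x * dd e g x + dd e f x * g x"
 by (rule dd_eq) (intro has_derivative_mult smooth_has_derivative)

lemma dd_comp: "smooth f x ==> ph analytic_on {f x} ==> dd e (%y. ph (f y)) x = deriv ph (f x) * dd e f x"
 by (rule dd_eq[OF has_derivative_compose[OF smooth_has_derivative analytic_has_derivative]])

lemma dd_scale_dir: "smooth f x ==> dd (r *\<^sub>R e) f x = of_real r * dd e f x"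
 and dd_add_dir: "smooth f x ==> dd (e + e') f x = dd e f x + dd e' f x"
 using linear_add[OF bounded_linear.linear[OF has_derivative_bounded_linear[OF smooth_has_derivative]]]
  linear_scale[OF bounded_linear.linear[OF has_derivative_bounded_linear[OF smooth_has_derivative]]] by (auto simp: scaleR_conv_of_real)

text \<open>Closure under derivatives and equality of mixed derivatives are proved together: the
  derivative of a product or composition contains derivatives of its parts, and differentiating it
  once more needs both facts for them.\<close>

lemma smooth_dd_and_commute:
 assumes "smooth f x"
 shows "(ALL e. smooth (dd e f) x) & (ALL e e'. dd e (dd e' f) x = dd e' (dd e f) x)" using assms
proof (induction rule: smooth.induct)
 case (const c x)
 have "dd e (%_. c) = (%_. 0)" for e :: 'a by (rule ext) (rule dd_const)
 thus ?case by (simp add: dd_const smooth.const)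
next
 case (lin L x)
 hence "dd e L = (%_. L e)" for e by (intro ext dd_lin)
 thus ?case by (simp add: dd_const smooth.const)
next
 case (add f x g)
 have ev: "near x (%y. dd e f y + dd e g y = dd e (%y. f y + g y) y)" for e
  using smooth_near[OF add(1)] smooth_near[OF add(2)] by eventually_elim (simp add: dd_add)
 show ?case
 proof (intro conjI allI)
  show "smooth (dd e (%y. f y + g y)) x" for e by (rule smooth.cong[OF smooth.add ev]) (use add in auto)
  show "dd e (dd e' (%y. f y + g y)) x = dd e' (dd e (%y. f y + g y)) x" for e e' using add(3,4) by (simp add: dd_add flip: dd_cong[OF ev])
 qed
next
 case (mult f x g)
 have ev: "near x (%y. f y * dd e g y + dd e f y * g y = dd e (%y. f y * g y) y)" for e
  using smooth_near[OF mult(1)] smooth_near[OF mult(2)] by eventually_elim (simp add: dd_mult)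
 show ?case
 proof (intro conjI allI)
  show "smooth (dd e (%y. f y * g y)) x" for e by (rule smooth.cong[OF _ ev]) (intro smooth.add smooth.mult, use mult in auto)
  show "dd e (dd e' (%y. f y * g y)) x = dd e' (dd e (%y. f y * g y)) x" for e e'
   using mult by (simp add: dd_add dd_mult smooth.mult flip: dd_cong[OF ev])
 qed
next
 case (comp f x ph)
 have c: "near x (%y. ph analytic_on {f y})" by (rule near_isCont[OF smooth_continuous[OF comp(1)]]) (rule analytic_at_eventually[OF comp(2)])
 have ev: "near x (%y. deriv ph (f y) * dd e f y = dd e (%y. ph (f y)) y)" for e
  using smooth_near[OF comp(1)] c by eventually_elim (simp add: dd_comp)
 have a: "deriv ph analytic_on {f x}" using comp(2) by (rule analytic_deriv)
 have d: "smooth (%y. deriv ph (f y)) x" by (rule smooth.comp[OF comp(1) a])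
 show ?case
 proof (intro conjI allI)
  show "smooth (dd e (%y. ph (f y))) x" for e by (rule smooth.cong[OF smooth.mult[OF d] ev]) (use comp in auto)
  show "dd e (dd e' (%y. ph (f y))) x = dd e' (dd e (%y. ph (f y))) x" for e e'
   using comp d by (simp add: dd_mult dd_comp[OF comp(1) a] flip: dd_cong[OF ev])
 qed
next
 case (cong f x g)
 have ev: "near x (%y. dd e f y = dd e g y)" for e
 proof -
  have "near x (%y. near y (%y. f y = g y))" using cong(2) by (simp add: eventually_eventually)
  thus ?thesis by eventually_elim (rule dd_cong)
 qed
 show ?case using cong(3) by (auto simp flip: dd_cong[OF ev] intro: smooth.cong[OF _ ev])
qed

lemmas smooth_dd = smooth_dd_and_commute[THEN conjunct1, rule_format]
lemmas dd_commute = smooth_dd_and_commute[THEN conjunct2, rule_format]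

lemma smooth_uminus: "smooth f x ==> smooth (%y. - f y) x" using smooth.mult[OF smooth.const[of "-1"], of f x] by simp

lemma smooth_diff: "smooth f x ==> smooth g x ==> smooth (%y. f y - g y) x" using smooth.add[OF _ smooth_uminus, of f x g] by simp

lemma smooth_scale: "smooth f x ==> smooth (%y. c * f y) x" by (rule smooth.mult[OF smooth.const])

lemma smooth_exp: "smooth f x ==> smooth (%y. exp (f y)) x" by (rule smooth.comp) (auto intro!: analytic_intros)

lemma smooth_inverse: "smooth f x ==> f x ~= 0 ==> smooth (%y. inverse (f y)) x" by (rule smooth.comp) (auto intro!: analytic_intros)

lemma smooth_divide: "smooth f x ==> smooth g x ==> g x ~= 0 ==> smooth (%y. f y / g y) x"
 unfolding divide_inverse by (intro smooth.mult smooth_inverse)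

lemma smooth_power: "smooth f x ==> smooth (%y. f y ^ n) x" by (rule smooth.comp) (auto intro!: analytic_intros)

lemma smooth_Ln: "smooth f x ==> f x ~: \<real>\<^sub>\<le>\<^sub>0 ==> smooth (%y. Ln (f y)) x" by (rule smooth.comp) (auto intro!: analytic_intros)

lemma smooth_sum_mset: "(!!i. i :# I ==> smooth (f i) x) ==> smooth (%y. SUM i:#I. f i y) x" by (induction I) (auto intro: smooth.const smooth.add)

lemma analytic_cnj_cnj:
 assumes "f analytic_on {cnj z}"
 shows "(%w. cnj (f (cnj w))) analytic_on {z}"
proof -
 obtain s where s: "open s" "cnj z : s" "f holomorphic_on s" using assms by (auto simp: analytic_at)
 have "open (cnj ` s)" unfolding image_cnj_conv_vimage_cnj using s by (intro open_vimage) (auto intro: continuous_intros)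
 moreover have "z : cnj ` s" using s by (metis complex_cnj_cnj imageI)
 moreover have "cnj ` cnj ` s = s" by (auto simp: image_image)
 hence "cnj \<circ> f \<circ> cnj holomorphic_on cnj ` s" using s(3) calculation(1) by (intro holomorphic_on_compose_cnj_cnj) auto
 ultimately show ?thesis by (auto simp: analytic_at comp_def)
qed

lemma smooth_cnj: "smooth f x ==> smooth (%y. cnj (f y)) x"
proof (induction rule: smooth.induct)
 case (lin L x)
 show ?case by (rule smooth.lin) (rule bounded_linear_compose[OF bounded_linear_cnj lin])
next
 case (comp f x ph)
 \<comment> \<open>The conjugate of \<open>ph (f y)\<close> is the reflected function
   \<open>cnj \<circ> ph \<circ> cnj\<close>, again analytic, at the conjugate of
   \<open>f y\<close>.\<close>
 show ?case using smooth.comp[OF comp(3), of "%w. cnj (ph (cnj w))"] analytic_cnj_cnj[of ph "cnj (f x)"] comp(2) by simp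
next
 case (cong f x g)
 show ?case by (rule smooth.cong[OF cong(3)]) (use cong(2) in eventually_elim, simp)
qed (simp_all add: smooth.const smooth.add smooth.mult)

lemma dd_cnj: "smooth f x ==> dd e (%y. cnj (f y)) x = cnj (dd e f x)" by (rule dd_eq) (intro has_derivative_cnj smooth_has_derivative)

text \<open>The quotient \<open>f y / f x\<close> stays near 1 and off the cut, so its principal
  logarithm is analytic there; no branch of the logarithm of f itself has to be chosen.\<close>

lemma ln_norm_conv_Ln:
 fixes f :: "'a::real_normed_vector => complex"
 assumes "isCont f x" "f x ~= 0"
 shows "near x (%y. f y / f x ~: \<real>\<^sub>\<le>\<^sub>0 & complex_of_real (ln (norm (f y))) = of_real (ln (norm (f x))) + (Ln (f y / f x) + cnj (Ln (f y / f x))) / 2)"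
proof -
 have "isCont (%y. f y / f x) x" using assms by (intro continuous_intros) auto
 moreover have "open (- \<real>\<^sub>\<le>\<^sub>0 :: complex set)" by auto
 moreover have "f x / f x : - \<real>\<^sub>\<le>\<^sub>0" using assms by simp
 ultimately have "near x (%y. f y / f x : - \<real>\<^sub>\<le>\<^sub>0)" by (intro near_isCont[where f = "%y. f y / f x"] eventually_nhds_in_open)
 thus ?thesis
 proof eventually_elim
  case (elim y)
  hence "f y ~= 0" by auto
  hence "Re (Ln (f y / f x)) = ln (norm (f y)) - ln (norm (f x))" using assms by (subst Re_Ln) (auto simp: norm_divide ln_div)
  hence "Ln (f y / f x) + cnj (Ln (f y / f x)) = of_real (2 * (ln (norm (f y)) - ln (norm (f x))))" by (simp add: complex_add_cnj)
  thus ?case using elim by (simp add: diff_divide_distrib)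
 qed
qed

lemma smooth_ln_norm:
 assumes "smooth f x" "f x ~= 0"
 shows "smooth (%y. of_real (ln (norm (f y)))) x"
proof (rule smooth.cong)
 show "near x (%y. of_real (ln (norm (f x))) + (Ln (f y / f x) + cnj (Ln (f y / f x))) / 2 = complex_of_real (ln (norm (f y))))"
  using ln_norm_conv_Ln[OF smooth_continuous[OF assms(1)] assms(2)] by eventually_elim simp
 show "smooth (%y. of_real (ln (norm (f x))) + (Ln (f y / f x) + cnj (Ln (f y / f x))) / 2) x"
 proof -
  have q: "smooth (%y. f y / f x) x" by (rule smooth_divide[OF assms(1) smooth.const assms(2)])
  have l: "smooth (%y. Ln (f y / f x)) x" by (rule smooth_Ln[OF q]) (use assms in simp)
  show ?thesis by (intro smooth.add smooth.const smooth_divide[OF _ smooth.const] l smooth_cnj) simp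
 qed
qed

lemma dd_ln_norm:
 assumes "smooth f x" "f x ~= 0"
 shows "dd e (%y. of_real (ln (norm (f y)))) x = (dd e f x / f x + cnj (dd e f x / f x)) / 2"
proof -
 let ?h = "%y. f y * (1 / f x)"
 let ?g = "%y. of_real (ln (norm (f x))) + (1/2) * (Ln (?h y) + cnj (Ln (?h y)))"
 have m: "smooth ?h x" by (rule smooth.mult[OF assms(1) smooth.const])
 have h1: "?h x = 1" using assms(2) by simp
 have l: "smooth (%y. Ln (?h y)) x" by (rule smooth_Ln[OF m]) (simp add: h1 assms(2))
 note sm = m l smooth_cnj[OF l] smooth.add[OF l smooth_cnj[OF l]]
 have "deriv Ln 1 = 1" by (intro DERIV_imp_deriv) (auto intro!: derivative_eq_intros)
 moreover have "Ln analytic_on {1}" by (auto intro!: analytic_intros)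
 ultimately have L: "dd e (%y. Ln (?h y)) x = dd e f x / f x"
  using dd_comp[OF m, of Ln e] dd_mult[OF assms(1) smooth.const, of e "1 / f x"] by (simp only: h1 dd_const) simp
 have "dd e (%y. of_real (ln (norm (f y)))) x = dd e ?g x"
  by (rule dd_cong) (use ln_norm_conv_Ln[OF smooth_continuous[OF assms(1)] assms(2)] in \<open>eventually_elim, simp\<close>)
 also have "\<dots> = (1/2) * (dd e (%y. Ln (?h y)) x + cnj (dd e (%y. Ln (?h y)) x))"
  using sm by (simp only: dd_add dd_mult dd_const smooth.const smooth.mult dd_cnj) simp
 finally show ?thesis by (simp only: L) simp
qed

lemma smooth_affine:
 assumes "smooth f y" "bounded_linear M" "y = M x + b"
 shows "smooth (%u. f (M u + b)) x" using assms
proof (induction rule: smooth.induct)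
 case (lin L y)
 have "L (M u + b) = L (M u) + L b" for u using lin(1) by (simp add: bounded_linear.linear linear_add)
 thus ?case by (simp add: smooth.add smooth.const smooth.lin bounded_linear_compose[OF lin(1,2)])
next
 case (cong f y g)
 have "isCont (%u. M u + b) x" using cong(4) by (intro continuous_intros linear_continuous_at)
 hence "near x (%u. f (M u + b) = g (M u + b))" using cong(2,5) by (intro near_isCont[where f = "%u. M u + b"]) simp_all
 thus ?case by (rule smooth.cong[OF cong(3)[OF cong(4,5)]])
next
 case (comp f y ph)
 show ?case by (rule smooth.comp[OF comp(3)]) (use comp in auto)
qed (simp_all add: smooth.const smooth.add smooth.mult)

lemma dd_affine:
 assumes "smooth f (M x + b)" "bounded_linear M"
 shows "dd e (%u. f (M u + b)) x = dd (M e) f (M x + b)"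
proof (rule dd_eq)
 have "((%u. M u + b) has_derivative M) (at x)"
  using has_derivative_add[OF bounded_linear_imp_has_derivative[OF assms(2)] has_derivative_const[of b]] by simp
 from has_derivative_compose[OF this smooth_has_derivative[OF assms(1)]]
 show "((%u. f (M u + b)) has_derivative (%e. dd (M e) f (M x + b))) (at x)" .
qed

text \<open>The derivative \<open>\<partial>\<close> (for \<open>s = -\<i>\<close>) or \<open>\<partial>bar\<close> (for \<open>s = \<i>\<close>) in the complex direction L.\<close>

definition wirt :: "complex => (complex => 'a) => ('a::real_normed_vector => complex) => 'a => complex" where
 "wirt s L f x = (dd (L 1) f x + s * dd (L \<i>) f x) / 2"

lemma dz_wirt: "dz = wirt (- \<i>) (%h. h)" and dzbar_wirt: "dzbar = wirt \<i> (%h. h)" by (simp_all add: fun_eq_iff dz_def dzbar_def wirt_def dd_def)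

lemma wirt_cong: "near x (%y. f y = g y) ==> wirt s L f x = wirt s L g x" by (simp add: wirt_def dd_cong[of f g])

lemma smooth_wirt: "smooth f x ==> smooth (wirt s L f) x"
 unfolding wirt_def[abs_def] by (intro smooth_divide smooth.add smooth_scale smooth_dd smooth.const) auto

lemma wirt_const [simp]: "wirt s L (%_. c) x = 0" by (simp add: wirt_def dd_const)

lemma wirt_add: "smooth f x ==> smooth g x ==> wirt s L (%y. f y + g y) x = wirt s L f x + wirt s L g x"
 by (simp add: wirt_def dd_add algebra_simps add_divide_distrib)

lemma wirt_mult: "smooth f x ==> smooth g x ==> wirt s L (%y. f y * g y) x = f x * wirt s L g x + wirt s L f x * g x"
 by (simp add: wirt_def dd_mult field_simps)

lemma wirt_scale: "smooth f x ==> wirt s L (%y. c * f y) x = c * wirt s L f x" by (simp add: wirt_mult smooth.const)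

lemma wirt_comp: "smooth f x ==> ph analytic_on {f x} ==> wirt s L (%y. ph (f y)) x = deriv ph (f x) * wirt s L f x"
 by (simp add: wirt_def dd_comp field_simps)

lemma dd_scale: "smooth f x ==> dd e (%y. c * f y) x = c * dd e f x" by (simp add: dd_mult smooth.const dd_const)

lemma wirt_alt: "wirt s L f = (%y. (1/2) * (dd (L 1) f y + s * dd (L \<i>) f y))" by (simp add: fun_eq_iff wirt_def)

lemma dd_wirt:
 assumes "smooth f x"
 shows "dd e (wirt s L f) x = (dd e (dd (L 1) f) x + s * dd e (dd (L \<i>) f) x) / 2"
proof -
 have "smooth (dd (L 1) f) x" "smooth (%y. s * dd (L \<i>) f y) x" "smooth (dd (L \<i>) f) x" using assms by (auto intro: smooth_dd smooth_scale)
 thus ?thesis by (simp only: wirt_alt dd_scale dd_add smooth.add) simp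
qed

lemma dd_wirt_commute: "smooth f x ==> dd e (wirt s L f) x = wirt s L (dd e f) x"
 by (simp only: dd_wirt wirt_def[of s L "dd e f"] dd_commute[of f x e])

lemma wirt_commute:
 assumes "smooth f x"
 shows "wirt s L (wirt s' L' f) x = wirt s' L' (wirt s L f) x"
proof -
 have sm: "smooth (dd (L 1) f) x" "smooth (%y. s * dd (L \<i>) f y) x" "smooth (dd (L \<i>) f) x" using assms by (auto intro: smooth_dd smooth_scale)
 have "wirt s' L' (wirt s L f) x = (1/2) * (wirt s' L' (dd (L 1) f) x + s * wirt s' L' (dd (L \<i>) f) x)"
  unfolding wirt_alt[of s L f] using sm by (simp only: wirt_scale wirt_add smooth.add)
 also have "\<dots> = wirt s L (wirt s' L' f) x" using assms by (simp only: wirt_alt[of s L "wirt s' L' f"] dd_wirt_commute)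
 finally show ?thesis ..
qed

lemma wirt_affine:
 assumes "smooth f (M x + b)" "bounded_linear M"
 shows "wirt s L (%u. f (M u + b)) x = wirt s (%h. M (L h)) f (M x + b)" using assms by (simp add: wirt_def dd_affine)

lemma wirt_pow_cong: "near x (%y. f y = g y) ==> (wirt s L ^^ n) f x = (wirt s L ^^ n) g x"
proof (induction n arbitrary: x)
 case 0 thus ?case by (simp add: eventually_at_self[of "%y. f y = g y"])
next
 case (Suc n)
 have "near x (%y. near y (%y. f y = g y))" using Suc(2) by (simp add: eventually_eventually)
 hence "near x (%y. (wirt s L ^^ n) f y = (wirt s L ^^ n) g y)" by eventually_elim (rule Suc(1))
 thus ?case by (simp add: wirt_cong)
qed

lemma smooth_wirt_pow: "smooth f x ==> smooth ((wirt s L ^^ n) f) x" by (induction n) (auto intro: smooth_wirt)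

lemma wirt_pow_affine:
 assumes "smooth f (M x + b)" "bounded_linear M"
 shows "(wirt s L ^^ n) (%u. f (M u + b)) x = (wirt s (%h. M (L h)) ^^ n) f (M x + b)" using assms(1)
proof (induction n arbitrary: x)
 case (Suc n)
 have "isCont (%u. M u + b) x" using assms(2) by (intro continuous_intros linear_continuous_at)
 hence "near x (%u. smooth f (M u + b))" using smooth_near[OF Suc(2)] by (rule near_isCont)
 hence "near x (%u. (wirt s L ^^ n) (%u. f (M u + b)) u = (wirt s (%h. M (L h)) ^^ n) f (M u + b))" by eventually_elim (rule Suc(1))
 thus ?case by (simp add: wirt_cong wirt_affine smooth_wirt_pow Suc(2) assms(2))
qed simp

lemma wirt_pow_add: "smooth f x ==> smooth g x ==> (wirt s L ^^ n) (%y. f y + g y) x = (wirt s L ^^ n) f x + (wirt s L ^^ n) g x"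
proof (induction n arbitrary: x)
 case (Suc n)
 have "near x (%y. (wirt s L ^^ n) (%y. f y + g y) y = (wirt s L ^^ n) f y + (wirt s L ^^ n) g y)"
  using smooth_near[OF Suc(2)] smooth_near[OF Suc(3)] by eventually_elim (rule Suc(1))
 thus ?case by (simp add: wirt_cong wirt_add smooth_wirt_pow Suc(2,3))
qed simp

lemma wirt_pow_scale: "smooth f x ==> (wirt s L ^^ n) (%y. c * f y) x = c * (wirt s L ^^ n) f x"
proof (induction n arbitrary: x)
 case (Suc n)
 have "near x (%y. (wirt s L ^^ n) (%y. c * f y) y = c * (wirt s L ^^ n) f y)" using smooth_near[OF Suc(2)] by eventually_elim (rule Suc(1))
 thus ?case by (simp add: wirt_cong wirt_scale smooth_wirt_pow Suc(2))
qed simp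

lemma wirt_pow_commute:
 assumes "smooth f x"
 shows "wirt s L ((wirt s' L' ^^ n) f) x = (wirt s' L' ^^ n) (wirt s L f) x" using assms
proof (induction n arbitrary: x)
 case (Suc n)
 have "near x (%y. wirt s L ((wirt s' L' ^^ n) f) y = (wirt s' L' ^^ n) (wirt s L f) y)" using smooth_near[OF Suc(2)] by eventually_elim (rule Suc(1))
 thus ?case by (simp add: wirt_commute[of _ x s] smooth_wirt_pow Suc(2) wirt_cong)
qed simp

lemma dd_wirt_pow_commute:
 assumes "smooth f x"
 shows "dd e ((wirt s' L' ^^ n) f) x = (wirt s' L' ^^ n) (dd e f) x" using assms
proof (induction n arbitrary: x)
 case (Suc n)
 have "near x (%y. dd e ((wirt s' L' ^^ n) f) y = (wirt s' L' ^^ n) (dd e f) y)" using smooth_near[OF Suc(2)] by eventually_elim (rule Suc(1))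
 thus ?case by (simp add: dd_wirt_commute smooth_wirt_pow Suc(2) wirt_cong)
qed simp

text \<open>L embeds the plane into the domain of f. On pairs of points the embeddings
  \<open>in1\<close> and \<open>in2\<close> give the partial derivatives in one of the two complex
  variables.\<close>

definition jet :: "(complex => 'a) => nat * nat => ('a::real_normed_vector => complex) => 'a => complex" where
 "jet L d f = (wirt (- \<i>) L ^^ fst d) ((wirt \<i> L ^^ snd d) f)"

abbreviation wirt1 :: "complex => (complex => complex) => complex => complex" where
 "wirt1 s \<equiv> wirt s (%h. h)"

abbreviation jet1 :: "nat * nat => (complex => complex) => complex => complex" where
 "jet1 \<equiv> jet (%h. h)"

lemma jet_00 [simp]: "jet L (0, 0) f = f" by (simp add: jet_def)

lemma smooth_jet: "smooth f x ==> smooth (jet L d f) x" by (simp add: jet_def smooth_wirt_pow)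

lemma jet_cong: "near x (%y. f y = g y) ==> jet L d f x = jet L d g x" unfolding jet_def
proof (rule wirt_pow_cong)
 assume "near x (%y. f y = g y)"
 hence "near x (%y. near y (%y. f y = g y))" by (simp add: eventually_eventually)
 thus "near x (%y. (wirt \<i> L ^^ snd d) f y = (wirt \<i> L ^^ snd d) g y)" by eventually_elim (rule wirt_pow_cong)
qed

lemma eventually_jet_cong: "near x (%y. f y = g y) ==> near x (%y. jet L d f y = jet L d g y)"
proof -
 assume "near x (%y. f y = g y)"
 hence "near x (%y. near y (%y. f y = g y))" by (simp add: eventually_eventually)
 thus ?thesis by eventually_elim (rule jet_cong)
qed

lemma jet_add:
 assumes "smooth f x" "smooth g x"
 shows "jet L d (%y. f y + g y) x = jet L d f x + jet L d g x"
proof -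
 have "near x (%y. (wirt \<i> L ^^ snd d) (%y. f y + g y) y = (wirt \<i> L ^^ snd d) f y + (wirt \<i> L ^^ snd d) g y)"
  using smooth_near[OF assms(1)] smooth_near[OF assms(2)] by eventually_elim (rule wirt_pow_add)
 thus ?thesis unfolding jet_def by (simp add: wirt_pow_cong wirt_pow_add smooth_wirt_pow assms)
qed

lemma jet_scale:
 assumes "smooth f x"
 shows "jet L d (%y. c * f y) x = c * jet L d f x"
proof -
 have "near x (%y. (wirt \<i> L ^^ snd d) (%y. c * f y) y = c * (wirt \<i> L ^^ snd d) f y)"
  using smooth_near[OF assms(1)] by eventually_elim (rule wirt_pow_scale)
 thus ?thesis unfolding jet_def by (simp add: wirt_pow_cong wirt_pow_scale smooth_wirt_pow assms)
qed

lemma isCont_affine: "bounded_linear M ==> isCont (%u. M u + b) x" by (intro continuous_intros linear_continuous_at)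

lemma jet_affine:
 assumes "smooth f (M x + b)" "bounded_linear M"
 shows "jet L d (%u. f (M u + b)) x = jet (%h. M (L h)) d f (M x + b)"
proof -
 have "near x (%u. smooth f (M u + b))" using smooth_near[OF assms(1)] by (rule near_isCont[OF isCont_affine[OF assms(2)]])
 hence "near x (%u. (wirt \<i> L ^^ snd d) (%u. f (M u + b)) u = (wirt \<i> (%h. M (L h)) ^^ snd d) f (M u + b))"
  by eventually_elim (rule wirt_pow_affine[OF _ assms(2)])
 thus ?thesis unfolding jet_def by (simp add: wirt_pow_cong wirt_pow_affine smooth_wirt_pow assms)
qed

lemma jet_wirt_commute: "smooth f x ==> wirt s L (jet L' d f) x = jet L' d (wirt s L f) x"
proof -
 assume f: "smooth f x"
 have "near x (%y. wirt s L ((wirt \<i> L' ^^ snd d) f) y = (wirt \<i> L' ^^ snd d) (wirt s L f) y)"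
  using smooth_near[OF f] by eventually_elim (rule wirt_pow_commute)
 thus ?thesis by (simp add: jet_def wirt_pow_commute[where s' = "- \<i>"] smooth_wirt_pow f wirt_pow_cong)
qed

lemma jet_commute: "smooth f x ==> jet L d (jet L' e f) x = jet L' e (jet L d f) x"
proof -
 assume f: "smooth f x"
 have 1: "(wirt s L ^^ n) (jet L' e g) y = jet L' e ((wirt s L ^^ n) g) y" if "smooth g y" for s n g y using that
 proof (induction n arbitrary: y)
  case (Suc n)
  have "near y (%u. (wirt s L ^^ n) (jet L' e g) u = jet L' e ((wirt s L ^^ n) g) u)" using smooth_near[OF Suc(2)] by eventually_elim (rule Suc(1))
  thus ?case by (simp add: wirt_cong jet_wirt_commute smooth_wirt_pow Suc(2))
 qed simp
 have "near x (%u. (wirt \<i> L ^^ snd d) (jet L' e f) u = jet L' e ((wirt \<i> L ^^ snd d) f) u)" using smooth_near[OF f] by eventually_elim (rule 1)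
 hence "jet L d (jet L' e f) x = (wirt (- \<i>) L ^^ fst d) (jet L' e ((wirt \<i> L ^^ snd d) f)) x" unfolding jet_def[of L] by (rule wirt_pow_cong)
 also have "\<dots> = jet L' e (jet L d f) x" unfolding jet_def[of L] by (rule 1) (rule smooth_wirt_pow[OF f])
 finally show ?thesis .
qed

lemma wirt_jet_dz: "wirt (- \<i>) L (jet L (j, k) f) x = jet L (Suc j, k) f x" by (simp add: jet_def)

lemma wirt_jet_dzbar: "smooth f x ==> wirt \<i> L (jet L (j, k) f) x = jet L (j, Suc k) f x" by (simp add: jet_def wirt_pow_commute smooth_wirt_pow)

section \<open>Functions of two points and derivatives of the Green function\<close>

abbreviation in1 :: "complex => complex * complex" where "in1 h \<equiv> (h, 0)"
abbreviation in2 :: "complex => complex * complex" where "in2 h \<equiv> (0, h)"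

lemma bl_in1: "bounded_linear in1" and bl_in2: "bounded_linear in2"
 subgoal by (rule bounded_linear_Pair[OF bounded_linear_ident bounded_linear_zero])
 subgoal by (rule bounded_linear_Pair[OF bounded_linear_zero bounded_linear_ident])
 done

lemma in1_plus: "in1 u + (0, v) = (u, v)" and in2_plus: "in2 v + (u, 0) = (u, v)" by simp_all

lemma smooth_slice1:
 fixes f :: "complex * complex => complex"
 assumes "smooth f (u, v)"
 shows "smooth (%u. f (u, v)) u" using smooth_affine[OF assms bl_in1 in1_plus[symmetric]] unfolding in1_plus .

lemma jet_slice1:
 fixes f :: "complex * complex => complex"
 assumes "smooth f (u, v)"
 shows "jet1 d (%u. f (u, v)) u = jet in1 d f (u, v)" using jet_affine[OF _ bl_in1, of f u "(0, v)" "%h. h" d] assms unfolding in1_plus by blast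

lemma jet_slice2:
 fixes f :: "complex * complex => complex"
 assumes "smooth f (u, v)"
 shows "jet1 d (%v. f (u, v)) v = jet in2 d f (u, v)" using jet_affine[OF _ bl_in2, of f v "(u, 0)" "%h. h" d] assms unfolding in2_plus by blast

lemma wirt_slice1:
 fixes f :: "complex * complex => complex"
 assumes "smooth f (u, v)"
 shows "wirt1 s (%u. f (u, v)) u = wirt s in1 f (u, v)" using wirt_affine[OF _ bl_in1, of f u "(0, v)" s "%h. h"] assms unfolding in1_plus by blast

lemma
 fixes u v :: complex
 shows eventually_slice1: "eventually P (nhds (u, v)) ==> near u (%u. P (u, v))"
 and eventually_slice2: "eventually P (nhds (u, v)) ==> near v (%v. P (u, v))" using near_isCont[where f = "%u. (u, v)" and x = u and P = P]
  near_isCont[where f = "%v. (u, v)" and x = v and P = P] by (auto intro: continuous_intros)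

text \<open>\<open>pair_expectation\<close> differentiates one variable after the other, slice by
  slice. As partial derivatives of one jointly smooth function these operations commute.\<close>

lemma jet_jet_slice:
 fixes f :: "complex * complex => complex"
 assumes "smooth f (u, v)"
 shows "jet1 d (%u. jet1 e (%v. f (u, v)) v) u = jet in1 d (jet in2 e f) (u, v)"
proof -
 have "near u (%u. jet1 e (%v. f (u, v)) v = jet in2 e f (u, v))"
  using eventually_slice1[OF smooth_near[OF assms]] by eventually_elim (rule jet_slice2)
 thus ?thesis by (simp add: jet_cong jet_slice1 smooth_jet assms)
qed

definition green2 :: "(complex => complex) => (complex => complex) => complex * complex => complex" where
 "green2 h g w = 2 * of_real (green (h (fst w)) (g (snd w)))"

lemma bl_fst: "bounded_linear (fst :: complex * complex => complex)"
 and bl_snd: "bounded_linear (snd :: complex * complex => complex)" by (rule bounded_linear_fst, rule bounded_linear_snd)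

lemma smooth_fst_comp: "h analytic_on {u} ==> smooth (%w. h (fst w)) (u, v :: complex)"
 using smooth.comp[OF smooth.lin[OF bl_fst], where ph = h and x = "(u, v)"] by simp

lemma smooth_snd_comp: "h analytic_on {v} ==> smooth (%w. h (snd w)) (u :: complex, v)"
 using smooth.comp[OF smooth.lin[OF bl_snd], where ph = h and x = "(u, v)"] by simp

lemma upper_neq_cnj: "Im a > 0 ==> Im b > 0 ==> a ~= cnj b" by (auto simp: complex_eq_iff)

lemma smooth_green2:
 assumes "h analytic_on {u}" "g analytic_on {v}" "Im (h u) > 0" "Im (g v) > 0" "h u ~= g v"
 shows "smooth (green2 h g) (u, v)"
 unfolding green2_def[abs_def] green_def using upper_neq_cnj[OF assms(3,4)] assms by (intro smooth_scale smooth_ln_norm smooth_divide smooth_diff smooth_cnj smooth_fst_comp smooth_snd_comp) auto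

lemma pair_expectation_jet:
 assumes "h analytic_on {u}" "g analytic_on {v}" "Im (h u) > 0" "Im (g v) > 0" "h u ~= g v"
 shows "pair_expectation (Factor j k h u) (Factor l m g v) = jet in1 (j, k) (jet in2 (l, m) (green2 h g)) (u, v)"
proof -
 define F where "F w = complex_of_real (green (h (fst w)) (g (snd w)))" for w :: "complex * complex"
 have F: "smooth F (u, v)"
  unfolding F_def[abs_def] green_def using upper_neq_cnj[OF assms(3,4)] assms by (intro smooth_scale smooth_ln_norm smooth_divide smooth_diff smooth_cnj smooth_fst_comp smooth_snd_comp) auto
 have ev: "near (u, v) (%w. jet in2 (l, m) (%w. 2 * F w) w = 2 * jet in2 (l, m) F w)" using smooth_near[OF F] by eventually_elim (rule jet_scale)
 have "pair_expectation (Factor j k h u) (Factor l m g v) = 2 * jet1 (j, k) (%u. jet1 (l, m) (%v. F (u, v)) v) u"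
  by (simp add: jet_def F_def dz_wirt dzbar_wirt)
 also have "\<dots> = jet in1 (j, k) (jet in2 (l, m) (%w. 2 * F w)) (u, v)"
  unfolding jet_jet_slice[OF F] jet_cong[OF ev] jet_scale[OF smooth_jet[OF F]] ..
 finally show ?thesis by (simp add: green2_def[abs_def] F_def[abs_def])
qed

lemma green_commute: "green a b = green b a"
proof -
 have "cmod (a - cnj b) = cmod (b - cnj a)" by (metis complex_cnj_cnj complex_cnj_diff complex_mod_cnj norm_minus_commute)
 thus ?thesis by (simp add: green_def norm_divide norm_minus_commute)
qed

lemma bl_swap: "bounded_linear (prod.swap :: complex * complex => complex * complex)"
 unfolding prod.swap_def[abs_def] by (intro bounded_linear_Pair bounded_linear_fst bounded_linear_snd)

lemma jet_jet_swap:
 fixes f :: "complex * complex => complex"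
 assumes "smooth f (u, v)" "!!w. f w = g (prod.swap w)"
 shows "jet in1 d (jet in2 e f) (u, v) = jet in1 e (jet in2 d g) (v, u)"
proof -
 have g: "smooth g (v, u)" using smooth_affine[OF assms(1) bl_swap, of "(v, u)" 0] by (simp add: assms(2))
 have f: "f = (%w. g (prod.swap w + 0))" by (simp add: assms(2) fun_eq_iff)
 have "near (u, v) (%w. smooth g (prod.swap w))"
  using near_isCont[where f = prod.swap and x = "(u, v)", OF _ smooth_near[of g]] g bl_swap by (simp add: linear_continuous_at)
 hence "near (u, v) (%w. jet in2 e f w = jet in1 e g (prod.swap w + 0))" by eventually_elim (unfold f, subst jet_affine[OF _ bl_swap], simp_all)
 hence "jet in1 d (jet in2 e f) (u, v) = jet in2 d (jet in1 e g) (v, u)"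
  using jet_affine[OF _ bl_swap, of "jet in1 e g" "(u, v)" 0 in1 d] g by (simp add: jet_cong smooth_jet)
 thus ?thesis by (simp add: jet_commute[OF g])
qed

fun fnode :: "factor => complex" where
 "fnode (Factor j k h z) = h z"

lemma pair_expectation_commute:
 assumes "valid_factor S p" "valid_factor T q" "fnode p ~= fnode q"
 shows "pair_expectation p q = pair_expectation q p"
proof -
 obtain j k h u l m g v where pq: "p = Factor j k h u" "q = Factor l m g v" by (metis factor.exhaust)
 have s: "smooth (green2 h g) (u, v)" using assms by (intro smooth_green2) (auto simp: pq)
 show ?thesis using assms unfolding pq by (subst (1 2) pair_expectation_jet) (auto intro!: jet_jet_swap[OF s] simp: green2_def green_commute)
qed

lemma pair_expectation_smooth:
 assumes "h analytic_on {u}" "Im (h u) > 0" "valid_factor S q" "h u ~= fnode q"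
 shows "smooth (%u. pair_expectation (Factor j k h u) q) u"
  and "dz (%u. pair_expectation (Factor j k h u) q) u = pair_expectation (Factor (Suc j) k h u) q"
  and "dzbar (%u. pair_expectation (Factor j k h u) q) u = pair_expectation (Factor j (Suc k) h u) q"
proof -
 obtain l m g v where q: "q = Factor l m g v" by (cases q)
 have g: "g analytic_on {v}" "Im (g v) > 0" "h u ~= g v" using assms by (auto simp: q)
 have s: "smooth (green2 h g) (u, v)" using assms g by (intro smooth_green2) auto
 have "isCont h u" using assms(1) by (rule analytic_at_imp_isCont)
 hence c: "near u (%w. Im (h w) > 0 & h w ~= g v)" using near_isCont[where f = h and x = u and P = "%x. Im x > 0 & x ~= g v"] assms g
   eventually_nhds_in_open[of "{x. Im x > 0} - {g v}" "h u"] by (auto simp: open_halfspace_Im_gt open_Diff)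
 have ev: "near u (%w. pair_expectation (Factor j k h w) q = jet in1 (j, k) (jet in2 (l, m) (green2 h g)) (w, v))" for j k
  using analytic_at_eventually[OF assms(1)] c by eventually_elim (simp add: pair_expectation_jet q g del: pair_expectation.simps)
 let ?J = "jet in2 (l, m) (green2 h g)"
 have J: "smooth ?J (u, v)" by (rule smooth_jet[OF s])
 show "smooth (%u. pair_expectation (Factor j k h u) q) u"
 proof (rule smooth.cong)
  show "smooth (%w. jet in1 (j, k) ?J (w, v)) u" by (intro smooth_slice1 smooth_jet J)
  show "near u (%w. jet in1 (j, k) ?J (w, v) = pair_expectation (Factor j k h w) q)" using ev[of j k] by eventually_elim simp
 qed
 show "dz (%u. pair_expectation (Factor j k h u) q) u = pair_expectation (Factor (Suc j) k h u) q"
  unfolding eventually_at_self[OF ev] dz_wirt wirt_cong[OF ev] wirt_slice1[OF smooth_jet[OF J]] wirt_jet_dz ..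
 show "dzbar (%u. pair_expectation (Factor j k h u) q) u = pair_expectation (Factor j (Suc k) h u) q"
  unfolding eventually_at_self[OF ev] dzbar_wirt wirt_cong[OF ev] wirt_slice1[OF smooth_jet[OF J]] wirt_jet_dzbar[OF J] ..
qed

section \<open>Merging functionals and replacing fields inside correlations\<close>

lemma image_mset_sum: "finite I ==> image_mset f (SUM i:I. M i) = (SUM i:I. image_mset f (M i))" by (induction I rule: finite_induct) auto

lemma tags_image:
 assumes "!!i. i < length L ==> L ! i ~= {#} ==> g i = c"
 shows "image_mset (%(i, p). (g i, p)) (tags L) = image_mset (Pair c) (sum_list L)"
proof -
 have "image_mset (%(i, p). (g i, p)) (image_mset (Pair i) (L ! i)) = image_mset (Pair c) (L ! i)" if "i < length L" for i
  using assms[OF that] by (cases "L ! i = {#}") (auto simp: image_mset.compositionality comp_def)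
 thus ?thesis by (simp add: tags_def image_mset_sum sum_list_sum_nth atLeast0LessThan)
qed

lemma tagged_exps_image:
 assumes "!!i. i < length L ==> L ! i ~= [] ==> g i = c"
 shows "map (map_prod id (%(i, p). (g i, p))) (tagged_exps L) = map (map_prod id (Pair c)) (concat L)"
proof -
 have 1: "map (map_prod id (%(i, p). (g i, p))) (map (map_prod id (Pair i)) (L ! i)) = map (map_prod id (Pair c)) (L ! i)" if "i < length L" for i
  using assms[OF that] by (cases "L ! i = []") (auto)
 have "map (map_prod id (%(i, p). (g i, p))) (tagged_exps L) =
   concat (map (%i. map (map_prod id (%(i, p). (g i, p))) (map (map_prod id (Pair i)) (L ! i))) [0..<length L])"
  by (simp add: tagged_exps_def map_concat comp_def)
 also have "\<dots> = concat (map (%i. map (map_prod id (Pair c)) (L ! i)) [0..<length L])"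
  using 1 by (intro arg_cong[of _ _ concat] map_cong refl) (simp only: set_upt atLeastLessThan_iff)
 also have "\<dots> = concat (map (map (map_prod id (Pair c))) (map ((!) L) [0..<length L]))" by (simp add: comp_def)
 also have "\<dots> = map (map_prod id (Pair c)) (concat L)" unfolding map_nth by (simp add: map_concat)
 finally show ?thesis .
qed

definition disjoint_sets_list :: "'a set list => bool" where
 "disjoint_sets_list Ss \<longleftrightarrow> (ALL i<length Ss. ALL j<length Ss. i ~= j --> Ss ! i \<inter> Ss ! j = {})"

lemma valid_factor_node: "valid_factor S p ==> fnode p : S" by (cases p) auto

text \<open>By Wick's formula a product of terms at different nodes is again a combination of terms,
  namely the \<open>reg_term\<close> whose covariance pairs factors of different slots only. This is
  why a test against one functional decides equality in longer correlations.\<close>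

lemma merge_rest:
 assumes ts: "list_all2 (%(P, ls) S. valid_term S P ls) ts Ss" and dis: "disjoint_sets_list Ss"
  and x: "!!S. S : set Ss ==> X \<inter> S = {}" and k: "k <= length ts"
 shows "EX H:wick_span (\<Union>(set Ss)). ALL A:wick_span X. corr (take k (term_list ts) @ A # drop k (term_list ts)) = corr [A, H]"
proof -
 define n where "n = length ts"
 have n: "length Ss = n" using ts by (simp add: n_def list_all2_lengthD)
 \<comment> \<open>Since the node sets are disjoint, the node of a factor tells its slot. The
   covariance of the merged functional can thus be defined without tags.\<close>
 define si where "si p = (LEAST i. i < n & fnode p : Ss ! i)" for p
 have si: "si p = i" if "valid_factor (Ss ! i) p" "i < n" for p i
 proof -
  have i: "i < n & fnode p : Ss ! i" using that valid_factor_node by auto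
  have "j = i" if "j < n & fnode p : Ss ! j" for j using that i dis n unfolding disjoint_sets_list_def by blast
  thus ?thesis unfolding si_def using i by (metis (mono_tags, lifting) LeastI)
 qed
 define C where "C p q = (if si p < si q then pair_expectation p q else if si q < si p then pair_expectation q p else 0)" for p q
 have sGa: "symm C" by (auto simp: symm_def C_def)
 have tsv: "valid_term (Ss ! i) (fst (ts ! i)) (snd (ts ! i))" if "i < n" for i
  using ts that by (auto simp: list_all2_conv_all_nth n_def case_prod_beta)
 define PH where "PH = sum_list (map fst ts)"
 define lH where "lH = concat (map snd ts)"
 have PHm: "p :# PH \<longleftrightarrow> (EX i<n. p :# fst (ts ! i))" for p
 proof -
  have "p :# sum_list L \<longleftrightarrow> (EX i<length L. p :# L ! i)" for L :: "factor multiset list"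
   by (induction L) (auto simp: nth_Cons' less_Suc_eq_0_disj gr0_conv_Suc)
  from this[of "map fst ts"] show ?thesis by (auto simp: PH_def n_def)
 qed
 have lHm: "p : snd ` set lH \<longleftrightarrow> (EX i<n. p : snd ` set (snd (ts ! i)))" for p by (force simp: lH_def n_def in_set_conv_nth)
 have Hv: "valid_term (\<Union>(set Ss)) PH lH"
 proof -
  have "valid_factor (\<Union>(set Ss)) p" if "valid_factor (Ss ! i) p" "i < n" for i p using that n by (cases p) auto
  thus ?thesis using tsv unfolding valid_term_def PHm Ball_def Un_iff lHm by blast
 qed
 define H where "H = reg_term C (%_. 0) PH lH"
 have Hin: "H : wick_span (\<Union>(set Ss))" unfolding H_def by (rule reg_term_in_span[OF sGa Hv])
 have base: "corr (take k (term_list ts) @ wick_term P ls # drop k (term_list ts)) = corr [wick_term P ls, H]"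
  if v: "valid_term X P ls" for P ls
 proof -
  define us where "us = take k ts @ (P, ls) # drop k ts"
  \<comment> \<open>Relabelling for the list of two functionals: position k gets tag 0 and every
    other position tag 1.\<close>
  define f where "f = (%(i, p::factor). ((if i = k then 0 else 1) :: nat, p))"
  define sH where "sH = \<lparr>s_cov = C, s_mean = %_. 0, s_poly = PH, s_exp = lH\<rparr>"
  define ss where "ss = [trivial_slot (P, ls), sH]"
  have lk: "length (take k ts) = k" using k by simp
  let ?U = "tags (map fst us)" and ?V = "tagged_exps (map snd us)" and ?X = "map fst (take k ts) @ {#} # map fst (drop k ts)" and ?Y = "map snd (take k ts) @ [] # map snd (drop k ts)" and ?g = "gauss (slot_cov ss) (%_. 0)" and ?W = "take k (term_list ts) @ wick_term P ls # drop k (term_list ts)"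
  have L: "corr ?W = gauss tag_cov (%_. 0) ?U ?V"
  proof -
   have "?W = term_list us" by (simp add: us_def term_list_def take_map drop_map)
   thus ?thesis by (simp only: corr_term_list(2))
  qed
  have ssym: "symm (slot_cov ss)" by (rule symm_slot_cov) (auto simp: ss_def sH_def sGa)
  have sm: "slot_mean ss = (%_. 0)" by (auto simp: fun_eq_iff ss_def sH_def nth_Cons')
  have R: "corr [wick_term P ls, H] = ?g (tags [P, PH]) (tagged_exps [ls, lH])"
  proof -
   have "symm (s_cov s)" if "s : set ss" for s using that sGa by (auto simp: ss_def sH_def)
   from corr_slots[OF this] have "corr (map slot_fun ss) = ?g (tags (map s_poly ss)) (tagged_exps (map s_exp ss))" by (simp add: sm)
   moreover have "map slot_fun ss = [wick_term P ls, H]" by (simp add: ss_def slot_fun_trivial) (simp add: slot_fun_def H_def sH_def)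
   ultimately show ?thesis by (simp add: ss_def sH_def)
  qed
  have t1: "image_mset f ?U = tags [P, PH]"
  proof -
   have "image_mset f ?U = image_mset f (image_mset (Pair k) P) + image_mset f (tags ?X)"
    unfolding us_def using tags_append_Cons[of "map fst (take k ts)" P "map fst (drop k ts)"] lk by simp
   also have "image_mset f (tags ?X) =
     image_mset (Pair 1) (sum_list ?X)" unfolding f_def by (rule tags_image) (insert lk, auto simp: nth_append nth_Cons' split: if_splits)
   also have "sum_list ?X = PH"
   proof -
    have "map fst ts = map fst (take k ts) @ map fst (drop k ts)" by (simp flip: map_append)
    thus ?thesis unfolding PH_def by (simp only: sum_list_append) simp
   qed
   also have "image_mset f (image_mset (Pair k) P) = image_mset (Pair 0) P" by (simp add: f_def image_mset.compositionality comp_def)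
   finally show ?thesis by (simp add: tags_def numeral_2_eq_2)
  qed
  have t2: "mset (map (map_prod id f) ?V) = mset (tagged_exps [ls, lH])"
  proof -
   have "mset (map (map_prod id f) ?V) =
     mset (map (map_prod id f) (map (map_prod id (Pair k)) ls @ tagged_exps ?Y))"
    unfolding us_def mset_map using tagged_exps_append_Cons[of "map snd (take k ts)" ls "map snd (drop k ts)"] lk by simp
   also have "map (map_prod id f) (map (map_prod id (Pair k)) ls @ tagged_exps ?Y)
    = map (map_prod id (Pair 0)) ls @ map (map_prod id f) (tagged_exps ?Y)" by (auto simp: f_def)
   also have "map (map_prod id f) (tagged_exps ?Y) =
     map (map_prod id (Pair 1)) (concat ?Y)" unfolding f_def by (rule tagged_exps_image) (insert lk, auto simp: nth_append nth_Cons' split: if_splits)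
   also have "concat ?Y = lH"
   proof -
    have "map snd ts = map snd (take k ts) @ map snd (drop k ts)" by (simp flip: map_append)
    thus ?thesis unfolding lH_def by (simp only: concat_append) simp
   qed
   finally have "mset (map (map_prod id f) ?V) = mset (map (map_prod id (Pair 0)) ls @ map (map_prod id (Pair 1)) lH)" .
   moreover have "tagged_exps [ls, lH] = map (map_prod id (Pair 0)) ls @ map (map_prod id (Pair 1)) lH" by (simp add: tagged_exps_def)
   ultimately show ?thesis by (simp only:)
  qed
  \<comment> \<open>The node set that belongs to tag i once X has been inserted at position
    k.\<close>
  define S' where "S' i = (if i = k then X else if i < k then Ss ! i else Ss ! (i - 1))" for i
  have lab: "fst y <= n & valid_factor (S' (fst y)) (snd y)" if "y : set_mset ?U Un snd ` set ?V" for y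
  proof -
   have lu: "length us = Suc n" using k by (simp add: us_def n_def)
   have y: "fst y < Suc n" "snd y : set_mset (fst (us ! fst y)) Un snd ` set (snd (us ! fst y))"
    using that lu by (auto simp: set_tags snd_tagged_exps)
   have "us ! fst y = (if fst y = k then (P, ls) else if fst y < k then ts ! fst y else ts ! (fst y - 1))"
    using lk k y(1) by (auto simp: us_def nth_append nth_Cons' n_def)
   hence "valid_term (S' (fst y)) (fst (us ! fst y)) (snd (us ! fst y))"
    using v tsv[of "fst y"] tsv[of "fst y - 1"] y(1) k by (auto simp: S'_def n_def)
   thus ?thesis using y by (auto simp: valid_term_def)
  qed
  have "?g (tags [P, PH]) (tagged_exps [ls, lH]) =
    ?g (image_mset f ?U) (map (map_prod id f) ?V)" unfolding t1 by (rule gauss_perm) (rule t2[symmetric])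
  also have "\<dots> = gauss (%x y. slot_cov ss (f x) (f y)) (%_. 0) ?U ?V" by (rule gauss_image[OF ssym])
  also have "\<dots> = gauss tag_cov (%_. 0) ?U ?V"
  proof (rule gauss_cong[OF _ symm_tag_cov])
   show "symm (%x y. slot_cov ss (f x) (f y))" using ssym unfolding symm_def by blast
   fix y z assume y: "y : set_mset ?U Un snd ` set ?V"
    and z: "z : set_mset ?U Un snd ` set ?V"
   obtain i p j q where e: "y = (i, p)" "z = (j, q)" by (metis surj_pair)
   have vp: "i <= n" "valid_factor (S' i) p" and vq: "j <= n" "valid_factor (S' j) q" using lab[OF y] lab[OF z] by (auto simp: e)
   have xS: "X \<inter> S' i = {}" if "i ~= k" "i <= n" for i using x that n k by (auto simp: S'_def n_def)
   have si': "si p = (if i < k then i else i - 1)" if "valid_factor (S' i) p" "i <= n" "i ~= k" for i p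
    using that si[of i p] si[of "i - 1" p] k by (auto simp: S'_def n_def split: if_splits)
   \<comment> \<open>The merged list puts the distinguished functional first although some slots
     preceded it. The arguments of the pair expectation are then exchanged, which is allowed because
     the nodes differ.\<close>
   have comm: "pair_expectation p q = pair_expectation q p" if "(i = k) ~= (j = k)"
   proof (rule pair_expectation_commute[OF vp(2) vq(2)])
    have "fnode p : S' i" "fnode q : S' j" using vp vq valid_factor_node by auto
    thus "fnode p ~= fnode q" using that xS[of i] xS[of j] vp(1) vq(1) by (cases "i = k") (auto simp: S'_def[of k])
   qed
   show "slot_cov ss (f y) (f z) = tag_cov y z"
   proof (cases "i = k | j = k")
    case True
    thus ?thesis using comm by (auto simp: e f_def ss_def)
   next
    case False
    thus ?thesis using si'[OF vp(2,1)] si'[OF vq(2,1)] by (auto simp: e f_def ss_def sH_def C_def)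
   qed
  qed simp
  finally show ?thesis using L R by simp
 qed
 have all: "set (take k (term_list ts)) <= all_span" "set (drop k (term_list ts)) <= all_span"
  by (auto simp: term_list_def dest!: in_set_takeD in_set_dropD intro: term_span.tm)
 have "corr (take k (term_list ts) @ A # drop k (term_list ts)) = corr [A, H]" if "A : wick_span X" for A using that
 proof induction
  case (tm P ls)
  thus ?case by (rule base)
 next
  case (add F G)
  thus ?case using corr_add[OF all wick_span_all wick_span_all, OF add(1,2)] corr_add[of "[]" "[H]" F G]
    wick_span_all[OF Hin] wick_span_all[OF add(1)] wick_span_all[OF add(2)] by simp
 next
  case (scale F c)
  thus ?case using corr_scale[of "[]" c F "[H]"] by (simp add: corr_scale)
 qed
 thus ?thesis using Hin by blast
qed

lemma span_list_all: "list_all2 (%F V. F : term_span V) Fs Vs ==> set Fs <= all_span"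
 by (induction rule: list_all2_induct) (auto intro: wick_span_all)

text \<open>Fields of the OPE family are characterised only by their correlations with one further
  functional; \<open>merge_rest\<close> makes the replacement legitimate at any position of a longer
  list.\<close>

lemma corr_replace:
 assumes mem: "list_all2 (%F S. F : wick_span S) Hs Ss" and dis: "disjoint_sets_list Ss"
  and x: "!!S. S : set Ss ==> x ~: S" and k: "k <= length Hs"
  and A: "A : wick_span {x}" "A' : wick_span {x}"
  and eq: "!!P ls. valid_term (- {x}) P ls ==> corr [A, wick_term P ls] = corr [A', wick_term P ls]"
 shows "corr (take k Hs @ A # drop k Hs) = corr (take k Hs @ A' # drop k Hs)"
proof -
 have eq': "corr [A, H] = corr [A', H]" if "H : wick_span (- {x})" for H using that
 proof induction
  case (tm P ls)
  thus ?case by (rule eq)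
 next
  case (add F G)
  thus ?case using corr_add[of "[A]" "[]" F G] corr_add[of "[A']" "[]" F G] A[THEN wick_span_all]
    wick_span_all[OF add(1)] wick_span_all[OF add(2)] add(3,4) by simp
 next
  case (scale F c)
  thus ?case using corr_scale[of "[A]" c F "[]"] corr_scale[of "[A']" c F "[]"] by simp
 qed
 have len: "length Ss = length Hs" using mem by (simp add: list_all2_lengthD)
 have "length Hs' = length Ss --> corr (take k Hs' @ A # drop k Hs') = corr (take k Hs' @ A' # drop k Hs')"
  if "list_all2 (%F V. F : term_span V) Hs' (map valid_term Ss)" for Hs' using that
 proof (induction rule: multilinear_induct)
  case (base ts)
  have ts: "list_all2 (%(P, ls) S. valid_term S P ls) ts Ss" using base unfolding list_all2_map2 by (rule list_all2_mono) auto
  obtain H where "H : wick_span (\<Union>(set Ss))"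
   "!!A. A:wick_span {x} ==> corr (take k (term_list ts) @ A # drop k (term_list ts)) = corr [A, H]"
   using merge_rest[OF ts dis, of "{x}" k] x k len ts[THEN list_all2_lengthD] by auto
  moreover have "H : wick_span (- {x})"
  proof (rule term_span_mono[OF _ calculation(1)])
   fix P ls assume v: "valid_term (\<Union> (set Ss)) P ls"
   have "valid_factor (- {x}) p" if "valid_factor (\<Union> (set Ss)) p" for p using that x by (cases p) auto
   thus "valid_term (- {x}) P ls" using v by (auto simp: valid_term_def)
  qed
  ultimately show ?case using A eq' by simp
 next
  case (add As F G Bs)
  have all: "set As <= all_span" "set Bs <= all_span" "F : all_span" "G : all_span"
   using span_list_all[OF add(1)] span_list_all[OF add(2)] by auto
  have sub: "set (take j xs) <= all_span" "set (drop j xs) <= all_span"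
   if "set xs <= all_span" for j xs using that by (auto dest: in_set_takeD in_set_dropD)
  show ?case
  proof (cases "k <= length As")
   case True
   have "corr ((take k As @ B # drop k As) @ (%M. F M + G M) # Bs) = corr ((take k As @ B # drop k As) @ F # Bs) + corr ((take k As @ B # drop k As) @ G # Bs)"
    if "B : wick_span {x}" for B by (rule corr_add) (insert all sub that, auto intro: wick_span_all)
   thus ?thesis using add(3,4) True A by simp
  next
   case False
   then obtain j where j: "k - length As = Suc j" by (metis Suc_diff_Suc not_le_imp_less)
   have "corr (As @ (%M. F M + G M) # take j Bs @ B # drop j Bs) = corr (As @ F # take j Bs @ B # drop j Bs) + corr (As @ G # take j Bs @ B # drop j Bs)"
    if "B : wick_span {x}" for B by (rule corr_add) (insert all sub that, auto intro: wick_span_all)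
   thus ?thesis using add(3,4) False A j by simp
  qed
 next
  case (scale As F c Bs)
  show ?case
  proof (cases "k <= length As")
   case True
   thus ?thesis using scale(2) corr_scale[of "take k As @ A # drop k As" c F Bs] corr_scale[of "take k As @ A' # drop k As" c F Bs] by simp
  next
   case False
   then obtain j where j: "k - length As = Suc j" by (metis Suc_diff_Suc not_le_imp_less)
   thus ?thesis using scale(2) False by (simp add: corr_scale)
  qed
 qed
 from this[of Hs] show ?thesis using mem len by (simp add: list_all2_map2)
qed

lemma chart_at_eventually:
 assumes "chart_at c z"
 shows "near z (%u. chart_at c u)"
proof -
 have a: "par c analytic_on {z}" "lg c analytic_on {z}" using assms by (auto simp: chart_at_def)
 have "near z (%u. Im (par c u) > 0)" using near_isCont[where f = "par c" and x = z and P = "%w. Im w > 0"] a(1)[THEN analytic_at_imp_isCont] assms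
   eventually_nhds_in_open[of "{w. Im w > 0}" "par c z"] by (auto simp: open_halfspace_Im_gt chart_at_def)
 moreover have "near z (%u. near u (%u. exp (lg c u) = deriv (par c) u))" using assms by (simp add: eventually_eventually chart_at_def)
 ultimately show ?thesis using analytic_at_eventually[OF a(1)] analytic_at_eventually[OF a(2)] by eventually_elim (simp add: chart_at_def)
qed

lemma chart_at_deriv: "chart_at c z ==> deriv (par c) z ~= 0"
 unfolding chart_at_def using eventually_at_self[of "%u. exp (lg c u) = deriv (par c) u" z] exp_not_eq_zero by metis

section \<open>Covariances in charts\<close>

text \<open>Only charts c that arise from flows of the vector fields \<open>\<kappa> / (p - \<zeta>)\<close> are needed. For them
 \<open>(p - \<zeta>)\<^sup>2\<close> changes by a constant, which makes the difference quotient of \<open>par c\<close> explicit.\<close>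

definition good_chart :: "complex => chart => complex => bool" where
 "good_chart p c z \<longleftrightarrow> chart_at c z & p ~= z & p ~= par c z &
   (EX s. near z (%u. (p - par c u)\<^sup>2 = (p - u)\<^sup>2 - s))"

lemma good_chart_eventually:
 assumes "good_chart p c z"
 shows "near z (%u. good_chart p c u)"
proof -
 obtain s where s: "near z (%u. (p - par c u)\<^sup>2 = (p - u)\<^sup>2 - s)" using assms by (auto simp: good_chart_def)
 hence s': "near z (%u. near u (%u. (p - par c u)\<^sup>2 = (p - u)\<^sup>2 - s))" by (simp add: eventually_eventually)
 have ch: "chart_at c z" using assms by (simp add: good_chart_def)
 have "isCont (par c) z" using ch by (auto simp: chart_at_def analytic_at_imp_isCont)
 hence "near z (%u. par c u ~= p)" using near_isCont[where f = "par c" and x = z and P = "%w. w ~= p"] assms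
   eventually_nhds_in_open[of "- {p}" "par c z"] by (auto simp: good_chart_def)
 moreover have "near z (%u. u ~= p)" using eventually_nhds_in_open[of "- {p}" z] assms by (auto simp: good_chart_def)
 ultimately show ?thesis using chart_at_eventually[OF ch] s' by eventually_elim (auto simp: good_chart_def)
qed

text \<open>The covariance in the chart without its singular part - 2 ln |u - v|. For a good chart h
  one has (h u - h v) (2 p - h u - h v) = (u - v) (2 p - u - v), which eliminates ln |h u - h v|;
  the three remaining logarithms are smooth across the diagonal.\<close>

definition reg_green :: "complex => chart => complex * complex => complex" where
 "reg_green p c w = 2 * of_real (ln (cmod (par c (fst w) - cnj (par c (snd w))))) - 2 * of_real (ln (cmod (2 * p - fst w - snd w)))
   + 2 * of_real (ln (cmod (2 * p - par c (fst w) - par c (snd w))))"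

definition log_kernel :: "complex * complex => complex" where
 "log_kernel w = - 2 * of_real (ln (cmod (fst w - snd w)))"

lemma smooth_fst: "smooth fst w" and smooth_snd: "smooth snd w"
 by (rule smooth.lin, rule bounded_linear_fst, rule smooth.lin, rule bounded_linear_snd)

lemma smooth_reg_green:
 assumes "par c analytic_on {u}" "par c analytic_on {v}" "Im (par c u) > 0" "Im (par c v) > 0"
  "2 * p - u - v ~= 0" "2 * p - par c u - par c v ~= 0"
 shows "smooth (reg_green p c) (u, v)"
 unfolding reg_green_def[abs_def] using upper_neq_cnj[OF assms(3,4)] assms by (intro smooth.add smooth_scale smooth_ln_norm smooth_diff smooth_cnj smooth_fst_comp smooth_snd_comp
   smooth.const smooth_fst smooth_snd) auto

lemma good_smooth_reg_green: "good_chart p c z ==> smooth (reg_green p c) (z, z)" by (rule smooth_reg_green) (auto simp: good_chart_def chart_at_def)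

lemma smooth_log_kernel: "u ~= v ==> smooth log_kernel (u, v)"
 unfolding log_kernel_def[abs_def] by (intro smooth_scale smooth_ln_norm smooth_diff smooth_fst smooth_snd) auto

lemma eventually_fst_nhds: "eventually P (nhds z) ==> near (z, v) (%w. P (fst w))"
 and eventually_snd_nhds: "eventually P (nhds z) ==> near (v, z) (%w. P (snd w))"
 for z v :: complex
 using near_isCont[where f = fst and x = "(z, v)" and P = P] near_isCont[where f = snd and x = "(v, z)" and P = P] by (auto intro: continuous_intros)

definition reg_jet :: "complex => chart => nat * nat => nat * nat => complex * complex => complex" where
 "reg_jet p c d e = jet in1 d (jet in2 e (reg_green p c))"

definition log_jet :: "nat * nat => nat * nat => complex * complex => complex" where
 "log_jet d e = jet in1 d (jet in2 e log_kernel)"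

lemma reg_jet_commute:
 assumes "good_chart p c z"
 shows "reg_jet p c d e (z, z) = reg_jet p c e d (z, z)" unfolding reg_jet_def
proof (rule jet_jet_swap[OF good_smooth_reg_green[OF assms]])
 fix w
 have "cmod (a - cnj b) = cmod (b - cnj a)" for a b by (metis complex_cnj_cnj complex_cnj_diff complex_mod_cnj norm_minus_commute)
 moreover have "2 * p - a - b = 2 * p - b - a" for a b by simp
 ultimately show "reg_green p c w = reg_green p c (prod.swap w)" unfolding reg_green_def prod.swap_def fst_conv snd_conv by metis
qed

lemma pair_expectation_split:
 assumes "good_chart p c z"
 shows "\<forall>\<^sub>F ze in at z. par c ze ~= par c z & (ALL j k l m. pair_expectation (Factor j k (par c) ze) (Factor l m (par c) z)
   = reg_jet p c (j, k) (l, m) (ze, z) + log_jet (j, k) (l, m) (ze, z))"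
proof -
 let ?h = "par c"
 obtain s where s: "near z (%u. (p - ?h u)\<^sup>2 = (p - u)\<^sup>2 - s)" using assms by (auto simp: good_chart_def)
 have ch: "chart_at c z" "?h analytic_on {z}" "p ~= z" "p ~= ?h z" using assms by (auto simp: good_chart_def chart_at_def)
 define P where "P w \<longleftrightarrow> chart_at c (fst w) & chart_at c (snd w) & (p - ?h (fst w))\<^sup>2 = (p - fst w)\<^sup>2 - s & (p - ?h (snd w))\<^sup>2 = (p - snd w)\<^sup>2 - s
  & 2 * p - fst w - snd w ~= 0 & 2 * p - ?h (fst w) - ?h (snd w) ~= 0" for w
 have n1: "near (z, z) (%w. 2 * p - fst w - snd w ~= 0)"
  using near_isCont[where f = "%w. 2 * p - fst w - snd w" and x = "(z, z)" and P = "%x. x ~= 0"]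
   eventually_nhds_in_open[of "- {0}" "2 * p - z - z"] ch by (auto intro!: continuous_intros)
 have "isCont ?h z" using ch(2) by (rule analytic_at_imp_isCont)
 hence "isCont (%w. 2 * p - ?h (fst w) - ?h (snd w)) (z, z)"
  by (intro continuous_intros isCont_o2[where f = fst and g = ?h] isCont_o2[where f = snd and g = ?h]) auto
 hence n2: "near (z, z) (%w. 2 * p - ?h (fst w) - ?h (snd w) ~= 0)"
  using near_isCont[where f = "%w. 2 * p - ?h (fst w) - ?h (snd w)" and x = "(z, z)" and P = "%x. x ~= 0"]
   eventually_nhds_in_open[of "- {0}" "2 * p - ?h z - ?h z"] ch by auto
 have "near (z, z) (%w. P w)" using eventually_fst_nhds[OF s, of z] eventually_snd_nhds[OF s, of z] n1 n2
   eventually_fst_nhds[OF chart_at_eventually[OF ch(1)], of z] eventually_snd_nhds[OF chart_at_eventually[OF ch(1)], of z]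
  unfolding P_def by eventually_elim blast
 hence "near (z, z) (%w. eventually P (nhds w))" by (simp add: eventually_eventually)
 from eventually_slice1[OF this] have ev: "near z (%ze. eventually P (nhds (ze, z)))" .
 show ?thesis unfolding eventually_at_filter using ev
 proof (eventually_elim, intro impI)
  case (elim ze)
  assume "ze ~= z"
  have Pz: "P (ze, z)" by (rule eventually_at_self[OF elim])
  \<comment> \<open>The chart relations at the two points are subtracted and both sides factored. As
    2 p - fst w - snd w does not vanish near the diagonal, the chart is also seen to be injective
    there.\<close>
  have inj: "(?h (fst w) - ?h (snd w)) * (2 * p - ?h (fst w) - ?h (snd w)) = (fst w - snd w) * (2 * p - fst w - snd w)" if "P w" for w
  proof -
   have "(p - ?h (snd w))\<^sup>2 - (p - ?h (fst w))\<^sup>2 = (p - snd w)\<^sup>2 - (p - fst w)\<^sup>2" using that by (simp add: P_def)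
   thus ?thesis by (simp add: power2_eq_square algebra_simps)
  qed
  have ne: "?h ze ~= ?h z" using inj[OF Pz] Pz \<open>ze ~= z\<close> by (auto simp: P_def)
  have "near (ze, z) (%w. fst w - snd w ~= 0)" using near_isCont[where f = "%w. fst w - snd w" and x = "(ze, z)" and P = "%x. x ~= 0"]
    eventually_nhds_in_open[of "- {0}" "ze - z"] \<open>ze ~= z\<close> by (auto intro!: continuous_intros)
  with elim have e: "near (ze, z) (%w. green2 ?h ?h w = reg_green p c w + log_kernel w)"
  proof eventually_elim
   case (elim w)
   let ?a = "?h (fst w)" and ?b = "?h (snd w)"
   have nz: "?a - ?b ~= 0" "2 * p - ?a - ?b ~= 0" "2 * p - fst w - snd w ~= 0" "fst w - snd w ~= 0" using inj[OF elim(1)] elim by (auto simp: P_def)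
   have "ln (cmod (?a - ?b)) + ln (cmod (2 * p - ?a - ?b)) = ln (cmod (fst w - snd w)) + ln (cmod (2 * p - fst w - snd w))"
    using nz arg_cong[OF inj[OF elim(1)], of "%x. ln (cmod x)"] by (simp add: norm_mult ln_mult)
   moreover have "?a ~= cnj ?b" using elim(1) by (intro upper_neq_cnj) (auto simp: P_def chart_at_def)
   ultimately have "green ?a ?b = ln (cmod (?a - cnj ?b)) - (ln (cmod (fst w - snd w)) + ln (cmod (2 * p - fst w - snd w)) - ln (cmod (2 * p - ?a - ?b)))"
    using nz by (simp add: green_def norm_divide ln_div)
   thus ?case by (simp add: green2_def reg_green_def log_kernel_def)
  qed
  have sm: "smooth (reg_green p c) (ze, z)" "smooth log_kernel (ze, z)"
   using Pz \<open>ze ~= z\<close> by (auto intro!: smooth_reg_green smooth_log_kernel simp: P_def chart_at_def)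
  have "jet in1 d (jet in2 e (green2 ?h ?h)) (ze, z) = reg_jet p c d e (ze, z) + log_jet d e (ze, z)" for d e
  proof -
   have "near (ze, z) (%w. jet in2 e (%w. reg_green p c w + log_kernel w) w = jet in2 e (reg_green p c) w + jet in2 e log_kernel w)"
    using smooth_near[OF sm(1)] smooth_near[OF sm(2)] by eventually_elim (rule jet_add)
   hence "jet in1 d (jet in2 e (%w. reg_green p c w + log_kernel w)) (ze, z) = reg_jet p c d e (ze, z) + log_jet d e (ze, z)"
    by (simp add: jet_cong jet_add smooth_jet sm reg_jet_def log_jet_def)
   thus ?thesis using jet_cong[OF eventually_jet_cong[OF e]] by metis
  qed
  thus "?h ze ~= ?h z & (ALL j k l m. pair_expectation (Factor j k ?h ze) (Factor l m ?h z)
    = reg_jet p c (j, k) (l, m) (ze, z) + log_jet (j, k) (l, m) (ze, z))"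
   using ne Pz by (auto simp: pair_expectation_jet P_def chart_at_def simp del: pair_expectation.simps)
 qed
qed

text \<open>The shapes that derivatives of ln |x| take. The class is stable under both Wirtinger
  derivatives away from 0.\<close>

definition singular_form :: "(complex => complex) => bool" where
 "singular_form f \<longleftrightarrow> (EX c. f = (%x. c * of_real (ln (cmod x)))) | (EX c m n. f = (%x. c * (x powi m * cnj x powi n)))"

lemma singular_form_power: "singular_form (%x. c * (x powi m * cnj x powi n))"
 and singular_form_ln: "singular_form (%x. c * of_real (ln (cmod x)))" unfolding singular_form_def by blast+

lemma smooth_powi: "smooth f x ==> f x ~= 0 ==> smooth (%y. f y powi m) x"
 by (rule smooth.comp[where ph = "%w. w powi m"]) (auto intro!: analytic_intros)

lemma smooth_ident: "smooth (%y :: complex. y) x" by (rule smooth.lin) (rule bounded_linear_ident)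

lemma smooth_singular_form: "singular_form f ==> x ~= 0 ==> smooth f x"
 by (auto simp: singular_form_def intro!: smooth_scale smooth_ln_norm smooth.mult smooth_powi smooth_cnj smooth_ident)

lemma dd_ident: "dd e (%y::complex. y) x = e" by (rule dd_lin) (rule bounded_linear_ident)

lemma wirt_ident: "wirt1 s (%y::complex. y) x = (1 + s * \<i>) / 2"
 and wirt_cnj_ident: "wirt1 s (%y::complex. cnj y) x = (1 - s * \<i>) / 2" by (simp_all add: wirt_def dd_ident dd_cnj smooth_ident)

lemma deriv_powi: "x ~= 0 ==> deriv (%w::complex. w powi m) x = of_int m * x powi (m - 1)"
 by (rule DERIV_imp_deriv) (auto intro!: derivative_eq_intros)

lemma wirt_singular_form:
 assumes "singular_form f" "s = \<i> | s = - \<i>"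
 shows "EX psi. singular_form psi & (ALL x. x ~= 0 --> wirt1 s f x = psi x)" using assms(1) unfolding singular_form_def[of f]
proof (elim disjE exE)
 fix c assume f: "f = (%x. c * of_real (ln (cmod x)))"
 define m n :: int where "m = (if s = \<i> then 0 else -1)" and "n = (if s = \<i> then -1 else 0)"
 have "wirt1 s f x = (c / 2) * (x powi m * cnj x powi n)" if "x ~= 0" for x
  unfolding f using that assms(2) by (auto simp: wirt_scale smooth_ln_norm smooth_ident m_def n_def power_int_minus)
   (auto simp: wirt_def dd_ln_norm smooth_ident dd_ident field_simps)
 thus ?thesis using singular_form_power by blast
next
 fix c m n assume f: "f = (%x. c * (x powi m * cnj x powi n))"
 define A where "A = (if s = \<i> then of_int n else of_int m :: complex)"
 define m' n' where "m' = (if s = \<i> then m else m - 1)" and "n' = (if s = \<i> then n - 1 else n)"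
 have "wirt1 s f x = (c * A) * (x powi m' * cnj x powi n')" if x: "x ~= 0" for x
 proof -
  have an: "(%w. w powi i) analytic_on {y}" if "y ~= 0" for i :: int and y :: complex using that by (auto intro!: analytic_intros)
  have 1: "wirt1 s (%x. x powi m) x = of_int m * x powi (m - 1) * ((1 + s * \<i>) / 2)"
   using wirt_comp[OF smooth_ident an[OF x], of s "%h. h" m] x by (simp add: deriv_powi wirt_ident)
  have 2: "wirt1 s (%x. cnj x powi n) x = of_int n * cnj x powi (n - 1) * ((1 - s * \<i>) / 2)"
   using wirt_comp[OF smooth_cnj[OF smooth_ident] an, of x s "%h. h" n] x by (simp add: deriv_powi wirt_cnj_ident)
  have "wirt1 s f x = c * (x powi m * (of_int n * cnj x powi (n - 1) * ((1 - s * \<i>) / 2)) +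
     of_int m * x powi (m - 1) * ((1 + s * \<i>) / 2) * cnj x powi n)"
  proof -
   have sm: "smooth (%x. x powi m) x" "smooth (%x. cnj x powi n) x"
    using x by (auto intro: smooth_powi[OF smooth_ident] smooth_powi[OF smooth_cnj[OF smooth_ident]])
   show ?thesis unfolding f wirt_scale[OF smooth.mult[OF sm]] wirt_mult[OF sm] 1 2 ..
  qed
  thus ?thesis using assms(2) by (auto simp: A_def m'_def n'_def)
 qed
 thus ?thesis using singular_form_power by blast
qed

lemma singular_form_uminus:
 assumes "singular_form f"
 shows "singular_form (%x. - f x)" using assms unfolding singular_form_def[of f]
proof (elim disjE exE)
 fix c assume "f = (%x. c * complex_of_real (ln (cmod x)))"
 thus ?thesis using singular_form_ln[of "- c"] by simp
next
 fix c m n assume "f = (%x. c * (x powi m * cnj x powi n))"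
 thus ?thesis using singular_form_power[of "- c" m n] by simp
qed

lemma bl_diff: "bounded_linear (%w :: complex * complex. fst w - snd w)" by (intro bounded_linear_sub bounded_linear_fst bounded_linear_snd)

lemma wirt_diff_in1:
 assumes "smooth ph (u - v)"
 shows "wirt s in1 (%w. ph (fst w - snd w)) (u, v) = wirt1 s ph (u - v)"
 using wirt_affine[where M = "%w. fst w - snd w" and f = ph and x = "(u, v)" and b = 0 and s = s and L = in1] bl_diff assms by simp

lemma wirt_diff_in2:
 assumes "smooth ph (u - v)"
 shows "wirt s in2 (%w. ph (fst w - snd w)) (u, v) = - wirt1 s ph (u - v)"
proof -
 have "dd (- e) ph (u - v) = - dd e ph (u - v)" for e using dd_scale_dir[OF assms, of "-1" e] by simp
 hence "wirt s uminus ph (u - v) = - wirt1 s ph (u - v)" by (simp add: wirt_def field_simps)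
 thus ?thesis using wirt_affine[where M = "%w. fst w - snd w" and f = ph and x = "(u, v)" and b = 0 and s = s and L = in2] bl_diff assms by simp
qed

definition sing_on_pairs :: "(complex * complex => complex) => bool" where
 "sing_on_pairs F \<longleftrightarrow> (EX f. singular_form f & (ALL u v. u ~= v --> F (u, v) = f (u - v)))"

lemma eventually_neq_nhds: "u ~= v ==> near (u, v) (%w. fst w ~= snd (w :: complex * complex))"
 using near_isCont[where f = "%w. fst w - snd w" and x = "(u, v)" and P = "%x. x ~= 0"]
  eventually_nhds_in_open[of "- {0}" "u - v"] by (auto intro!: continuous_intros)

lemma sing_on_pairs_wirt:
 assumes "sing_on_pairs F" "s = \<i> | s = - \<i>"
 shows "sing_on_pairs (wirt s in1 F)" "sing_on_pairs (wirt s in2 F)"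
proof -
 obtain f where f: "singular_form f" "!!u v. u ~= v ==> F (u, v) = f (u - v)" using assms by (auto simp: sing_on_pairs_def)
 obtain psi where psi: "singular_form psi" "!!x. x ~= 0 ==> wirt1 s f x = psi x" using wirt_singular_form[OF f(1) assms(2)] by blast
 have ev: "near (u, v) (%w. F w = f (fst w - snd w))" if "u ~= v" for u v
  using eventually_neq_nhds[OF that] by eventually_elim (metis f(2) prod.collapse)
 show "sing_on_pairs (wirt s in1 F)"
  unfolding sing_on_pairs_def by (rule exI[of _ psi]) (auto simp: wirt_cong[OF ev] wirt_diff_in1 smooth_singular_form f psi)
 show "sing_on_pairs (wirt s in2 F)"
  unfolding sing_on_pairs_def by (rule exI[of _ "%x. - psi x"]) (auto simp: wirt_cong[OF ev] wirt_diff_in2 smooth_singular_form f psi intro: singular_form_uminus)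
qed

lemma sing_on_pairs_log_jet: "sing_on_pairs (log_jet d e)"
proof -
 have "sing_on_pairs log_kernel"
  unfolding sing_on_pairs_def log_kernel_def by (rule exI[of _ "%x. - 2 * of_real (ln (cmod x))"], rule conjI, rule singular_form_ln) simp
 moreover have "sing_on_pairs ((wirt s in1 ^^ n) F)"
  if "sing_on_pairs F" "s = \<i> | s = - \<i>" for F s n by (induction n) (simp_all add: that sing_on_pairs_wirt(1)[OF _ that(2)])
 moreover have "sing_on_pairs ((wirt s in2 ^^ n) F)"
  if "sing_on_pairs F" "s = \<i> | s = - \<i>" for F s n by (induction n) (simp_all add: that sing_on_pairs_wirt(2)[OF _ that(2)])
 ultimately show ?thesis unfolding log_jet_def jet_def by simp
qed

text \<open>Conjugate powers have no index of their own; |x|^2 = x cnj x turns them into powers of x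
  and |x|.\<close>

lemma cnj_powi_ope_term:
 assumes "x ~= 0"
 shows "x powi m * cnj x powi n = ope_term (m - n, 2 * of_int n, 0) x"
proof -
 have "(of_real (cmod x) :: complex) powr of_int k = of_real (cmod x) powi k" for k
  using assms powr_of_int[of "of_real (cmod x)" k] by (simp add: power_int_def power_inverse)
 from this[of "2 * n"] have "(of_real (cmod x) :: complex) powr (2 * of_int n) = (of_real (cmod x) ^ 2) powi n" by (simp add: power_int_mult)
 also have "(of_real (cmod x) :: complex) ^ 2 = x * cnj x" by (metis complex_norm_square of_real_power)
 finally have "x powi (m - n) * of_real (cmod x) powr (2 * of_int n) = x powi (m - n) * (x powi n * cnj x powi n)"
  by (simp add: power_int_mult_distrib)
 also have "\<dots> = x powi m * cnj x powi n" using assms power_int_add[of x "m - n" n] by simp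
 finally show ?thesis by simp
qed

text \<open>Each derivative of the singular covariance is a multiple of a single OPE term, so that
  multiplication by it merely shifts the indices of an expansion.\<close>

lemma log_jet_ope_term: "EX k i. ALL u v. u ~= v --> log_jet d e (u, v) = k * ope_term i (u - v)"
proof -
 obtain f where f: "singular_form f" "!!u v. u ~= v ==> log_jet d e (u, v) = f (u - v)"
  using sing_on_pairs_log_jet[of d e] by (auto simp: sing_on_pairs_def)
 have "EX k i. ALL x. x ~= 0 --> f x = k * ope_term i x" using f(1) unfolding singular_form_def
 proof (elim disjE exE)
  fix c assume "f = (%x. c * of_real (ln (cmod x)))"
  thus ?thesis by (intro exI[of _ c] exI[of _ "(0, 0, 1)"]) auto
 next
  fix c m n assume "f = (%x. c * (x powi m * cnj x powi n))"
  thus ?thesis by (intro exI[of _ c] exI[of _ "(m - n, 2 * of_int n, 0)"]) (auto simp: cnj_powi_ope_term simp del: ope_term.simps)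
 qed
 then obtain k i where "!!x. x ~= 0 ==> f x = k * ope_term i x" by blast
 thus ?thesis using f(2) by (intro exI[of _ k] exI[of _ i]) (simp del: ope_term.simps)
qed

lemma smooth_moment:
 assumes "!!w. symm (C w)"
  and "!!a b. a :# M ==> b :# M ==> smooth (%w. C w a b) x" "!!a. a :# M ==> smooth (%w. m w a) x"
 shows "smooth (%w. moment (C w) (m w) M) x" using assms(2,3)
proof (induction M rule: multiset_size_induct)
 case empty
 thus ?case by (simp add: smooth.const)
next
 case (add y M)
 have 1: "smooth (%w. moment (C w) (m w) (M - N)) x" for N by (rule add(1)) (use add(2,3) in \<open>auto dest: in_diffD simp: size_mset_mono\<close>)
 from this[of "{#}"] have 2: "smooth (%w. moment (C w) (m w) M) x" by simp
 show ?case unfolding moment_add[OF assms(1)] by (intro smooth.add smooth.mult smooth_sum_mset 1 2 add(2,3)) auto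
qed

lemma smooth_lin:
 assumes "!!a. a : snd ` set ls ==> smooth (%w. f w a) x"
 shows "smooth (%w. lin (f w) ls) x" using assms
proof (induction ls)
 case (Cons a ls)
 obtain al p where a: "a = (al, p)" by force
 have "smooth (%w. lin (f w) ls) x" by (rule Cons(1)) (use Cons(2) in auto)
 moreover have "smooth (%w. f w p) x" by (rule Cons(2)) (auto simp: a)
 ultimately show ?case unfolding a lin_Cons by (intro smooth.add smooth_scale)
qed (simp add: smooth.const)

lemma smooth_gauss:
 assumes "!!w. symm (C w)"
  and "!!a b. a : set_mset P Un snd ` set ls ==> b : set_mset P Un snd ` set ls ==> smooth (%w. C w a b) x"
  and "!!a. a : set_mset P Un snd ` set ls ==> smooth (%w. m w a) x"
 shows "smooth (%w. gauss (C w) (m w) P ls) x"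
 unfolding gauss_def bil_def gmean_def by (intro smooth.mult smooth_exp smooth.add smooth_divide[OF _ smooth.const] smooth_lin smooth_moment)
   (use assms in auto)

lemma gauss_deriv_cong:
 assumes "!!a b. a : set_mset P Un snd ` set ls ==> b : set_mset P Un snd ` set ls ==> dGa a b = dGa' a b"
  and "!!a. a : set_mset P Un snd ` set ls ==> dmu a = dmu' a"
 shows "gauss_deriv C mu P ls dGa dmu = gauss_deriv C mu P ls dGa' dmu'"
proof -
 have 1: "lin dmu ls = lin dmu' ls" "bil dGa ls = bil dGa' ls" using assms by (auto intro!: lin_cong bil_cong)
 have 2: "gmean dGa dmu ls x = gmean dGa' dmu' ls x" if "x :# P" for x using assms that by (auto simp: gmean_def intro!: lin_cong)
 have "moment_deriv C m P dGa (gmean dGa dmu ls) = moment_deriv C m P dGa' (gmean dGa' dmu' ls)" for m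
 proof -
  have "(SUM x:#P. SUM y:#P - {#x#}. dGa x y * moment C m (P - {#x#} - {#y#})) =
   (SUM x:#P. SUM y:#P - {#x#}. dGa' x y * moment C m (P - {#x#} - {#y#}))"
   using assms(1) by (intro sum_mset_cong) (auto dest: in_diffD)
  moreover have "(SUM x:#P. gmean dGa dmu ls x * moment C m (P - {#x#})) = (SUM x:#P. gmean dGa' dmu' ls x * moment C m (P - {#x#}))"
   using 2 by (intro sum_mset_cong) simp
  ultimately show ?thesis unfolding moment_deriv_def by simp
 qed
 thus ?thesis by (simp add: gauss_deriv_def 1)
qed

lemma bil_linear: "bil (%x y. c * f x y + d * g x y) ls = c * bil f ls + d * bil g ls" unfolding bil_def by (simp add: lin_plus lin_scale)

lemma gauss_deriv_linear:
 "gauss_deriv C mu P ls (%a b. c * f a b + d * g a b) (%a. c * m a + d * n a)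
  = c * gauss_deriv C mu P ls f m + d * gauss_deriv C mu P ls g n"
proof -
 have 1: "gmean (%a b. c * f a b + d * g a b) (%a. c * m a + d * n a) ls = (%x. c * gmean f m ls x + d * gmean g n ls x)"
  by (simp add: gmean_def[abs_def] lin_plus lin_scale algebra_simps)
 have 2: "moment_deriv C M P (%a b. c * f a b + d * g a b) (%x. c * m x + d * n x)
   = c * moment_deriv C M P f m + d * moment_deriv C M P g n" for M m n
  unfolding moment_deriv_def by (simp add: ring_distribs sum_mset.distrib mult.assoc flip: sum_mset_distrib_left)
 show ?thesis unfolding gauss_deriv_def 1 2 bil_linear by (simp add: lin_plus lin_scale) (simp add: field_simps)
qed

lemma wirt_gauss:
 assumes s: "!!w. symm (C w)"
  and G: "!!a b. a : set_mset P Un snd ` set ls ==> b : set_mset P Un snd ` set ls ==> smooth (%w. C w a b) x"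
  and M: "!!a. a : set_mset P Un snd ` set ls ==> smooth (%w. m w a) x"
 shows "wirt s L (%w. gauss (C w) (m w) P ls) x =
  gauss_deriv (C x) (m x) P ls (%a b. wirt s L (%w. C w a b) x) (%a. wirt s L (%w. m w a) x)"
proof -
 have sy: "symm (%a b. dd h (%w. C w a b) x)" for h unfolding symm_def
 proof (intro allI)
  fix a b have "(%w. C w a b) = (%w. C w b a)" using s by (auto simp: symm_def)
  thus "dd h (%w. C w a b) x = dd h (%w. C w b a) x" by simp
 qed
 have dd: "dd h (%w. gauss (C w) (m w) P ls) x =
  gauss_deriv (C x) (m x) P ls (%a b. dd h (%w. C w a b) x) (%a. dd h (%w. m w a) x)" for h
  by (rule dd_eq, rule gauss_has_derivative[where C' = "%a b h. dd h (%w. C w a b) x" and m' = "%a h. dd h (%w. m w a) x", OF s sy])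
    (auto intro!: smooth_has_derivative G M)
 have "wirt s L (%w. gauss (C w) (m w) P ls) x = (1/2) * dd (L 1) (%w. gauss (C w) (m w) P ls) x
   + (s/2) * dd (L \<i>) (%w. gauss (C w) (m w) P ls) x" by (simp add: wirt_def field_simps)
 thus ?thesis unfolding dd gauss_deriv_linear[symmetric] by (simp add: wirt_def field_simps)
qed

text \<open>If the variables move infinitesimally in the directions h x, the Gaussian expectation
  changes as formal differentiation predicts: each factor is replaced in turn by its derivative, and
  the exponential brings down the derivative of its exponent.\<close>

lemma gauss_deriv_move:
 assumes s: "symm C"
 shows "gauss_deriv C m P ls (%x y. C (h x) y + C x (h y)) (%x. m (h x)) =
   lin (%p. gauss C m (add_mset (h p) P) ls) ls + (SUM x:#P. gauss C m (add_mset (h x) (P - {#x#})) ls)"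
proof -
 define E where "E = exp (lin m ls + bil C ls / 2)"
 define g where "g = gmean C m ls"
 define H where "H = moment C g"
 have sy: "C x y = C y x" for x y using s by (simp add: symm_def)
 have H: "H (add_mset x M) = g x * H M + (SUM y:#M. C x y * H (M - {#y#}))" for x M unfolding H_def by (rule moment_add[OF s])
 have gs: "gauss C m M ls = E * H M" for M by (simp add: gauss_def E_def H_def g_def)
 let ?dGa = "%x y. C (h x) y + C x (h y)" and ?dmu = "%x. m (h x)"
 have l1: "lin (%p. g (h p)) ls = lin ?dmu ls + bil ?dGa ls / 2"
 proof -
  have "bil ?dGa ls = lin (%p. lin (%q. C (h p) q) ls) ls + lin (%p. lin (%q. C p (h q)) ls) ls" by (simp add: bil_def lin_plus)
  also have "lin (%p. lin (%q. C p (h q)) ls) ls = lin (%p. lin (%q. C (h p) q) ls) ls" by (subst lin_swap) (simp add: sy[of _ "h _"])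
  finally have "bil ?dGa ls = 2 * lin (%p. lin (%q. C (h p) q) ls) ls" by simp
  moreover have "lin (%p. g (h p)) ls = lin ?dmu ls + lin (%p. lin (%q. C (h p) q) ls) ls" by (simp add: g_def gmean_def lin_plus sy[of _ "h _"])
  ultimately show ?thesis by simp
 qed
 have l2: "lin (%p. SUM y:#P. C (h p) y * H (P - {#y#})) ls = (SUM y:#P. lin (%p. C (h p) y) ls * H (P - {#y#}))"
  by (induction ls) (auto simp: sum_mset_distrib_left sum_mset.distrib algebra_simps)
 have gm: "gmean ?dGa ?dmu ls y = g (h y) + lin (%p. C (h p) y) ls" for y by (simp add: gmean_def g_def lin_plus)
 have sw: "(SUM x:#P. SUM y:#P - {#x#}. C x (h y) * H (P - {#x#} - {#y#})) =
   (SUM x:#P. SUM y:#P - {#x#}. C (h x) y * H (P - {#x#} - {#y#}))"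
  by (subst sum_mset_remove_swap') (simp only: sy[of _ "h _"])
 have md: "moment_deriv C g P ?dGa (gmean ?dGa ?dmu ls) = (SUM x:#P. g (h x) * H (P - {#x#})) + (SUM x:#P. lin (%p. C (h p) x) ls * H (P - {#x#})) +
   (SUM x:#P. SUM y:#P - {#x#}. C (h x) y * H (P - {#x#} - {#y#}))"
  unfolding moment_deriv_def H_def[symmetric] gm ring_distribs sum_mset.distrib sw by simp
 have "gauss_deriv C m P ls ?dGa ?dmu = E * (lin (%p. g (h p)) ls * H P + moment_deriv C g P ?dGa (gmean ?dGa ?dmu ls))"
  unfolding gauss_deriv_def l1 E_def[symmetric] g_def[symmetric] H_def[symmetric] ..
 also have "\<dots> = E * (lin (%p. H (add_mset (h p) P)) ls + (SUM x:#P. H (add_mset (h x) (P - {#x#}))))"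
 proof -
  have "lin (%p. H (add_mset (h p) P)) ls = H P * lin (%p. g (h p)) ls + (SUM y:#P. lin (%p. C (h p) y) ls * H (P - {#y#}))"
   unfolding H lin_plus l2 by (simp only: mult.commute[of _ "H P"] lin_scale)
  moreover have "(SUM x:#P. H (add_mset (h x) (P - {#x#}))) = (SUM x:#P. g (h x) * H (P - {#x#})) + (SUM x:#P. SUM y:#P - {#x#}. C (h x) y * H (P - {#x#} - {#y#}))"
   unfolding H sum_mset.distrib ..
  ultimately show ?thesis unfolding md by (simp add: algebra_simps)
 qed
 finally show ?thesis unfolding gs by (simp add: distrib_left lin_scale sum_mset_distrib_left)
qed

definition bump :: "complex => nat * nat => nat * nat" where
 "bump s d = (if s = \<i> then (fst d, Suc (snd d)) else (Suc (fst d), snd d))"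

lemma wirt_jet:
 assumes "smooth f x" "s = \<i> | s = - \<i>"
 shows "wirt s L (jet L d f) x = jet L (bump s d) f x"
 using assms wirt_jet_dz[of L "fst d" "snd d" f x] wirt_jet_dzbar[of f x L "fst d" "snd d"] by (auto simp: bump_def)

lemma wirt_reg_jet:
 assumes "smooth (reg_green p c) w" "s = \<i> | s = - \<i>"
 shows "wirt s in1 (reg_jet p c d e) w = reg_jet p c (bump s d) e w"
  and "wirt s in2 (reg_jet p c d e) w = reg_jet p c d (bump s e) w"
proof -
 show "wirt s in1 (reg_jet p c d e) w = reg_jet p c (bump s d) e w" unfolding reg_jet_def by (rule wirt_jet[OF smooth_jet[OF assms(1)] assms(2)])
 have "near w (%w. wirt s in2 (jet in2 e (reg_green p c)) w = jet in2 (bump s e) (reg_green p c) w)"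
  using smooth_near[OF assms(1)] by eventually_elim (rule wirt_jet[OF _ assms(2)])
 thus "wirt s in2 (reg_jet p c d e) w = reg_jet p c d (bump s e) w" unfolding reg_jet_def by (simp add: jet_wirt_commute smooth_jet assms(1) jet_cong)
qed

abbreviation diag :: "complex => complex * complex" where "diag h \<equiv> (h, h)"

lemma bl_diag: "bounded_linear diag" by (rule bounded_linear_Pair[OF bounded_linear_ident bounded_linear_ident])

lemma smooth_diag:
 fixes f :: "complex * complex => complex"
 assumes "smooth f (u, u)"
 shows "smooth (%u. f (u, u)) u" using smooth_affine[OF assms bl_diag, where b = 0 and x = u] by (simp add: zero_prod_def)

lemma wirt_diag:
 fixes f :: "complex * complex => complex"
 assumes "smooth f (u, u)"
 shows "wirt1 s (%u. f (u, u)) u = wirt s in1 f (u, u) + wirt s in2 f (u, u)"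
proof -
 have "dd (h, h) f (u, u) = dd (h, 0) f (u, u) + dd (0, h) f (u, u)" for h using dd_add_dir[OF assms, of "(h, 0)" "(0, h)"] by simp
 hence "wirt s diag f (u, u) = wirt s in1 f (u, u) + wirt s in2 f (u, u)" by (simp add: wirt_def ring_distribs add_divide_distrib)
 moreover have "wirt1 s (%u. f (u, u)) u = wirt s diag f (u, u)"
  using wirt_affine[OF _ bl_diag, where f = f and x = u and b = 0 and s = s and L = "%h. h"] assms by (simp add: zero_prod_def)
 ultimately show ?thesis by simp
qed

definition mean_jet :: "real => chart => nat * nat => complex => complex" where
 "mean_jet b c d = jet1 d (%u. of_real (- 2 * b * Im (lg c u)))"

lemma smooth_mean:
 assumes "lg c analytic_on {u}"
 shows "smooth (%u. complex_of_real (- 2 * b * Im (lg c u))) u"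
proof -
 have s: "smooth (lg c) u" using smooth.comp[OF smooth_ident, where ph = "lg c" and x = u] assms by simp
 have e: "complex_of_real (- 2 * b * Im w) = of_real b * \<i> * (w - cnj w)" for w by (simp add: complex_eq_iff)
 show ?thesis unfolding e by (intro smooth_scale smooth_diff smooth_cnj s)
qed

lemma smooth_mean_jet: "chart_at c u ==> smooth (mean_jet b c d) u" unfolding mean_jet_def by (intro smooth_jet smooth_mean) (simp add: chart_at_def)

lemma wirt_mean_jet: "chart_at c u ==> s = \<i> | s = - \<i> ==> wirt1 s (mean_jet b c d) u = mean_jet b c (bump s d) u"
 unfolding mean_jet_def by (rule wirt_jet[OF smooth_mean]) (simp_all add: chart_at_def)

section \<open>Two normal-ordered fields near the diagonal\<close>

definition factor_at :: "chart => nat * nat => complex => factor" where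
 "factor_at c d u = Factor (fst d) (snd d) (par c) u"

text \<open>\<open>LA\<close> marks derivatives at the moving point w, \<open>LB\<close> those at
  the fixed point z, \<open>LC\<close> the factors of the test functional. \<open>LZ\<close> is a
  null variable that serves as the w-derivative of everything that does not depend on w.\<close>

datatype label = LA "nat * nat" | LB "nat * nat" | LC factor | LZ

text \<open>Between w and z only the regular part of the covariance is taken, which keeps the matrix
  smooth at w = z; the singular part is \<open>sing_cov\<close>. Averaging over both orders at
  coinciding points makes the matrix symmetric in every chart.\<close>

fun two_cov :: "complex => chart => complex => complex => label => label => complex" where
 "two_cov p c z w (LA d) (LA e) = (reg_jet p c d e (w, w) + reg_jet p c e d (w, w)) / 2"
| "two_cov p c z w (LA d) (LB e) = reg_jet p c d e (w, z)"
| "two_cov p c z w (LB e) (LA d) = reg_jet p c d e (w, z)"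
| "two_cov p c z w (LB d) (LB e) = (reg_jet p c d e (z, z) + reg_jet p c e d (z, z)) / 2"
| "two_cov p c z w (LA d) (LC q) = pair_expectation (factor_at c d w) q"
| "two_cov p c z w (LC q) (LA d) = pair_expectation (factor_at c d w) q"
| "two_cov p c z w (LB d) (LC q) = pair_expectation (factor_at c d z) q"
| "two_cov p c z w (LC q) (LB d) = pair_expectation (factor_at c d z) q"
| "two_cov p c z w _ _ = 0"

fun two_mean :: "real => chart => complex => complex => label => complex" where
 "two_mean b c z w (LA d) = mean_jet b c d w"
| "two_mean b c z w (LB d) = mean_jet b c d z"
| "two_mean b c z w _ = 0"

lemma symm_two_cov: "symm (two_cov p c z w)" unfolding symm_def
proof (intro allI)
 fix x y show "two_cov p c z w x y = two_cov p c z w y x" by (cases x; cases y) (auto simp: add.commute)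
qed

definition near_ok :: "complex => chart => complex => factor multiset => (complex * factor) list => complex => bool" where
 "near_ok p c z Q lq w \<longleftrightarrow> good_chart p c w & smooth (reg_green p c) (w, z) & valid_term (- {par c w}) Q lq"

lemma near_ok_eventually:
 assumes "good_chart p c z" "valid_term (- {par c z}) Q lq"
 shows "near z (%ze. near_ok p c z Q lq ze)"
proof -
 let ?N = "fnode ` (set_mset Q Un snd ` set lq)"
 have N: "valid_term S Q lq" if "?N <= S" for S
 proof -
  have "valid_factor S q" if "q : set_mset Q Un snd ` set lq" for q
  proof -
   have "valid_factor (- {par c z}) q" using assms(2) that unfolding valid_term_def by blast
   moreover have "fnode q : S" using \<open>?N <= S\<close> that by blast
   ultimately show ?thesis by (cases q) auto
  qed
  thus ?thesis using assms(2) by (auto simp: valid_term_def)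
 qed
 have "par c z ~: ?N"
 proof
  assume "par c z : ?N"
  then obtain q where q: "q : set_mset Q Un snd ` set lq" "fnode q = par c z" by (metis imageE)
  hence "valid_factor (- {par c z}) q" using assms(2) unfolding valid_term_def by blast
  thus False using valid_factor_node q(2) by fastforce
 qed
 hence nN: "par c z : - ?N" by blast
 have "isCont (par c) z" using assms(1) by (auto simp: good_chart_def chart_at_def analytic_at_imp_isCont)
 hence "near z (%ze. par c ze : - ?N)" using near_isCont[where f = "par c" and x = z and P = "%w. w : - ?N"]
   eventually_nhds_in_open[OF _ nN] by (auto intro!: open_Compl finite_imp_closed)
 moreover have "near z (%ze. smooth (reg_green p c) (ze, z))" by (rule eventually_slice1[OF smooth_near[OF good_smooth_reg_green[OF assms(1)]]])
 ultimately show ?thesis using good_chart_eventually[OF assms(1)]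
 proof eventually_elim
  case (elim ze)
  have "?N <= - {par c ze}" using elim(1) by blast
  from N[OF this] show ?case using elim by (simp add: near_ok_def)
 qed
qed

definition two_labels :: "(nat * nat) multiset => (nat * nat) multiset => factor multiset => label multiset" where
 "two_labels D E Q = image_mset LA D + image_mset LB E + image_mset LC Q"

definition two_exps :: "complex => complex => (complex * factor) list => (complex \<times> label) list" where
 "two_exps al b lq = (al, LA (0, 0)) # (b, LB (0, 0)) # map (map_prod id LC) lq"

text \<open>A stand-in, smooth at w = z, for the correlation of normal-ordered fields at w and z:
  their mutual singular covariance is left out. Expansions are obtained from Taylor expansions of
  such functions.\<close>

definition two_point where
 "two_point b p c z Q lq al D bt E w = gauss (two_cov p c z w) (two_mean b c z w) (two_labels D E Q) (two_exps al bt lq)"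

fun bump_label :: "complex => label => label" where
 "bump_label s (LA d) = LA (bump s d)"
| "bump_label s _ = LZ"

lemma gauss_LZ: "gauss (two_cov p c z w) (two_mean b c z w) (add_mset LZ M) ls = 0"
proof -
 have z: "two_cov p c z w LZ x = 0" "two_cov p c z w x LZ = 0" for x by (cases x; simp)+
 show ?thesis by (simp add: gauss_def moment_add[OF symm_two_cov] gmean_def z)
qed

lemma two_cov_smooth:
 assumes ok: "near_ok p c z Q lq ze" and s: "s = \<i> | s = - \<i>"
  and x: "x : set_mset (two_labels D E Q) Un snd ` set (two_exps al bt lq)" and y: "y : set_mset (two_labels D E Q) Un snd ` set (two_exps al bt lq)"
 shows "smooth (%ze. two_cov p c z ze x y) ze"
  and "wirt1 s (%ze. two_cov p c z ze x y) ze = two_cov p c z ze (bump_label s x) y + two_cov p c z ze x (bump_label s y)"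
  and "smooth (%ze. two_mean b c z ze x) ze"
  and "wirt1 s (%ze. two_mean b c z ze x) ze = two_mean b c z ze (bump_label s x)"
proof -
 have g: "good_chart p c ze" "chart_at c ze" and sg: "smooth (reg_green p c) (ze, ze)" "smooth (reg_green p c) (ze, z)"
  and v: "valid_term (- {par c ze}) Q lq" using ok good_smooth_reg_green by (auto simp: near_ok_def good_chart_def)
 have sj: "smooth (reg_jet p c d e) (ze, ze)" "smooth (reg_jet p c d e) (ze, z)" for d e unfolding reg_jet_def using sg by (auto intro: smooth_jet)
 have q: "valid_factor (- {par c ze}) q" if "LC q : set_mset (two_labels D E Q) Un snd ` set (two_exps al bt lq)" for q
 proof -
  have "q : set_mset Q Un snd ` set lq" using that by (force simp: two_labels_def two_exps_def)
  thus ?thesis using v unfolding valid_term_def by blast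
 qed
 have pq: "smooth (%ze. pair_expectation (factor_at c d ze) q) ze"
   "wirt1 s (%ze. pair_expectation (factor_at c d ze) q) ze = pair_expectation (factor_at c (bump s d) ze) q"
  if "valid_factor (- {par c ze}) q" for q d
 proof -
  have "par c analytic_on {ze}" "Im (par c ze) > 0" using g by (auto simp: chart_at_def)
  moreover have "par c ze ~= fnode q" using valid_factor_node[OF that] by auto
  ultimately show "smooth (%ze. pair_expectation (factor_at c d ze) q) ze"
   "wirt1 s (%ze. pair_expectation (factor_at c d ze) q) ze = pair_expectation (factor_at c (bump s d) ze) q"
   using pair_expectation_smooth[of "par c" ze _ q] that s by (auto simp: factor_at_def bump_def dz_wirt dzbar_wirt simp del: pair_expectation.simps)
 qed
 have aa: "smooth (%ze. (reg_jet p c d e (ze, ze) + reg_jet p c e d (ze, ze)) / 2) ze"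
   "wirt1 s (%ze. (reg_jet p c d e (ze, ze) + reg_jet p c e d (ze, ze)) / 2) ze =
   (reg_jet p c (bump s d) e (ze, ze) + reg_jet p c e (bump s d) (ze, ze)) / 2 + (reg_jet p c d (bump s e) (ze, ze) + reg_jet p c (bump s e) d (ze, ze)) / 2" for d e
 proof -
  have sd: "smooth (%ze. reg_jet p c d e (ze, ze)) ze" for d e by (rule smooth_diag[OF sj(1)])
  have w: "wirt1 s (%ze. reg_jet p c d e (ze, ze)) ze = reg_jet p c (bump s d) e (ze, ze) + reg_jet p c d (bump s e) (ze, ze)" for d e
   by (simp add: wirt_diag[OF sj(1)] wirt_reg_jet[OF sg(1) s])
  have e: "(%ze. (reg_jet p c d e (ze, ze) + reg_jet p c e d (ze, ze)) / 2) = (%ze. (1/2) * (reg_jet p c d e (ze, ze) + reg_jet p c e d (ze, ze)))" by auto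
  show "smooth (%ze. (reg_jet p c d e (ze, ze) + reg_jet p c e d (ze, ze)) / 2) ze" unfolding e by (intro smooth_scale smooth.add sd)
  show "wirt1 s (%ze. (reg_jet p c d e (ze, ze) + reg_jet p c e d (ze, ze)) / 2) ze =
   (reg_jet p c (bump s d) e (ze, ze) + reg_jet p c e (bump s d) (ze, ze)) / 2 + (reg_jet p c d (bump s e) (ze, ze) + reg_jet p c (bump s e) d (ze, ze)) / 2"
   unfolding e wirt_scale[OF smooth.add[OF sd sd]] wirt_add[OF sd sd] w by (simp add: add_divide_distrib)
 qed
 have ab: "smooth (%ze. reg_jet p c d e (ze, z)) ze" "wirt1 s (%ze. reg_jet p c d e (ze, z)) ze = reg_jet p c (bump s d) e (ze, z)" for d e
  using smooth_slice1[OF sj(2)] wirt_slice1[OF sj(2)] wirt_reg_jet(1)[OF sg(2) s] by auto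
 show "smooth (%ze. two_cov p c z ze x y) ze" by (cases x; cases y) (use q pq(1) aa(1) ab(1) x y in \<open>simp_all add: smooth.const\<close>)
 show "wirt1 s (%ze. two_cov p c z ze x y) ze = two_cov p c z ze (bump_label s x) y + two_cov p c z ze x (bump_label s y)"
  by (cases x; cases y) (use q pq(2) aa(2) ab(2) x y in simp_all)
 show "smooth (%ze. two_mean b c z ze x) ze" using smooth_mean_jet[OF g(2)] by (cases x) (auto simp: smooth.const)
 show "wirt1 s (%ze. two_mean b c z ze x) ze = two_mean b c z ze (bump_label s x)" using wirt_mean_jet[OF g(2) s] by (cases x) auto
qed

lemma two_point_smooth:
 assumes ok: "near_ok p c z Q lq w"
 shows "smooth (two_point b p c z Q lq al D bt E) w"
 unfolding two_point_def[abs_def] by (rule smooth_gauss[OF symm_two_cov]) (use two_cov_smooth[OF ok, of \<i>] in auto)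

text \<open>Derivatives stay within the same kind of function, with coefficients built from al and
  multiplicities only. This is the source of the chart independence of OPE coefficients.\<close>

lemma two_point_wirt:
 assumes ok: "near_ok p c z Q lq w" and s: "s = \<i> | s = - \<i>"
 shows "wirt1 s (two_point b p c z Q lq al D bt E) w =
  al * two_point b p c z Q lq al (add_mset (bump s (0, 0)) D) bt E w +
  (SUM d:#D. two_point b p c z Q lq al (add_mset (bump s d) (D - {#d#})) bt E w)"
proof -
 let ?P = "two_labels D E Q" and ?l = "two_exps al bt lq" and ?G = "two_cov p c z w" and ?m = "two_mean b c z w" and ?d = "bump_label s"
 have "wirt1 s (two_point b p c z Q lq al D bt E) w =
   gauss_deriv ?G ?m ?P ?l (%x y. wirt1 s (%w. two_cov p c z w x y) w) (%x. wirt1 s (%w. two_mean b c z w x) w)"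
  unfolding two_point_def[abs_def] by (rule wirt_gauss[OF symm_two_cov]) (use two_cov_smooth[OF ok s] in auto)
 also have "\<dots> = gauss_deriv ?G ?m ?P ?l (%x y. ?G (?d x) y + ?G x (?d y)) (%x. ?m (?d x))"
  by (rule gauss_deriv_cong) (use two_cov_smooth[OF ok s] in auto)
 also have "\<dots> = lin (%x. gauss ?G ?m (add_mset (?d x) ?P) ?l) ?l + (SUM x:#?P. gauss ?G ?m (add_mset (?d x) (?P - {#x#})) ?l)"
  by (rule gauss_deriv_move[OF symm_two_cov])
 also have "lin (%x. gauss ?G ?m (add_mset (?d x) ?P) ?l) ?l = al * two_point b p c z Q lq al (add_mset (bump s (0, 0)) D) bt E w"
 proof -
  have "lin f (map (map_prod id LC) lq) = 0" if "!!q. f (LC q) = 0" for f using that by (simp add: lin_map)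
  thus ?thesis by (subst (2) two_exps_def) (simp add: gauss_LZ two_point_def two_labels_def)
 qed
 also have "(SUM x:#?P. gauss ?G ?m (add_mset (?d x) (?P - {#x#})) ?l) =
  (SUM d:#D. two_point b p c z Q lq al (add_mset (bump s d) (D - {#d#})) bt E w)"
 proof -
  have "(SUM x:#?P. gauss ?G ?m (add_mset (?d x) (?P - {#x#})) ?l) = (SUM d:#D. gauss ?G ?m (add_mset (LA (bump s d)) (?P - {#LA d#})) ?l)"
   by (simp add: two_labels_def gauss_LZ image_mset.compositionality comp_def)
  also have "\<dots> = (SUM d:#D. two_point b p c z Q lq al (add_mset (bump s d) (D - {#d#})) bt E w)"
  proof (intro sum_mset_cong)
   fix d assume "d :# D"
   hence "?P - {#LA d#} = two_labels (D - {#d#}) E Q" by (auto simp: two_labels_def image_mset_Diff dest!: multi_member_split)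
   thus "gauss ?G ?m (add_mset (LA (bump s d)) (?P - {#LA d#})) ?l = two_point b p c z Q lq al (add_mset (bump s d) (D - {#d#})) bt E w"
    by (simp add: two_point_def two_labels_def)
  qed
  finally show ?thesis .
 qed
 finally show ?thesis .
qed

fun self_cov :: "complex => chart => complex => factor => factor => complex" where
 "self_cov p c z (Factor j k h u) (Factor l m g v) =
   (reg_jet p c (j, k) (l, m) (z, z) + reg_jet p c (l, m) (j, k) (z, z)) / 2"

fun self_mean :: "real => chart => complex => factor => complex" where
 "self_mean b c z (Factor j k h u) = mean_jet b c (j, k) z"

definition normal_slot :: "real => complex => (nat * nat) multiset => complex => chart => complex => slot" where
 "normal_slot b al D p c z = \<lparr>s_cov = self_cov p c z, s_mean = self_mean b c z,
   s_poly = image_mset (%d. factor_at c d z) D, s_exp = [(al, factor_at c (0, 0) z)]\<rparr>"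

text \<open>The product of the derivatives D of the modified free field and of its exponential,
 normal ordered in the chart c: only the singular part \<open>- 2 ln |u - v|\<close> of the covariance, taken
 in the coordinate, is subtracted.\<close>

definition normal_field :: "real => complex => (nat * nat) multiset => complex => chart => complex => functional" where
 "normal_field b al D p c z = slot_fun (normal_slot b al D p c z)"

lemma symm_self_cov: "symm (self_cov p c z)" unfolding symm_def
proof (intro allI)
 fix x y show "self_cov p c z x y = self_cov p c z y x" by (cases x; cases y) (simp add: add.commute)
qed

lemma normal_field_in_span:
 assumes "chart_at c z"
 shows "normal_field b al D p c z : wick_span {par c z}" unfolding normal_field_def normal_slot_def slot_fun_def slot.simps
 using assms chart_at_deriv[OF assms] by (intro reg_term_in_span[OF symm_self_cov]) (auto simp: valid_term_def factor_at_def chart_at_def)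

fun sing_cov :: "complex => complex => label => label => complex" where
 "sing_cov z w (LA d) (LB e) = log_jet d e (w, z)"
| "sing_cov z w (LB e) (LA d) = log_jet d e (w, z)"
| "sing_cov z w _ _ = 0"

lemma symm_sing_cov: "symm (sing_cov z w)" unfolding symm_def
proof (intro allI)
 fix x y show "sing_cov z w x y = sing_cov z w y x" by (cases x; cases y) auto
qed

lemma symm_add: "symm f ==> symm g ==> symm (%x y. f x y + g x y)" by (simp add: symm_def)

lemma corr_normal_two:
 assumes split: "!!j k l m. pair_expectation (Factor j k (par c) w) (Factor l m (par c) z)
   = reg_jet p c (j, k) (l, m) (w, z) + log_jet (j, k) (l, m) (w, z)"
 shows "corr [normal_field b al D p c w, normal_field b bt E p c z, wick_term Q lq]
  = gauss (%x y. two_cov p c z w x y + sing_cov z w x y) (two_mean b c z w) (two_labels D E Q) (two_exps al bt lq)"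
proof -
 define ss where "ss = [normal_slot b al D p c w, normal_slot b bt E p c z, trivial_slot (Q, lq)]"
 define f where "f x = (case x of LA d => (0::nat, factor_at c d w) | LB d => (1, factor_at c d z) | LC q => (2, q) | LZ => (3, undefined))" for x
 have sy: "symm (s_cov s)" if "s : set ss" for s using that by (auto simp: ss_def normal_slot_def symm_self_cov)
 have cs: "corr (map slot_fun ss) = gauss (slot_cov ss) (slot_mean ss) (tags (map s_poly ss)) (tagged_exps (map s_exp ss))"
  by (rule corr_slots) (rule sy)
 have ssy: "symm (slot_cov ss)" by (rule symm_slot_cov) (rule sy)
 have "map slot_fun ss = [normal_field b al D p c w, normal_field b bt E p c z, wick_term Q lq]"
  by (simp add: ss_def normal_field_def slot_fun_trivial)
 hence "corr [normal_field b al D p c w, normal_field b bt E p c z, wick_term Q lq] =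
   gauss (slot_cov ss) (slot_mean ss) (tags (map s_poly ss)) (tagged_exps (map s_exp ss))" using cs by simp
 also have "tags (map s_poly ss) = image_mset f (two_labels D E Q)"
  by (simp add: ss_def tags_def two_labels_def f_def normal_slot_def image_mset.compositionality comp_def numeral_3_eq_3 numeral_2_eq_2)
 also have "tagged_exps (map s_exp ss) = map (map_prod id f) (two_exps al bt lq)"
  by (simp add: ss_def tagged_exps_def two_exps_def f_def normal_slot_def comp_def map_prod_def case_prod_beta numeral_2_eq_2)
 also have "gauss (slot_cov ss) (slot_mean ss) (image_mset f (two_labels D E Q)) (map (map_prod id f) (two_exps al bt lq)) =
   gauss (%x y. slot_cov ss (f x) (f y)) (%x. slot_mean ss (f x)) (two_labels D E Q) (two_exps al bt lq)" by (rule gauss_image[OF ssy])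
 also have "\<dots> = gauss (%x y. two_cov p c z w x y + sing_cov z w x y) (two_mean b c z w) (two_labels D E Q) (two_exps al bt lq)"
 proof (rule gauss_cong)
  show "symm (%x y. slot_cov ss (f x) (f y))" using ssy unfolding symm_def by blast
  show "symm (%x y. two_cov p c z w x y + sing_cov z w x y)" by (intro symm_add symm_two_cov symm_sing_cov)
  have nz: "x ~= LZ" if "x : set_mset (two_labels D E Q) Un snd ` set (two_exps al bt lq)" for x
   using that by (auto simp: two_labels_def two_exps_def)
  show "slot_cov ss (f x) (f y) = two_cov p c z w x y + sing_cov z w x y"
   if "x : set_mset (two_labels D E Q) Un snd ` set (two_exps al bt lq)" "y : set_mset (two_labels D E Q) Un snd ` set (two_exps al bt lq)" for x y
   using nz[OF that(1)] nz[OF that(2)] by (cases x; cases y) (auto simp: f_def ss_def normal_slot_def factor_at_def split nth_Cons' simp del: pair_expectation.simps)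
  show "slot_mean ss (f x) = two_mean b c z w x" if "x : set_mset (two_labels D E Q) Un snd ` set (two_exps al bt lq)" for x
   using nz[OF that] by (cases x) (auto simp: f_def ss_def normal_slot_def factor_at_def nth_Cons')
 qed
 finally show ?thesis .
qed

lemma gauss_zero_exp: "gauss C m P ((al, x) # (0, y) # ls) = gauss C m P ((al, x) # ls)" by (simp add: gauss_def bil_def gmean_def[abs_def])

text \<open>With the empty field at the second point, one-point correlations become instances of
  \<open>two_point\<close>, so that its derivative formulas apply to them.\<close>

lemma corr_normal_one:
 "corr [normal_field b al D p c w, wick_term Q lq] = two_point b p c z Q lq al D 0 {#} w"
proof -
 define ss where "ss = [normal_slot b al D p c w, trivial_slot (Q, lq)]"
 define f where "f x = (case x of LA d => (0::nat, factor_at c d w) | LB d => (2, undefined) | LC q => (1, q) | LZ => (3, undefined))" for x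
 define ls where "ls = (al, LA (0, 0)) # map (map_prod id LC) lq"
 have sy: "symm (s_cov s)" if "s : set ss" for s using that by (auto simp: ss_def normal_slot_def symm_self_cov)
 have cs: "corr (map slot_fun ss) = gauss (slot_cov ss) (slot_mean ss) (tags (map s_poly ss)) (tagged_exps (map s_exp ss))"
  by (rule corr_slots) (rule sy)
 have ssy: "symm (slot_cov ss)" by (rule symm_slot_cov) (rule sy)
 have "map slot_fun ss = [normal_field b al D p c w, wick_term Q lq]" by (simp add: ss_def normal_field_def slot_fun_trivial)
 hence "corr [normal_field b al D p c w, wick_term Q lq] =
   gauss (slot_cov ss) (slot_mean ss) (tags (map s_poly ss)) (tagged_exps (map s_exp ss))" using cs by simp
 also have "tags (map s_poly ss) = image_mset f (two_labels D {#} Q)"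
  by (simp add: ss_def tags_def two_labels_def f_def normal_slot_def image_mset.compositionality comp_def numeral_2_eq_2)
 also have "tagged_exps (map s_exp ss) = map (map_prod id f) ls"
  by (simp add: ss_def tagged_exps_def ls_def f_def normal_slot_def comp_def map_prod_def case_prod_beta)
 also have "gauss (slot_cov ss) (slot_mean ss) (image_mset f (two_labels D {#} Q)) (map (map_prod id f) ls) =
   gauss (%x y. slot_cov ss (f x) (f y)) (%x. slot_mean ss (f x)) (two_labels D {#} Q) ls" by (rule gauss_image[OF ssy])
 also have "\<dots> = gauss (two_cov p c z w) (two_mean b c z w) (two_labels D {#} Q) ls"
 proof (rule gauss_cong)
  show "symm (%x y. slot_cov ss (f x) (f y))" using ssy unfolding symm_def by blast
  show "symm (two_cov p c z w)" by (rule symm_two_cov)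
  have nz: "(EX d. x = LA d) | (EX q. x = LC q)" if "x : set_mset (two_labels D {#} Q) Un snd ` set ls" for x
   using that by (auto simp: two_labels_def ls_def)
  show "slot_cov ss (f x) (f y) = two_cov p c z w x y"
   if "x : set_mset (two_labels D {#} Q) Un snd ` set ls" "y : set_mset (two_labels D {#} Q) Un snd ` set ls" for x y
   using nz[OF that(1)] nz[OF that(2)] by (auto simp: f_def ss_def normal_slot_def factor_at_def nth_Cons' simp del: pair_expectation.simps)
  show "slot_mean ss (f x) = two_mean b c z w x" if "x : set_mset (two_labels D {#} Q) Un snd ` set ls" for x
   using nz[OF that] by (auto simp: f_def ss_def normal_slot_def factor_at_def nth_Cons')
 qed
 also have "\<dots> = two_point b p c z Q lq al D 0 {#} w" by (simp add: two_point_def two_exps_def gauss_zero_exp ls_def)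
 finally show ?thesis .
qed

lemma gauss_merge_exp: "gauss C m P ((al, x) # (b, x) # ls) = gauss C m P ((al + b, x) # ls)"
 by (simp add: gauss_def bil_def gmean_def[abs_def] algebra_simps)

text \<open>On the diagonal the labels \<open>LA\<close> and \<open>LB\<close> have equal
  covariances, by \<open>reg_jet_commute\<close>, and may be identified. Exponents and derivatives
  then merge into those of a single normal-ordered field.\<close>

lemma two_point_diag:
 assumes "good_chart p c z"
 shows "two_point b p c z Q lq al D bt E z = two_point b p c z Q lq (al + bt) (D + E) 0 {#} z"
proof -
 define g where "g x = (case x of LB d => LA d | _ => x)" for x
 let ?G = "two_cov p c z z" and ?m = "two_mean b c z z"
 have G: "(%x y. ?G (g x) (g y)) = ?G"
 proof (intro ext)
  fix x y show "?G (g x) (g y) = ?G x y" using reg_jet_commute[OF assms] by (cases x; cases y) (auto simp: g_def)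
 qed
 have m: "(%x. ?m (g x)) = ?m" by (auto simp: fun_eq_iff g_def split: label.split)
 have "two_point b p c z Q lq al D bt E z = gauss ?G ?m (image_mset g (two_labels D E Q)) (map (map_prod id g) (two_exps al bt lq))"
  unfolding two_point_def gauss_image[OF symm_two_cov] G m ..
 also have "image_mset g (two_labels D E Q) = two_labels (D + E) {#} Q" by (simp add: two_labels_def g_def image_mset.compositionality comp_def)
 also have "map (map_prod id g) (two_exps al bt lq) = (al, LA (0, 0)) # (bt, LA (0, 0)) # map (map_prod id LC) lq"
  by (simp add: two_exps_def g_def comp_def map_prod_def case_prod_beta)
 also have "gauss ?G ?m (two_labels (D + E) {#} Q) \<dots> = two_point b p c z Q lq (al + bt) (D + E) 0 {#} z"
  by (simp add: two_point_def two_exps_def gauss_zero_exp gauss_merge_exp)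
 finally show ?thesis .
qed

text \<open>\<open>gauss_contract\<close> read backwards with the singular covariance as the second
  family. What remains is a power of |w - z| and a finite sum of singular coefficients times
  functions that are smooth at w = z.\<close>

lemma corr_normal_two_contract:
 assumes "!!j k l m. pair_expectation (Factor j k (par c) w) (Factor l m (par c) z)
   = reg_jet p c (j, k) (l, m) (w, z) + log_jet (j, k) (l, m) (w, z)"
 shows "corr [normal_field b al D p c w, normal_field b bt E p c z, wick_term Q lq] =
  exp (al * bt * log_jet (0, 0) (0, 0) (w, z)) *
   contract (sing_cov z w) (%x. al * sing_cov z w (LA (0, 0)) x + bt * sing_cov z w (LB (0, 0)) x)
    (image_mset LA D + image_mset LB E)
    (%M. gauss (two_cov p c z w) (two_mean b c z w) (M + image_mset LC Q) (two_exps al bt lq))"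
proof -
 let ?l2 = "[(al, LA (0, 0)), (bt, LB (0, 0))]"
 have e: "two_exps al bt lq = ?l2 @ map (map_prod id LC) lq" by (simp add: two_exps_def)
 have s: "sing_cov z w x y = 0" if "y : set_mset (image_mset LC Q) Un snd ` set (map (map_prod id LC) lq)" for x y using that by (cases x) auto
 have "exp (lin (%_. 0) ?l2 + bil (sing_cov z w) ?l2 / 2) *
   contract (sing_cov z w) (gmean (sing_cov z w) (%_. 0) ?l2) (image_mset LA D + image_mset LB E)
    (%M. gauss (two_cov p c z w) (two_mean b c z w) (M + image_mset LC Q) (?l2 @ map (map_prod id LC) lq))
  = gauss (%x y. two_cov p c z w x y + sing_cov z w x y) (%x. two_mean b c z w x + 0) (image_mset LA D + image_mset LB E + image_mset LC Q) (?l2 @ map (map_prod id LC) lq)"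
  by (rule gauss_contract[OF symm_two_cov symm_sing_cov s]) auto
 thus ?thesis unfolding corr_normal_two[OF assms] e[symmetric] two_labels_def by (simp add: bil_def gmean_def[abs_def] mult_ac)
qed

lemma dd_wirt_decomp:
 assumes "smooth f x"
 shows "dd h f x = wirt1 (- \<i>) f x * h + wirt1 \<i> f x * cnj h"
proof -
 have "dd h f x = of_real (Re h) * dd 1 f x + of_real (Im h) * dd \<i> f x"
 proof -
  have "h = Re h *\<^sub>R 1 + Im h *\<^sub>R \<i>" by (simp add: complex_eq_iff)
  hence "dd h f x = dd (Re h *\<^sub>R 1 + Im h *\<^sub>R \<i>) f x" by simp
  thus ?thesis using assms by (simp only: dd_add_dir dd_scale_dir)
 qed
 moreover have "h = of_real (Re h) + \<i> * of_real (Im h)" "cnj h = of_real (Re h) - \<i> * of_real (Im h)" by (simp_all add: complex_eq_iff)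
 moreover have "wirt1 (- \<i>) f x * (r + \<i> * m) + wirt1 \<i> f x * (r - \<i> * m) = r * dd 1 f x + m * dd \<i> f x" for r m
  by (simp add: wirt_def field_simps)
 ultimately show ?thesis by metis
qed

section \<open>Operator product expansions\<close>

definition taylor_poly :: "nat => (complex => complex) => complex => complex => complex" where
 "taylor_poly N f z x = (SUM j<=N. SUM k<=N - j. jet1 (j, k) f z / (fact j * fact k) * x ^ j * cnj x ^ k)"

lemma smooth_sum: "finite I ==> (!!i. i : I ==> smooth (f i) x) ==> smooth (%y. SUM i:I. f i y) x"
 by (induction I rule: finite_induct) (auto intro: smooth.const smooth.add)

lemma wirt_sum: "finite I ==> (!!i. i : I ==> smooth (f i) x) ==> wirt s L (%y. SUM i:I. f i y) x = (SUM i:I. wirt s L (f i) x)"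
 by (induction I rule: finite_induct) (auto simp: wirt_add smooth_sum)

lemma wirt_monomial:
 "wirt1 s (%ze. a * (ze - z) ^ j * cnj (ze - z) ^ k) ze =
  a * (((1 + s * \<i>) / 2) * of_nat j * (ze - z) ^ (j - 1) * cnj (ze - z) ^ k + ((1 - s * \<i>) / 2) * of_nat k * (ze - z) ^ j * cnj (ze - z) ^ (k - 1))"
 and smooth_monomial: "smooth (%ze. a * (ze - z) ^ j * cnj (ze - z) ^ k) ze"
proof -
 have sm: "smooth (%ze. (ze - z) ^ j) ze" "smooth (%ze. cnj (ze - z) ^ k) ze"
  "smooth (%ze. ze - z) ze" "smooth (%ze. cnj (ze - z)) ze" by (intro smooth_power smooth_cnj smooth_diff smooth_ident smooth.const)+
 show "smooth (%ze. a * (ze - z) ^ j * cnj (ze - z) ^ k) ze" by (intro smooth.mult smooth.const sm)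
 have pw: "deriv (%w::complex. w ^ n) y = of_nat n * y ^ (n - 1)" "(%w::complex. w ^ n) analytic_on {y}" for n y
  by (auto intro!: DERIV_imp_deriv derivative_eq_intros analytic_intros)
 have d: "dd h (%ze. ze - z) ze = h" "dd h (%ze. cnj (ze - z)) ze = cnj h" for h by (rule dd_eq, auto intro!: derivative_eq_intros)+
 have w: "wirt1 s (%ze. ze - z) ze = (1 + s * \<i>) / 2" "wirt1 s (%ze. cnj (ze - z)) ze = (1 - s * \<i>) / 2"
  by (simp_all only: wirt_def d) (simp_all)
 have 1: "wirt1 s (%ze. (ze - z) ^ j) ze = of_nat j * (ze - z) ^ (j - 1) * ((1 + s * \<i>) / 2)"
  using wirt_comp[OF sm(3) pw(2), of s "%h. h" j] unfolding pw w .
 have 2: "wirt1 s (%ze. cnj (ze - z) ^ k) ze = of_nat k * cnj (ze - z) ^ (k - 1) * ((1 - s * \<i>) / 2)"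
  using wirt_comp[OF sm(4) pw(2), of s "%h. h" k] unfolding pw w .
 show "wirt1 s (%ze. a * (ze - z) ^ j * cnj (ze - z) ^ k) ze =
  a * (((1 + s * \<i>) / 2) * of_nat j * (ze - z) ^ (j - 1) * cnj (ze - z) ^ k + ((1 - s * \<i>) / 2) * of_nat k * (ze - z) ^ j * cnj (ze - z) ^ (k - 1))"
  unfolding mult.assoc[of a] wirt_scale[OF smooth.mult[OF sm(1,2)]] wirt_mult[OF sm(1,2)] 1 2 by (simp add: mult_ac add.commute)
qed

lemma smooth_taylor_poly: "smooth (%w. taylor_poly N f z (w - z)) w" unfolding taylor_poly_def by (intro smooth_sum finite_atMost smooth_monomial)

lemma fact_cancel:
 fixes A B C :: complex
 shows "A / (fact j * fact (Suc k)) * (of_nat (Suc k) * B * C) = A / (fact j * fact k) * B * C"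
  and "A / (fact (Suc j) * fact k) * (of_nat (Suc j) * B * C) = A / (fact j * fact k) * B * C"
proof -
 have 1: "A / (p * (n * q)) * (n * B * C) = A / (p * q) * B * C" "A / (n * p * q) * (n * B * C) = A / (p * q) * B * C" if "n ~= 0" for n p q :: complex
  using that by simp_all
 show "A / (fact j * fact (Suc k)) * (of_nat (Suc k) * B * C) = A / (fact j * fact k) * B * C"
  "A / (fact (Suc j) * fact k) * (of_nat (Suc j) * B * C) = A / (fact j * fact k) * B * C" unfolding fact_Suc by (rule 1, simp del: of_nat_Suc)+
qed

lemma wirt_taylor_poly:
 assumes "smooth f z" "s = \<i> | s = - \<i>"
 shows "wirt1 s (%ze. taylor_poly (Suc N) f z (ze - z)) ze = taylor_poly N (wirt1 s f) z (ze - z)"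
proof -
 let ?x = "ze - z" and ?J = "%j k. jet1 (j, k) f z"
 have w: "wirt1 s (%ze. taylor_poly (Suc N) f z (ze - z)) ze = (SUM j<=Suc N. SUM k<=Suc N - j.
   ?J j k / (fact j * fact k) * (((1 + s * \<i>) / 2) * of_nat j * ?x ^ (j - 1) * cnj ?x ^ k + ((1 - s * \<i>) / 2) * of_nat k * ?x ^ j * cnj ?x ^ (k - 1)))"
  unfolding taylor_poly_def by (simp only: wirt_sum smooth_sum finite_atMost smooth_monomial wirt_monomial)
 show ?thesis
 proof (cases "s = \<i>")
  case True
  have J: "jet1 (j, k) (wirt1 s f) z = ?J j (Suc k)" for j k
   using wirt_jet[OF assms, of "%h. h" "(j, k)"] jet_wirt_commute[OF assms(1), of s "%h. h" "%h. h" "(j, k)"] True by (simp add: bump_def)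
  have inner: "(SUM k<=Suc N - j. ?J j k / (fact j * fact k) * (of_nat k * ?x ^ j * cnj ?x ^ (k - 1))) =
    (SUM k<=N - j. ?J j (Suc k) / (fact j * fact k) * ?x ^ j * cnj ?x ^ k)" if "j <= N" for j
  proof -
   have "(SUM k<=Suc (N - j). ?J j k / (fact j * fact k) * (of_nat k * ?x ^ j * cnj ?x ^ (k - 1))) =
    (SUM k<=N - j. ?J j (Suc k) / (fact j * fact (Suc k)) * (of_nat (Suc k) * ?x ^ j * cnj ?x ^ k))"
    by (subst sum.atMost_Suc_shift) simp
   also have "\<dots> = (SUM k<=N - j. ?J j (Suc k) / (fact j * fact k) * ?x ^ j * cnj ?x ^ k)" by (intro sum.cong refl fact_cancel(1))
   finally show ?thesis using that by (simp add: Suc_diff_le)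
  qed
  have "wirt1 s (%ze. taylor_poly (Suc N) f z (ze - z)) ze =
    (SUM j<=Suc N. SUM k<=Suc N - j. ?J j k / (fact j * fact k) * (of_nat k * ?x ^ j * cnj ?x ^ (k - 1)))"
   unfolding w using True by simp
  also have "\<dots> = (SUM j<=N. SUM k<=Suc N - j. ?J j k / (fact j * fact k) * (of_nat k * ?x ^ j * cnj ?x ^ (k - 1)))"
   by (simp only: sum.atMost_Suc) simp
  also have "\<dots> = taylor_poly N (wirt1 s f) z ?x" unfolding taylor_poly_def J by (intro sum.cong refl inner) simp
  finally show ?thesis .
 next
  case False
  hence s: "s = - \<i>" using assms by simp
  have J: "jet1 (j, k) (wirt1 s f) z = ?J (Suc j) k" for j k
   using wirt_jet[OF assms, of "%h. h" "(j, k)"] jet_wirt_commute[OF assms(1), of s "%h. h" "%h. h" "(j, k)"] False by (simp add: bump_def)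
  have "(SUM j<=Suc N. SUM k<=Suc N - j. ?J j k / (fact j * fact k) * (of_nat j * ?x ^ (j - 1) * cnj ?x ^ k)) =
    (SUM j<=N. SUM k<=N - j. ?J (Suc j) k / (fact (Suc j) * fact k) * (of_nat (Suc j) * ?x ^ j * cnj ?x ^ k))"
   by (subst sum.atMost_Suc_shift) simp
  also have "\<dots> = (SUM j<=N. SUM k<=N - j. ?J (Suc j) k / (fact j * fact k) * ?x ^ j * cnj ?x ^ k)" by (intro sum.cong refl fact_cancel(2))
  also have "\<dots> = taylor_poly N (wirt1 s f) z ?x" unfolding taylor_poly_def J ..
  finally show ?thesis unfolding w using s by simp
 qed
qed

text \<open>Both Wirtinger derivatives of the remainder of order N + 1 are remainders of order N, of
  the derivatives of f. The mean value inequality on a disc then gains one power of the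
  radius.\<close>

lemma taylor_remainder:
 assumes "smooth f z"
 shows "((%ze. (f ze - taylor_poly N f z (ze - z)) / of_real (cmod (ze - z) ^ N)) \<longlongrightarrow> 0) (at z)" using assms
proof (induction N arbitrary: f)
 case 0
 have "(f \<longlongrightarrow> f z) (at z)" using smooth_continuous[OF 0] by (simp add: continuous_at)
 thus ?case by (simp add: taylor_poly_def LIM_zero_iff)
next
 case (Suc N)
 define R where "R ze = f ze - taylor_poly (Suc N) f z (ze - z)" for ze
 have ev: "near z (%ze. smooth f ze)" by (rule smooth_near[OF Suc(2)])
 have R0: "R z = 0"
 proof -
  have "taylor_poly (Suc N) f z 0 = (SUM j<=Suc N. SUM k<=Suc N - j. if k = 0 then (if j = 0 then f z else 0) else 0)"
   unfolding taylor_poly_def by (intro sum.cong refl) (auto simp: power_0_left)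
  also have "\<dots> = f z" by (simp add: sum.delta)
  finally show ?thesis by (simp add: R_def)
 qed
 show ?case unfolding R_def[symmetric] tendsto_iff dist_norm diff_zero
 proof (intro allI impI)
  fix ep :: real assume ep: "ep > 0"
  let ?e = "%s ze. norm ((wirt1 s f ze - taylor_poly N (wirt1 s f) z (ze - z)) / of_real (cmod (ze - z) ^ N)) < ep / 3"
  have "\<forall>\<^sub>F ze in at z. ?e s ze" for s using tendstoD[OF Suc(1)[OF smooth_wirt[OF Suc(2)], of s "%h. h"], of "ep / 3"] ep
   unfolding dist_norm diff_zero by simp
  hence "\<forall>\<^sub>F ze in at z. ?e \<i> ze & ?e (- \<i>) ze" by (intro eventually_conj)
  then obtain d1 where d1': "d1 > 0" "!!ze. ze ~= z ==> dist ze z < d1 ==> ?e \<i> ze & ?e (- \<i>) ze" unfolding eventually_at by blast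
  hence d1: "d1 > 0" "!!ze s. ze ~= z ==> dist ze z < d1 ==> s = \<i> | s = - \<i> ==> ?e s ze"
  proof -
   fix ze s assume a: "ze ~= z" "dist ze z < d1" "s = \<i> | s = - \<i>"
   show "?e s ze" using a(3) d1'(2)[OF a(1,2)] by (elim disjE) (simp_all only:)
  qed (use d1' in simp)
  from ev obtain d2 where d2: "d2 > 0" "!!ze. dist ze z < d2 ==> smooth f ze" unfolding eventually_nhds_metric by auto
  \<comment> \<open>Each of the two Wirtinger derivatives contributes ep/3; the last third keeps the
    final inequality strict.\<close>
  have bound: "norm (R ze) <= (2 * ep / 3) * cmod (ze - z) ^ Suc N" if ze: "ze ~= z" "dist ze z < min d1 d2" for ze
  proof -
   define r where "r = cmod (ze - z)"
   have r: "r > 0" "r < d1" "r < d2" using ze by (auto simp: r_def dist_norm)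
   have der: "(R has_derivative (%h. dd h R w)) (at w within cball z r)" "onorm (%h. dd h R w) <= (2 * ep / 3) * r ^ N" if w: "w : cball z r" for w
   proof -
    have sf: "smooth f w" using d2(2)[of w] w r by (simp add: dist_commute)
    have "R = (%ze. f ze - taylor_poly (Suc N) f z (ze - z))" by (rule ext) (rule R_def)
    hence sR: "smooth R w" using smooth_diff[OF sf smooth_taylor_poly, of "Suc N" f z] by (simp only:)
    thus "(R has_derivative (%h. dd h R w)) (at w within cball z r)" by (rule has_derivative_at_withinI[OF smooth_has_derivative])
    have wR: "norm (wirt1 s R w) <= (ep / 3) * r ^ N" if s: "s = \<i> | s = - \<i>" for s
    proof -
     have "R = (%ze. f ze + (-1) * taylor_poly (Suc N) f z (ze - z))" by (auto simp: R_def)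
     hence "wirt1 s R w = wirt1 s f w + (-1) * wirt1 s (%ze. taylor_poly (Suc N) f z (ze - z)) w"
      using wirt_add[OF sf smooth_scale[OF smooth_taylor_poly]] wirt_scale[OF smooth_taylor_poly] by metis
     hence e: "wirt1 s R w = wirt1 s f w - taylor_poly N (wirt1 s f) z (w - z)" by (simp add: wirt_taylor_poly[OF Suc(2) s])
     show ?thesis
     proof (cases "w = z")
      case True
      have "taylor_poly N (wirt1 s f) z 0 = (SUM j<=N. SUM k<=N - j. if k = 0 then (if j = 0 then wirt1 s f z else 0) else 0)"
       unfolding taylor_poly_def by (intro sum.cong refl) (auto simp: power_0_left)
      also have "\<dots> = wirt1 s f z" by (simp add: sum.delta)
      finally show ?thesis using True e ep r by simp
     next
      case False
      have "norm (wirt1 s R w) < ep / 3 * cmod (w - z) ^ N"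
       using d1(2)[OF False _ s] w r False unfolding e by (simp add: norm_divide dist_norm norm_minus_commute divide_simps norm_power split: if_splits)
      also have "\<dots> <= ep / 3 * r ^ N" using w ep by (intro mult_left_mono power_mono) (auto simp: dist_norm norm_minus_commute)
      finally show ?thesis by simp
     qed
    qed
    show "onorm (%h. dd h R w) <= (2 * ep / 3) * r ^ N"
    proof (rule onorm_le)
     fix h
     have "norm (dd h R w) <= norm (wirt1 (- \<i>) R w) * norm h + norm (wirt1 \<i> R w) * norm h"
      unfolding dd_wirt_decomp[OF sR] by (rule order_trans[OF norm_triangle_ineq]) (simp add: norm_mult)
     also have "\<dots> <= (ep / 3) * r ^ N * norm h + (ep / 3) * r ^ N * norm h" by (intro add_mono mult_right_mono wR) auto
     finally show "norm (dd h R w) <= (2 * ep / 3) * r ^ N * norm h" by (simp add: mult_ac)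
    qed
   qed
   have "norm (R ze - R z) <= (2 * ep / 3) * r ^ N * norm (ze - z)"
    by (rule differentiable_bound[OF convex_cball der]) (insert r, auto simp: r_def dist_norm norm_minus_commute)
   thus ?thesis using R0 by (simp add: r_def mult_ac)
  qed
  show "\<forall>\<^sub>F ze in at z. norm (R ze / of_real (cmod (ze - z) ^ Suc N)) < ep" unfolding eventually_at
  proof (intro exI[of _ "min d1 d2"] conjI ballI impI)
   fix ze assume "ze ~= z & dist ze z < min d1 d2"
   hence "norm (R ze) <= (2 * ep / 3) * cmod (ze - z) ^ Suc N" "cmod (ze - z) > 0" using bound by auto
   hence "norm (R ze / of_real (cmod (ze - z) ^ Suc N)) <= 2 * ep / 3" by (simp add: norm_divide norm_power divide_le_eq norm_mult)
   thus "norm (R ze / of_real (cmod (ze - z) ^ Suc N)) < ep" using ep by linarith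
  qed (use d1 d2 in auto)
 qed
qed

text \<open>The choice h = 1/|s| gives an exponent of modulus 1, which is no multiple of 2 pi
  i.\<close>

lemma exp_neq_1_exists:
 fixes s :: complex
 assumes "s ~= 0"
 obtains h :: real where "exp (s * of_real h) ~= 1"
proof
 define h where "h = 1 / cmod s"
 have n: "cmod (s * of_real h) = 1" using assms by (simp add: h_def norm_mult norm_divide)
 show "exp (s * of_real h) ~= 1"
 proof
  assume "exp (s * of_real h) = 1"
  then obtain k :: int where k: "Re (s * of_real h) = 0" "Im (s * of_real h) = of_int (2 * k) * pi" by (auto simp: exp_eq_1)
  hence "\<bar>of_int (2 * k) * pi\<bar> = 1" using n cmod_eq_Im[OF k(1)] unfolding k(2) by simp
  hence "\<bar>of_int (2 * k) :: real\<bar> * pi = 1" by (simp add: abs_mult)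
  moreover have "k ~= 0" using calculation by auto
  hence "\<bar>of_int (2 * k) :: real\<bar> \<ge> 2" by linarith
  hence "\<bar>of_int (2 * k) :: real\<bar> * pi \<ge> 2 * 3" using pi_gt3 by (intro mult_mono) auto
  ultimately show False by simp
 qed
qed

lemma pcompose_shift:
 fixes p :: "complex poly"
 shows "coeff (pcompose p [:h, 1:]) (degree p) = lead_coeff p" "degree (pcompose p [:h, 1:]) = degree p"
proof -
 show d: "degree (pcompose p [:h, 1:]) = degree p" by (simp add: degree_pcompose)
 show "coeff (pcompose p [:h, 1:]) (degree p) = lead_coeff p" using lead_coeff_comp[of "[:h, 1:]" p] d by simp
qed

text \<open>The difference operators \<open>g \<mapsto> g(L + h) - e\<^sup>s\<^sup>h g(L)\<close> preserve convergence to 0; they lower the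
 degree of the polynomial factor of \<open>e\<^sup>s\<^sup>L\<close> and keep the degree of the polynomial p.\<close>

lemma exp_poly_tendsto_0:
 fixes p :: "complex poly" and q :: "complex => complex poly"
 assumes "finite S" "0 ~: S"
  and "((%L::real. poly p (of_real L) + (SUM s:S. exp (s * of_real L) * poly (q s) (of_real L))) \<longlongrightarrow> 0) at_bot"
 shows "p = 0" using assms
proof (induction S arbitrary: p q rule: finite_induct)
 case empty
 have pt: "((%L::real. poly p (of_real L)) \<longlongrightarrow> 0) at_bot" using empty by simp
 show ?case
 proof (cases "degree p = 0")
  case True
  then obtain a where "p = [:a:]" by (metis degree_eq_zeroE)
  thus ?thesis using pt by (simp add: tendsto_const_iff)
 next
  case False
  have "filterlim (%L::real. complex_of_real L) at_infinity at_bot"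
   unfolding filterlim_at_bot_mirror by (rule filterlim_norm_at_top_imp_at_infinity) (simp add: filterlim_abs_real)
  hence "filterlim (%L::real. poly p (of_real L)) at_infinity at_bot"
   using False by (intro filterlim_compose[OF filterlim_poly_at_infinity[of p]]) simp_all
  thus ?thesis using not_tendsto_and_filterlim_at_infinity[OF trivial_limit_at_bot_linorder pt] by blast
 qed
next
 case (insert s0 S)
 have "p = 0" if "((%L::real. poly p (of_real L) + (SUM s:insert s0 S. exp (s * of_real L) * poly (q s) (of_real L))) \<longlongrightarrow> 0) at_bot"
  "q s0 = 0 | degree (q s0) < n" for n p q using that
 proof (induction n arbitrary: p q)
  case (0 p q)
  hence "q s0 = 0" by auto
  thus ?case using insert(3)[of p q] insert 0 by simp
 next
  case (Suc n p q)
  show ?case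
  proof (cases "q s0 = 0")
   case True
   thus ?thesis using insert(3)[of p q] insert Suc by simp
  next
   case False
   have "s0 ~= 0" using insert by auto
   then obtain h :: real where h: "exp (s0 * of_real h) ~= 1" by (rule exp_neq_1_exists)
   define nu where "nu = exp (s0 * of_real h)"
   define sh where "sh r = pcompose r [:of_real h, 1:]" for r :: "complex poly"
   define p' where "p' = sh p - smult nu p"
   define q' where "q' s = smult (exp (s * of_real h)) (sh (q s)) - smult nu (q s)" for s
   let ?g = "%L::real. poly p (of_real L) + (SUM s:insert s0 S. exp (s * of_real L) * poly (q s) (of_real L))"
   have sh: "poly (sh r) (of_real L) = poly r (of_real (L + h))" for r L by (simp add: sh_def poly_pcompose add.commute)
   have e: "exp (s * of_real L) * poly (q' s) (of_real L) = exp (s * of_real (L + h)) * poly (q s) (of_real (L + h)) - nu * (exp (s * of_real L) * poly (q s) (of_real L))" for s L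
    unfolding q'_def poly_diff poly_smult sh by (simp add: exp_add distrib_left algebra_simps)
   have "filterlim (%L. L + h) at_bot at_bot" unfolding filterlim_at_bot eventually_at_bot_linorder by (metis le_diff_eq)
   hence "((%L. ?g (L + h)) \<longlongrightarrow> 0) at_bot" by (rule filterlim_compose[OF Suc(2)])
   hence "((%L. ?g (L + h) - nu * ?g L) \<longlongrightarrow> 0 - nu * 0) at_bot" by (intro tendsto_diff tendsto_mult tendsto_const Suc(2))
   moreover have "?g (L + h) - nu * ?g L = poly p' (of_real L) + (SUM s:insert s0 S. exp (s * of_real L) * poly (q' s) (of_real L))" for L
    unfolding e sum_subtractf sum_distrib_left[symmetric] p'_def poly_diff poly_smult sh by (simp only: ring_distribs) simp
   ultimately have t: "((%L. poly p' (of_real L) + (SUM s:insert s0 S. exp (s * of_real L) * poly (q' s) (of_real L))) \<longlongrightarrow> 0) at_bot"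
    by simp
   have "q' s0 = smult nu (sh (q s0) - q s0)" by (simp add: q'_def nu_def smult_diff_right)
   moreover have "sh (q s0) - q s0 = 0 | degree (sh (q s0) - q s0) < degree (q s0)"
   proof (cases "degree (q s0) = 0")
    case True
    then obtain a where "q s0 = [:a:]" by (metis degree_eq_zeroE)
    thus ?thesis by (simp add: sh_def)
   next
    case False
    have "degree (sh (q s0) - q s0) <= degree (q s0)" by (intro degree_diff_le) (auto simp: sh_def pcompose_shift)
    moreover have "coeff (sh (q s0) - q s0) (degree (q s0)) = 0" by (simp add: sh_def pcompose_shift)
    ultimately show ?thesis by (metis leading_coeff_0_iff le_neq_implies_less)
   qed
   ultimately have "q' s0 = 0 | degree (q' s0) < n" using Suc(3) False by auto
   from Suc(1)[OF t this] have "p' = 0" .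
   hence "coeff p' (degree p) = 0" by simp
   hence "(1 - nu) * lead_coeff p = 0" by (simp add: p'_def sh_def pcompose_shift algebra_simps)
   thus ?thesis using h by (simp add: nu_def)
  qed
 qed
 from this[of p q "Suc (degree (q s0))"] insert(5) show ?case by simp
qed

lemma sum_list_swap_sum: "(SUM i:I. SUM x<-xs. f i x) = (SUM x<-xs. SUM i:I. f i x :: complex)" by (induction xs) (auto simp: sum.distrib)

text \<open>Averaging over rotations by n-th roots of unity kills all terms with a nonzero power of
  x. On the positive axis x = exp L turns the others into exponential polynomials in L, to which
  \<open>exp_poly_tendsto_0\<close> applies. T is a list because indices may repeat.\<close>

lemma ope_terms_tendsto_0:
 assumes "((%x. SUM (i, a)<-T. a * ope_term i x) \<longlongrightarrow> 0) (at 0)"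
 shows "(SUM (i, a)<-T. if i = (0, 0, 0) then a else 0) = 0"
proof -
 \<comment> \<open>n exceeds every |m| that occurs, so m = 0 is the only occurring power that is a
   multiple of n.\<close>
 define n where "n = Suc (SUM (i, a)<-T. nat \<bar>fst i\<bar>)"
 have n: "nat \<bar>fst i\<bar> < n" if "(i, a) : set T" for i a
 proof -
  have "nat \<bar>fst i\<bar> <= (SUM (i, a)<-T. nat \<bar>fst i\<bar>)" using that by (induction T) auto
  thus ?thesis by (simp add: n_def)
 qed
 have n0: "n > 0" by (simp add: n_def)
 define v where "v = cis (2 * pi / real n)"
 have wp: "v ^ k = cis (real k * (2 * pi / real n))" for k unfolding v_def by (rule Complex.DeMoivre)
 have w1: "v ~= 0" "cmod v = 1" "v ^ n = 1" using n0 by (simp_all add: wp) (simp_all add: v_def)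
 have wm: "(SUM j<n. (v ^ j) powi m) = (if m = 0 then of_nat n else 0)" if "nat \<bar>m\<bar> < n" for m
 proof (cases "m = 0")
  case False
  have "v powi m ~= 1"
  proof
   assume "v powi m = 1"
   hence "v ^ nat \<bar>m\<bar> = 1" by (auto simp: power_int_def power_inverse split: if_splits)
   hence "cis (2 * pi * real (nat \<bar>m\<bar>) / real n) = 1" by (simp add: wp mult_ac)
   hence "cos (2 * pi * real (nat \<bar>m\<bar>) / real n) = 1" by (metis cis.sel(1) one_complex.sel(1))
   then obtain k :: int where k: "2 * pi * real (nat \<bar>m\<bar>) / real n = of_int k * 2 * pi" by (auto simp: cos_one_2pi_int)
   hence "real (nat \<bar>m\<bar>) = of_int k * real n" using n0 by (simp add: field_simps)
   hence "int (nat \<bar>m\<bar>) = k * int n" by (metis of_int_eq_iff of_int_mult of_int_of_nat_eq)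
   moreover have "nat \<bar>m\<bar> > 0" using False by simp
   ultimately have "k \<ge> 1" using n0 by (smt (verit) of_nat_0_less_iff zero_less_mult_pos2)
   hence "int n <= k * int n" by (simp add: mult_le_cancel_right1)
   hence "int n <= int (nat \<bar>m\<bar>)" unfolding \<open>int (nat \<bar>m\<bar>) = k * int n\<close> .
   thus False using that by linarith
  qed
  moreover have "(SUM j<n. (v powi m) ^ j) = (if v powi m = 1 then of_nat n else ((v powi m) ^ n - 1) / (v powi m - 1))" by (simp add: geometric_sum)
  moreover have "(v powi m) ^ n = 1"
  proof -
   have "(v powi m) ^ n = (v ^ n) powi m" by (simp add: power_int_power' power_int_power mult.commute)
   thus ?thesis using w1 by simp
  qed
  moreover have "(v ^ j) powi m = (v powi m) ^ j" for j by (simp add: power_int_power' power_int_power mult.commute)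
  ultimately show ?thesis using False by simp
 qed simp
 define T0 where "T0 = filter (%(i, a). fst i = 0) T"
 have avg: "(SUM j<n. SUM (i, a)<-T. a * ope_term i (of_real r * v ^ j)) = of_nat n * (SUM (i, a)<-T0. a * ope_term i (of_real r))" if "r > 0" for r :: real
 proof -
  have "(SUM j<n. a * ope_term i (of_real r * v ^ j)) = (if fst i = 0 then of_nat n * (a * ope_term i (of_real r)) else 0)"
   if "(i, a) : set T" for i a
  proof -
   obtain m s k where i: "i = (m, s, k)" by (cases i)
   have "ope_term i (of_real r * v ^ j) = (v ^ j) powi m * ope_term i (of_real r)" for j
    using \<open>r > 0\<close> w1 by (simp add: i norm_mult norm_power power_int_mult_distrib)
   hence "(SUM j<n. a * ope_term i (of_real r * v ^ j)) = (SUM j<n. (v ^ j) powi m) * (a * ope_term i (of_real r))"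
    by (simp add: sum_distrib_left mult_ac)
   thus ?thesis using n[OF that] wm[of m] by (simp add: i)
  qed
  hence "(SUM j<n. SUM (i, a)<-T. a * ope_term i (of_real r * v ^ j)) = (SUM (i, a)<-T. if fst i = 0 then of_nat n * (a * ope_term i (of_real r)) else 0)"
   unfolding sum_list_swap_sum by (intro arg_cong[of _ _ sum_list] map_cong) (auto simp: case_prod_beta)
  also have "\<dots> = of_nat n * (SUM (i, a)<-T0. a * ope_term i (of_real r))" unfolding T0_def by (induction T) (auto simp: distrib_left)
  finally show ?thesis .
 qed
 have lim1: "((%r. of_nat n * (SUM (i, a)<-T0. a * ope_term i (of_real r))) \<longlongrightarrow> 0) (at_right (0::real))"
 proof -
  have "((%r::real. SUM (i, a)<-T. a * ope_term i (of_real r * v ^ j)) \<longlongrightarrow> 0) (at_right 0)" for j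
  proof (rule filterlim_compose[OF assms])
   show "filterlim (%r::real. of_real r * v ^ j) (at 0) (at_right 0)" unfolding filterlim_at
    using w1 by (auto intro!: tendsto_eq_intros simp: eventually_at_filter)
  qed
  hence "((%r::real. SUM j<n. SUM (i, a)<-T. a * ope_term i (of_real r * v ^ j)) \<longlongrightarrow> (SUM j<n. 0)) (at_right 0)"
   by (intro tendsto_sum)
  hence "((%r::real. SUM j<n. SUM (i, a)<-T. a * ope_term i (of_real r * v ^ j)) \<longlongrightarrow> 0) (at_right 0)" by simp
  thus ?thesis by (rule Lim_transform_eventually) (auto simp: eventually_at_filter avg)
 qed
 \<comment> \<open>S contains the nonzero exponents of |x|. The polynomial \<open>q 0\<close>
   collects the pure powers of the logarithm, and its constant coefficient is the number
   sought.\<close>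
 define S where "S = (%(i, a). fst (snd i)) ` set T0 - {0}"
 define q where "q s = (SUM (i, a)<-T0. if fst (snd i) = s then monom a (snd (snd i)) else 0)" for s
 have el: "filterlim (exp :: real => real) (at_right 0) at_bot" by (simp add: filterlim_at exp_at_bot)
 have "((%L::real. of_nat n * (SUM (i, a)<-T0. a * ope_term i (of_real (exp L)))) \<longlongrightarrow> 0) at_bot"
  by (rule filterlim_compose[OF lim1 el])
 from tendsto_mult[OF tendsto_const[of "1 / of_nat n"] this]
 have lim2: "((%L::real. SUM (i, a)<-T0. a * ope_term i (of_real (exp L))) \<longlongrightarrow> 0) at_bot" using n0 by simp
 have fin: "finite S" by (simp add: S_def)
 have "(SUM (i, a)<-T0. a * ope_term i (of_real (exp L))) = poly (q 0) (of_real L) + (SUM s:S. exp (s * of_real L) * poly (q s) (of_real L))" for L :: real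
 proof -
  let ?L = "complex_of_real L"
  have pq: "exp (s * ?L) * poly (q s) ?L = (SUM (i, a)<-T0. if fst (snd i) = s then exp (s * ?L) * (a * ?L ^ snd (snd i)) else 0)" for s
   unfolding q_def by (induction T0) (auto simp: poly_monom distrib_left)
  have "poly (q 0) ?L + (SUM s:S. exp (s * ?L) * poly (q s) ?L) = (SUM s:insert 0 S. exp (s * ?L) * poly (q s) ?L)"
   using fin by (subst sum.insert) (auto simp: S_def)
  also have "\<dots> = (SUM (i, a)<-T0. SUM s:insert 0 S. if fst (snd i) = s then exp (s * ?L) * (a * ?L ^ snd (snd i)) else 0)"
   unfolding pq by (subst sum_list_swap_sum) (intro arg_cong[of _ _ sum_list] map_cong refl, auto)
  also have "\<dots> = (SUM (i, a)<-T0. a * ope_term i (of_real (exp L)))"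
  proof (intro arg_cong[of _ _ sum_list] map_cong refl, clarify)
   fix m s k a assume T: "((m, s, k), a) : set T0"
   hence "m = 0" by (auto simp: T0_def)
   have "s : insert 0 S" using T by (force simp: S_def)
   thus "(SUM s':insert 0 S. if fst (snd (m, s, k)) = s' then exp (s' * ?L) * (a * ?L ^ snd (snd (m, s, k))) else 0) = a * ope_term (m, s, k) (of_real (exp L))"
    using fin \<open>m = 0\<close> by (simp add: powr_def Ln_of_real mult_ac flip: exp_of_real)
  qed
  finally show ?thesis ..
 qed
 hence "q 0 = 0" using exp_poly_tendsto_0[OF fin, of "q 0" q] lim2 by (simp add: S_def)
 hence "coeff (q 0) 0 = 0" by simp
 moreover have "coeff (q 0) 0 = (SUM (i, a)<-T. if i = (0, 0, 0) then a else 0)" unfolding q_def T0_def by (induction T) auto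
 ultimately show ?thesis by simp
qed

section \<open>Expansions with chart-independent coefficients\<close>

type_synonym normal_comb = "(complex * complex * (nat * nat) multiset) list"

definition comb_corr ::
  "real => normal_comb => complex => chart => complex => factor multiset => (complex * factor) list => complex" where
 "comb_corr b L p c z Q lq = (SUM (k, al, D)<-L. k * two_point b p c z Q lq al D 0 {#} z)"

lemma comb_corr_simps [simp]:
 "comb_corr b [] p c z Q lq = 0"
 "comb_corr b (L @ L') p c z Q lq = comb_corr b L p c z Q lq + comb_corr b L' p c z Q lq" by (simp_all add: comb_corr_def)

definition comb_scale :: "complex => normal_comb => normal_comb" where
 "comb_scale a L = map (%(k, al, D). (a * k, al, D)) L"

lemma comb_corr_scale [simp]: "comb_corr b (comb_scale a L) p c z Q lq = a * comb_corr b L p c z Q lq"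
 by (induction L) (auto simp: comb_corr_def comb_scale_def distrib_left)

type_synonym kernel = "complex => chart => complex => factor multiset => (complex * factor) list => complex => complex"

type_synonym pair_comb = "(complex * complex * (nat * nat) multiset * complex * (nat * nat) multiset) list"

definition pair_corr :: "real => pair_comb => kernel" where
 "pair_corr b T p c z Q lq w = (SUM (k, al, D, bt, E)<-T. k * two_point b p c z Q lq al D bt E w)"

lemma pair_corr_simps [simp]:
 "pair_corr b [] p c z Q lq w = 0"
 "pair_corr b ((k, al, D, bt, E) # T) p c z Q lq w = k * two_point b p c z Q lq al D bt E w + pair_corr b T p c z Q lq w"
 "pair_corr b (T @ T') p c z Q lq w = pair_corr b T p c z Q lq w + pair_corr b T' p c z Q lq w" by (simp_all add: pair_corr_def)

lemma smooth_pair_corr: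
 assumes "near_ok p c z Q lq w"
 shows "smooth (pair_corr b T p c z Q lq) w"
proof (induction T)
 case Nil
 show ?case unfolding pair_corr_def[abs_def] by (simp add: smooth.const)
next
 case (Cons t T)
 obtain k al D bt E where t: "t = (k, al, D, bt, E)" by (cases t)
 have e: "pair_corr b (t # T) p c z Q lq = (%w. k * two_point b p c z Q lq al D bt E w + pair_corr b T p c z Q lq w)" by (rule ext) (simp add: t)
 show ?case unfolding e by (rule smooth.add[OF smooth_scale[OF two_point_smooth[OF assms]] Cons])
qed

text \<open>The derivative formula \<open>two_point_wirt\<close> as an operation on coefficient
  lists alone, in which no chart or point occurs.\<close>

fun bump_terms :: "complex => complex * complex * (nat * nat) multiset * complex * (nat * nat) multiset => pair_comb" where
 "bump_terms s (k, al, D, b, E) = (k * al, al, add_mset (bump s (0, 0)) D, b, E) #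
   map (%d. (k, al, add_mset (bump s d) (D - {#d#}), b, E)) (SOME ds. mset ds = D)"

definition bump_comb :: "complex => pair_comb => pair_comb" where
 "bump_comb s T = concat (map (bump_terms s) T)"

lemma mset_SOME: "mset (SOME xs. mset xs = D) = D" by (rule someI_ex) (rule ex_mset)

lemma sum_list_SOME: "(SUM d<-(SOME ds. mset ds = D). f d) = (SUM d:#D. f d)" unfolding sum_mset_sum_list[symmetric] mset_map mset_SOME ..

lemma wirt_pair_corr:
 assumes ok: "near_ok p c z Q lq w" and s: "s = \<i> | s = - \<i>"
 shows "wirt1 s (pair_corr b T p c z Q lq) w = pair_corr b (bump_comb s T) p c z Q lq w"
proof (induction T)
 case (Cons t T)
 obtain k al D bt E where t: "t = (k, al, D, bt, E)" by (cases t)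
 have e: "pair_corr b (t # T) p c z Q lq = (%w. k * two_point b p c z Q lq al D bt E w + pair_corr b T p c z Q lq w)" by (rule ext) (simp add: t)
 have "pair_corr b (bump_terms s t) p c z Q lq w = k * wirt1 s (two_point b p c z Q lq al D bt E) w"
  unfolding two_point_wirt[OF ok s] by (simp add: t pair_corr_def comp_def sum_list_SOME distrib_left mult_ac sum_mset_distrib_left)
 thus ?case unfolding e wirt_add[OF smooth_scale[OF two_point_smooth[OF ok]] smooth_pair_corr[OF ok]]
   wirt_scale[OF two_point_smooth[OF ok]] Cons by (simp add: bump_comb_def)
qed (simp add: pair_corr_def[abs_def] bump_comb_def)

definition jet_comb :: "nat * nat => pair_comb => pair_comb" where
 "jet_comb d T = (bump_comb (- \<i>) ^^ fst d) ((bump_comb \<i> ^^ snd d) T)"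

lemma jet_pair_corr:
 assumes "good_chart p c z" "valid_term (- {par c z}) Q lq"
 shows "jet1 d (pair_corr b T p c z Q lq) z = pair_corr b (jet_comb d T) p c z Q lq z"
proof -
 have pw: "near z (%w. (wirt1 s ^^ n) f w = pair_corr b ((bump_comb s ^^ n) T) p c z Q lq w)"
  if "near z (%w. f w = pair_corr b T p c z Q lq w)" "s = \<i> | s = - \<i>" for s n f T
 proof (induction n)
  case (Suc n)
  hence "near z (%w. near w (%w. (wirt1 s ^^ n) f w = pair_corr b ((bump_comb s ^^ n) T) p c z Q lq w))" by (simp add: eventually_eventually)
  with near_ok_eventually[OF assms] show ?case by eventually_elim (simp add: wirt_cong wirt_pair_corr[OF _ that(2)])
 qed (use that in simp)
 have "near z (%w. jet1 d (pair_corr b T p c z Q lq) w = pair_corr b (jet_comb d T) p c z Q lq w)" unfolding jet_def jet_comb_def by (intro pw) auto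
 thus ?thesis by (rule eventually_at_self)
qed

definition merge_comb :: "pair_comb => normal_comb" where
 "merge_comb T = map (%(k, al, D, b, E). (k, al + b, D + E)) T"

lemma pair_corr_diag: "good_chart p c z ==> pair_corr b T p c z Q lq z = comb_corr b (merge_comb T) p c z Q lq"
 unfolding pair_corr_def comb_corr_def merge_comb_def map_map comp_def by (intro arg_cong[of _ _ sum_list] map_cong refl) (auto simp: two_point_diag[symmetric])

abbreviation ope_sum :: "real => (ope_index * normal_comb) list => kernel" where
 "ope_sum b T p c z Q lq w \<equiv> SUM (i, L)<-T. comb_corr b L p c z Q lq * ope_term i (w - z)"

abbreviation vanishes :: "real => complex => (complex => complex) => bool" where
 "vanishes N z f \<equiv> ((%w. f w / of_real (cmod (w - z) powr N)) \<longlongrightarrow> 0) (at z)"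

text \<open>The list T is given before chart, point and test functional. This uniformity is what
  makes the coefficient of 1 a normal form valid in all good charts at once.\<close>

definition expands_upto :: "real => real => (ope_index * normal_comb) list => kernel => bool" where
 "expands_upto b N T K \<longleftrightarrow> (ALL p c z Q lq. good_chart p c z --> valid_term (- {par c z}) Q lq -->
   vanishes N z (%w. K p c z Q lq w - ope_sum b T p c z Q lq w))"

definition expands :: "real => kernel => bool" where
 "expands b K \<longleftrightarrow> (ALL N. EX T. expands_upto b N T K)"

lemma expands_cong:
 assumes "!!p c z Q lq. good_chart p c z ==> valid_term (- {par c z}) Q lq ==> \<forall>\<^sub>F w in at z. K p c z Q lq w = K' p c z Q lq w"
  and "expands b K'"
 shows "expands b K" unfolding expands_def
proof
 fix N obtain T where T: "expands_upto b N T K'" using assms(2) unfolding expands_def by blast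
 have "expands_upto b N T K" unfolding expands_upto_def
 proof (intro allI impI)
  fix p c z Q lq assume A: "good_chart p c z" "valid_term (- {par c z}) Q lq"
  have "\<forall>\<^sub>F w in at z. (K' p c z Q lq w - ope_sum b T p c z Q lq w) / of_real (cmod (w - z) powr N)
    = (K p c z Q lq w - ope_sum b T p c z Q lq w) / of_real (cmod (w - z) powr N)" using assms(1)[OF A] by eventually_elim simp
  moreover have "vanishes N z (%w. K' p c z Q lq w - ope_sum b T p c z Q lq w)" using T A unfolding expands_upto_def by blast
  ultimately show "vanishes N z (%w. K p c z Q lq w - ope_sum b T p c z Q lq w)" by (rule Lim_transform_eventually[rotated])
 qed
 thus "EX T. expands_upto b N T K" ..
qed

lemma expands_zero: "expands b (%p c z Q lq w. 0)" unfolding expands_def expands_upto_def by (auto intro!: exI[of _ "[]"])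

lemma expands_add:
 assumes "expands b K" "expands b K'"
 shows "expands b (%p c z Q lq w. K p c z Q lq w + K' p c z Q lq w)" unfolding expands_def
proof
 fix N obtain T T' where T: "expands_upto b N T K" "expands_upto b N T' K'" using assms unfolding expands_def by blast
 have "expands_upto b N (T @ T') (%p c z Q lq w. K p c z Q lq w + K' p c z Q lq w)" unfolding expands_upto_def
 proof (intro allI impI)
  fix p c z Q lq assume A: "good_chart p c z" "valid_term (- {par c z}) Q lq"
  let ?S = "%T. ope_sum b T p c z Q lq"
  have "((%w. (K p c z Q lq w - ?S T w) / of_real (cmod (w - z) powr N) + (K' p c z Q lq w - ?S T' w) / of_real (cmod (w - z) powr N)) \<longlongrightarrow> 0 + 0) (at z)"
   using T A unfolding expands_upto_def by (intro tendsto_add) blast+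
  thus "vanishes N z (%w. K p c z Q lq w + K' p c z Q lq w - ?S (T @ T') w)"
   by (simp add: add_divide_distrib[symmetric] algebra_simps del: ope_term.simps)
 qed
 thus "EX T. expands_upto b N T (%p c z Q lq w. K p c z Q lq w + K' p c z Q lq w)" ..
qed

lemma expands_scale:
 assumes "expands b K"
 shows "expands b (%p c z Q lq w. a * K p c z Q lq w)" unfolding expands_def
proof
 fix N obtain T where T: "expands_upto b N T K" using assms unfolding expands_def by blast
 have "expands_upto b N (map (%(i, L). (i, comb_scale a L)) T) (%p c z Q lq w. a * K p c z Q lq w)" unfolding expands_upto_def
 proof (intro allI impI)
  fix p c z Q lq assume A: "good_chart p c z" "valid_term (- {par c z}) Q lq"
  let ?S = "%T. ope_sum b T p c z Q lq"
  have S: "?S (map (%(i, L). (i, comb_scale a L)) T) w = a * ?S T w" for w by (induction T) (auto simp: distrib_left simp del: ope_term.simps)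
  have "((%w. a * ((K p c z Q lq w - ?S T w) / of_real (cmod (w - z) powr N))) \<longlongrightarrow> a * 0) (at z)"
   using T A unfolding expands_upto_def by (intro tendsto_mult tendsto_const) blast+
  thus "((%w. (a * K p c z Q lq w - ?S (map (%(i, L). (i, comb_scale a L)) T) w) / of_real (cmod (w - z) powr N)) \<longlongrightarrow> 0) (at z)"
   unfolding S by (simp add: right_diff_distrib del: ope_term.simps)
 qed
 thus "EX T. expands_upto b N T (%p c z Q lq w. a * K p c z Q lq w)" ..
qed

lemma expands_sum_mset:
 "(!!y. y :# M ==> expands b (K y)) ==> expands b (%p c z Q lq w. SUM y:#M. K y p c z Q lq w)"
 by (induction M) (simp_all add: expands_zero expands_add)

lemma ope_term_mult:
 assumes "x ~= 0"
 shows "ope_term (m, s, k) x * ope_term (m', s', k') x = ope_term (m + m', s + s', k + k') x"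
 using assms by (simp add: power_int_add powr_add power_add mult_ac)

lemma norm_ope_term: "x ~= 0 ==> cmod (ope_term (m, s, k) x) = cmod x powr (real_of_int m + Re s) * \<bar>ln (cmod x)\<bar> ^ k"
proof -
 assume x: "x ~= 0"
 have "cmod (x powi m) = cmod x powr real_of_int m" using x by (simp add: norm_power_int powr_real_of_int')
 moreover have "cmod (of_real (cmod x) powr s) = cmod x powr Re s" using x by (simp add: norm_powr_real_powr)
 ultimately show ?thesis using x by (simp add: norm_mult norm_power powr_add)
qed

lemma mult_ln_power_tendsto_0: "((%x::real. x * \<bar>ln x\<bar> ^ k) \<longlongrightarrow> 0) (at_right 0)"
proof -
 have "((%x::real. (- ln x) ^ k / exp (- ln x)) \<longlongrightarrow> 0) (at_right 0)"
  by (rule filterlim_compose[OF tendsto_power_div_exp_0]) (simp add: filterlim_uminus_at_top ln_at_0)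
 moreover have "\<forall>\<^sub>F x::real in at_right 0. (- ln x) ^ k / exp (- ln x) = x * \<bar>ln x\<bar> ^ k"
  unfolding eventually_at_right_field by (intro exI[of _ 1]) (auto simp: exp_minus divide_inverse mult.commute)
 ultimately show ?thesis by (rule Lim_transform_eventually)
qed

lemma filterlim_cmod_at_right: "filterlim (%w. cmod (w - z)) (at_right 0) (at z)"
 unfolding filterlim_at by (auto intro!: tendsto_eq_intros simp: eventually_at_filter)

lemma expands_ope_term:
 assumes "expands b K"
 shows "expands b (%p c z Q lq w. ope_term i (w - z) * K p c z Q lq w)" unfolding expands_def
proof
 fix N
 obtain m s k where i: "i = (m, s, k)" by (cases i)
 define r where "r = real_of_int m + Re s"
 \<comment> \<open>The factor has size |w - z|^r times a power of the logarithm. K is expanded one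
   order further than N - r, and the surplus power absorbs the logarithms.\<close>
 obtain T where T: "expands_upto b (N - r + 1) T K" using assms unfolding expands_def by blast
 define T' where "T' = map (%((m', s', k'), L). ((m + m', s + s', k + k'), L)) T"
 have "expands_upto b N T' (%p c z Q lq w. ope_term i (w - z) * K p c z Q lq w)" unfolding expands_upto_def
 proof (intro allI impI)
  fix p c z Q lq assume A: "good_chart p c z" "valid_term (- {par c z}) Q lq"
  let ?S = "%T. ope_sum b T p c z Q lq"
  have S: "?S T' w = ope_term i (w - z) * ?S T w" if "w ~= z" for w
  proof -
   have "w - z ~= 0" using that by simp
   show ?thesis
    unfolding T'_def i by (induction T) (auto simp: ope_term_mult[OF \<open>w - z ~= 0\<close>, symmetric] distrib_left mult.left_commute simp del: ope_term.simps)
  qed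
  have 1: "vanishes (N - r + 1) z (%w. K p c z Q lq w - ?S T w)" using T A unfolding expands_upto_def by blast
  have 2: "((%w. ope_term i (w - z) * of_real (cmod (w - z) powr (1 - r))) \<longlongrightarrow> 0) (at z)"
  proof (rule tendsto_norm_zero_cancel, rule Lim_transform_eventually)
   show "((%w. cmod (w - z) * \<bar>ln (cmod (w - z))\<bar> ^ k) \<longlongrightarrow> 0) (at z)"
    by (rule filterlim_compose[OF mult_ln_power_tendsto_0 filterlim_cmod_at_right])
   show "\<forall>\<^sub>F w in at z. cmod (w - z) * \<bar>ln (cmod (w - z))\<bar> ^ k = norm (ope_term i (w - z) * of_real (cmod (w - z) powr (1 - r)))"
    unfolding eventually_at_filter
   proof (intro always_eventually allI impI)
    fix w assume "w ~= z"
    hence x: "w - z ~= 0" by simp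
    have "cmod (w - z) powr r * cmod (w - z) powr (1 - r) = cmod (w - z)" using x by (simp add: powr_add[symmetric])
    thus "cmod (w - z) * \<bar>ln (cmod (w - z))\<bar> ^ k = norm (ope_term i (w - z) * of_real (cmod (w - z) powr (1 - r)))"
     unfolding norm_mult i norm_ope_term[OF x] r_def[symmetric] by (simp add: mult_ac)
   qed
  qed
  have "((%w. (K p c z Q lq w - ?S T w) / of_real (cmod (w - z) powr (N - r + 1)) * (ope_term i (w - z) * of_real (cmod (w - z) powr (1 - r)))) \<longlongrightarrow> 0 * 0) (at z)"
   by (rule tendsto_mult[OF 1 2])
  moreover have "\<forall>\<^sub>F w in at z. (K p c z Q lq w - ?S T w) / of_real (cmod (w - z) powr (N - r + 1)) * (ope_term i (w - z) * of_real (cmod (w - z) powr (1 - r)))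
    = (ope_term i (w - z) * K p c z Q lq w - ?S T' w) / of_real (cmod (w - z) powr N)" unfolding eventually_at_filter
  proof (intro always_eventually allI impI)
   fix w assume z: "w ~= z"
   define x where "x = cmod (w - z)"
   have "x > 0" using z by (simp add: x_def)
   have "x powr (N - r + 1) = x powr N * x powr (1 - r)" by (simp add: powr_add[symmetric] algebra_simps)
   moreover have "x powr (1 - r) ~= 0" "x powr N ~= 0" using \<open>x > 0\<close> by auto
   ultimately have "A / of_real (x powr (N - r + 1)) * (B * of_real (x powr (1 - r))) = B * A / complex_of_real (x powr N)" for A B by simp
   thus "(K p c z Q lq w - ?S T w) / of_real (cmod (w - z) powr (N - r + 1)) * (ope_term i (w - z) * of_real (cmod (w - z) powr (1 - r)))
    = (ope_term i (w - z) * K p c z Q lq w - ?S T' w) / of_real (cmod (w - z) powr N)" unfolding S[OF z] x_def by (simp only: right_diff_distrib)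
  qed
  ultimately show "vanishes N z (%w. ope_term i (w - z) * K p c z Q lq w - ?S T' w)" using Lim_transform_eventually by fastforce
 qed
 thus "EX T. expands_upto b N T (%p c z Q lq w. ope_term i (w - z) * K p c z Q lq w)" ..
qed

lemma tendsto_weaken_order:
 fixes f :: "complex => complex"
 assumes "((%w. f w / of_real (cmod (w - z) ^ n)) \<longlongrightarrow> 0) (at z)" "N <= real n"
 shows "vanishes N z f"
proof (rule tendsto_0_le[OF assms(1), of _ 1])
 have "\<forall>\<^sub>F w in at z. dist w z < 1" by (auto simp: eventually_at intro!: exI[of _ 1])
 moreover have "\<forall>\<^sub>F w in at z. w ~= z" by (simp add: eventually_at_filter)
 ultimately show "\<forall>\<^sub>F w in at z. norm (f w / of_real (cmod (w - z) powr N)) <= norm (f w / of_real (cmod (w - z) ^ n)) * 1"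
 proof eventually_elim
  case (elim w)
  hence x: "0 < cmod (w - z)" "cmod (w - z) <= 1" by (auto simp: dist_norm)
  have "cmod (w - z) ^ n = cmod (w - z) powr real n" using x by (simp add: powr_realpow)
  also have "\<dots> <= cmod (w - z) powr N" using x assms(2) by (intro powr_mono') auto
  finally show ?case using x by (simp add: norm_divide norm_power divide_left_mono)
 qed
qed

lemma sum_pairs_conv_list:
 "(SUM j<=n. SUM k<=n - j. f j k) = (SUM (j, k)<-concat (map (%j. map (Pair j) [0..<Suc (n - j)]) [0..<Suc n]). f j k :: complex)"
proof -
 have 1: "(SUM j<-[0..<Suc m]. g j) = (SUM j<=m. g j)" for g :: "nat => complex" and m
  by (simp add: interv_sum_list_conv_sum_set_nat atLeast0LessThan lessThan_Suc_atMost del: upt_Suc)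
 have 2: "(SUM (j, k)<-concat (map (%j. map (Pair j) (h j)) js). f j k) = (SUM j<-js. SUM k<-h j. f j k)" for h js
  by (induction js) (auto simp: comp_def)
 show ?thesis unfolding 2 1 ..
qed

text \<open>Taylor expansion at w = z. The derivatives on the diagonal are again combinations of
  one-point correlations, by \<open>jet_pair_corr\<close> and \<open>pair_corr_diag\<close>, with
  coefficients that do not involve the chart.\<close>

lemma expands_pair_corr: "expands b (pair_corr b T)" unfolding expands_def
proof
 fix N :: real
 define n where "n = nat \<lceil>N\<rceil>"
 have n: "N <= real n" unfolding n_def by linarith
 define T' where "T' = map (%(j, k). ((int j - int k, 2 * of_nat k, 0) :: ope_index,
   comb_scale (1 / (fact j * fact k)) (merge_comb (jet_comb (j, k) T)))) (concat (map (%j. map (Pair j) [0..<Suc (n - j)]) [0..<Suc n]))"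
 have "expands_upto b N T' (pair_corr b T)" unfolding expands_upto_def
 proof (intro allI impI)
  fix p c z Q lq assume A: "good_chart p c z" "valid_term (- {par c z}) Q lq"
  let ?f = "pair_corr b T p c z Q lq"
  have sm: "smooth ?f z" by (rule smooth_pair_corr[OF eventually_at_self[OF near_ok_eventually[OF A]]])
  have lim: "vanishes N z (%w. ?f w - taylor_poly n ?f z (w - z))" by (rule tendsto_weaken_order[OF taylor_remainder[OF sm] n])
  have e: "x ^ j * cnj x ^ k = ope_term (int j - int k, 2 * of_nat k, 0) x" if "x ~= 0" for x j k
   using cnj_powi_ope_term[OF that, of "int j" "int k"] by (simp del: ope_term.simps)
  have "taylor_poly n ?f z x = (SUM (i, L)<-T'. comb_corr b L p c z Q lq * ope_term i x)" if x: "x ~= 0" for x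
   unfolding taylor_poly_def jet_pair_corr[OF A] pair_corr_diag[OF A(1)] sum_pairs_conv_list T'_def map_map comp_def by (intro arg_cong[of _ _ sum_list] map_cong refl, thin_tac "_ : _") (clarsimp simp: e[OF x] simp del: ope_term.simps)
  hence "\<forall>\<^sub>F w in at z. (?f w - taylor_poly n ?f z (w - z)) / of_real (cmod (w - z) powr N) =
    (?f w - ope_sum b T' p c z Q lq w) / of_real (cmod (w - z) powr N)"
   by (simp add: eventually_at_filter del: ope_term.simps)
  with lim show "vanishes N z (%w. ?f w - ope_sum b T' p c z Q lq w)" by (rule Lim_transform_eventually)
 qed
 thus "EX T'. expands_upto b N T' (pair_corr b T)" ..
qed

lemma expands_two_point: "expands b (%p c z Q lq w. two_point b p c z Q lq al D bt E w)"
 using expands_pair_corr[of b "[(1, al, D, bt, E)]"] by (simp add: pair_corr_def[abs_def])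

definition multiplier :: "real => (complex => complex => complex) => bool" where
 "multiplier b g \<longleftrightarrow> (ALL K. expands b K --> expands b (%p c z Q lq w. g z w * K p c z Q lq w))"

lemma multiplier_zero: "multiplier b (%z w. 0)" by (simp add: multiplier_def expands_zero)

lemma multiplier_scale: "multiplier b g ==> multiplier b (%z w. a * g z w)" using expands_scale by (fastforce simp: multiplier_def mult.assoc)

lemma multiplier_add: "multiplier b g ==> multiplier b h ==> multiplier b (%z w. g z w + h z w)"
 using expands_add by (fastforce simp: multiplier_def distrib_right)

lemma multiplier_ope_term:
 assumes "!!z w. w ~= z ==> g z w = k * ope_term i (w - z)"
 shows "multiplier b g" unfolding multiplier_def
proof (intro allI impI)
 fix K assume "expands b K"
 hence "expands b (%p c z Q lq w. k * (ope_term i (w - z) * K p c z Q lq w))" by (intro expands_scale expands_ope_term)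
 thus "expands b (%p c z Q lq w. g z w * K p c z Q lq w)" by (rule expands_cong[rotated]) (simp add: assms eventually_at_filter del: ope_term.simps)
qed

lemma multiplier_sing_cov: "multiplier b (%z w. sing_cov z w x y)"
proof -
 have "multiplier b (%z w. log_jet d e (w, z))" for d e
 proof -
  obtain k i where "!!u v. u ~= v ==> log_jet d e (u, v) = k * ope_term i (u - v)" using log_jet_ope_term[of d e] by blast
  thus ?thesis by (rule multiplier_ope_term)
 qed
 thus ?thesis by (cases x; cases y) (simp_all add: multiplier_zero)
qed

lemma expands_contract:
 assumes s: "!!z w. symm (C z w)" and C: "!!x y. multiplier b (%z w. C z w x y)" and m: "!!x. multiplier b (%z w. m z w x)"
  and f: "!!A. A <=# M ==> expands b (f A)"
 shows "expands b (%p c z Q lq w. contract (C z w) (m z w) M (%A. f A p c z Q lq w))" using f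
proof (induction M arbitrary: f rule: multiset_size_induct)
 case (add x M)
 have sub: "A <=# add_mset x M" if "A <=# M" for A using that by (metis add_mset_add_single mset_subset_eq_add_left subset_mset.order_trans)
 have sub2: "A <=# add_mset x M" if "A <=# M - {#y#}" for A y using that sub by (meson diff_subset_eq_self subset_mset.order_trans)
 show ?case
  unfolding contract_add[OF s] by (intro expands_add expands_sum_mset m[unfolded multiplier_def, rule_format] C[unfolded multiplier_def, rule_format] add(1))
    (use add(2) sub sub2 in auto)
qed simp

text \<open>After \<open>corr_normal_two_contract\<close> the singular factors are OPE terms, hence
  multipliers of expansions, and every remaining function is a \<open>two_point\<close> with its
  Taylor expansion.\<close>

lemma expands_corr_normal:
 "expands b (%p c z Q lq w. corr [normal_field b al D p c w, normal_field b bt E p c z, wick_term Q lq])"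
proof (rule expands_cong)
 let ?f = "%M p c z Q lq w. gauss (two_cov p c z w) (two_mean b c z w) (M + image_mset LC Q) (two_exps al bt lq)"
 let ?m = "%z w x. al * sing_cov z w (LA (0, 0)) x + bt * sing_cov z w (LB (0, 0)) x"
 let ?K = "%p c z Q lq w. exp (al * bt * log_jet (0, 0) (0, 0) (w, z)) * contract (sing_cov z w) (?m z w) (image_mset LA D + image_mset LB E) (%M. ?f M p c z Q lq w)"
 fix p c z Q lq assume A: "good_chart p c z" "valid_term (- {par c z}) Q lq"
 show "\<forall>\<^sub>F w in at z. corr [normal_field b al D p c w, normal_field b bt E p c z, wick_term Q lq] = ?K p c z Q lq w"
  using pair_expectation_split[OF A(1)]
 proof eventually_elim
  case (elim w)
  show ?case by (rule corr_normal_two_contract) (use elim in blast)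
 qed
next
 let ?f = "%M p c z Q lq w. gauss (two_cov p c z w) (two_mean b c z w) (M + image_mset LC Q) (two_exps al bt lq)"
 let ?m = "%z w x. al * sing_cov z w (LA (0, 0)) x + bt * sing_cov z w (LB (0, 0)) x"
 have "multiplier b (%z w. exp (al * bt * log_jet (0, 0) (0, 0) (w, z)))"
 proof (rule multiplier_ope_term)
  fix z w :: complex assume "w ~= z"
  \<comment> \<open>The contractions between the two exponentials amount to the power |w - z|^(-2 al
    bt), a single OPE term with a complex exponent.\<close>
  thus "exp (al * bt * log_jet (0, 0) (0, 0) (w, z)) = 1 * ope_term (0, - 2 * al * bt, 0) (w - z)"
   by (simp add: log_jet_def log_kernel_def powr_def Ln_of_real mult_ac)
 qed
 moreover have "expands b (%p c z Q lq w. contract (sing_cov z w) (?m z w) (image_mset LA D + image_mset LB E) (%M. ?f M p c z Q lq w))"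
 proof (rule expands_contract[OF symm_sing_cov multiplier_sing_cov])
  show "multiplier b (%z w. ?m z w x)" for x by (intro multiplier_add multiplier_scale multiplier_sing_cov)
  fix A assume "A <=# image_mset LA D + image_mset LB E"
  hence "set_mset A <= set_mset (image_mset LA D + image_mset LB E)" by (rule set_mset_mono)
  hence "set_mset A <= range LA Un range LB" by auto
  hence "EX D' E'. A = image_mset LA D' + image_mset LB E'"
  proof (induction A)
   case (add x A)
   then obtain D' E' where "A = image_mset LA D' + image_mset LB E'" by auto
   moreover have "(EX d. x = LA d) | (EX d. x = LB d)" using add by auto
   ultimately show ?case
    by (elim disjE exE) (metis image_mset_add_mset add_mset_add_single union_mset_add_mset_left, metis image_mset_add_mset union_mset_add_mset_right)
  qed simp
  then obtain D' E' where "A = image_mset LA D' + image_mset LB E'" by blast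
  hence "?f A = (%p c z Q lq w. two_point b p c z Q lq al D' bt E' w)" by (simp add: two_point_def two_labels_def fun_eq_iff)
  thus "expands b (?f A)" by (simp add: expands_two_point)
 qed
 ultimately show "expands b (%p c z Q lq w. exp (al * bt * log_jet (0, 0) (0, 0) (w, z)) *
   contract (sing_cov z w) (?m z w) (image_mset LA D + image_mset LB E) (%M. ?f M p c z Q lq w))" unfolding multiplier_def by blast
qed

section \<open>Normal forms of the fields in the OPE family\<close>

definition comb_field :: "real => normal_comb => complex => chart => complex => functional" where
 "comb_field b L p c z M = (SUM (k, al, D)<-L. k * normal_field b al D p c z M)"

lemma comb_field_Nil: "comb_field b [] p c z = (%M. 0 * normal_field b 0 {#} p c z M)" by (rule ext) (simp add: comb_field_def)

lemma comb_field_Cons: "comb_field b ((k, al, D) # L) p c z = (%M. k * normal_field b al D p c z M + comb_field b L p c z M)"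
 by (rule ext) (simp add: comb_field_def)

lemma normal_field_all: "normal_field b al D p c z : all_span"
 by (simp add: normal_field_def slot_fun_def normal_slot_def reg_term_in_all symm_self_cov)

lemma comb_field_all: "comb_field b L p c z : all_span"
proof (induction L)
 case Nil
 show ?case unfolding comb_field_Nil by (rule term_span.scale[OF normal_field_all])
next
 case (Cons a L)
 obtain k al D where a: "a = (k, al, D)" by (cases a)
 show ?case unfolding a comb_field_Cons by (rule term_span.add[OF term_span.scale[OF normal_field_all] Cons])
qed

lemma comb_field_in_span:
 assumes "chart_at c z"
 shows "comb_field b L p c z : wick_span {par c z}"
proof (induction L)
 case Nil
 show ?case unfolding comb_field_Nil by (rule term_span.scale[OF normal_field_in_span[OF assms]])
next
 case (Cons a L)
 obtain k al D where a: "a = (k, al, D)" by (cases a)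
 show ?case unfolding a comb_field_Cons by (rule term_span.add[OF term_span.scale[OF normal_field_in_span[OF assms]] Cons])
qed

lemma corr_comb_field:
 assumes "set As <= all_span" "set Bs <= all_span"
 shows "corr (As @ comb_field b L p c z # Bs) = (SUM (k, al, D)<-L. k * corr (As @ normal_field b al D p c z # Bs))"
proof (induction L)
 case Nil
 show ?case unfolding comb_field_Nil corr_scale by simp
next
 case (Cons a L)
 obtain k al D where a: "a = (k, al, D)" by (cases a)
 show ?case unfolding a comb_field_Cons corr_add[OF assms term_span.scale[OF normal_field_all] comb_field_all] corr_scale Cons by simp
qed

lemma wick_term_all: "wick_term Q lq : all_span" by (rule term_span.tm) simp

lemma corr_comb_field_one: "corr [comb_field b L p c z, wick_term Q lq] = comb_corr b L p c z Q lq"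
 using corr_comb_field[of "[]" "[wick_term Q lq]" b L p c z] by (simp add: wick_term_all comb_corr_def corr_normal_one[where z = z])

lemma expands_sum_list:
 "(!!x. x : set xs ==> expands b (K x)) ==> expands b (%p c z Q lq w. SUM x<-xs. K x p c z Q lq w)"
 by (induction xs) (simp_all add: expands_zero expands_add)

lemma expands_corr_comb:
 "expands b (%p c z Q lq w. corr [comb_field b L p c w, comb_field b L' p c z, wick_term Q lq])"
proof -
 have 1: "corr [comb_field b L p c w, F, wick_term Q lq] = (SUM x<-L. fst x * corr [normal_field b (fst (snd x)) (snd (snd x)) p c w, F, wick_term Q lq])"
  if "F : all_span" for F p c w Q lq
  using corr_comb_field[of "[]" "[F, wick_term Q lq]" b L p c w] that by (simp add: wick_term_all case_prod_unfold)
 have 2: "corr [F, comb_field b L' p c z, wick_term Q lq] = (SUM x<-L'. fst x * corr [F, normal_field b (fst (snd x)) (snd (snd x)) p c z, wick_term Q lq])"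
  if "F : all_span" for F p c z Q lq
  using corr_comb_field[of "[F]" "[wick_term Q lq]" b L' p c z] that by (simp add: wick_term_all case_prod_unfold)
 show ?thesis unfolding 1[OF comb_field_all] 2[OF normal_field_all] by (intro expands_sum_list expands_scale expands_corr_normal)
qed

text \<open>The identity is required in good charts only, where the normal-ordered fields have been
  analysed. Membership in the span, in all charts, is what allows the field to be replaced inside
  longer correlations.\<close>

definition normal_form :: "real => conf_field => normal_comb => bool" where
 "normal_form b X L \<longleftrightarrow> (ALL c z. chart_at c z --> X c z : wick_span {par c z}) &
   (ALL p c z Q lq. good_chart p c z --> valid_term (- {par c z}) Q lq -->
    corr [X c z, wick_term Q lq] = comb_corr b L p c z Q lq)"

lemma fock_field_in_span:
 assumes "fock_field X" "chart_at c z"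
 shows "X c z : wick_span {par c z}"
proof -
 have c: "par c analytic_on {z}" "Im (par c z) > 0" "deriv (par c) z ~= 0" using assms(2) chart_at_deriv[OF assms(2)] by (auto simp: chart_at_def)
 have "X c z : functionals {par c z}" using assms(1) by induction (insert c, auto intro: functionals.intros)
 thus ?thesis by (simp add: functionals_eq_wick_span)
qed

lemma slot_fun_normal:
 "normal_field b al {#} p c z = (%M. exp (al * mean_jet b c (0, 0) z + al\<^sup>2 * reg_green p c (z, z) / 2) * wick_exp al (factor_at c (0, 0) z) M)"
 "normal_field b 0 {#d#} p c z = (%M. wick_factor (factor_at c d z) M + mean_jet b c d z * wick_one M)"
proof -
 have z: "coeff_of [(0, q)] = (%x::factor. 0)" for q by (auto simp: coeff_of_def)
 have z': "coeff_of [] = (%x::factor. 0)" by (auto simp: coeff_of_def)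
 show "normal_field b al {#} p c z = (%M. exp (al * mean_jet b c (0, 0) z + al\<^sup>2 * reg_green p c (z, z) / 2) * wick_exp al (factor_at c (0, 0) z) M)"
  by (rule ext) (simp add: normal_field_def slot_fun_def normal_slot_def reg_term_def factor_at_def wick_exp_term bil_def reg_jet_def power2_eq_square mult.assoc)
 show "normal_field b 0 {#d#} p c z = (%M. wick_factor (factor_at c d z) M + mean_jet b c d z * wick_one M)"
  by (rule ext) (simp add: normal_field_def slot_fun_def normal_slot_def reg_term_def factor_at_def wick_one_term wick_factor_term bil_def
    contract_add[OF symm_self_cov] gmean_def wick_term_def z z')
qed

lemma modified_gff_normal: "modified_gff b c z = normal_field b 0 {#(0, 0)#} p c z"
 by (rule ext) (simp add: slot_fun_normal modified_gff_def factor_at_def mean_jet_def)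

text \<open>Differentiating (p - h)^2 = (p - u)^2 - s at z gives (p - h z) h'(z) = p - z. Hence the
  regular covariance on the diagonal is 2 ln C with C the conformal radius, and half the variance of
  the exponent produces the power of C in the vertex field.\<close>

lemma vertex_normal:
 assumes "good_chart p c z"
 shows "vertex b al c z = normal_field b al {#} p c z"
proof -
 let ?h = "par c"
 obtain s where s: "near z (%u. (p - ?h u)\<^sup>2 = (p - u)\<^sup>2 - s)" using assms by (auto simp: good_chart_def)
 have g: "chart_at c z" "p ~= z" "p ~= ?h z" "Im (?h z) > 0" "deriv ?h z ~= 0" "?h analytic_on {z}"
  using assms chart_at_deriv by (auto simp: good_chart_def chart_at_def)
 have d: "(?h has_field_derivative deriv ?h z) (at z)"
  using g(6) by (meson analytic_on_imp_differentiable_at DERIV_deriv_iff_field_differentiable singletonI)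
 have "((%u. (p - ?h u)\<^sup>2) has_field_derivative 2 * (p - ?h z) * - deriv ?h z) (at z)" by (auto intro!: derivative_eq_intros d)
 moreover have "((%u. (p - u)\<^sup>2 - s) has_field_derivative 2 * (p - z) * - 1) (at z)" by (auto intro!: derivative_eq_intros)
 hence "((%u. (p - ?h u)\<^sup>2) has_field_derivative 2 * (p - z) * - 1) (at z)"
  by (rule DERIV_cong_ev[THEN iffD1, rotated -1]) (insert s, auto elim: eventually_mono)
 ultimately have "2 * (p - ?h z) * - deriv ?h z = 2 * (p - z) * - 1" by (rule DERIV_unique)
 hence h: "(p - ?h z) * deriv ?h z = p - z" by (simp only: mult_minus_right mult_1_right neg_equal_iff_equal mult.assoc mult_cancel_left) simp
 have ne: "?h z ~= cnj (?h z)" by (rule upper_neq_cnj[OF g(4,4)])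
 define r where "r = conf_radius c z"
 have r: "r > 0" using ne g(5) by (simp add: r_def conf_radius_def)
 have "r = cmod (?h z - cnj (?h z)) / (cmod (p - z) / cmod (p - ?h z))"
  using h[symmetric] g by (simp add: r_def conf_radius_def norm_divide norm_mult)
 hence "ln r = ln (cmod (?h z - cnj (?h z))) - (ln (cmod (p - z)) - ln (cmod (p - ?h z)))" using ne g by (simp add: ln_div ln_mult)
 moreover have "2 * p - z - z = 2 * (p - z)" "2 * p - ?h z - ?h z = 2 * (p - ?h z)" by simp_all
 hence "ln (cmod (2 * p - z - z)) = ln 2 + ln (cmod (p - z))" "ln (cmod (2 * p - ?h z - ?h z)) = ln 2 + ln (cmod (p - ?h z))"
  using g by (simp_all only: norm_mult) (simp_all add: ln_mult)
 ultimately have rg: "reg_green p c (z, z) = 2 * of_real (ln r)" by (simp add: reg_green_def)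
 have "of_real r powr (al\<^sup>2) = exp (al\<^sup>2 * reg_green p c (z, z) / 2)" using r by (simp add: rg powr_def Ln_of_real)
 thus ?thesis unfolding slot_fun_normal by (intro ext) (simp add: vertex_def mean_jet_def factor_at_def r_def mult_ac flip: exp_add)
qed

text \<open>The derivative field is known through correlations only. Its one-point correlations are
  derivatives of a \<open>pair_corr\<close>, and \<open>jet_comb\<close> gives their coefficients
  independently of chart and point.\<close>

lemma is_field_deriv_normal_form:
 assumes "is_field_deriv j k X Y"
  and X: "!!p c u. good_chart p c u ==> X c u = normal_field b al D p c u"
 shows "normal_form b Y (merge_comb (jet_comb (j, k) [(1, al, D, 0, {#})]))" unfolding normal_form_def
proof (intro conjI allI impI)
 show "Y c z : wick_span {par c z}" if "chart_at c z" for c z using fock_field_in_span that assms(1) by (auto simp: is_field_deriv_def)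
 fix p c z Q lq assume A: "good_chart p c z" "valid_term (- {par c z}) Q lq"
 let ?T = "[(1, al, D, 0, {#})]"
 have "near z (%u. corr [X c u, wick_term Q lq] = pair_corr b ?T p c z Q lq u)"
  using good_chart_eventually[OF A(1)] by eventually_elim (simp add: X corr_normal_one[where z = z])
 hence "jet1 (j, k) (%u. corr [X c u, wick_term Q lq]) z = jet1 (j, k) (pair_corr b ?T p c z Q lq) z" by (rule jet_cong)
 also have "\<dots> = comb_corr b (merge_comb (jet_comb (j, k) ?T)) p c z Q lq" unfolding jet_pair_corr[OF A] by (rule pair_corr_diag[OF A(1)])
 also have "jet1 (j, k) (%u. corr [X c u, wick_term Q lq]) z = corr [Y c z, wick_term Q lq]"
 proof -
  have "wick_term Q lq : functionals (- {par c z})" unfolding functionals_eq_wick_span by (rule term_span.tm) (rule A(2))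
  moreover have "chart_at c z" using A(1) by (simp add: good_chart_def)
  ultimately show ?thesis using assms(1) unfolding is_field_deriv_def jet_def fst_conv snd_conv dz_wirt dzbar_wirt by metis
 qed
 finally show "corr [Y c z, wick_term Q lq] = comb_corr b (merge_comb (jet_comb (j, k) ?T)) p c z Q lq" .
qed

lemma valid_term_Int: "valid_term S Q lq ==> valid_term S' Q lq ==> valid_term (S \<inter> S') Q lq"
proof -
 have "valid_factor S q ==> valid_factor S' q ==> valid_factor (S \<inter> S') q" for q by (cases q) auto
 thus "valid_term S Q lq ==> valid_term S' Q lq ==> valid_term (S \<inter> S') Q lq" unfolding valid_term_def by blast
qed

lemma corr_two_normal_form:
 assumes X: "normal_form b X L" and Y: "normal_form b Y L'" and z: "good_chart p c z" and W: "valid_term (- {par c z}) Q lq"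
  and w: "near_ok p c z Q lq w" "par c w ~= par c z"
 shows "corr [X c w, Y c z, wick_term Q lq] = corr [comb_field b L p c w, comb_field b L' p c z, wick_term Q lq]"
proof -
 have c: "chart_at c z" "chart_at c w" "good_chart p c w" using z w by (auto simp: good_chart_def near_ok_def)
 let ?S = "- {par c w} \<inter> - {par c z}"
 have W': "wick_term Q lq : wick_span ?S" using w W by (intro term_span.tm[of "valid_term ?S"] valid_term_Int) (auto simp: near_ok_def)
 have "corr (take 0 [Y c z, wick_term Q lq] @ X c w # drop 0 [Y c z, wick_term Q lq]) =
   corr (take 0 [Y c z, wick_term Q lq] @ comb_field b L p c w # drop 0 [Y c z, wick_term Q lq])"
 proof (rule corr_replace[where Ss = "[{par c z}, ?S]" and x = "par c w"])
  show "list_all2 (%F S. F : wick_span S) [Y c z, wick_term Q lq] [{par c z}, ?S]" using Y W' c by (simp add: normal_form_def)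
  show "disjoint_sets_list [{par c z}, ?S]" by (auto simp: disjoint_sets_list_def nth_Cons')
  show "corr [X c w, wick_term P ls] = corr [comb_field b L p c w, wick_term P ls]" if "valid_term (- {par c w}) P ls" for P ls
   using X that c unfolding normal_form_def corr_comb_field_one by blast
 qed (insert X c w, auto simp: normal_form_def intro: comb_field_in_span)
 also have "\<dots> = corr (take 1 [comb_field b L p c w, wick_term Q lq] @ Y c z # drop 1 [comb_field b L p c w, wick_term Q lq])" by simp
 also have "\<dots> = corr (take 1 [comb_field b L p c w, wick_term Q lq] @ comb_field b L' p c z # drop 1 [comb_field b L p c w, wick_term Q lq])"
 proof (rule corr_replace[where Ss = "[{par c w}, ?S]" and x = "par c z"])
  show "list_all2 (%F S. F : wick_span S) [comb_field b L p c w, wick_term Q lq] [{par c w}, ?S]" using W' c by (simp add: comb_field_in_span)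
  show "disjoint_sets_list [{par c w}, ?S]" by (auto simp: disjoint_sets_list_def nth_Cons')
  show "corr [Y c z, wick_term P ls] = corr [comb_field b L' p c z, wick_term P ls]" if "valid_term (- {par c z}) P ls" for P ls
   using Y that z unfolding normal_form_def corr_comb_field_one by blast
 qed (insert Y c w, auto simp: normal_form_def intro: comb_field_in_span)
 finally show ?thesis by simp
qed

text \<open>The given OPE, whose coefficients are arbitrary Fock space fields, is compared with the
  expansion of the normal forms, both up to order 0. The difference of the two finite sums tends to
  0, so their coefficients of 1 agree in every correlation.\<close>

lemma ope_product_normal_form:
 assumes X: "normal_form b X L" and Y: "normal_form b Y L'" and Z: "is_ope_product X Y Z"
 shows "EX L. normal_form b Z L"
proof -
 obtain C where C: "has_ope X Y C" "C (0, 0, 0) = Z" using Z by (auto simp: is_ope_product_def)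
 obtain T where T: "expands_upto b 0 T (%p c z Q lq w. corr [comb_field b L p c w, comb_field b L' p c z, wick_term Q lq])"
  using expands_corr_comb unfolding expands_def by blast
 define L0 where "L0 = concat (map (%(i, L). if i = (0, 0, 0) then L else []) T)"
 have "normal_form b Z L0" unfolding normal_form_def
 proof (intro conjI allI impI)
  show "Z c z : wick_span {par c z}" if "chart_at c z" for c z
  proof -
   have "fock_field Z" using C unfolding has_ope_def by blast
   thus ?thesis using that by (rule fock_field_in_span)
  qed
  fix p c z Q lq assume A: "good_chart p c z" "valid_term (- {par c z}) Q lq"
  define I where "I = ope_indices C 0"
  have ch: "chart_at c z" using A(1) by (simp add: good_chart_def)
  have fin: "finite I" using C unfolding has_ope_def I_def by blast
  obtain ix where ix: "distinct ix" "set ix = I" using finite_distinct_list[OF fin] by blast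
  define T1 where "T1 = map (%i. (i, corr [C i c z, wick_term Q lq])) ix"
  define T2 where "T2 = map (%(i, L). (i, comb_corr b L p c z Q lq)) T"
  let ?x = "%w. corr [X c w, Y c z, wick_term Q lq]"
  have "wick_term Q lq : functionals (- {par c z})" unfolding functionals_eq_wick_span by (rule term_span.tm) (rule A(2))
  hence l1: "((%w. (?x w - (SUM i:I. corr [C i c z, wick_term Q lq] * ope_term i (w - z))) / of_real (cmod (w - z) powr 0)) \<longlongrightarrow> 0) (at z)"
   using C(1) ch unfolding has_ope_def I_def by blast
  have l2: "((%w. (corr [comb_field b L p c w, comb_field b L' p c z, wick_term Q lq] -
     ope_sum b T p c z Q lq w) / of_real (cmod (w - z) powr 0)) \<longlongrightarrow> 0) (at z)" using T A unfolding expands_upto_def by blast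
  \<comment> \<open>The difference of the two truncated expansions as one list of terms, as
    \<open>ope_terms_tendsto_0\<close> expects.\<close>
  define T3 where "T3 = T2 @ map (%(i, a). (i, - a)) T1"
  have s1: "(SUM i:I. corr [C i c z, wick_term Q lq] * f i) = (SUM (i, a)<-T1. a * f i)" for f
   unfolding T1_def ix(2)[symmetric] by (simp add: sum.distinct_set_conv_list[OF ix(1)] comp_def)
  have s2: "(SUM (i, L)<-T. comb_corr b L p c z Q lq * f i) = (SUM (i, a)<-T2. a * f i)" for f
   unfolding T2_def by (simp add: comp_def case_prod_unfold)
  have neg: "(SUM (i, a)<-map (%(i, a). (i, - a)) T1. a * f i) = - (SUM (i, a)<-T1. a * f i)" for f by (induction T1) auto
  have s3: "(SUM (i, a)<-T3. a * f i) = (SUM (i, a)<-T2. a * f i) - (SUM (i, a)<-T1. a * f i)" for f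
   unfolding T3_def map_append sum_list_append neg by simp
  have eq: "\<forall>\<^sub>F w in at z. ?x w = corr [comb_field b L p c w, comb_field b L' p c z, wick_term Q lq]"
  proof -
   have "\<forall>\<^sub>F w in at z. near_ok p c z Q lq w" using near_ok_eventually[OF A] unfolding eventually_at_filter by eventually_elim simp
   with pair_expectation_split[OF A(1)] show ?thesis by eventually_elim (rule corr_two_normal_form[OF X Y A], auto)
  qed
  have "((%w. SUM (i, a)<-T3. a * ope_term i (w - z)) \<longlongrightarrow> 0 - 0) (at z)"
  proof (rule Lim_transform_eventually[OF tendsto_diff[OF l1 l2]])
   have "\<forall>\<^sub>F w in at z. w ~= z" by (simp add: eventually_at_filter)
   with eq show "\<forall>\<^sub>F w in at z. (?x w - (SUM i:I. corr [C i c z, wick_term Q lq] * ope_term i (w - z))) / of_real (cmod (w - z) powr 0) -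
     (corr [comb_field b L p c w, comb_field b L' p c z, wick_term Q lq] -
     ope_sum b T p c z Q lq w) / of_real (cmod (w - z) powr 0) = (SUM (i, a)<-T3. a * ope_term i (w - z))"
    unfolding s1 s2 s3 by eventually_elim (simp del: ope_term.simps)
  qed
  hence "((%x. SUM (i, a)<-T3. a * ope_term i x) \<longlongrightarrow> 0) (at 0)"
   using LIM_offset_zero[of "%w. SUM (i, a)<-T3. a * ope_term i (w - z)" 0 z] by (simp del: ope_term.simps)
  hence "(SUM (i, a)<-T3. if i = (0, 0, 0) then a else 0) = 0" by (rule ope_terms_tendsto_0)
  moreover have "(SUM (i, a)<-T3. if i = (0, 0, 0) then a else 0) = (SUM (i, a)<-T3. a * (if i = (0, 0, 0) then 1 else 0))"
   by (intro arg_cong[of _ _ sum_list] map_cong) auto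
  ultimately have "(SUM i:I. corr [C i c z, wick_term Q lq] * (if i = (0, 0, 0) then 1 else 0)) =
    (SUM (i, L)<-T. comb_corr b L p c z Q lq * (if i = (0, 0, 0) then 1 else 0))"
   using s3 unfolding s1 s2 by simp
  moreover have "(SUM (i, L)<-T. comb_corr b L p c z Q lq * (if i = (0, 0, 0) then 1 else 0)) = comb_corr b L0 p c z Q lq"
   unfolding L0_def by (induction T) auto
  moreover have "(SUM i:I. corr [C i c z, wick_term Q lq] * (if i = (0, 0, 0) then 1 else 0)) = corr [Z c z, wick_term Q lq]"
  proof (cases "(0, 0, 0) : I")
   case True
   thus ?thesis using fin C(2) by (simp add: sum.delta if_distrib[of "%a. _ * a"] cong: if_cong)
  next
   \<comment> \<open>The index (0, 0, 0) has order 0 and passes the truncation, so it can be missing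
     only because its coefficient field is identically 0.\<close>
   case False
   hence "Z = (%c z M. 0)" using C(2) by (auto simp: I_def ope_indices_def)
   hence "corr [Z c z, wick_term Q lq] = 0" using corr_scale[of "[]" 0 "%M. 0" "[wick_term Q lq]"] by simp
   thus ?thesis using False by (auto intro!: sum.neutral)
  qed
  ultimately show "corr [Z c z, wick_term Q lq] = comb_corr b L0 p c z Q lq" by simp
 qed
 thus ?thesis ..
qed

text \<open>The generators are covered by \<open>modified_gff_normal\<close>,
  \<open>vertex_normal\<close> and the derivative formulas, sums by appending lists. Only OPE
  products need the comparison of expansions.\<close>

theorem ope_family_normal_form:
 assumes "X : ope_family b"
 shows "EX L. normal_form b X L" using assms
proof induction
 case one
 have w: "wick_one = normal_field b 0 {#} p c z" for p c z
  by (rule ext) (simp add: slot_fun_normal wick_exp_term wick_one_term wick_term_def coeff_of_def[abs_def] fun_eq_iff)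
 have "normal_form b (%c z. wick_one) [(1, 0, {#})]" unfolding normal_form_def
 proof (intro conjI allI impI)
  show "wick_one : wick_span {par c z}" if "chart_at c z" for c z using normal_field_in_span[OF that] w by metis
  show "corr [wick_one, wick_term Q lq] = comb_corr b [(1, 0, {#})] p c z Q lq" for p c z Q lq
   by (simp add: w[of p c z] comb_corr_def corr_normal_one[where z = z])
 qed
 thus ?case ..
next
 case (gff j k Y)
 show ?case by (rule exI, rule is_field_deriv_normal_form[OF gff modified_gff_normal])
next
 case (vertex j k al Y)
 show ?case by (rule exI, rule is_field_deriv_normal_form[OF vertex vertex_normal])
next
 case (add X Y)
 then obtain L L' where L: "normal_form b X L" "normal_form b Y L'" by blast
 have "normal_form b (%c z M. X c z M + Y c z M) (L @ L')" unfolding normal_form_def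
 proof (intro conjI allI impI)
  show "(%M. X c z M + Y c z M) : wick_span {par c z}" if "chart_at c z" for c z using L that by (intro term_span.add) (auto simp: normal_form_def)
  fix p c z Q lq assume A: "good_chart p c z" "valid_term (- {par c z}) Q lq"
  hence "X c z : all_span" "Y c z : all_span" using L by (auto simp: normal_form_def good_chart_def intro!: wick_span_all)
  thus "corr [%M. X c z M + Y c z M, wick_term Q lq] = comb_corr b (L @ L') p c z Q lq"
   using corr_add[of "[]" "[wick_term Q lq]" "X c z" "Y c z"] L A by (simp add: normal_form_def wick_term_all)
 qed
 thus ?case ..
next
 case (scale X k)
 then obtain L where L: "normal_form b X L" by blast
 have "normal_form b (%c z M. k * X c z M) (comb_scale k L)" unfolding normal_form_def
 proof (intro conjI allI impI)
  show "(%M. k * X c z M) : wick_span {par c z}" if "chart_at c z" for c z using L that by (intro term_span.scale) (auto simp: normal_form_def)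
  fix p c z Q lq assume A: "good_chart p c z" "valid_term (- {par c z}) Q lq"
  thus "corr [%M. k * X c z M, wick_term Q lq] = comb_corr b (comb_scale k L) p c z Q lq"
   using corr_scale[of "[]" k "X c z" "[wick_term Q lq]"] L by (simp add: normal_form_def)
 qed
 thus ?case ..
next
 case (ope X Y Z)
 thus ?case using ope_product_normal_form by blast
qed

section \<open>Flows\<close>

text \<open>The flow of \<open>\<kappa> / (p - \<zeta>)\<close> at time t is \<open>flow_map p (\<kappa> t)\<close>; it satisfies
 \<open>(p - flow_map p s u)\<^sup>2 = (p - u)\<^sup>2 - 2 s\<close>.\<close>

definition flow_map :: "complex => complex => complex => complex" where
 "flow_map p s u = p - (p - u) * exp (Ln (1 - 2 * s / (p - u)\<^sup>2) / 2)"

text \<open>The logarithm of the u-derivative of the flow map, which is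
  \<open>1 - 2 s / (p - u)\<^sup>2\<close> to the power -1/2, on the branch that vanishes at s =
  0.\<close>

definition flow_log :: "complex => complex => complex => complex" where
 "flow_log p s u = - Ln (1 - 2 * s / (p - u)\<^sup>2) / 2"

definition moved :: "complex => complex => chart" where
 "moved p s = \<lparr>par = flow_map p s, lg = flow_log p s\<rparr>"

definition small_time :: "complex => complex => complex => bool" where
 "small_time p s u \<longleftrightarrow> u ~= p & 1 - 2 * s / (p - u)\<^sup>2 ~: \<real>\<^sub>\<le>\<^sub>0"

lemma moved_0: "moved p 0 = id_chart" by (simp add: moved_def id_chart_def flow_map_def flow_log_def fun_eq_iff)

lemma flow_map_0 [simp]: "flow_map p 0 u = u" by (simp add: flow_map_def)

lemma small_time_0 [simp]: "small_time p 0 u \<longleftrightarrow> u ~= p" by (simp add: small_time_def)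

lemma small_time_bound:
 assumes "4 * cmod s < cmod (p - u) ^ 2"
 shows "small_time p s u"
proof -
 have n: "u ~= p" using assms by auto
 hence "cmod (2 * s / (p - u)\<^sup>2) < 1/2" using assms by (simp add: norm_divide norm_power norm_mult divide_simps)
 hence "Re (2 * s / (p - u)\<^sup>2) < 1" using complex_Re_le_cmod[of "2 * s / (p - u)\<^sup>2"] by linarith
 hence "Re (1 - 2 * s / (p - u)\<^sup>2) > 0" by simp
 thus ?thesis using n complex_nonpos_Reals_iff unfolding small_time_def by force
qed

lemma flow_map_neq: "u ~= p ==> flow_map p s u ~= p" by (simp add: flow_map_def)

lemma flow_map_square:
 assumes "small_time p s u"
 shows "(p - flow_map p s u)\<^sup>2 = (p - u)\<^sup>2 - 2 * s"
proof -
 define w where "w = 1 - 2 * s / (p - u)\<^sup>2"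
 have w: "w ~= 0" "u ~= p" using assms by (auto simp: small_time_def w_def)
 have "(exp (Ln w / 2))\<^sup>2 = w" using w by (simp add: power2_eq_square exp_add[symmetric])
 hence "(p - flow_map p s u)\<^sup>2 = (p - u)\<^sup>2 * w" by (simp add: flow_map_def w_def power_mult_distrib)
 also have "\<dots> = (p - u)\<^sup>2 - 2 * s" using w(2) by (simp add: w_def right_diff_distrib)
 finally show ?thesis .
qed

lemma flow_map_deriv:
 assumes "small_time p s u"
 shows "(flow_map p s has_field_derivative exp (flow_log p s u)) (at u)"
  and "((%s. flow_map p s u) has_field_derivative 1 / (p - flow_map p s u)) (at s)"
proof -
 define w where "w = 1 - 2 * s / (p - u)\<^sup>2"
 \<comment> \<open>E is the principal square root of w, and p - \<open>flow_map p s u\<close> = (p -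
   u) E.\<close>
 define E where "E = exp (Ln w / 2)"
 have w: "w ~: \<real>\<^sub>\<le>\<^sub>0" "p - u ~= 0" "w ~= 0" using assms by (auto simp: small_time_def w_def)
 have E: "E * E = w" "E ~= 0" using w by (simp_all add: E_def exp_add[symmetric])
 have e: "exp (flow_log p s u) = 1 / E"
 proof -
  have "flow_log p s u = - (Ln w / 2)" by (simp add: flow_log_def w_def)
  thus ?thesis by (simp only: exp_minus E_def inverse_eq_divide)
 qed
 have chain: "((%x. exp (Ln (f x) / 2)) has_field_derivative E * (1 / w * d / 2)) (at x)"
  if "(f has_field_derivative d) (at x)" "f x = w" for f d x
 proof -
  have "(Ln has_field_derivative 1 / w) (at (f x))" using has_field_derivative_Ln[OF w(1)] that(2) by (simp add: divide_inverse)
  from DERIV_cdivide[OF DERIV_chain2[OF this that(1)], of 2]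
  have "((%x. Ln (f x) / 2) has_field_derivative 1 / w * d / 2) (at x)" .
  from DERIV_chain2[OF DERIV_exp this] show ?thesis by (simp add: that(2) E_def)
 qed
 have "((%u. (p - u)\<^sup>2) has_field_derivative - 2 * (p - u)) (at u)" by (auto intro!: derivative_eq_intros)
 from DERIV_divide[OF DERIV_const[of "2 * s"] this]
 have "((%u. 1 - 2 * s / (p - u)\<^sup>2) has_field_derivative 0 - (0 * (p - u)\<^sup>2 - 2 * s * (- 2 * (p - u))) / ((p - u)\<^sup>2 * (p - u)\<^sup>2)) (at u)"
  using w(2) by (intro DERIV_diff DERIV_const) simp
 moreover define D where "D = 0 - (0 * (p - u)\<^sup>2 - 2 * s * (- 2 * (p - u))) / ((p - u)\<^sup>2 * (p - u)\<^sup>2)"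
 ultimately have c1: "((%u. exp (Ln (1 - 2 * s / (p - u)\<^sup>2) / 2)) has_field_derivative E * (1 / w * D / 2)) (at u)"
  by (intro chain) (simp_all add: w_def)
 have D: "D * (p - u) = 2 * (w - 1)"
 proof -
  have "(0 - (0 * x\<^sup>2 - 2 * s * (- 2 * x)) / (x\<^sup>2 * x\<^sup>2)) * x = - (2 * (2 * s / x\<^sup>2))" if "x ~= 0" for x
   using that by (simp add: power2_eq_square)
  from this[OF w(2)] show ?thesis by (simp add: D_def w_def)
 qed
 have "((%u. p - u) has_field_derivative 0 - 1) (at u)" by (intro DERIV_diff DERIV_const DERIV_ident)
 from DERIV_diff[OF DERIV_const[of p] DERIV_mult[OF this c1]]
 have "(flow_map p s has_field_derivative 0 - ((0 - 1) * E + E * (1 / w * D / 2) * (p - u))) (at u)" by (simp add: flow_map_def[abs_def] E_def w_def)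
 moreover have "0 - ((0 - 1) * E + E * (1 / w * D / 2) * (p - u)) = E - E / w * (D * (p - u)) / 2" by simp
 moreover have "\<dots> = E / w" using w(3) unfolding D by (simp add: field_simps)
 moreover have "\<dots> = 1 / E" using E by (simp flip: E(1))
 ultimately show "(flow_map p s has_field_derivative exp (flow_log p s u)) (at u)" unfolding e by metis
 have "((%s. 1 - 2 * s / (p - u)\<^sup>2) has_field_derivative 0 - 2 * 1 / (p - u)\<^sup>2) (at s)"
  by (intro DERIV_diff DERIV_const DERIV_cdivide DERIV_cmult DERIV_ident)
 from DERIV_diff[OF DERIV_const[of p] DERIV_cmult[OF chain[OF this], of "p - u"]]
 have "((%s. flow_map p s u) has_field_derivative 0 - (p - u) * (E * (1 / w * (0 - 2 * 1 / (p - u)\<^sup>2) / 2))) (at s)"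
  by (simp add: flow_map_def[abs_def] w_def)
 moreover have "0 - (p - u) * (E * (1 / w * (0 - 2 * 1 / (p - u)\<^sup>2) / 2)) = 1 / ((p - u) * E)"
 proof -
  have "0 - x * (E * (1 / (E * E) * (0 - 2 * 1 / x\<^sup>2) / 2)) = 1 / (x * E)" if "x ~= 0" for x
   using that E(2) by (simp add: field_simps power2_eq_square)
  from this[OF w(2)] show ?thesis by (simp add: E(1))
 qed
 moreover have "p - flow_map p s u = (p - u) * E" by (simp add: flow_map_def E_def w_def)
 ultimately show "((%s. flow_map p s u) has_field_derivative 1 / (p - flow_map p s u)) (at s)" by simp
qed

lemma small_time_nhds:
 assumes "small_time p s u"
 shows "near u (%v. small_time p s v)"
proof -
 have u: "u ~= p" "1 - 2 * s / (p - u)\<^sup>2 : - \<real>\<^sub>\<le>\<^sub>0" using assms by (auto simp: small_time_def)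
 have "near u (%v. v ~= p)" using u eventually_nhds_in_open[of "- {p}" u] by auto
 moreover have "near u (%v. 1 - 2 * s / (p - v)\<^sup>2 : - \<real>\<^sub>\<le>\<^sub>0)"
  by (rule near_isCont[where f = "%v. 1 - 2 * s / (p - v)\<^sup>2", OF _ eventually_nhds_in_open[OF _ u(2)]])
    (insert u, auto intro!: continuous_intros)
 ultimately show ?thesis by eventually_elim (simp add: small_time_def)
qed

lemma flow_map_analytic: "small_time p s u ==> flow_map p s analytic_on {u}"
 and flow_log_analytic: "small_time p s u ==> flow_log p s analytic_on {u}"
 unfolding flow_map_def[abs_def] flow_log_def[abs_def] small_time_def by (auto intro!: analytic_intros)

lemma moved_good:
 assumes "small_time p s u" "Im (flow_map p s u) > 0"
 shows "good_chart p (moved p s) u"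
proof -
 have d: "near u (%v. small_time p s v)" by (rule small_time_nhds[OF assms(1)])
 have "near u (%v. exp (flow_log p s v) = deriv (flow_map p s) v)" using d by eventually_elim (rule DERIV_imp_deriv[OF flow_map_deriv(1), symmetric])
 moreover have "near u (%v. (p - flow_map p s v)\<^sup>2 = (p - v)\<^sup>2 - 2 * s)" using d by eventually_elim (rule flow_map_square)
 moreover have "u ~= p" using assms by (simp add: small_time_def)
 ultimately show ?thesis using assms flow_map_neq[of u p s] flow_map_analytic flow_log_analytic
  unfolding good_chart_def chart_at_def moved_def chart.simps by auto
qed

lemma finite_separation:
 fixes p :: complex
 assumes "finite S" "p ~: S"
 shows "EX r>0. ALL q:S. r < cmod (p - q)"
proof -
 obtain d where "d > 0" "!!q. q : S ==> d <= dist p q" using finite_set_avoid[OF assms(1), of p] assms(2) by metis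
 thus ?thesis by (intro exI[of _ "d / 2"]) (force simp: dist_norm)
qed

lemma flow_exists:
 assumes "finite S" "p ~: S" "cmod k = 1"
 shows "local_flow (%w. k * (1 / (p - w))) S (%t. flow_map p (k * of_real t))"
proof -
 obtain r where r: "r > 0" "!!q. q : S ==> r < cmod (p - q)" using finite_separation[OF assms(1,2)] by blast
 let ?U = "{q. r < cmod (p - q)}" and ?V = "- {p}"
 have o: "open ?U" by (intro open_Collect_less continuous_intros)
 have st: "small_time p (k * of_real t) q" if "q : ?U" "\<bar>t\<bar> < r\<^sup>2 / 4" for q t
 proof (rule small_time_bound)
  have "4 * cmod (k * of_real t) < r\<^sup>2" using that assms(3) by (simp add: norm_mult)
  also have "\<dots> <= cmod (p - q) ^ 2" using that r by (intro power_mono) auto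
  finally show "4 * cmod (k * of_real t) < (cmod (p - q))\<^sup>2" .
 qed
 show ?thesis unfolding local_flow_def
 proof (rule exI[of _ "r\<^sup>2 / 4"], rule conjI[rotated], rule exI[of _ ?U], rule exI[of _ ?V], intro conjI ballI allI impI)
  show "(%w. k * (1 / (p - w))) holomorphic_on ?V" by (auto intro!: holomorphic_intros)
  show "S <= ?U" using r by auto
  fix q assume q: "q : ?U"
  hence "q ~= p" using r by auto
  show "flow_map p (k * of_real 0) q = q" by simp
  fix t :: real assume t: "\<bar>t\<bar> < r\<^sup>2 / 4"
  show "flow_map p (k * of_real t) q : ?V" using flow_map_neq[OF \<open>q ~= p\<close>] by simp
  have "((%s. flow_map p (k * s) q) has_field_derivative 1 / (p - flow_map p (k * of_real t) q) * k) (at (of_real t))"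
   by (rule DERIV_chain2[where f = "%s. flow_map p s q" and g = "%s. k * s", OF flow_map_deriv(2)[OF st[OF q t]]])
     (auto intro!: derivative_eq_intros)
  hence "((%s. flow_map p (k * of_real s) q) has_vector_derivative 1 / (p - flow_map p (k * of_real t) q) * k) (at t)"
   by (rule has_vector_derivative_real_field)
  thus "((%s. flow_map p (k * of_real s) q) has_vector_derivative k * (1 / (p - flow_map p (k * of_real t) q))) (at t)" by (simp add: mult.commute)
 qed (use r o in auto)
qed

text \<open>Division is total, so the vector field has a value at p and \<open>local_flow\<close>
  does not visibly exclude p from its domain. Continuity at p, multiplied by p - w, would force k =
  0.\<close>

lemma holomorphic_pole_notin:
 assumes "open V" "(%w. k * (1 / (p - w))) holomorphic_on V" "k ~= 0"
 shows "p ~: V"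
proof
 assume p: "p : V"
 let ?f = "%w. k * (1 / (p - w))"
 have "isCont ?f p" using holomorphic_on_imp_continuous_on[OF assms(2)] continuous_on_eq_continuous_at[OF assms(1)] p by blast
 hence "(?f \<longlongrightarrow> ?f p) (at p)" by (simp only: isCont_def)
 from tendsto_mult[OF tendsto_diff[OF tendsto_const tendsto_ident_at] this]
 have "((%w. (p - w) * ?f w) \<longlongrightarrow> (p - p) * ?f p) (at p)" .
 moreover have "\<forall>\<^sub>F w in at p. (p - w) * ?f w = k" by (simp add: eventually_at_filter)
 ultimately have "((%w. k) \<longlongrightarrow> (p - p) * ?f p) (at p)" by (rule Lim_transform_eventually)
 thus False using assms(3) by (simp add: tendsto_const_iff)
qed

text \<open>Along any flow \<open>(p - \<psi>\<^sub>t)\<^sup>2 + 2 \<kappa> t\<close> is constant. This determines \<open>\<psi>\<^sub>t\<close> up to the sign of the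
 square root, which is fixed by continuity.\<close>

lemma flow_unique:
 assumes fl: "local_flow (%ze. k * (1 / (p - ze))) S psi" and x: "x : S" and k: "cmod k = 1"
 shows "near 0 (%t. near x (%u. psi t u = flow_map p (k * of_real t) u))"
  and "x ~= p"
proof -
 obtain e U V where f: "e > 0" "open U" "S <= U" "open V" "(%ze. k * (1 / (p - ze))) holomorphic_on V"
  "!!q. q : U ==> psi 0 q = q"
  "!!q t. q : U ==> \<bar>t\<bar> < e ==> psi t q : V"
  "!!q t. q : U ==> \<bar>t\<bar> < e ==> ((%s. psi s q) has_vector_derivative k * (1 / (p - psi t q))) (at t)"
  using fl unfolding local_flow_def by (elim exE conjE) blast
 have "k ~= 0" using k by auto
 hence pV: "p ~: V" using holomorphic_pole_notin f by blast
 have ne: "psi t q ~= p" if "q : U" "\<bar>t\<bar> < e" for t q using f(7)[OF that] pV by auto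
 have xU: "x : U" using f x by auto
 show xp: "x ~= p" using ne[OF xU, of 0] f(1) f(6)[OF xU] by auto
 define r where "r = cmod (p - x) / 2"
 have r: "r > 0" "cmod (p - x) > r" using xp by (auto simp: r_def)
 \<comment> \<open>For times below r^2/4 and |p - q| > r the quantity 2 k t / (p - q)^2 has modulus
   below 1/2, so the square root stays off its cut.\<close>
 define d where "d = min e (r\<^sup>2 / 4)"
 have d: "d > 0" using f r by (simp add: d_def)
 have main: "psi t q = flow_map p (k * of_real t) q" if q: "q : U" "cmod (p - q) > r" and t: "\<bar>t\<bar> < d" for q t
 proof -
  have qp: "q ~= p" using q r by auto
  define y where "y s = (p - psi s q) / (p - q)" for s
  have st: "4 * cmod (k * of_real s) < cmod (p - q) ^ 2" if "\<bar>s\<bar> < d" for s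
  proof -
   have "4 * cmod (k * of_real s) < r\<^sup>2" using that k by (simp add: norm_mult d_def)
   also have "\<dots> <= cmod (p - q) ^ 2" using q r by (intro power_mono) auto
   finally show ?thesis .
  qed
  have sq: "(p - psi s q)\<^sup>2 + 2 * k * of_real s = (p - q)\<^sup>2" if "s : {-d<..<d}" for s
  proof -
   have "((%s. (p - psi s q)\<^sup>2 + 2 * k * of_real s) has_vector_derivative 0) (at s within {-d<..<d})" if "s : {-d<..<d}" for s
   proof -
    have s: "\<bar>s\<bar> < e" using that by (auto simp: d_def)
    have "((%s. p - psi s q) has_vector_derivative 0 - k * (1 / (p - psi s q))) (at s)"
     by (intro has_vector_derivative_diff has_vector_derivative_const f(8)[OF q(1) s])
    from has_vector_derivative_mult[OF this this]
    have "((%s. (p - psi s q) * (p - psi s q)) has_vector_derivative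
      (p - psi s q) * (0 - k * (1 / (p - psi s q))) + (0 - k * (1 / (p - psi s q))) * (p - psi s q)) (at s)" .
    moreover have "A * (0 - k * (1 / A)) + (0 - k * (1 / A)) * A = - 2 * k" if "A ~= 0" for A by (simp add: that)
    hence "(p - psi s q) * (0 - k * (1 / (p - psi s q))) + (0 - k * (1 / (p - psi s q))) * (p - psi s q) = - 2 * k" using ne[OF q(1) s] by simp
    ultimately have "((%s. (p - psi s q) * (p - psi s q)) has_vector_derivative - 2 * k) (at s)" by (simp only:)
    moreover have "((%s. 2 * k * of_real s) has_vector_derivative 2 * k) (at s)"
     by (rule has_vector_derivative_real_field) (auto intro!: derivative_eq_intros)
    ultimately have "((%s. (p - psi s q) * (p - psi s q) + 2 * k * of_real s) has_vector_derivative - 2 * k + 2 * k) (at s)"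
     by (rule has_vector_derivative_add)
    thus ?thesis unfolding power2_eq_square by (simp add: has_vector_derivative_at_within)
   qed
   then obtain c where c: "!!s. s : {-d<..<d} ==> (p - psi s q)\<^sup>2 + 2 * k * of_real s = c"
    using has_vector_derivative_zero_constant[of "{-d<..<d}" "%s. (p - psi s q)\<^sup>2 + 2 * k * of_real s"] by auto
   show ?thesis using c[OF that] c[of 0] d f(6)[OF q(1)] by simp
  qed
  have y2: "(y s)\<^sup>2 = 1 - 2 * (k * of_real s) / (p - q)\<^sup>2" if "s : {-d<..<d}" for s
  proof -
   have "(p - psi s q)\<^sup>2 = (p - q)\<^sup>2 - 2 * k * of_real s" using sq[OF that] by (simp add: algebra_simps)
   thus ?thesis unfolding y_def power_divide using qp by (simp add: diff_divide_distrib mult.assoc)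
  qed
  \<comment> \<open>The square of y has positive real part, so y never meets the imaginary axis. As
    y 0 = 1, its real part stays positive, which selects the principal root.\<close>
  have Re0: "Re (y s) ~= 0" if "s : {-d<..<d}" for s
  proof
   assume "Re (y s) = 0"
   hence "Re ((y s)\<^sup>2) <= 0" by (simp add: power2_eq_square)
   moreover have "cmod (2 * (k * of_real s) / (p - q)\<^sup>2) < 1"
   proof -
    have "4 * cmod (k * of_real s) < cmod (p - q) ^ 2" using that by (intro st) auto
    hence "2 * cmod (k * of_real s) < cmod (p - q) ^ 2" using norm_ge_zero[of "k * of_real s"] by linarith
    thus ?thesis using qp by (simp add: norm_divide norm_power norm_mult divide_simps)
   qed
   hence "Re (2 * (k * of_real s) / (p - q)\<^sup>2) < 1" using complex_Re_le_cmod[of "2 * (k * of_real s) / (p - q)\<^sup>2"] by linarith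
   ultimately show False using y2[OF that] by simp
  qed
  have cont: "continuous_on {-d<..<d} (%s. Re (y s))"
  proof -
   have "continuous_on {-d<..<d} (%s. psi s q)"
    by (intro continuous_at_imp_continuous_on ballI has_vector_derivative_continuous[OF f(8)[OF q(1)]]) (auto simp: d_def)
   thus ?thesis unfolding y_def using qp by (intro continuous_intros) auto
  qed
  have pos: "Re (y t) > 0"
  proof (rule ccontr)
   assume "\<not> Re (y t) > 0"
   moreover have "y 0 = 1" using f(6)[OF q(1)] qp by (simp add: y_def)
   moreover have "connected ((%s. Re (y s)) ` {-d<..<d})" by (intro connected_continuous_image cont) simp
   hence "is_interval ((%s. Re (y s)) ` {-d<..<d})" by (simp add: is_interval_connected_1)
   moreover have "t : {-d<..<d}" "0 : {-d<..<d}" using t d by auto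
   ultimately have "0 : (%s. Re (y s)) ` {-d<..<d}" unfolding is_interval_1 by (smt (verit) imageI one_complex.sel(1))
   thus False using Re0 by auto
  qed
  have tI: "t : {-d<..<d}" using t by auto
  define w where "w = 1 - 2 * (k * of_real t) / (p - q)\<^sup>2"
  have "w ~= 0" using small_time_bound[OF st[OF t]] by (auto simp: small_time_def w_def)
  have "y t = csqrt w" using csqrt_unique[of "y t" w] y2[OF tI] pos by (simp add: w_def)
  also have "\<dots> = exp (Ln w / 2)" using \<open>w ~= 0\<close> by (simp add: csqrt_exp_Ln)
  finally have "p - psi t q = (p - q) * exp (Ln w / 2)" using qp by (simp add: y_def field_simps)
  thus ?thesis by (simp add: flow_map_def w_def algebra_simps)
 qed
 have "near x (%u. u : U & u : {q. r < cmod (p - q)})"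
  using f(2) xU r by (intro eventually_conj eventually_nhds_in_open open_Collect_less continuous_intros) auto
 thus "near 0 (%t. near x (%u. psi t u = flow_map p (k * of_real t) u))"
  unfolding eventually_nhds_metric[of _ "0::real"] by (intro exI[of _ d] conjI allI impI d) (auto elim!: eventually_mono simp: main dist_norm)
qed

lemma dd_jet_commute: "smooth f x ==> dd e (jet L d f) x = jet L d (dd e f) x"
proof -
 assume f: "smooth f x"
 have "near x (%y. dd e ((wirt \<i> L ^^ snd d) f) y = (wirt \<i> L ^^ snd d) (dd e f) y)"
  using smooth_near[OF f] by eventually_elim (rule dd_wirt_pow_commute)
 thus ?thesis by (simp add: jet_def dd_wirt_pow_commute[where s' = "- \<i>"] smooth_wirt_pow f wirt_pow_cong)
qed

abbreviation jet2 :: "nat * nat => nat * nat => (complex * complex => complex) => complex * complex => complex" where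
 "jet2 d e f \<equiv> jet in1 d (jet in2 e f)"

lemma jet2_cong: "near x (%w. f w = g w) ==> jet2 d e f x = jet2 d e g x" by (rule jet_cong[OF eventually_jet_cong])

lemma jet2_add:
 assumes "smooth f x" "smooth g x"
 shows "jet2 d e (%w. f w + g w) x = jet2 d e f x + jet2 d e g x"
proof -
 have "near x (%w. jet in2 e (%w. f w + g w) w = jet in2 e f w + jet in2 e g w)"
  using smooth_near[OF assms(1)] smooth_near[OF assms(2)] by eventually_elim (rule jet_add)
 thus ?thesis by (simp add: jet_cong jet_add smooth_jet assms)
qed

lemma jet2_scale:
 assumes "smooth f x"
 shows "jet2 d e (%w. c * f w) x = c * jet2 d e f x"
proof -
 have "near x (%w. jet in2 e (%w. c * f w) w = c * jet in2 e f w)" using smooth_near[OF assms(1)] by eventually_elim (rule jet_scale)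
 thus ?thesis by (simp add: jet_cong jet_scale smooth_jet assms)
qed

lemma jet2_product:
 assumes "smooth f x" "smooth g y"
 shows "jet2 d e (%w. f (fst w) * g (snd w)) (x, y) = jet1 d f x * jet1 e g y"
proof -
 have "smooth (%w::complex* complex. f (fst w)) (x, y)" "smooth (%w::complex* complex. g (snd w)) (x, y)"
  using smooth_affine[OF assms(1) bl_fst, of "(x, y)" 0] smooth_affine[OF assms(2) bl_snd, of "(x, y)" 0] by simp_all
 from jet_jet_slice[OF smooth.mult[OF this], of d e, symmetric]
 have "jet2 d e (%w. f (fst w) * g (snd w)) (x, y) = jet1 d (%u. jet1 e g y * f u) x" by (simp add: jet_scale[OF assms(2)] mult.commute)
 thus ?thesis by (simp add: jet_scale[OF assms(1)])
qed

type_synonym moving_pair = "complex * complex * real"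

abbreviation at_time :: "real => complex * complex => moving_pair" where
 "at_time t w \<equiv> (fst w, snd w, t)"

lemma bl_at_time: "bounded_linear (at_time 0)" by (intro bounded_linear_Pair bounded_linear_fst bounded_linear_snd bounded_linear_zero)

lemma at_time_affine: "at_time t w = at_time 0 w + (0, 0, t)" by simp

lemma eventually_at_time0:
 assumes "eventually P (nhds (x, y, t))"
 shows "near (x, y) (%w. P (at_time t w))"
proof -
 have "isCont (at_time t) (x, y)" by (auto intro!: continuous_intros)
 from near_isCont[OF this, of P] show ?thesis using assms by simp
qed

lemma eventually_at_time:
 assumes "eventually P (nhds (x, y, 0))"
 shows "near (0::real) (%t. near (x, y) (%w. P (at_time t w)))"
proof -
 have "near (x, y, 0::real) (%v. eventually P (nhds v))" using assms by (simp add: eventually_eventually)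
 hence "near (0::real) (%t. eventually P (nhds (x, y, t)))" by (rule near_isCont[where f = "%t. (x, y, t)", rotated]) (auto intro!: continuous_intros)
 thus ?thesis by eventually_elim (rule eventually_at_time0)
qed

lemma jet2_at_time:
 assumes "smooth F (x, y, t)"
 shows "jet2 d e (%w. F (at_time t w)) (x, y) = jet (%h. (h, 0, 0)) d (jet (%h. (0, h, 0)) e F) (x, y, t)"
proof -
 have 1: "jet L d (%w. f (at_time t w)) w = jet (%h. at_time 0 (L h)) d f (at_time t w)"
  if "smooth f (at_time t w)" for f L d w using jet_affine[OF _ bl_at_time, of f w "(0, 0, t)" L d] that unfolding at_time_affine[symmetric] .
 have "near (x, y) (%w. jet in2 e (%w. F (at_time t w)) w = jet (%h. (0, h, 0)) e F (at_time t w))"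
  using eventually_at_time0[OF smooth_near[OF assms]] by eventually_elim (simp add: 1)
 thus ?thesis using 1[of "jet (%h. (0, h, 0)) e F" "(x, y)" in1 d] assms by (simp add: jet_cong smooth_jet)
qed

text \<open>The covariances at all times are point derivatives of one function F, smooth jointly in
  the two points and the time. The time derivative therefore commutes with the point derivatives and
  may be computed first.\<close>

lemma jet2_time_derivative:
 assumes F: "smooth F (x, y, 0)" and dF: "near (x, y) (%w. dd (0, 0, 1) F (at_time 0 w) = Xi w)"
 shows "((%t. jet2 d e (%w. F (at_time t w)) (x, y)) has_vector_derivative jet2 d e Xi (x, y)) (at 0)"
proof -
 let ?G = "jet (%h. (h, 0, 0)) d (jet (%h. (0, h, 0)) e F)"
 have sG: "smooth ?G (x, y, 0)" by (intro smooth_jet F)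
 have "near (0::real) (%t. smooth F (x, y, t))" by (rule near_isCont[where f = "%t. (x, y, t)", OF _ smooth_near])
    (insert F, auto intro!: continuous_intros)
 hence ev: "near (0::real) (%t. ?G (x, y, t) = jet2 d e (%w. F (at_time t w)) (x, y))" by eventually_elim (simp add: jet2_at_time)
 have "((%t. (x, y, t)) has_derivative (%h. (0, 0, h))) (at (0::real))" by (auto intro!: derivative_eq_intros)
 from has_derivative_compose[OF this smooth_has_derivative[OF sG]]
 have "((%t. ?G (x, y, t)) has_derivative (%h. dd (0, 0, h) ?G (x, y, 0))) (at 0)" .
 moreover have "(%h. dd (0, 0, h) ?G (x, y, 0)) = (%h. h *\<^sub>R dd (0, 0, 1) ?G (x, y, 0))"
 proof
  fix h :: real
  have v: "(0, 0, h) = h *\<^sub>R (0 :: complex, 0 :: complex, 1 :: real)" by simp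
  show "dd (0, 0, h) ?G (x, y, 0) = h *\<^sub>R dd (0, 0, 1) ?G (x, y, 0)" unfolding v dd_scale_dir[OF sG] by (rule scaleR_conv_of_real[symmetric])
 qed
 ultimately have "((%t. ?G (x, y, t)) has_vector_derivative dd (0, 0, 1) ?G (x, y, 0)) (at 0)" unfolding has_vector_derivative_def by metis
 moreover have "dd (0, 0, 1) ?G (x, y, 0) = jet2 d e Xi (x, y)"
 proof -
  have "near (x, y, 0) (%om. dd (0, 0, 1) (jet (%h. (0, h, 0)) e F) om = jet (%h. (0, h, 0)) e (dd (0, 0, 1) F) om)"
   using smooth_near[OF F] by eventually_elim (rule dd_jet_commute)
  hence "dd (0, 0, 1) ?G (x, y, 0) = jet (%h. (h, 0, 0)) d (jet (%h. (0, h, 0)) e (dd (0, 0, 1) F)) (x, y, 0)"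
   by (simp add: dd_jet_commute smooth_jet F jet_cong)
  also have "\<dots> = jet2 d e (%w. dd (0, 0, 1) F (at_time 0 w)) (x, y)" by (rule jet2_at_time[symmetric]) (rule smooth_dd[OF F])
  also have "\<dots> = jet2 d e Xi (x, y)" by (rule jet2_cong[OF dF])
  finally show ?thesis .
 qed
 ultimately show ?thesis unfolding has_vector_derivative_def using has_derivative_cong_nhds[OF ev] by simp
qed

definition exp_half_Ln :: "complex => complex" where
 "exp_half_Ln w = exp (Ln w / 2)"

lemma exp_half_Ln_analytic: "w ~: \<real>\<^sub>\<le>\<^sub>0 ==> exp_half_Ln analytic_on {w}"
 unfolding exp_half_Ln_def[abs_def] by (auto intro!: analytic_intros)

lemma deriv_exp_half_Ln: "deriv exp_half_Ln 1 = 1 / 2" and deriv_Ln_1: "deriv Ln 1 = (1::complex)"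
proof -
 show "deriv Ln 1 = (1::complex)" by (intro DERIV_imp_deriv) (auto intro!: derivative_eq_intros)
 have "(Ln has_field_derivative 1) (at (1::complex))" by (auto intro!: derivative_eq_intros)
 from DERIV_chain2[OF DERIV_exp DERIV_cdivide[OF this, of 2]]
 show "deriv exp_half_Ln 1 = 1 / 2" unfolding exp_half_Ln_def[abs_def] by (intro DERIV_imp_deriv) simp
qed

context
 fixes S f :: "'a::real_normed_vector => complex" and v :: 'a and p :: complex
 assumes S: "smooth S v" and f: "smooth f v" and st: "small_time p (S v) (f v)"
begin

lemma smooth_flow_ratio: "smooth (%v. 1 - 2 * S v / (p - f v)\<^sup>2) v"
 by (intro smooth_diff smooth.const smooth_divide smooth_scale S f smooth_power) (insert st, auto simp: small_time_def)

lemma smooth_flow_map: "smooth (%v. flow_map p (S v) (f v)) v"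
proof -
 have "smooth (%v. exp_half_Ln (1 - 2 * S v / (p - f v)\<^sup>2)) v"
  by (rule smooth.comp[OF smooth_flow_ratio]) (insert st, simp add: small_time_def exp_half_Ln_analytic)
 thus ?thesis unfolding flow_map_def exp_half_Ln_def by (intro smooth_diff smooth.mult smooth.const f)
qed

lemma smooth_flow_log: "smooth (%v. flow_log p (S v) (f v)) v"
 unfolding flow_log_def by (intro smooth_divide smooth_uminus smooth_Ln smooth_flow_ratio smooth.const) (insert st, auto simp: small_time_def)

context
 assumes S0: "S v = 0"
begin

lemma dd_flow_ratio: "dd e (%v. 1 - 2 * S v / (p - f v)\<^sup>2) v = - 2 * dd e S v / (p - f v)\<^sup>2"
proof -
 have g: "smooth (%v. - 2 / (p - f v)\<^sup>2) v"
  by (intro smooth_divide smooth.const smooth_power smooth_diff f) (insert st, auto simp: small_time_def)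
 have "(%v. 1 - 2 * S v / (p - f v)\<^sup>2) = (%v. 1 + S v * (- 2 / (p - f v)\<^sup>2))" by auto
 thus ?thesis by (simp only: dd_add[OF smooth.const smooth.mult[OF S g]] dd_mult[OF S g] dd_const S0) simp
qed

lemma dd_flow_map: "dd e (%v. flow_map p (S v) (f v)) v = dd e f v + dd e S v / (p - f v)"
proof -
 let ?w = "%v. 1 - 2 * S v / (p - f v)\<^sup>2"
 have n: "f v ~= p" "?w v = 1" using st S0 by (simp_all add: small_time_def)
 have a: "exp_half_Ln analytic_on {?w v}" by (simp only: n) (simp add: exp_half_Ln_analytic)
 have sE: "smooth (%v. exp_half_Ln (?w v)) v" by (rule smooth.comp[OF smooth_flow_ratio a])
 have E: "dd e (%v. exp_half_Ln (?w v)) v = - dd e S v / (p - f v)\<^sup>2"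
  unfolding dd_comp[OF smooth_flow_ratio a] dd_flow_ratio by (simp only: n deriv_exp_half_Ln) simp
 have sf: "smooth (%v. f v + (- p)) v" by (intro smooth.add f smooth.const)
 have "(%v. flow_map p (S v) (f v)) = (%v. p + (f v + (- p)) * exp_half_Ln (?w v))"
  by (rule ext) (simp add: flow_map_def exp_half_Ln_def algebra_simps)
 hence "dd e (%v. flow_map p (S v) (f v)) v = (f v - p) * (- dd e S v / (p - f v)\<^sup>2) + dd e f v * exp_half_Ln 1"
  by (simp only: dd_add[OF smooth.const smooth.mult[OF sf sE]] dd_mult[OF sf sE] dd_add[OF f smooth.const] dd_const E n) simp
 also have "exp_half_Ln 1 = 1" by (simp add: exp_half_Ln_def)
 also have "(f v - p) * (- dd e S v / (p - f v)\<^sup>2) = dd e S v / (p - f v)"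
 proof -
  have "- x * (- d / x\<^sup>2) = d / x" if "x ~= 0" for x d :: complex using that by (simp add: power2_eq_square)
  from this[of "p - f v" "dd e S v"] show ?thesis using n by simp
 qed
 finally show ?thesis by simp
qed

lemma dd_flow_log: "dd e (%v. flow_log p (S v) (f v)) v = dd e S v / (p - f v)\<^sup>2"
proof -
 let ?w = "%v. 1 - 2 * S v / (p - f v)\<^sup>2"
 have n: "?w v = 1" using S0 by simp
 have a: "Ln analytic_on {?w v}" by (simp only: n) (auto intro!: analytic_intros)
 have s: "smooth (%v. Ln (?w v)) v" by (rule smooth.comp[OF smooth_flow_ratio a])
 have "(%v. flow_log p (S v) (f v)) = (%v. (- 1 / 2) * Ln (?w v))" by (rule ext) (simp add: flow_log_def)
 thus ?thesis by (simp only: dd_scale[OF s] dd_comp[OF smooth_flow_ratio a] dd_flow_ratio n deriv_Ln_1) simp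
qed

end

end

definition clock :: "complex => moving_pair => complex" where
 "clock k v = k * of_real (snd (snd v))"

definition pt1 :: "moving_pair => complex" where "pt1 v = fst v"
definition pt2 :: "moving_pair => complex" where "pt2 v = fst (snd v)"

lemma pt_simps [simp]: "pt1 (u, v, t) = u" "pt2 (u, v, t) = v" "clock k (u, v, t) = k * of_real t" by (simp_all add: pt1_def pt2_def clock_def)

lemma bl_pts: "bounded_linear pt1" "bounded_linear pt2" "bounded_linear (clock k)"
 unfolding pt1_def[abs_def] pt2_def[abs_def] clock_def[abs_def] by (intro bounded_linear_fst bounded_linear_snd_comp bounded_linear_fst_comp
   bounded_linear_mult_right[THEN bounded_linear_compose] bounded_linear_of_real[THEN bounded_linear_compose] bounded_linear_ident)+

lemma smooth_pts: "smooth pt1 v" "smooth pt2 v" "smooth (clock k) v" using bl_pts by (auto intro: smooth.lin)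

lemma dd_pts: "dd (0, 0, 1) pt1 v = 0" "dd (0, 0, 1) pt2 v = 0" "dd (0, 0, 1) (clock k) v = k" by (simp_all add: dd_lin bl_pts)

section \<open>Rates of change along flows\<close>

text \<open>The real part of a velocity is written as a sum with its conjugate: the \<open>\<complex>\<close>-linear and antilinear
 parts in \<open>\<kappa>\<close> can then be read off.\<close>

definition re2 :: "complex => complex" where
 "re2 x = x + cnj x"

text \<open>The chain rule for twice the Green function when its points have velocities k/(p - u)
  and l/(q - v). Within the real part, conjugates have been moved off the velocities, so this
  expression is complex linear in (k, l) and \<open>re2\<close> of it is the rate.\<close>

definition cross_rate :: "complex => complex => complex => complex => complex * complex => complex" where
 "cross_rate p k q l w = k / (p - fst w) * (1 / (fst w - cnj (snd w)) - 1 / (fst w - snd w))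
   + l / (q - snd w) * (1 / (fst w - snd w) - 1 / (cnj (fst w) - snd w))"

text \<open>The same for \<open>reg_green\<close>. The last summand is the contribution of ln |2 p -
  h u - h v|, where the moving points approach or leave the pole.\<close>

definition self_rate :: "complex => complex => complex * complex => complex" where
 "self_rate p k w = k / (p - fst w) / (fst w - cnj (snd w)) - k / (p - snd w) / (cnj (fst w) - snd w)
   - (k / (p - fst w) + k / (p - snd w)) / (2 * p - fst w - snd w)"

lemma re2_ln_norm:
 assumes "smooth f x" "f x ~= 0"
 shows "dd e (%y. 2 * of_real (ln (norm (f y)))) x = re2 (dd e f x / f x)"
 unfolding dd_scale[OF smooth_ln_norm[OF assms]] dd_ln_norm[OF assms] re2_def by (simp add: mult.commute)

lemma dd_diff: "smooth f x ==> smooth g x ==> dd e (%y. f y - g y) x = dd e f x - dd e g x"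
 using dd_add[OF _ smooth_uminus, of f x g e] dd_scale[of g x e "-1"] by simp

lemma cross_time_derivative:
 assumes x: "x ~= p" "y ~= q" "Im x > 0" "Im y > 0" "x ~= y"
 shows "((%t. pair_expectation (factor_at (moved p (ka * of_real t)) d x) (factor_at (moved q (l * of_real t)) e y))
   has_vector_derivative jet2 d e (%w. re2 (cross_rate p ka q l w)) (x, y)) (at 0)"
proof -
 define H where "H om = flow_map p (clock ka om) (pt1 om)" for om
 define K where "K om = flow_map q (clock l om) (pt2 om)" for om
 define F where "F om = 2 * of_real (ln (cmod (H om - cnj (K om)))) - 2 * complex_of_real (ln (cmod (H om - K om)))" for om
 define ok where "ok om \<longleftrightarrow> small_time p (clock ka om) (pt1 om) & small_time q (clock l om) (pt2 om) &
   Im (H om) > 0 & Im (K om) > 0 & H om ~= K om" for om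
 have sm: "smooth H om" "smooth K om" if "small_time p (clock ka om) (pt1 om)" "small_time q (clock l om) (pt2 om)" for om
  unfolding H_def[abs_def] K_def[abs_def] by (rule smooth_flow_map[OF smooth_pts(3) smooth_pts(1) that(1)], rule smooth_flow_map[OF smooth_pts(3) smooth_pts(2) that(2)])
 have ev: "near (x, y, 0) (%om. ok om)"
 proof -
  have o: "open (- \<real>\<^sub>\<le>\<^sub>0 :: complex set)" by auto
  have ps: "near (x, y, 0) (%om. small_time r (clock k om) (g om))"
   if "g (x, y, 0) ~= r" "isCont g (x, y, 0)" for r k g
  proof -
   have c: "isCont (clock k) (x, y, 0)" by (rule linear_continuous_at[OF bl_pts(3)])
   have "near (x, y, 0) (%om. g om : - {r})" by (rule near_isCont[OF that(2) eventually_nhds_in_open]) (use that in auto)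
   moreover have "near (x, y, 0) (%om. 1 - 2 * clock k om / (r - g om)\<^sup>2 : - \<real>\<^sub>\<le>\<^sub>0)"
    by (rule near_isCont[where f = "%om. 1 - 2 * clock k om / (r - g om)\<^sup>2", OF _ eventually_nhds_in_open[OF o]])
      (insert that, auto intro!: continuous_intros c)
   ultimately show ?thesis by eventually_elim (simp add: small_time_def)
  qed
  have c: "isCont pt1 (x, y, 0)" "isCont pt2 (x, y, 0)" using bl_pts by (auto intro: linear_continuous_at)
  have s0: "smooth H (x, y, 0)" "smooth K (x, y, 0)" using sm[of "(x, y, 0)"] x by auto
  have HK: "isCont H (x, y, 0)" "isCont K (x, y, 0)" using s0 by (auto intro: smooth_continuous)
  have "near (x, y, 0) (%om. H om : {w. Im w > 0})"
   by (rule near_isCont[OF HK(1) eventually_nhds_in_open]) (insert x, auto simp: open_halfspace_Im_gt H_def)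
  moreover have "near (x, y, 0) (%om. K om : {w. Im w > 0})"
   by (rule near_isCont[OF HK(2) eventually_nhds_in_open]) (insert x, auto simp: open_halfspace_Im_gt K_def)
  moreover have "near (x, y, 0) (%om. H om - K om : - {0})"
   by (rule near_isCont[where f = "%om. H om - K om", OF isCont_diff[OF HK] eventually_nhds_in_open])
     (insert x, auto simp: H_def K_def)
  ultimately show ?thesis using ps[of pt1 p ka, OF _ c(1)] ps[of pt2 q l, OF _ c(2)] x unfolding ok_def by (simp add: eventually_conj_iff)
 qed
 have nz: "H om - cnj (K om) ~= 0" "H om - K om ~= 0" if "ok om" for om using upper_neq_cnj[of "H om" "K om"] that by (auto simp: ok_def)
 have smo: "smooth H om" "smooth K om" "smooth (%om. cnj (K om)) om" "smooth (%om. H om - cnj (K om)) om" "smooth (%om. H om - K om) om" if "ok om" for om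
  using sm[of om] that by (auto simp: ok_def intro: smooth_diff smooth_cnj)
 have F: "smooth F (x, y, 0)" unfolding F_def[abs_def] using eventually_at_self[OF ev] by (intro smooth_diff smooth_scale smooth_ln_norm smo nz)
 have dF: "near (x, y) (%w. dd (0, 0, 1) F (at_time 0 w) = re2 (cross_rate p ka q l w))" using eventually_at_time0[OF ev]
 proof eventually_elim
  case (elim w)
  obtain u v where w: "w = (u, v)" by force
  have om: "ok (u, v, 0)" using elim by (simp add: w)
  have dH: "dd (0, 0, 1) H (u, v, 0) = ka / (p - u)"
   unfolding H_def[abs_def] using om by (subst dd_flow_map[OF smooth_pts(3,1)]) (auto simp: ok_def dd_pts)
  have dK: "dd (0, 0, 1) K (u, v, 0) = l / (q - v)"
   unfolding K_def[abs_def] using om by (subst dd_flow_map[OF smooth_pts(3,2)]) (auto simp: ok_def dd_pts)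
  note s = smo[OF om] and n = nz[OF om]
  have "dd (0, 0, 1) F (u, v, 0) = re2 ((ka / (p - u) - cnj (l / (q - v))) / (u - cnj v)) - re2 ((ka / (p - u) - l / (q - v)) / (u - v))"
   unfolding F_def[abs_def] dd_diff[OF smooth_scale[OF smooth_ln_norm[OF s(4) n(1)]] smooth_scale[OF smooth_ln_norm[OF s(5) n(2)]]]
    re2_ln_norm[OF s(4) n(1)] re2_ln_norm[OF s(5) n(2)] dd_diff[OF s(1,2)] dd_diff[OF s(1,3)] dd_cnj[OF s(2)] dH dK by (simp add: H_def K_def)
  also have "\<dots> = re2 (cross_rate p ka q l (u, v))"
  proof -
   have "re2 ((A - cnj B) / D) - re2 ((A - B) / E) = re2 (A * (1 / D - 1 / E) + B * (1 / E - 1 / cnj D))" for A B D E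
    by (simp add: re2_def diff_divide_distrib algebra_simps)
   from this[of "ka / (p - u)" "l / (q - v)" "u - cnj v" "u - v"] show ?thesis by (simp add: cross_rate_def)
  qed
  finally show ?case by (simp add: w)
 qed
 have "near 0 (%t. pair_expectation (factor_at (moved p (ka * of_real t)) d x) (factor_at (moved q (l * of_real t)) e y) = jet2 d e (%w. F (at_time t w)) (x, y))"
  using eventually_at_time[OF ev]
 proof eventually_elim
  case (elim t)
  have xy: "ok (x, y, t)" using eventually_at_self[OF elim] by simp
  have "pair_expectation (factor_at (moved p (ka * of_real t)) d x) (factor_at (moved q (l * of_real t)) e y) =
   jet2 d e (green2 (flow_map p (ka * of_real t)) (flow_map q (l * of_real t))) (x, y)"
   using pair_expectation_jet[of "flow_map p (ka * of_real t)" x "flow_map q (l * of_real t)" y "fst d" "snd d" "fst e" "snd e"] xy by (simp add: factor_at_def moved_def ok_def H_def K_def flow_map_analytic del: pair_expectation.simps)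
  also have "\<dots> = jet2 d e (%w. F (at_time t w)) (x, y)"
  proof (rule jet2_cong, use elim in eventually_elim)
   case (elim w)
   show ?case using nz[OF elim] by (simp add: green2_def green_def F_def H_def K_def norm_divide ln_div algebra_simps)
  qed
  finally show ?case .
 qed
 from has_derivative_cong_nhds[OF this] jet2_time_derivative[OF F dF, of d e]
 show ?thesis unfolding has_vector_derivative_def by blast
qed

lemma self_time_derivative:
 assumes x: "x ~= p" "Im x > 0"
 shows "((%t. reg_jet p (moved p (k * of_real t)) d e (x, x))
   has_vector_derivative jet2 d e (%w. re2 (self_rate p k w)) (x, x)) (at 0)"
proof -
 define H where "H om = flow_map p (clock k om) (pt1 om)" for om
 define K where "K om = flow_map p (clock k om) (pt2 om)" for om
 define F where "F om = 2 * of_real (ln (cmod (H om - cnj (K om)))) - 2 * complex_of_real (ln (cmod (2 * p - pt1 om - pt2 om)))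
   + 2 * of_real (ln (cmod (2 * p - H om - K om)))" for om
 define ok where "ok w \<longleftrightarrow> fst w ~= p & snd w ~= p & fst w ~= cnj (snd w) & 2 * p - fst w - snd w ~= 0" for w
 have sm: "smooth H (at_time 0 w)" "smooth K (at_time 0 w)" if "ok w" for w
  unfolding H_def[abs_def] K_def[abs_def] using that by (intro smooth_flow_map smooth_pts; simp add: ok_def)+
 have n: "H (at_time 0 w) - cnj (K (at_time 0 w)) ~= 0" "2 * p - pt1 (at_time 0 w) - pt2 (at_time 0 w) ~= 0" "2 * p - H (at_time 0 w) - K (at_time 0 w) ~= 0" if "ok w" for w
  using that by (auto simp: H_def K_def ok_def)
 have s: "smooth (%om. H om - cnj (K om)) (at_time 0 w)" "smooth (%om. 2 * p - pt1 om - pt2 om) (at_time 0 w)" "smooth (%om. 2 * p - H om - K om) (at_time 0 w)"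
   "smooth (%om. cnj (K om)) (at_time 0 w)" "smooth (%om. 2 * p - pt1 om) (at_time 0 w)" "smooth (%om. 2 * p - H om) (at_time 0 w)" if "ok w" for w
  by (intro smooth_diff smooth_cnj sm[OF that] smooth.const smooth_pts)+
 have ok: "ok (x, x)" using x upper_neq_cnj[of x x] by (auto simp: ok_def)
 have Fs: "smooth F (at_time 0 w)" if "ok w" for w
  unfolding F_def[abs_def] by (intro smooth_diff smooth.add smooth_scale smooth_ln_norm s[OF that] n[OF that])
 have F: "smooth F (x, x, 0)" using Fs[OF ok] by simp
 have ev: "near (x, x) (%w. ok w)"
 proof -
  have "open {w :: complex * complex. fst w ~= p}" "open {w :: complex * complex. snd w ~= p}" "open {w. fst w ~= cnj (snd w)}" "open {w. 2 * p - fst w - snd w ~= 0}"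
   by (intro open_Collect_neq continuous_intros)+
  hence "open ({w :: complex * complex. fst w ~= p} \<inter> {w. snd w ~= p} \<inter> {w. fst w ~= cnj (snd w)} \<inter> {w. 2 * p - fst w - snd w ~= 0})"
   by (intro open_Int)
  from eventually_nhds_in_open[OF this, of "(x, x)"] show ?thesis using ok by (auto simp: ok_def elim!: eventually_mono)
 qed
 have "near (x, x) (%w. dd (0, 0, 1) F (at_time 0 w) = re2 (self_rate p k w))" using ev
 proof eventually_elim
  case (elim w)
  obtain u v where w: "w = (u, v)" by force
  have uv: "u ~= p" "v ~= p" using elim by (auto simp: ok_def w)
  have dH: "dd (0, 0, 1) H (u, v, 0) = k / (p - u)" unfolding H_def[abs_def] using uv by (subst dd_flow_map[OF smooth_pts(3,1)]) (auto simp: dd_pts)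
  have dK: "dd (0, 0, 1) K (u, v, 0) = k / (p - v)" unfolding K_def[abs_def] using uv by (subst dd_flow_map[OF smooth_pts(3,2)]) (auto simp: dd_pts)
  note s' = s[OF elim, unfolded w fst_conv snd_conv] and n' = n[OF elim, unfolded w fst_conv snd_conv] and sm' = sm[OF elim, unfolded w fst_conv snd_conv]
  note l = smooth_ln_norm[OF s'(1) n'(1)] smooth_ln_norm[OF s'(2) n'(2)] smooth_ln_norm[OF s'(3) n'(3)]
  have "dd (0, 0, 1) F (u, v, 0) = re2 ((k / (p - u) - cnj (k / (p - v))) / (u - cnj v)) - re2 0 + re2 ((0 - k / (p - u) - k / (p - v)) / (2 * p - u - v))"
   unfolding F_def[abs_def] dd_add[OF smooth_diff[OF smooth_scale[OF l(1)] smooth_scale[OF l(2)]] smooth_scale[OF l(3)]]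
     dd_diff[OF smooth_scale[OF l(1)] smooth_scale[OF l(2)]] re2_ln_norm[OF s'(1) n'(1)] re2_ln_norm[OF s'(2) n'(2)] re2_ln_norm[OF s'(3) n'(3)]
     dd_diff[OF sm'(1) s'(4)] dd_diff[OF s'(5) smooth_pts(2)] dd_diff[OF smooth.const smooth_pts(1)] dd_diff[OF s'(6) sm'(2)] dd_diff[OF smooth.const sm'(1)]
     dd_cnj[OF sm'(2)] dd_const dd_pts dH dK by (simp add: H_def K_def)
  also have "\<dots> = re2 (self_rate p k (u, v))"
  proof -
   have "re2 ((A - cnj B) / D) - re2 0 + re2 ((0 - A - B) / E) = re2 (A / D - B / cnj D - (A + B) / E)" for A B D E
    by (simp add: re2_def diff_divide_distrib add_divide_distrib algebra_simps)
   from this[of "k / (p - u)" "k / (p - v)" "u - cnj v"] show ?thesis by (simp add: self_rate_def)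
  qed
  finally show ?case by (simp add: w)
 qed
 from jet2_time_derivative[OF F this, of d e]
 show ?thesis unfolding reg_jet_def by (rule back_subst[where P = "%f. (f has_vector_derivative _) _"])
    (auto simp: reg_green_def[abs_def] F_def H_def K_def moved_def fun_eq_iff)
qed

text \<open>The logarithm of the derivative of the flow starts at rate k/(p - u)^2, and - 2 b Im w =
  i b (w - cnj w).\<close>

lemma mean_time_derivative:
 assumes x: "x ~= p"
 shows "((%t. mean_jet b (moved p (k * of_real t)) d x)
   has_vector_derivative jet1 d (%u. of_real b * \<i> * (k / (p - u)\<^sup>2 - cnj (k / (p - u)\<^sup>2))) x) (at 0)"
proof -
 define g where "g om = flow_log p (clock k om) (pt1 om)" for om
 define F where "F om = of_real b * \<i> * (g om - cnj (g om))" for om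
 have st: "small_time p (clock k (u, v, 0)) (pt1 (u, v, 0))" if "u ~= p" for u v using that by simp
 have sg: "smooth g (u, v, 0)" if "u ~= p" for u v unfolding g_def[abs_def] by (rule smooth_flow_log[OF smooth_pts(3,1) st[OF that]])
 have sF: "smooth F (u, v, 0)" if "u ~= p" for u v unfolding F_def[abs_def] by (intro smooth_scale smooth_diff smooth_cnj sg that)
 have "near (x, x) (%w. fst w ~= p)" using eventually_fst_nhds[OF eventually_nhds_in_open[of "- {p}" x]] x by auto
 hence "near (x, x) (%w. dd (0, 0, 1) F (at_time 0 w) = of_real b * \<i> * (k / (p - fst w)\<^sup>2 - cnj (k / (p - fst w)\<^sup>2)))"
 proof eventually_elim
  case (elim w)
  let ?w = "(fst w, snd w, 0)"
  have "dd (0, 0, 1) g ?w = k / (p - fst w)\<^sup>2"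
   unfolding g_def[abs_def] using dd_flow_log[OF smooth_pts(3,1) st[OF elim, of "snd w"], of "(0, 0, 1)"] by (simp add: dd_pts)
  thus ?case
   unfolding F_def[abs_def] dd_scale[OF smooth_diff[OF sg[OF elim] smooth_cnj[OF sg[OF elim]]]] dd_diff[OF sg[OF elim] smooth_cnj[OF sg[OF elim]]] dd_cnj[OF sg[OF elim]] by simp
 qed
 from jet2_time_derivative[OF sF[OF x, of x] this, of d "(0, 0)"]
 have der: "((%t. jet in1 d (%w. F (at_time t w)) (x, x)) has_vector_derivative
   jet in1 d (%w. of_real b * \<i> * (k / (p - fst w)\<^sup>2 - cnj (k / (p - fst w)\<^sup>2))) (x, x)) (at 0)" by simp
 have sl: "jet in1 d (%w. f (fst w)) (x, x) = jet1 d f x" if "smooth f x" for f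
 proof -
  have "smooth (%w :: complex * complex. f (fst w)) (x, x)" using smooth_affine[OF that bl_fst, of "(x, x)" 0] by simp
  from jet_slice1[OF this] show ?thesis by simp
 qed
 have sI: "smooth (%u. of_real b * \<i> * (k / (p - u)\<^sup>2 - cnj (k / (p - u)\<^sup>2))) x"
  by (intro smooth_scale smooth_diff smooth_cnj smooth_divide smooth_power smooth.const smooth_ident) (use x in simp)+
 note d = der[unfolded sl[OF sI]]
 have "near 0 (%t. mean_jet b (moved p (k * of_real t)) d x = jet in1 d (%w. F (at_time t w)) (x, x))"
 proof -
  have "isCont (%t::real. 1 - 2 * (k * of_real t) / (p - x)\<^sup>2) 0" using x by (intro continuous_intros) auto
  moreover have "open (- \<real>\<^sub>\<le>\<^sub>0 :: complex set)" by auto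
  ultimately have "near 0 (%t. 1 - 2 * (k * of_real t) / (p - x)\<^sup>2 : - \<real>\<^sub>\<le>\<^sub>0)"
   by (intro near_isCont[where f = "%t::real. 1 - 2 * (k * of_real t) / (p - x)\<^sup>2"] eventually_nhds_in_open) auto
  thus ?thesis
  proof eventually_elim
   case (elim t)
   have st: "small_time p (k * of_real t) x" using elim x by (simp add: small_time_def)
   have e: "complex_of_real (- 2 * b * Im w) = of_real b * \<i> * (w - cnj w)" for w by (simp add: complex_eq_iff)
   have "smooth (%u. complex_of_real (- 2 * b * Im (flow_log p (k * of_real t) u))) x"
    using smooth_mean[of "moved p (k * of_real t)" x b] flow_log_analytic[OF st] by (simp add: moved_def)
   from sl[OF this, unfolded e] show ?case unfolding mean_jet_def e by (simp add: moved_def F_def g_def)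
  qed
 qed
 from has_derivative_cong_nhds[OF this] d show ?thesis unfolding has_vector_derivative_def by blast
qed

text \<open>Each site has its own pole p i and speed k i. Speed 0 freezes a site, so one computation
  serves the Lie derivative that spares the vertex field and the one that moves it.\<close>

definition site_chart :: "(nat => complex) => (nat => complex) => real => nat => chart" where
 "site_chart p k t i = moved (p i) (k i * of_real t)"

fun site_cov :: "(nat => complex) => (nat => complex) => (nat => complex) => real => nat * nat * nat => nat * nat * nat => complex" where
 "site_cov p k x t (i, d) (j, e) =
   (if i < j then pair_expectation (factor_at (site_chart p k t i) d (x i)) (factor_at (site_chart p k t j) e (x j))
   else if j < i then pair_expectation (factor_at (site_chart p k t j) e (x j)) (factor_at (site_chart p k t i) d (x i))
   else (reg_jet (p i) (site_chart p k t i) d e (x i, x i) + reg_jet (p i) (site_chart p k t i) e d (x i, x i)) / 2)"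

fun site_mean :: "real => (nat => complex) => (nat => complex) => (nat => complex) => real => nat * nat * nat => complex" where
 "site_mean b p k x t (i, d) = mean_jet b (site_chart p k t i) d (x i)"

type_synonym monomials = "(complex * (nat * nat) multiset) list"

definition site_string :: "real => (nat => complex) => (nat => complex) => (nat => complex) => real => monomials => functional list" where
 "site_string b p k x t ms =
   map (%i. normal_field b (fst (ms ! i)) (snd (ms ! i)) (p i) (site_chart p k t i) (x i)) [0..<length ms]"

definition site_labels :: "monomials => (nat * nat * nat) multiset" where
 "site_labels ms = tags (map snd ms)"

definition site_exps :: "monomials => (complex * nat * nat * nat) list" where
 "site_exps ms = tagged_exps (map (%m. [(fst m, (0, 0))]) ms)"

lemma symm_site_cov: "symm (site_cov p k x t)" by (auto simp: symm_def add.commute)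

lemma site_labels_less: "a : set_mset (site_labels ms) Un snd ` set (site_exps ms) ==> fst a < length ms"
 by (auto simp: site_labels_def site_exps_def set_tags snd_tagged_exps simp flip: image_iff)

lemma corr_sites:
 "corr (site_string b p k x t ms) = gauss (site_cov p k x t) (site_mean b p k x t) (site_labels ms) (site_exps ms)"
proof -
 define n where "n = length ms"
 define ss where "ss = map (%i. normal_slot b (fst (ms ! i)) (snd (ms ! i)) (p i) (site_chart p k t i) (x i)) [0..<n]"
 define f where "f a = (fst a, factor_at (site_chart p k t (fst a)) (snd a) (x (fst a)))" for a :: "nat * nat * nat"
 have sy: "symm (s_cov s)" if "s : set ss" for s using that by (auto simp: ss_def normal_slot_def symm_self_cov)
 have ssy: "symm (slot_cov ss)" by (rule symm_slot_cov) (rule sy)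
 have "map slot_fun ss = site_string b p k x t ms" by (simp add: ss_def site_string_def normal_field_def n_def)
 hence "corr (site_string b p k x t ms) = gauss (slot_cov ss) (slot_mean ss) (tags (map s_poly ss)) (tagged_exps (map s_exp ss))"
  using corr_slots[of ss] sy by simp
 also have "tags (map s_poly ss) = image_mset f (site_labels ms)"
  by (simp add: tags_def site_labels_def image_mset_sum image_mset.compositionality comp_def f_def ss_def normal_slot_def n_def)
 also have "tagged_exps (map s_exp ss) = map (map_prod id f) (site_exps ms)"
  unfolding tagged_exps_def site_exps_def map_concat length_map map_map by (intro arg_cong[of _ _ concat] map_cong) (auto simp: f_def ss_def normal_slot_def n_def)
 also have "gauss (slot_cov ss) (slot_mean ss) (image_mset f (site_labels ms)) (map (map_prod id f) (site_exps ms)) =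
   gauss (%a c. slot_cov ss (f a) (f c)) (%a. slot_mean ss (f a)) (site_labels ms) (site_exps ms)" by (rule gauss_image[OF ssy])
 also have "\<dots> = gauss (site_cov p k x t) (site_mean b p k x t) (site_labels ms) (site_exps ms)"
 proof (rule gauss_cong[OF _ symm_site_cov])
  show "symm (%a c. slot_cov ss (f a) (f c))" using ssy unfolding symm_def by blast
  fix a assume a: "a : set_mset (site_labels ms) Un snd ` set (site_exps ms)"
  obtain i d where a': "a = (i, d)" by (cases a)
  have i: "i < n" using site_labels_less[OF a] by (simp add: a' n_def)
  show "slot_mean ss (f a) = site_mean b p k x t a" using i by (simp add: a' f_def ss_def normal_slot_def factor_at_def)
  fix c assume c: "c : set_mset (site_labels ms) Un snd ` set (site_exps ms)"
  obtain j e where c': "c = (j, e)" by (cases c)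
  have j: "j < n" using site_labels_less[OF c] by (simp add: c' n_def)
  show "slot_cov ss (f a) (f c) = site_cov p k x t a c"
   using i j by (auto simp: a' c' f_def ss_def normal_slot_def factor_at_def simp del: pair_expectation.simps)
 qed
 finally show ?thesis .
qed

lemma reg_green_id: "reg_green p id_chart w = 2 * of_real (ln (cmod (fst w - cnj (snd w))))" by (simp add: reg_green_def id_chart_def)

lemma site_chart_0 [simp]: "site_chart p k 0 i = id_chart" by (simp add: site_chart_def moved_0)

lemma reg_jet_id: "reg_jet p id_chart = reg_jet q id_chart"
proof -
 have "reg_green p id_chart = reg_green q id_chart" by (rule ext) (simp add: reg_green_id)
 thus ?thesis unfolding reg_jet_def[abs_def] by (simp only:)
qed

lemma mean_jet_id: "mean_jet b id_chart d u = 0"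
proof -
 have "jet1 d (%u. 0 * 0) u = 0 * jet1 d (%u. 0) u" by (rule jet_scale) (rule smooth.const)
 thus ?thesis by (simp add: mean_jet_def id_chart_def)
qed

text \<open>At time 0 every chart is the identity, whatever poles and speeds follow. All rates are
  thus integrated against one Gaussian law and can be combined linearly.\<close>

lemma site_cov_0: "site_cov p k x 0 = site_cov q l x 0"
proof (intro ext)
 fix a c :: "nat * nat * nat"
 obtain i d j e where a: "a = (i, d)" "c = (j, e)" by (cases a, cases c)
 show "site_cov p k x 0 a c = site_cov q l x 0 a c" using reg_jet_id[of "p i" "q i"] by (cases "i = j") (simp_all add: a)
qed

lemma site_mean_0: "site_mean b p k x 0 a = 0" by (cases a) (simp add: mean_jet_id)

fun site_rate :: "(nat => complex) => (nat => complex) => (nat => complex) => nat * nat * nat => nat * nat * nat => complex" where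
 "site_rate p k x (i, d) (j, e) =
   (if i < j then jet2 d e (%w. re2 (cross_rate (p i) (k i) (p j) (k j) w)) (x i, x j)
   else if j < i then jet2 e d (%w. re2 (cross_rate (p j) (k j) (p i) (k i) w)) (x j, x i)
   else (jet2 d e (%w. re2 (self_rate (p i) (k i) w)) (x i, x i) + jet2 e d (%w. re2 (self_rate (p i) (k i) w)) (x i, x i)) / 2)"

fun site_mean_rate :: "real => (nat => complex) => (nat => complex) => (nat => complex) => nat * nat * nat => complex" where
 "site_mean_rate b p k x (i, d) = jet1 d (%u. of_real b * \<i> * (k i / (p i - u)\<^sup>2 - cnj (k i / (p i - u)\<^sup>2))) (x i)"

lemma site_derivative:
 assumes x: "!!i. i < length ms ==> x i ~= p i & Im (x i) > 0" "!!i j. i < length ms ==> j < length ms ==> i ~= j ==> x i ~= x j"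
 shows "((%t. corr (site_string b p k x t ms)) has_vector_derivative
   gauss_deriv (site_cov p k x 0) (site_mean b p k x 0) (site_labels ms) (site_exps ms) (site_rate p k x) (site_mean_rate b p k x)) (at 0)"
proof -
 let ?L = "set_mset (site_labels ms) Un snd ` set (site_exps ms)"
 have cov: "((%t. site_cov p k x t a c) has_vector_derivative site_rate p k x a c) (at 0)" if ac: "a : ?L" "c : ?L" for a c
 proof -
  obtain i d j e where a: "a = (i, d)" "c = (j, e)" by (metis prod.collapse)
  have ij: "i < length ms" "j < length ms" using ac[THEN site_labels_less] by (auto simp: a)
  show ?thesis
  proof (cases "i = j")
   case True
   have h: "((%t. reg_jet (p i) (moved (p i) (k i * of_real t)) d e (x i, x i)) has_vector_derivative jet2 d e (%w. re2 (self_rate (p i) (k i) w)) (x i, x i)) (at 0)" for d e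
    using x(1)[OF ij(1)] by (intro self_time_derivative) auto
   from has_vector_derivative_mult_right[OF has_vector_derivative_add[OF h[of d e] h[of e d]], of "1/2"]
   show ?thesis unfolding a True by (simp add: site_chart_def True)
  next
   case False
   then consider "i < j" | "j < i" by linarith
   thus ?thesis
   proof cases
    case 1
    thus ?thesis using cross_time_derivative[of "x i" "p i" "x j" "p j" "k i" d "k j" e] x(1)[OF ij(1)] x(1)[OF ij(2)] x(2)[OF ij]
     by (simp add: a site_chart_def)
   next
    case 2
    thus ?thesis using cross_time_derivative[of "x j" "p j" "x i" "p i" "k j" e "k i" d] x(1)[OF ij(1)] x(1)[OF ij(2)] x(2)[OF ij]
     by (simp add: a site_chart_def)
   qed
  qed
 qed
 have mean: "((%t. site_mean b p k x t a) has_vector_derivative site_mean_rate b p k x a) (at 0)" if "a : ?L" for a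
 proof -
  obtain i d where a: "a = (i, d)" by (cases a)
  have "i < length ms" using site_labels_less[OF that] by (simp add: a)
  thus ?thesis using mean_time_derivative[of "x i" "p i" b "k i" d] x(1) by (simp add: a site_chart_def)
 qed
 have sy: "symm (%a c. h *\<^sub>R site_rate p k x a c)" for h by (auto simp: symm_def add.commute)
 have g: "((%t. gauss (site_cov p k x t) (site_mean b p k x t) (site_labels ms) (site_exps ms)) has_derivative
   (%h. gauss_deriv (site_cov p k x 0) (site_mean b p k x 0) (site_labels ms) (site_exps ms) (%a c. h *\<^sub>R site_rate p k x a c) (%a. h *\<^sub>R site_mean_rate b p k x a))) (at 0)"
  by (rule gauss_has_derivative[OF symm_site_cov sy]) (insert cov mean, auto simp: has_vector_derivative_def)
 have "gauss_deriv C m P ls (%a c. h *\<^sub>R dGa a c) (%a. h *\<^sub>R dmu a) = h *\<^sub>R gauss_deriv C m P ls dGa dmu" for C m P ls h dGa and dmu :: "nat * nat * nat => complex"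
  using gauss_deriv_linear[of C m P ls "of_real h" dGa 0 dGa dmu dmu] by (simp add: scaleR_conv_of_real)
 thus ?thesis using g unfolding corr_sites has_vector_derivative_def by simp
qed

lemma lin_neg: "lin (%x. - f x) ls = - lin f ls" using lin_scale[of "-1" f ls] by simp

lemma sum_mset_neg: "(SUM x:#M. - f x) = - (SUM x:#M. f x :: complex)" by (induction M) auto

text \<open>The coefficient of \<open>H P\<close> in the Ward identity, with I the imaginary unit, w
  = 1/(z - cnj z), and x, y the values of the exponent ls under the linear forms A and B. The
  hypothesis on A and B is the relation between a and b.\<close>

lemma ward_constants:
 fixes A B I w x y :: complex
 assumes "I * I = - 1" "2 * A * (A + B) = 1"
 shows "(I * A) * (- (I * A) * (w * w) + y) + (I * A) * (I * A) * (((I * A) * w - x) * ((I * A) * w - x)) =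
   2 * (A * A) * (- (I * A) * I * B * (w * w) + I * B * y) + A * A * (- 3 * ((I * A) * (I * A)) * (w * w) + 2 * (I * A) * (y + x * w) - x * x)"
 using assms by algebra

section \<open>Ward identity\<close>

text \<open>V, V1, V2 stand for the field at z and its first two z-derivatives, ze for z - cnj z; A
  and B are, up to sign, the covariances of V1 and V2 with the other variables. Both sides are
  reduced by integration by parts to \<open>H P\<close>, SA, SB and SS, and their coefficients are
  compared.\<close>

lemma ward_gauss:
 fixes C dGa :: "'a => 'a => complex" and a b :: real and ze :: complex
 defines "al \<equiv> \<i> * of_real a"
 assumes s: "symm C" "symm dGa" and ab: "2 * a * (a + b) = 1" and ze: "ze ~= 0"
  and V1: "C V1 V = 1 / ze" "C V1 V1 = 0" "m V1 = 0" and V2: "C V2 V = - 1 / ze\<^sup>2" "m V2 = 0"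
  and V: "dGa V V = - 3 / ze\<^sup>2" "dmu V = - \<i> * of_real b / ze\<^sup>2"
  and y: "!!y. y : set_mset P Un snd ` set ls ==> C V1 y = - A y & C V2 y = B y & dGa V y = B y + A y / ze & dmu y = \<i> * of_real b * B y"
  and yy: "!!y y'. y : set_mset P Un snd ` set ls ==> y' : set_mset P Un snd ` set ls ==> dGa y y' = - A y * A y'"
 shows "al\<^sup>2 * gauss C m (add_mset V1 (add_mset V1 P)) ((al, V) # ls) + al * gauss C m (add_mset V2 P) ((al, V) # ls)
  = 2 * (of_real a)\<^sup>2 * gauss_deriv C m P ((al, V) # ls) dGa dmu"
proof -
 define L where "L = (al, V) # ls"
 define g where "g = gmean C m L"
 define H where "H = moment C g"
 define E where "E = exp (lin m L + bil C L / 2)"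
 \<comment> \<open>la and lb come from contractions with the other exponentials; SA and SB from a
   contraction with one factor of P, SS from contractions with two.\<close>
 define la where "la = lin A ls"
 define lb where "lb = lin B ls"
 define SA where "SA = (SUM y:#P. A y * H (P - {#y#}))"
 define SB where "SB = (SUM y:#P. B y * H (P - {#y#}))"
 define SS where "SS = (SUM x:#P. SUM y:#P - {#x#}. A x * A y * H (P - {#x#} - {#y#}))"
 let ?V = "add_mset V1 (add_mset V1 P)" and ?D = "(lin dmu L + bil dGa L / 2) * H P + moment_deriv C g P dGa (gmean dGa dmu L)"
 have sy: "C x y = C y x" "dGa x y = dGa y x" for x y using s by (auto simp: symm_def)
 have H: "H (add_mset x M) = g x * H M + (SUM y:#M. C x y * H (M - {#y#}))" for x M unfolding H_def by (rule moment_add[OF s(1)])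
 have g1: "g V1 = al / ze - la"
 proof -
  have "lin (%p. C p V1) ls = lin (%p. - A p) ls" by (rule lin_cong) (insert y, simp add: sy(1)[of _ V1])
  thus ?thesis by (simp add: g_def gmean_def L_def V1 sy(1)[of V V1] lin_neg la_def)
 qed
 have g2: "g V2 = - al / ze\<^sup>2 + lb"
 proof -
  have "lin (%p. C p V2) ls = lin B ls" by (rule lin_cong) (insert y, simp add: sy(1)[of _ V2])
  thus ?thesis by (simp add: g_def gmean_def L_def V2 sy(1)[of V V2] lb_def)
 qed
 have H1: "H (add_mset V1 M) = g V1 * H M - (SUM y:#M. A y * H (M - {#y#}))" if "set_mset M <= set_mset P" for M
 proof -
  have "(SUM y:#M. C V1 y * H (M - {#y#})) = (SUM y:#M. - (A y * H (M - {#y#})))" by (rule sum_mset_cong) (use that y in auto)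
  thus ?thesis unfolding H by (simp add: sum_mset_neg)
 qed
 have H2: "H (add_mset V2 P) = g V2 * H P + SB"
 proof -
  have "(SUM y:#P. C V2 y * H (P - {#y#})) = SB" unfolding SB_def by (rule sum_mset_cong) (use y in auto)
  thus ?thesis unfolding H by simp
 qed
 have H11: "H ?V = (g V1)\<^sup>2 * H P - 2 * g V1 * SA + SS"
 proof -
  have "(SUM y:#P. C V1 y * H (add_mset V1 P - {#y#})) = (SUM y:#P. - (g V1 * (A y * H (P - {#y#}))) + (SUM x:#P - {#y#}. A y * A x * H (P - {#y#} - {#x#})))"
  proof (rule sum_mset_cong)
   fix y assume y': "y :# P"
   have "add_mset V1 P - {#y#} = add_mset V1 (P - {#y#})" using y' by (auto dest!: multi_member_split)
   moreover have "H (add_mset V1 (P - {#y#})) = g V1 * H (P - {#y#}) - (SUM x:#P - {#y#}. A x * H (P - {#y#} - {#x#}))"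
    by (rule H1) (auto dest: in_diffD)
   moreover have "C V1 y = - A y" using y y' by simp
   ultimately show "C V1 y * H (add_mset V1 P - {#y#}) = - (g V1 * (A y * H (P - {#y#}))) + (SUM x:#P - {#y#}. A y * A x * H (P - {#y#} - {#x#}))"
    using sum_mset_distrib_left[of "A y" "%x. A x * H (P - {#y#} - {#x#})" "P - {#y#}"] by (simp only: mult.assoc) (simp add: right_diff_distrib)
  qed
  also have "\<dots> = - g V1 * SA + SS" unfolding sum_mset.distrib SS_def SA_def by (simp add: sum_mset_neg sum_mset_distrib_left)
  finally have "H ?V = g V1 * H (add_mset V1 P) + (- g V1 * SA + SS)" unfolding H[of V1 "add_mset V1 P"] by (simp add: V1)
  thus ?thesis by (simp add: H1 SA_def[symmetric] power2_eq_square algebra_simps)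
 qed
 have dg: "gmean dGa dmu L x = \<i> * of_real b * B x + al * (B x + A x / ze) - la * A x" if "x :# P" for x
 proof -
  have "lin (%p. dGa p x) ls = lin (%p. - A x * A p) ls" by (rule lin_cong) (use yy that in simp)
  thus ?thesis using y that by (simp add: gmean_def L_def lin_neg lin_scale la_def)
 qed
 have lm: "lin dmu L = - al * \<i> * of_real b / ze\<^sup>2 + \<i> * of_real b * lb"
 proof -
  have "lin dmu ls = lin (%p. \<i> * of_real b * B p) ls" by (rule lin_cong) (use y in simp)
  thus ?thesis by (simp only: L_def lin_Cons lin_scale lb_def V) simp
 qed
 have lv: "lin (dGa V) ls = lb + la / ze"
 proof -
  have "lin (dGa V) ls = lin (%p. B p + (1 / ze) * A p) ls" by (rule lin_cong) (use y in simp)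
  thus ?thesis by (simp only: lin_plus lin_scale lb_def la_def) simp
 qed
 have bl: "bil dGa L = - 3 * al\<^sup>2 / ze\<^sup>2 + 2 * al * (lb + la / ze) - la\<^sup>2"
 proof -
  have v: "lin (%p. dGa p V) ls = lb + la / ze" using lv by (simp add: sy(2)[of _ V])
  have "lin (%p. lin (dGa p) ls) ls = lin (%p. - la * A p) ls"
  proof (rule lin_cong)
   fix p assume p: "p : snd ` set ls"
   have "lin (dGa p) ls = lin (%q. - A p * A q) ls" by (rule lin_cong) (use yy p in simp)
   thus "lin (dGa p) ls = - la * A p" by (simp only: lin_scale la_def) simp
  qed
  also have "\<dots> = - la\<^sup>2" by (simp only: lin_scale) (simp add: la_def power2_eq_square)
  finally have pp: "lin (%p. lin (dGa p) ls) ls = - la\<^sup>2" .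
  have "bil dGa L = al * (al * dGa V V + lin (dGa V) ls) + (al * lin (%p. dGa p V) ls + lin (%p. lin (dGa p) ls) ls)"
   by (simp add: bil_def L_def lin_plus lin_scale distrib_left)
  thus ?thesis unfolding lv v pp V by (simp add: power2_eq_square algebra_simps)
 qed
 have md: "moment_deriv C g P dGa (gmean dGa dmu L) = (\<i> * of_real b + al) * SB + (al / ze - la) * SA - SS / 2"
 proof -
  have 1: "(SUM x:#P. gmean dGa dmu L x * H (P - {#x#})) = (\<i> * of_real b + al) * SB + (al / ze - la) * SA"
  proof -
   have "(SUM x:#P. gmean dGa dmu L x * H (P - {#x#})) = (SUM x:#P. (\<i> * of_real b + al) * (B x * H (P - {#x#})) + (al / ze - la) * (A x * H (P - {#x#})))"
    by (rule sum_mset_cong) (simp add: dg algebra_simps)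
   thus ?thesis by (simp only: sum_mset.distrib SA_def SB_def sum_mset_distrib_left)
  qed
  have 2: "(SUM x:#P. SUM y:#P - {#x#}. dGa x y * H (P - {#x#} - {#y#})) = - SS"
  proof -
   have "(SUM x:#P. SUM y:#P - {#x#}. dGa x y * H (P - {#x#} - {#y#})) = (SUM x:#P. - (SUM y:#P - {#x#}. A x * A y * H (P - {#x#} - {#y#})))"
   proof (rule sum_mset_cong)
    fix x assume x: "x :# P"
    have "(SUM y:#P - {#x#}. dGa x y * H (P - {#x#} - {#y#})) = (SUM y:#P - {#x#}. - (A x * A y * H (P - {#x#} - {#y#})))"
     by (rule sum_mset_cong) (insert yy x, auto dest: in_diffD)
    thus "(SUM y:#P - {#x#}. dGa x y * H (P - {#x#} - {#y#})) = - (SUM y:#P - {#x#}. A x * A y * H (P - {#x#} - {#y#}))" by (simp only: sum_mset_neg)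
   qed
   thus ?thesis by (simp only: sum_mset_neg SS_def)
  qed
  show ?thesis unfolding moment_deriv_def H_def[symmetric] 1 2 by simp
 qed
 have e: "(of_real b :: complex) = 1 / (2 * of_real a) - of_real a" "(of_real a :: complex) ~= 0"
 proof -
  have "a ~= 0" using ab by auto
  moreover from this have "a + b = 1 / (2 * a)" unfolding eq_divide_eq using ab by (simp add: mult.commute)
  hence "b = 1 / (2 * a) - a" by simp
  ultimately show "(of_real b :: complex) = 1 / (2 * of_real a) - of_real a" "(of_real a :: complex) ~= 0" by simp_all
 qed
 \<comment> \<open>The coefficients of SB agree exactly by the first equation, where the relation
   between a and b enters. Those of SA and SS agree by the second.\<close>
 have c1: "al = 2 * (of_real a)\<^sup>2 * (\<i> * of_real b + al)" "al\<^sup>2 = - (of_real a)\<^sup>2"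
  unfolding al_def e(1) using e(2) by (simp_all add: power2_eq_square field_simps)
 have c0: "al * g V2 + al\<^sup>2 * (g V1)\<^sup>2 = 2 * (of_real a)\<^sup>2 * (lin dmu L + bil dGa L / 2)"
 proof -
  have "2 * complex_of_real a * (of_real a + of_real b) = 1" using ab by (metis of_real_1 of_real_add of_real_mult of_real_numeral)
  note ab' = this
  define w where "w = 1 / ze"
  have z: "x / ze = x * w" "x / (ze * ze) = x * (w * w)" for x by (simp_all add: w_def)
  have half: "2 * (A * A) * (X + Y / 2) = 2 * (A * A) * X + A * A * Y" for A X Y :: complex by (simp add: algebra_simps)
  show ?thesis unfolding g1 g2 lm bl z power2_eq_square half al_def by (rule ward_constants[OF _ ab']) simp
 qed
 have gs: "gauss C m M L = E * H M" for M by (simp add: gauss_def E_def H_def g_def)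
 have gd: "gauss_deriv C m P L dGa dmu = E * ?D" by (simp add: gauss_deriv_def E_def H_def g_def)
 have "al\<^sup>2 * H ?V + al * H (add_mset V2 P) = (al * g V2 + al\<^sup>2 * (g V1)\<^sup>2) * H P + al * SB - 2 * al\<^sup>2 * g V1 * SA + al\<^sup>2 * SS"
  unfolding H11 H2 by (simp add: algebra_simps)
 also have "\<dots> = 2 * (of_real a)\<^sup>2 * ?D" unfolding c0 md by (subst c1(1), unfold c1(2) g1) (simp add: algebra_simps)
 finally have f: "al\<^sup>2 * H ?V + al * H (add_mset V2 P) =
   2 * (of_real a)\<^sup>2 * ?D" .
 have "al\<^sup>2 * (E * H ?V) + al * (E * H (add_mset V2 P)) =
   E * (al\<^sup>2 * H ?V + al * H (add_mset V2 P))" by (simp add: algebra_simps)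
 thus ?thesis unfolding L_def[symmetric] gs gd f by (simp only: mult_ac)
qed

text \<open>A linear J gives \<open>J (re2 (c y)) = c J y + cnj c J (cnj y)\<close>. Comparing c = 1
  with c = i, the first combination selects the part linear in c and the second the antilinear
  part.\<close>

lemma holomorphic_antiholomorphic_parts:
 assumes lin: "!!f g c k. smooth f X ==> smooth g X ==> J (%w. c * f w + k * g w) = c * J f + k * J g"
  and y: "smooth y X" "smooth y' X"
 shows "(J (%w. re2 (1 * y w)) - \<i> * J (%w. re2 (\<i> * y w))) / 2 + (J (%w. re2 (1 * y' w)) + \<i> * J (%w. re2 (\<i> * y' w))) / 2
  = J (%w. y w + cnj (y' w))"
proof -
 have 1: "J (%w. re2 (c * f w)) = c * J f + cnj c * J (%w. cnj (f w))" if "smooth f X" for f c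
  using lin[OF that smooth_cnj[OF that], of c "cnj c"] by (simp add: re2_def)
 have 2: "J (%w. y w + cnj (y' w)) = J y + J (%w. cnj (y' w))" using lin[OF y(1) smooth_cnj[OF y(2)], of 1 1] by simp
 show ?thesis unfolding 1[OF y(1)] 1[OF y(2)] 2 by (simp add: algebra_simps)
qed

lemma jet2_linear:
 "smooth f X ==> smooth g X ==> jet2 d e (%w. c * f w + k * g w) X = c * jet2 d e f X + k * jet2 d e g X"
 by (simp add: jet2_add[OF smooth_scale smooth_scale] jet2_scale)

lemma jet_linear:
 "smooth f X ==> smooth g X ==> jet L d (%w. c * f w + k * g w) X = c * jet L d f X + k * jet L d g X"
 by (simp add: jet_add[OF smooth_scale smooth_scale] jet_scale)

lemma cross_rate_scale: "cross_rate p (c * k) q (c * l) w = c * cross_rate p k q l w"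
 and self_rate_scale: "self_rate p (c * k) w = c * self_rate p k w" by (simp_all add: cross_rate_def self_rate_def algebra_simps add_divide_distrib)

lemma smooth_fst_snd: "smooth fst (w :: complex * complex)" "smooth snd (w :: complex * complex)"
 "smooth (%w. cnj (fst w)) (w :: complex * complex)" "smooth (%w. cnj (snd w)) (w :: complex * complex)" by (intro smooth_fst smooth_snd smooth_cnj)+

lemma smooth_cross_rate:
 assumes "u ~= p" "v ~= q" "u ~= cnj v" "u ~= v"
 shows "smooth (cross_rate p k q l) (u, v)"
 unfolding cross_rate_def[abs_def] by (intro smooth.add smooth.mult smooth_divide smooth_diff smooth.const smooth_fst_snd) (use assms in auto)

lemma smooth_self_rate:
 assumes "u ~= p" "v ~= p" "u ~= cnj v" "2 * p - u - v ~= 0"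
 shows "smooth (self_rate p k) (u, v)"
 unfolding self_rate_def[abs_def] by (intro smooth.add smooth.mult smooth_divide smooth_diff smooth.const smooth_fst_snd) (use assms in auto)

section \<open>Evaluation of the combined rates by partial fractions\<close>

context
 fixes z :: complex
begin

text \<open>Minus the covariance of the first z-derivative of the field at z with the field at u,
  since twice the Green function has z-derivative 1/(z - cnj u) - 1/(z - u). Likewise
  \<open>ward_b\<close> is the covariance of the second z-derivative.\<close>

definition ward_a :: "complex => complex" where
 "ward_a u = 1 / (z - u) - 1 / (z - cnj u)"

definition ward_b :: "complex => complex" where
 "ward_b u = 1 / (z - u)\<^sup>2 - 1 / (z - cnj u)\<^sup>2"

text \<open>Oriented for rewriting: all poles in B - A are collected on the factor 1/B, where they
  cancel in the sums below.\<close>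

lemma partial_fractions:
 assumes "A ~= 0" "B ~= 0" "A ~= (B :: complex)"
 shows "1 / A * (1 / (B - A)) = 1 / A * (1 / B) + 1 / B * (1 / (B - A))"
proof -
 have "B - A ~= 0" using assms by simp
 thus ?thesis using assms by (simp add: divide_simps)
qed

text \<open>Conjugation moves the pole of the second field back to z, so only A, B and their
  reflections A', B' occur. The poles at coinciding or reflected points cancel, and what is left
  factors.\<close>

lemma cross_rate_total:
 assumes "u ~= z" "v ~= z" "cnj u ~= z" "cnj v ~= z" "u ~= v" "u ~= cnj v"
 shows "cross_rate z 1 z 1 (u, v) + cnj (cross_rate (cnj z) 1 (cnj z) 1 (u, v)) = - ward_a u * ward_a v"
proof -
 define A B A' B' where d: "A = z - u" "B = z - v" "A' = z - cnj u" "B' = z - cnj v"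
 have n: "A ~= 0" "B ~= 0" "A' ~= 0" "B' ~= 0" "A ~= B" "A' ~= B'" "A ~= B'" "A' ~= B" using assms by (auto simp: d)
 have e: "u - cnj v = B' - A" "u - v = B - A" "cnj u - v = B - A'" "cnj u - cnj v = B' - A'" by (simp_all add: d)
 have "cross_rate z 1 z 1 (u, v) + cnj (cross_rate (cnj z) 1 (cnj z) 1 (u, v)) =
   1 / A * (1 / (B' - A)) - 1 / A * (1 / (B - A)) + 1 / B * (1 / (B - A)) - 1 / B * (1 / (B - A'))
   + (1 / A' * (1 / (B - A')) - 1 / A' * (1 / (B' - A')) + 1 / B' * (1 / (B' - A')) - 1 / B' * (1 / (B' - A)))"
  by (simp only: cross_rate_def fst_conv snd_conv complex_cnj_add complex_cnj_mult complex_cnj_diff complex_cnj_divide complex_cnj_cnj complex_cnj_one complex_cnj_zero complex_cnj_numeral) (simp add: e d(1)[symmetric] d(2)[symmetric] d(3)[symmetric] d(4)[symmetric] right_diff_distrib)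
 also have "\<dots> = - (1 / A - 1 / A') * (1 / B - 1 / B')"
  unfolding partial_fractions[OF n(1,2,5)] partial_fractions[OF n(1,4,7)] partial_fractions[OF n(3,2,8)] partial_fractions[OF n(3,4,6)] by (simp only: minus_diff_eq algebra_simps)
 finally show ?thesis by (simp add: ward_a_def d)
qed

text \<open>The removed singular part - 2 ln |u - v| does not depend on time, so the regular part
  changes at the rate of the full covariance. Hence the product found in
  \<open>cross_rate_total\<close>, now also on the diagonal.\<close>

lemma self_rate_total:
 assumes "u ~= z" "v ~= z" "cnj u ~= z" "cnj v ~= z" "u ~= cnj v" "2 * z - u - v ~= 0" "2 * cnj z - u - v ~= 0"
 shows "self_rate z 1 (u, v) + cnj (self_rate (cnj z) 1 (u, v)) = - ward_a u * ward_a v"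
proof -
 define A B A' B' where d: "A = z - u" "B = z - v" "A' = z - cnj u" "B' = z - cnj v"
 have "cnj (2 * cnj z - u - v) ~= 0" using assms(7) complex_cnj_zero_iff by blast
 moreover have e: "u - cnj v = B' - A" "cnj u - v = B - A'" "2 * z - u - v = A + B" "2 * z - cnj u - cnj v = A' + B'" by (simp_all add: d)
 ultimately have "A + B ~= 0" "A' + B' ~= 0" using assms(6) by (simp_all only: complex_cnj_diff complex_cnj_mult complex_cnj_cnj complex_cnj_numeral not_False_eq_True)
 hence n: "A ~= 0" "B ~= 0" "A' ~= 0" "B' ~= 0" "A + B ~= 0" "A' + B' ~= 0" "A ~= B'" "A' ~= B" using assms by (auto simp: d)
 have s: "(1 / x + 1 / y) / (x + y) = 1 / x * (1 / y)" if "x ~= 0" "y ~= 0" "x + y ~= 0" for x y :: complex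
  using that by (simp add: add_frac_eq add.commute)
 have "self_rate z 1 (u, v) + cnj (self_rate (cnj z) 1 (u, v)) =
   1 / A * (1 / (B' - A)) - 1 / B * (1 / (B - A')) - (1 / A + 1 / B) / (A + B)
   + (1 / A' * (1 / (B - A')) - 1 / B' * (1 / (B' - A)) - (1 / A' + 1 / B') / (A' + B'))"
  by (simp only: self_rate_def fst_conv snd_conv complex_cnj_add complex_cnj_mult complex_cnj_diff complex_cnj_divide complex_cnj_cnj complex_cnj_one complex_cnj_zero complex_cnj_numeral) (simp add: e d(1)[symmetric] d(2)[symmetric] d(3)[symmetric] d(4)[symmetric])
 also have "\<dots> = - (1 / A - 1 / A') * (1 / B - 1 / B')"
  unfolding partial_fractions[OF n(1,4,7)] partial_fractions[OF n(3,2,8)] s[OF n(1,2,5)] s[OF n(3,4,6)] by (simp only: minus_diff_eq algebra_simps)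
 finally show ?thesis by (simp add: ward_a_def d)
qed

text \<open>The vertex point is moved only by the second field, with velocity 1/(cnj z - z), which
  accounts for the extra multiple of \<open>ward_a\<close>. The double poles of
  \<open>ward_b\<close> appear because velocity and covariance are both singular where the other
  point meets z.\<close>

lemma vertex_rate_total:
 assumes "v ~= z" "cnj v ~= z" "z ~= cnj z"
 shows "cross_rate (cnj z) 0 z 1 (z, v) + cnj (cross_rate (cnj z) 1 (cnj z) 1 (z, v)) = ward_b v + ward_a v / (z - cnj z)"
proof -
 define B B' D where d: "B = z - v" "B' = z - cnj v" "D = z - cnj z"
 have "cnj (cnj v) ~= cnj z" "cnj v ~= cnj z" using assms by (simp_all only: complex_cnj_cancel_iff not_False_eq_True)
 hence n: "B ~= 0" "B' ~= 0" "D ~= 0" "D ~= B" "D ~= B'" using assms by (auto simp: d)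
 have e: "cnj z - v = B - D" "cnj z - cnj v = B' - D" by (simp_all add: d)
 have "cross_rate (cnj z) 0 z 1 (z, v) + cnj (cross_rate (cnj z) 1 (cnj z) 1 (z, v)) =
   1 / B * (1 / B) - 1 / B * (1 / (B - D)) + (1 / D * (1 / (B - D)) - 1 / D * (1 / (B' - D)) + 1 / B' * (1 / (B' - D)) - 1 / B' * (1 / B'))"
  by (simp only: cross_rate_def fst_conv snd_conv complex_cnj_add complex_cnj_mult complex_cnj_diff complex_cnj_divide complex_cnj_cnj complex_cnj_one complex_cnj_zero complex_cnj_numeral) (simp add: e d(1)[symmetric] d(2)[symmetric] d(3)[symmetric] right_diff_distrib)
 also have "\<dots> = 1 / B * (1 / B) - 1 / B' * (1 / B') + (1 / B - 1 / B') / D"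
  unfolding partial_fractions[OF n(3,1,4)] partial_fractions[OF n(3,2,5)] by (simp add: algebra_simps diff_divide_distrib)
 finally show ?thesis by (simp add: ward_a_def ward_b_def d power2_eq_square)
qed

text \<open>The constant 3 arises as 1 + 1 + 1: the three summands of \<open>self_rate\<close>
  contribute equally at the vertex.\<close>

lemma vertex_self_rate:
 assumes "z ~= cnj z"
 shows "cnj (self_rate (cnj z) 1 (z, z)) = - 3 / (z - cnj z)\<^sup>2"
proof -
 define D where "D = z - cnj z"
 have n: "D ~= 0" using assms by (simp add: D_def)
 have "cnj (self_rate (cnj z) 1 (z, z)) = 1 / D / (- D) - 1 / D / D - (1 / D + 1 / D) / (2 * D)" by (simp add: self_rate_def D_def)
 also have "\<dots> = - 3 / D\<^sup>2" using n by (simp add: power2_eq_square field_simps)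
 finally show ?thesis by (simp add: D_def)
qed

end

definition sep :: "complex * complex => complex" where
 "sep w = fst w - cnj (snd w)"

definition gap :: "complex * complex => complex" where
 "gap w = fst w - snd w"

lemma bl_sep: "bounded_linear sep" and bl_gap: "bounded_linear gap"
 unfolding sep_def[abs_def] gap_def[abs_def] by (intro bounded_linear_sub bounded_linear_fst bounded_linear_snd bounded_linear_compose[OF bounded_linear_cnj bounded_linear_snd])+

lemma dd_sep: "dd e sep w = fst e - cnj (snd e)" and dd_gap: "dd e gap w = fst e - snd e"
 by (simp_all add: dd_lin bl_sep bl_gap) (simp_all add: sep_def gap_def)

lemma smooth_sep: "smooth sep w" and smooth_gap: "smooth gap w" by (rule smooth.lin[OF bl_sep], rule smooth.lin[OF bl_gap])

lemma dd_one_over: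
 assumes "smooth f x" "f x ~= 0"
 shows "dd e (%w. 1 / f w) x = - dd e f x / (f x)\<^sup>2"
proof -
 have "((%w. 1 / f w) has_derivative (%h. - (inverse (f x) * dd h f x * inverse (f x)))) (at x)"
  using Deriv.has_derivative_inverse[OF assms(2) smooth_has_derivative[OF assms(1)]] by (simp add: inverse_eq_divide)
 from dd_eq[OF this] show ?thesis by (simp add: power2_eq_square divide_inverse mult_ac)
qed

lemma smooth_one_over: "smooth f x ==> f x ~= 0 ==> smooth (%w. 1 / f w) x" by (rule smooth_divide[OF smooth.const])

abbreviation log2 :: "(complex * complex => complex) => complex * complex => complex" where
 "log2 f \<equiv> %w. 2 * of_real (ln (cmod (f w)))"

lemma wirt_log2:
 assumes "smooth f w" "f w ~= 0"
 shows "wirt (- \<i>) L (log2 f) w = (re2 (dd (L 1) f w / f w) - \<i> * re2 (dd (L \<i>) f w / f w)) / 2"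
 by (simp add: wirt_def re2_ln_norm[OF assms])

lemma wirt_kernels:
 "sep w ~= 0 ==> wirt (- \<i>) in1 (log2 sep) w = 1 / sep w"
 "sep w ~= 0 ==> wirt (- \<i>) in2 (log2 sep) w = cnj (- 1 / sep w)"
 "gap w ~= 0 ==> wirt (- \<i>) in1 (log2 gap) w = 1 / gap w"
 "sep w ~= 0 ==> wirt (- \<i>) in1 (%w. 1 / sep w) w = - 1 / (sep w)\<^sup>2"
 "gap w ~= 0 ==> wirt (- \<i>) in1 (%w. 1 / gap w) w = - 1 / (gap w)\<^sup>2"
 "sep w ~= 0 ==> wirt (- \<i>) in1 (%w. cnj (- 1 / sep w)) w = 0"
proof -
 have r: "(re2 (1 / x) - \<i> * re2 (\<i> / x)) / 2 = 1 / x" "(re2 (- 1 / x) - \<i> * re2 (\<i> / x)) / 2 = cnj (- 1 / x)" for x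
  by (simp_all add: re2_def algebra_simps)
 show "wirt (- \<i>) in1 (log2 sep) w = 1 / sep w" if "sep w ~= 0"
  using r(1)[of "sep w"] by (simp only: wirt_log2[OF smooth_sep that] dd_sep fst_conv snd_conv complex_cnj_zero diff_zero)
 show "wirt (- \<i>) in2 (log2 sep) w = cnj (- 1 / sep w)" if "sep w ~= 0"
  using r(2)[of "sep w"] by (simp only: wirt_log2[OF smooth_sep that] dd_sep fst_conv snd_conv complex_cnj_one complex_cnj_i diff_0 minus_minus)
 show "wirt (- \<i>) in1 (log2 gap) w = 1 / gap w" if "gap w ~= 0"
  using r(1)[of "gap w"] by (simp only: wirt_log2[OF smooth_gap that] dd_gap fst_conv snd_conv diff_zero)
 show "wirt (- \<i>) in1 (%w. 1 / sep w) w = - 1 / (sep w)\<^sup>2" if "sep w ~= 0" by (simp add: wirt_def dd_one_over[OF smooth_sep that] dd_sep)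
 show "wirt (- \<i>) in1 (%w. 1 / gap w) w = - 1 / (gap w)\<^sup>2" if "gap w ~= 0" by (simp add: wirt_def dd_one_over[OF smooth_gap that] dd_gap)
 show "wirt (- \<i>) in1 (%w. cnj (- 1 / sep w)) w = 0" if "sep w ~= 0"
 proof -
  have s: "smooth (%w. 1 / sep w) w" by (rule smooth_one_over[OF smooth_sep that])
  have "dd e (%w. cnj (- 1 / sep w)) w = cnj (- 1 * dd e (%w. 1 / sep w) w)" for e
   using dd_cnj[OF smooth_scale[OF s, of "-1"], of e] dd_scale[OF s, of e "-1"] by simp
  thus ?thesis by (simp add: wirt_def dd_one_over[OF smooth_sep that] dd_sep)
 qed
qed

lemma eventually_nonzero:
 assumes "smooth f w" "f w ~= 0"
 shows "near w (%v. f v ~= 0)" using near_isCont[OF smooth_continuous[OF assms(1)] eventually_nhds_in_open[of "- {0}"]] assms(2) by auto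

lemma jet_10: "jet L (1, 0) f = wirt (- \<i>) L f" and jet_20: "jet L (2, 0) f = wirt (- \<i>) L (wirt (- \<i>) L f)"
 by (simp_all add: jet_def numeral_2_eq_2)

lemma pair_expectation_vertex:
 assumes "Im z > 0" "Im x > 0" "x ~= z"
 shows "pair_expectation (factor_at id_chart (1, 0) z) (factor_at id_chart e x) = - jet1 e (ward_a z) x"
  and "pair_expectation (factor_at id_chart (2, 0) z) (factor_at id_chart e x) = jet1 e (ward_b z) x"
proof -
 let ?G = "green2 (%u. u) (%u. u)"
 have id: "(%u::complex. u) analytic_on {u}" for u by (rule analytic_on_ident)
 have nz: "sep (z, x) ~= 0" "gap (z, x) ~= 0" "cnj x ~= z" using assms upper_neq_cnj[of z x] by (auto simp: sep_def gap_def)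
 have ev: "near (z, x) (%w. sep w ~= 0 & gap w ~= 0)"
  using eventually_nonzero[OF smooth_sep nz(1)] eventually_nonzero[OF smooth_gap nz(2)] by eventually_elim simp
 have sG: "smooth ?G (z, x)" using assms by (intro smooth_green2 id) auto
 have sl: "smooth (log2 sep) w" "smooth (log2 gap) w" "smooth (%w. 1 / sep w) w" "smooth (%w. 1 / gap w) w" if "sep w ~= 0 & gap w ~= 0" for w
  using that by (auto intro!: smooth_scale smooth_ln_norm smooth_sep smooth_gap smooth_one_over)
 have w1: "near (z, x) (%w. wirt (- \<i>) in1 ?G w = 1 / sep w - 1 / gap w)"
 proof -
  have "near (z, x) (%w. ?G w = log2 sep w + (- 1) * log2 gap w)"
   using ev by eventually_elim (simp add: green2_def green_def sep_def gap_def norm_divide ln_div)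
  hence "near (z, x) (%w. near w (%w. ?G w = log2 sep w + (- 1) * log2 gap w))" by (simp add: eventually_eventually)
  with ev show ?thesis
  proof eventually_elim
   case (elim w)
   show ?case unfolding wirt_cong[OF elim(2)] wirt_add[OF sl(1)[OF elim(1)] smooth_scale[OF sl(2)[OF elim(1)]]] wirt_scale[OF sl(2)[OF elim(1)]]
    using elim(1) by (simp add: wirt_kernels)
  qed
 qed
 have w2: "near (z, x) (%w. wirt (- \<i>) in1 (wirt (- \<i>) in1 ?G) w = 1 / (gap w)\<^sup>2 - 1 / (sep w)\<^sup>2)"
 proof -
  have "near (z, x) (%w. near w (%w. wirt (- \<i>) in1 ?G w = 1 / sep w + (- 1) * (1 / gap w)))" using w1 by (simp add: eventually_eventually)
  with ev show ?thesis
  proof eventually_elim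
   case (elim w)
   show ?case unfolding wirt_cong[OF elim(2)] wirt_add[OF sl(3)[OF elim(1)] smooth_scale[OF sl(4)[OF elim(1)]]] wirt_scale[OF sl(4)[OF elim(1)]]
    using elim(1) by (simp add: wirt_kernels)
  qed
 qed
 have pe: "pair_expectation (factor_at id_chart (j, 0) z) (factor_at id_chart e x) = jet in2 e (jet in1 (j, 0) ?G) (z, x)" for j
  using pair_expectation_jet[OF id[of z] id[of x], of j 0 "fst e" "snd e"] assms by (simp add: factor_at_def id_chart_def jet_commute[OF sG] del: pair_expectation.simps)
 have sa: "smooth (%w. 1 / sep w - 1 / gap w) (z, x)" "smooth (%w. 1 / (gap w)\<^sup>2 - 1 / (sep w)\<^sup>2) (z, x)"
  by (intro smooth_diff smooth_one_over smooth_power smooth_sep smooth_gap; use nz in simp)+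
 have wa: "smooth (ward_a z) x"
  unfolding ward_a_def[abs_def] by (intro smooth_diff smooth_divide smooth.const smooth_ident smooth_cnj) (use assms nz in auto)
 show "pair_expectation (factor_at id_chart (1, 0) z) (factor_at id_chart e x) = - jet1 e (ward_a z) x"
 proof -
  have "jet in2 e (%w. 1 / sep w - 1 / gap w) (z, x) = jet1 e (%v. (- 1) * ward_a z v) x"
   unfolding jet_slice2[OF sa(1), symmetric] by (simp add: ward_a_def sep_def gap_def)
  thus ?thesis unfolding pe jet_10 jet_cong[OF w1] jet_scale[OF wa] by simp
 qed
 show "pair_expectation (factor_at id_chart (2, 0) z) (factor_at id_chart e x) = jet1 e (ward_b z) x"
 proof -
  have "jet in2 e (%w. 1 / (gap w)\<^sup>2 - 1 / (sep w)\<^sup>2) (z, x) = jet1 e (ward_b z) x"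
   unfolding jet_slice2[OF sa(2), symmetric] by (simp add: ward_b_def[abs_def] sep_def gap_def)
  thus ?thesis unfolding pe jet_20 jet_cong[OF w2] .
 qed
qed

lemma id_good: "Im x > 0 ==> p ~= x ==> good_chart p id_chart x" using moved_good[of p 0 x] by (simp add: moved_0)

lemma reg_jet_vertex:
 assumes "Im z > 0"
 shows "reg_jet p id_chart (1, 0) (0, 0) (z, z) = 1 / (z - cnj z)" "reg_jet p id_chart (0, 0) (1, 0) (z, z) = 1 / (z - cnj z)"
  "reg_jet p id_chart (1, 0) (1, 0) (z, z) = 0"
  "reg_jet p id_chart (2, 0) (0, 0) (z, z) = - 1 / (z - cnj z)\<^sup>2" "reg_jet p id_chart (0, 0) (2, 0) (z, z) = - 1 / (z - cnj z)\<^sup>2"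
proof -
 have zz: "z ~= cnj z" using assms upper_neq_cnj[of z z] by auto
 have nz: "sep (z, z) ~= 0" using zz by (simp add: sep_def)
 have ev: "near (z, z) (%w. sep w ~= 0)" by (rule eventually_nonzero[OF smooth_sep nz])
 have R: "reg_green p id_chart = log2 sep" by (rule ext) (simp add: reg_green_id sep_def)
 have w: "near (z, z) (%w. wirt (- \<i>) in1 (log2 sep) w = 1 / sep w)" "near (z, z) (%w. wirt (- \<i>) in2 (log2 sep) w = cnj (- 1 / sep w))"
  using ev by (eventually_elim, simp add: wirt_kernels)+
 show 1: "reg_jet p id_chart (1, 0) (0, 0) (z, z) = 1 / (z - cnj z)"
  unfolding reg_jet_def R jet_00 jet_10 by (simp add: wirt_kernels nz) (simp add: sep_def)
 show 2: "reg_jet p id_chart (2, 0) (0, 0) (z, z) = - 1 / (z - cnj z)\<^sup>2"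
  unfolding reg_jet_def R jet_00 jet_20 wirt_cong[OF w(1)] by (simp add: wirt_kernels nz) (simp add: sep_def)
 \<comment> \<open>The derivative of ln |u - cnj v| in v is antiholomorphic in u, so the mixed
   derivative vanishes.\<close>
 show "reg_jet p id_chart (1, 0) (1, 0) (z, z) = 0" unfolding reg_jet_def R jet_10 wirt_cong[OF w(2)] by (rule wirt_kernels(6)[OF nz])
 have "good_chart (cnj z) id_chart z" using id_good assms zz by metis
 hence "reg_jet p id_chart d e (z, z) = reg_jet p id_chart e d (z, z)" for d e using reg_jet_commute reg_jet_id[of p "cnj z"] by metis
 thus "reg_jet p id_chart (0, 0) (1, 0) (z, z) = 1 / (z - cnj z)" "reg_jet p id_chart (0, 0) (2, 0) (z, z) = - 1 / (z - cnj z)\<^sup>2"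
  using 1 2 by metis+
qed

text \<open>Site 0, the vertex at z, must not sit at its own pole. It gets the pole cnj z together
  with speed 0, so it does not move.\<close>

definition plus_p :: "complex => nat => complex" where
 "plus_p z i = (if i = 0 then cnj z else z)"

definition plus_k :: "complex => nat => complex" where
 "plus_k k i = (if i = 0 then 0 else k)"

text \<open>The combination of rates of change that belongs to \<open>\<L>\<^sup>+\<close> of the first vector field acting on all
 sites but the first, plus \<open>\<L>\<^sup>-\<close> of the second one acting on all sites.\<close>

definition lie_parts :: "(complex => complex) => (complex => complex) => complex" where
 "lie_parts f g = (f 1 - \<i> * f \<i>) / 2 + (g 1 + \<i> * g \<i>) / 2"

lemma gauss_deriv_lie_parts:
 "lie_parts (%k. gauss_deriv C mu P ls (F k) (m k)) (%k. gauss_deriv C mu P ls (G k) (n k)) =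
  gauss_deriv C mu P ls (%a c. lie_parts (%k. F k a c) (%k. G k a c)) (%a. lie_parts (%k. m k a) (%k. n k a))"
proof -
 let ?d = "gauss_deriv C mu P ls"
 have e: "lie_parts f g = 1 * ((1/2) * f 1 + (- \<i>/2) * f \<i>) + 1 * ((1/2) * g 1 + (\<i>/2) * g \<i>)" for f g
  by (simp add: lie_parts_def diff_divide_distrib add_divide_distrib)
 show ?thesis unfolding e gauss_deriv_linear ..
qed

lemma rate_linear: "cross_rate p k q k w = k * cross_rate p 1 q 1 w" "cross_rate p 0 q k w = k * cross_rate p 0 q 1 w"
 "self_rate p k w = k * self_rate p 1 w"
 using cross_rate_scale[of p k 1 q 1 w] cross_rate_scale[of p k 0 q 1 w] self_rate_scale[of p k 1 w] by (simp_all only: mult_1_right mult_zero_right)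

lemma lie_parts_jet2:
 assumes "smooth y X" "smooth y' X" "!!k w. f k w = k * y w" "!!k w. g k w = k * y' w"
 shows "lie_parts (%k. jet2 d e (%w. re2 (f k w)) X) (%k. jet2 d e (%w. re2 (g k w)) X) = jet2 d e (%w. y w + cnj (y' w)) X"
 unfolding lie_parts_def assms(3,4) by (rule holomorphic_antiholomorphic_parts[where J = "%f. jet2 d e f X", OF jet2_linear assms(1,2)])

lemma lie_parts_jet:
 assumes "smooth y X" "smooth y' X" "!!k w. f k w = k * y w" "!!k w. g k w = k * y' w"
 shows "lie_parts (%k. jet L d (%w. re2 (f k w)) X) (%k. jet L d (%w. re2 (g k w)) X) = jet L d (%w. y w + cnj (y' w)) X"
 unfolding lie_parts_def assms(3,4) by (rule holomorphic_antiholomorphic_parts[where J = "%f. jet L d f X", OF jet_linear assms(1,2)])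

context
 fixes z :: complex and zs :: "complex list"
 assumes up: "ALL u : set (z # zs). Im u > 0" and dist: "distinct (z # zs)"
begin

definition ward_pt :: "nat => complex" where
 "ward_pt i = (z # zs) ! i"

definition rate_total :: "nat * nat * nat => nat * nat * nat => complex" where
 "rate_total a c = lie_parts (%k. site_rate (plus_p z) (plus_k k) ward_pt a c) (%k. site_rate (%_. cnj z) (%_. k) ward_pt a c)"

definition mean_total :: "real => nat * nat * nat => complex" where
 "mean_total b a = lie_parts (%k. site_mean_rate b (plus_p z) (plus_k k) ward_pt a) (%k. site_mean_rate b (%_. cnj z) (%_. k) ward_pt a)"

definition jet_a :: "nat * nat * nat => complex" where
 "jet_a a = jet1 (snd a) (ward_a z) (ward_pt (fst a))"

definition jet_b :: "nat * nat * nat => complex" where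
 "jet_b a = jet1 (snd a) (ward_b z) (ward_pt (fst a))"

lemma symm_rate_total: "symm rate_total" unfolding symm_def
proof (intro allI)
 fix a c
 have "site_rate p k x a c = site_rate p k x c a" for p k x by (cases a; cases c) (simp add: add.commute)
 thus "rate_total a c = rate_total c a" by (simp add: rate_total_def)
qed

lemma ward_pt_0 [simp]: "ward_pt 0 = z" by (simp add: ward_pt_def)

lemma ward_pt_up: "i < Suc (length zs) ==> Im (ward_pt i) > 0" unfolding ward_pt_def by (rule up[rule_format]) (metis length_Cons nth_mem)

lemma ward_pt_eq: "i < Suc (length zs) ==> j < Suc (length zs) ==> ward_pt i = ward_pt j \<longleftrightarrow> i = j"
 unfolding ward_pt_def using nth_eq_iff_index_eq[OF dist] by simp

lemma z_neq_cnj: "z ~= cnj z" using upper_neq_cnj[of z z] up by simp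

lemma ward_pt_neq:
 assumes "0 < i" "i < Suc (length zs)"
 shows "ward_pt i ~= z" "cnj (ward_pt i) ~= z" "ward_pt i ~= cnj z" "cnj (ward_pt i) ~= cnj z"
proof -
 show "ward_pt i ~= z" using ward_pt_eq[of i 0] assms by simp
 thus "cnj (ward_pt i) ~= cnj z" by simp
 show "ward_pt i ~= cnj z" using upper_neq_cnj ward_pt_up[of i] up assms by simp
 thus "cnj (ward_pt i) ~= z" by (metis complex_cnj_cnj)
qed

lemma smooth_ward:
 assumes "u ~= z" "cnj u ~= z"
 shows "smooth (ward_a z) u" "smooth (ward_b z) u"
 unfolding ward_a_def[abs_def] ward_b_def[abs_def] by (intro smooth_diff smooth_divide smooth.const smooth_ident smooth_cnj smooth_power; use assms in auto)+

lemma eventually_distinct_pair: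
 assumes "u ~= z" "v ~= z" "cnj u ~= z" "cnj v ~= z"
 shows "near (u, v) (%w. fst w ~= z & snd w ~= z & cnj (fst w) ~= z & cnj (snd w) ~= z)"
proof -
 have "near y (%x. x ~= z & cnj x ~= z)" if "y ~= z" "cnj y ~= z" for y
 proof -
  have "near y (%x. x : - {z, cnj z})" using that by (intro eventually_nhds_in_open) auto
  thus ?thesis by eventually_elim auto
 qed
 from eventually_fst_nhds[OF this[OF assms(1,3)]] eventually_snd_nhds[OF this[OF assms(2,4)]] show ?thesis by eventually_elim simp
qed

lemma jet2_ward_product:
 assumes "u ~= z" "v ~= z" "cnj u ~= z" "cnj v ~= z"
 shows "jet2 d e (%w. - ward_a z (fst w) * ward_a z (snd w)) (u, v) = - jet1 d (ward_a z) u * jet1 e (ward_a z) v"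
proof -
 have "(%w. - ward_a z (fst w) * ward_a z (snd w)) = (%w. (- 1 * ward_a z (fst w)) * ward_a z (snd w))" by simp
 thus ?thesis
  using jet2_product[OF smooth_scale[OF smooth_ward(1)] smooth_ward(1), of u v d e "- 1"] jet_scale[OF smooth_ward(1), of u "%h. h" d "- 1"] assms by simp
qed

lemma rate_total_entry:
 assumes i: "0 < i" "i < Suc (length zs)" and j: "0 < j" "j < Suc (length zs)"
 shows "rate_total (i, d) (j, e) = - jet_a (i, d) * jet_a (j, e)"
proof -
 have lt: "rate_total (i, d) (j, e) = - jet_a (i, d) * jet_a (j, e)"
  if i: "0 < i" "i < Suc (length zs)" and j: "j < Suc (length zs)" "i < j" for i j d e
 proof -
  let ?u = "ward_pt i" and ?v = "ward_pt j"
  note n = ward_pt_neq[OF i] ward_pt_neq[of j]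
  have uv: "?u ~= ?v" "?u ~= cnj ?v" using ward_pt_eq[of i j] upper_neq_cnj ward_pt_up i j by auto
  have "rate_total (i, d) (j, e) = lie_parts (%k. jet2 d e (%w. re2 (cross_rate z k z k w)) (?u, ?v)) (%k. jet2 d e (%w. re2 (cross_rate (cnj z) k (cnj z) k w)) (?u, ?v))"
   using i j by (simp add: rate_total_def plus_p_def plus_k_def)
  also have "\<dots> = jet2 d e (%w. cross_rate z 1 z 1 w + cnj (cross_rate (cnj z) 1 (cnj z) 1 w)) (?u, ?v)"
   by (rule lie_parts_jet2[OF _ _ rate_linear(1) rate_linear(1)]; rule smooth_cross_rate) (use n uv i j in auto)
  also have "\<dots> = jet2 d e (%w. - ward_a z (fst w) * ward_a z (snd w)) (?u, ?v)"
  proof (rule jet2_cong)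
   have "sep (?u, ?v) ~= 0" "gap (?u, ?v) ~= 0" using uv by (auto simp: sep_def gap_def)
   from eventually_nonzero[OF smooth_sep this(1)] eventually_nonzero[OF smooth_gap this(2)]
   have "near (?u, ?v) (%w. fst w ~= cnj (snd w) & fst w ~= snd w)" by eventually_elim (auto simp: sep_def gap_def)
   moreover have "near (?u, ?v) (%w. fst w ~= z & snd w ~= z & cnj (fst w) ~= z & cnj (snd w) ~= z)"
    by (rule eventually_distinct_pair) (use n i j in auto)
   ultimately show "near (?u, ?v) (%w. cross_rate z 1 z 1 w + cnj (cross_rate (cnj z) 1 (cnj z) 1 w) = - ward_a z (fst w) * ward_a z (snd w))"
   proof eventually_elim
    case (elim w)
    thus ?case using cross_rate_total[of "fst w" z "snd w"] by simp
   qed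
  qed
  also have "\<dots> = - jet_a (i, d) * jet_a (j, e)" unfolding jet_a_def fst_conv snd_conv by (rule jet2_ward_product) (use n i j in auto)
  finally show ?thesis .
 qed
 consider "i < j" | "j < i" | "i = j" by linarith
 thus ?thesis
 proof cases
  case 1 thus ?thesis using lt i j by blast
 next
  case 2
  hence "rate_total (j, e) (i, d) = - jet_a (j, e) * jet_a (i, d)" using lt i j by blast
  moreover have "rate_total (i, d) (j, e) = rate_total (j, e) (i, d)" using symm_rate_total unfolding symm_def by blast
  ultimately show ?thesis by simp
 next
  case 3
  let ?u = "ward_pt i"
  note n = ward_pt_neq[OF i]
  have uu: "?u ~= cnj ?u" using upper_neq_cnj ward_pt_up i by auto
  have self: "lie_parts (%k. jet2 d e (%w. re2 (self_rate z k w)) (?u, ?u)) (%k. jet2 d e (%w. re2 (self_rate (cnj z) k w)) (?u, ?u)) = - jet_a (i, d) * jet_a (i, e)" for d e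
  proof -
   have "lie_parts (%k. jet2 d e (%w. re2 (self_rate z k w)) (?u, ?u)) (%k. jet2 d e (%w. re2 (self_rate (cnj z) k w)) (?u, ?u)) =
     jet2 d e (%w. self_rate z 1 w + cnj (self_rate (cnj z) 1 w)) (?u, ?u)"
    by (rule lie_parts_jet2[OF _ _ rate_linear(3) rate_linear(3)]; rule smooth_self_rate) (use n uu in auto)
   also have "\<dots> = jet2 d e (%w. - ward_a z (fst w) * ward_a z (snd w)) (?u, ?u)"
   proof (rule jet2_cong)
    have s: "smooth (%w. 2 * q - fst w - snd w) (?u, ?u)" for q by (intro smooth_diff smooth.const smooth_fst_snd)
    have "sep (?u, ?u) ~= 0" using uu by (simp add: sep_def)
    from eventually_nonzero[OF smooth_sep this]
    have "near (?u, ?u) (%w. fst w ~= cnj (snd w))" by eventually_elim (simp add: sep_def)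
    moreover have "near (?u, ?u) (%w. fst w ~= z & snd w ~= z & cnj (fst w) ~= z & cnj (snd w) ~= z)"
     by (rule eventually_distinct_pair) (use n in auto)
    moreover have "near (?u, ?u) (%w. 2 * z - fst w - snd w ~= 0)" "near (?u, ?u) (%w. 2 * cnj z - fst w - snd w ~= 0)"
     by (rule eventually_nonzero[OF s], use n in simp)+
    ultimately show "near (?u, ?u) (%w. self_rate z 1 w + cnj (self_rate (cnj z) 1 w) = - ward_a z (fst w) * ward_a z (snd w))"
    proof eventually_elim
     case (elim w)
     thus ?case using self_rate_total[of "fst w" z "snd w"] by simp
    qed
   qed
   also have "\<dots> = - jet_a (i, d) * jet_a (i, e)" unfolding jet_a_def fst_conv snd_conv by (rule jet2_ward_product) (use n in auto)
   finally show ?thesis .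
  qed
  have av: "lie_parts (%k. (f k + f' k) / 2) (%k. (g k + g' k) / 2) = (lie_parts f g + lie_parts f' g') / 2" for f f' g g'
   by (simp add: lie_parts_def field_simps)
  show ?thesis unfolding 3 using j by (simp add: rate_total_def plus_p_def plus_k_def av self[unfolded 3] mult.commute)
 qed
qed

lemma rate_total_vertex:
 assumes j: "0 < j" "j < Suc (length zs)"
 shows "rate_total (0, 0, 0) (j, e) = jet_b (j, e) + jet_a (j, e) / (z - cnj z)"
proof -
 let ?v = "ward_pt j"
 note n = ward_pt_neq[OF j]
 have "rate_total (0, 0, 0) (j, e) = lie_parts (%k. jet2 (0, 0) e (%w. re2 (cross_rate (cnj z) 0 z k w)) (z, ?v)) (%k. jet2 (0, 0) e (%w. re2 (cross_rate (cnj z) k (cnj z) k w)) (z, ?v))"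
  using j by (simp add: rate_total_def plus_p_def plus_k_def)
 also have "\<dots> = jet2 (0, 0) e (%w. cross_rate (cnj z) 0 z 1 w + cnj (cross_rate (cnj z) 1 (cnj z) 1 w)) (z, ?v)"
  by (rule lie_parts_jet2[OF _ _ rate_linear(2) rate_linear(1)]; rule smooth_cross_rate) (use n z_neq_cnj in auto)
 also have "\<dots> = jet1 e (%v. cross_rate (cnj z) 0 z 1 (z, v) + cnj (cross_rate (cnj z) 1 (cnj z) 1 (z, v))) ?v"
 proof -
  have "smooth (%w. cross_rate (cnj z) 0 z 1 w + cnj (cross_rate (cnj z) 1 (cnj z) 1 w)) (z, ?v)"
   by (intro smooth.add smooth_cnj smooth_cross_rate) (use n z_neq_cnj in auto)
  from jet_slice2[OF this] show ?thesis by simp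
 qed
 also have "\<dots> = jet1 e (%v. 1 * ward_b z v + (1 / (z - cnj z)) * ward_a z v) ?v"
 proof (rule jet_cong)
  have "near ?v (%v. v : - {z, cnj z})" using n by (intro eventually_nhds_in_open) auto
  thus "near ?v (%v. cross_rate (cnj z) 0 z 1 (z, v) + cnj (cross_rate (cnj z) 1 (cnj z) 1 (z, v)) = 1 * ward_b z v + (1 / (z - cnj z)) * ward_a z v)"
  proof eventually_elim
   case (elim v)
   hence "v ~= z" "cnj v ~= z" by auto
   thus ?case using vertex_rate_total[of v z] z_neq_cnj by simp
  qed
 qed
 also have "\<dots> = jet_b (j, e) + jet_a (j, e) / (z - cnj z)"
  using jet_linear[OF smooth_ward(2)[OF n(1,2)] smooth_ward(1)[OF n(1,2)], of "%h. h" e 1 "1 / (z - cnj z)"] by (simp add: jet_a_def jet_b_def)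
 finally show ?thesis .
qed

lemma rate_total_vertex_vertex: "rate_total (0, 0, 0) (0, 0, 0) = - 3 / (z - cnj z)\<^sup>2"
proof -
 have "rate_total (0, 0, 0) (0, 0, 0) = lie_parts (%k. re2 (k * 0)) (%k. re2 (k * self_rate (cnj z) 1 (z, z)))"
  using rate_linear(3)[of "cnj z" 0 "(z, z)"] rate_linear(3)[of "cnj z" \<i> "(z, z)"] by (simp add: rate_total_def plus_p_def plus_k_def lie_parts_def)
 also have "\<dots> = cnj (self_rate (cnj z) 1 (z, z))" by (simp add: lie_parts_def re2_def algebra_simps)
 finally show ?thesis using vertex_self_rate[OF z_neq_cnj] by simp
qed

lemma mean_total_entry:
 shows "0 < i ==> i < Suc (length zs) ==> mean_total b (i, d) = \<i> * of_real b * jet_b (i, d)"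
  and "mean_total b (0, 0, 0) = - \<i> * of_real b / (z - cnj z)\<^sup>2"
proof -
 have r: "of_real b * \<i> * (x - cnj x) = re2 (of_real b * \<i> * x)" for x by (simp add: re2_def algebra_simps)
 show "mean_total b (i, d) = \<i> * of_real b * jet_b (i, d)" if i: "0 < i" "i < Suc (length zs)"
 proof -
  let ?u = "ward_pt i"
  note n = ward_pt_neq[OF i]
  let ?y = "%p u. of_real b * \<i> * (1 / (p - u)\<^sup>2)"
  have sy: "smooth (?y p) ?u" if "?u ~= p" for p
   by (intro smooth_scale smooth_divide smooth_power smooth_diff smooth.const smooth_ident) (use that in auto)
  have "mean_total b (i, d) = lie_parts (%k. jet1 d (%u. re2 (of_real b * \<i> * (k / (z - u)\<^sup>2))) ?u) (%k. jet1 d (%u. re2 (of_real b * \<i> * (k / (cnj z - u)\<^sup>2))) ?u)"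
   using i by (simp only: mean_total_def site_mean_rate.simps plus_p_def plus_k_def r) simp
  also have "\<dots> = jet1 d (%u. ?y z u + cnj (?y (cnj z) u)) ?u" by (rule lie_parts_jet[OF sy sy]) (use n in simp_all)
  also have "(%u. ?y z u + cnj (?y (cnj z) u)) = (%u. (\<i> * of_real b) * ward_b z u)" by (rule ext) (simp add: ward_b_def algebra_simps)
  also have "jet1 d (%u. (\<i> * of_real b) * ward_b z u) ?u = \<i> * of_real b * jet_b (i, d)"
   using jet_scale[OF smooth_ward(2)[OF n(1,2)], of "%h. h" d "\<i> * of_real b"] by (simp add: jet_b_def)
  finally show ?thesis .
 qed
 have c: "cnj ((cnj z - z)\<^sup>2) = (z - cnj z)\<^sup>2" by (simp add: power2_commute)
 show "mean_total b (0, 0, 0) = - \<i> * of_real b / (z - cnj z)\<^sup>2"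
  by (simp add: mean_total_def lie_parts_def plus_p_def plus_k_def c) (simp add: field_simps)
qed

end

section \<open>The Ward identity for strings of normal-ordered fields\<close>

lemma site_labels_Cons: "site_labels ((al, D) # ms) = image_mset (Pair 0) D + site_labels ((al, {#}) # ms)"
 using tags_append_Cons[of "[]" D "map snd ms"] by (simp add: site_labels_def)

definition tail_exps :: "monomials => (complex * nat * nat * nat) list" where
 "tail_exps ms = map (%i. (fst (ms ! i), (Suc i, (0, 0)))) [0..<length ms]"

lemma upt_Suc_map: "[0..<Suc n] = 0 # map Suc [0..<n]" by (simp add: upt_conv_Cons map_Suc_upt del: upt_Suc)

lemma site_exps_Cons: "site_exps ((al, D) # ms) = (al, (0, (0, 0))) # tail_exps ms"
proof -
 have 1: "concat (map (%i. [f i]) xs) = map f xs" for f :: "nat => complex * nat * nat * nat" and xs by (induction xs) auto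
 have "site_exps ((al, D) # ms) = concat (map (%i. [(fst (((al, D) # ms) ! i), (i, (0, 0)))]) [0..<Suc (length ms)])"
  unfolding site_exps_def tagged_exps_def by (intro arg_cong[of _ _ concat] map_cong) (auto simp: nth_Cons' simp del: upt_Suc)
 thus ?thesis unfolding 1 upt_Suc_map by (simp add: tail_exps_def comp_def)
qed

text \<open>The covariances and rates of the sites satisfy the hypotheses of
  \<open>ward_gauss\<close>. The left-hand side is the form that the second z-derivative of the
  vertex correlation takes in \<open>normal_second_derivative\<close>.\<close>

lemma ward_sites:
 fixes a b :: real
 assumes up: "ALL u : set (z # zs). Im u > 0" and dist: "distinct (z # zs)" and ab: "2 * a * (a + b) = 1"
  and len: "length ms = length zs"
 defines "al \<equiv> \<i> * of_real a"
 shows "al\<^sup>2 * corr (site_string b (%_. cnj z) (%_. 0) (ward_pt z zs) 0 ((al, {#(1, 0), (1, 0)#}) # ms))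
   + al * corr (site_string b (%_. cnj z) (%_. 0) (ward_pt z zs) 0 ((al, {#(2, 0)#}) # ms))
  = 2 * (of_real a)\<^sup>2 * lie_parts
    (%ka. gauss_deriv (site_cov (plus_p z) (plus_k ka) (ward_pt z zs) 0) (site_mean b (plus_p z) (plus_k ka) (ward_pt z zs) 0)
     (site_labels ((al, {#}) # ms)) (site_exps ((al, {#}) # ms)) (site_rate (plus_p z) (plus_k ka) (ward_pt z zs)) (site_mean_rate b (plus_p z) (plus_k ka) (ward_pt z zs)))
    (%ka. gauss_deriv (site_cov (%_. cnj z) (%_. ka) (ward_pt z zs) 0) (site_mean b (%_. cnj z) (%_. ka) (ward_pt z zs) 0)
     (site_labels ((al, {#}) # ms)) (site_exps ((al, {#}) # ms)) (site_rate (%_. cnj z) (%_. ka) (ward_pt z zs)) (site_mean_rate b (%_. cnj z) (%_. ka) (ward_pt z zs)))"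
proof -
 define x where "x = ward_pt z zs"
 define C where "C = site_cov (%_. cnj z) (%_. 0) x 0"
 define P where "P = site_labels ((al, {#}) # ms)"
 define ls where "ls = tail_exps ms"
 define V V1 V2 :: "nat * nat * nat" where v: "V = (0, (0, 0))" "V1 = (0, (1, 0))" "V2 = (0, (2, 0))"
 have zz: "z ~= cnj z" using z_neq_cnj[OF up dist] by blast
 have x0: "x 0 = z" by (simp add: x_def ward_pt_0[OF up dist])
 have cov: "site_cov p k x 0 = C" for p k unfolding C_def by (rule site_cov_0)
 have mean: "site_mean b p k x 0 = (%_. 0)" for p k by (rule ext) (rule site_mean_0)
 have lab: "EX j e. y = (j, e) & 0 < j & j < Suc (length zs)" if "y : set_mset P Un snd ` set ls" for y using that
 proof
  assume "y : set_mset P"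
  thus ?thesis using len by (cases y) (auto simp: P_def site_labels_def set_tags nth_Cons' split: if_splits)
 qed (insert len, auto simp: ls_def tail_exps_def)
 have str: "corr (site_string b (%_. cnj z) (%_. 0) x 0 ((al, D) # ms)) = gauss C (%_. 0) (image_mset (Pair 0) D + P) ((al, V) # ls)" for D
  unfolding corr_sites cov mean site_labels_Cons[of al D] site_exps_Cons P_def ls_def v ..
 have rg: "C V1 V = 1 / (z - cnj z)" "C V1 V1 = 0" "C V2 V = - 1 / (z - cnj z)\<^sup>2"
 proof -
  have zp: "Im z > 0" and av: "(y + y) / 2 = y" for y :: complex using up by simp_all
  show "C V1 V = 1 / (z - cnj z)" "C V1 V1 = 0" "C V2 V = - 1 / (z - cnj z)\<^sup>2"
   by (simp_all only: C_def v site_cov.simps less_irrefl if_False site_chart_0 x0 reg_jet_vertex[OF zp] av)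
 qed
 have main: "al\<^sup>2 * gauss C (%_. 0) (add_mset V1 (add_mset V1 P)) ((al, V) # ls) + al * gauss C (%_. 0) (add_mset V2 P) ((al, V) # ls)
  = 2 * (of_real a)\<^sup>2 * gauss_deriv C (%_. 0) P ((al, V) # ls) (rate_total z zs) (mean_total z zs b)" unfolding al_def
 proof (rule ward_gauss[where ze = "z - cnj z" and A = "jet_a z zs" and B = "jet_b z zs" and b = b])
  show "symm C" unfolding C_def by (rule symm_site_cov)
  show "symm (rate_total z zs)" by (rule symm_rate_total[OF up dist])
  show "rate_total z zs V V = - 3 / (z - cnj z)\<^sup>2" unfolding v by (rule rate_total_vertex_vertex[OF up dist])
  show "mean_total z zs b V = - \<i> * of_real b / (z - cnj z)\<^sup>2" unfolding v by (rule mean_total_entry(2)[OF up dist])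
 next
  fix y assume "y : set_mset P Un snd ` set ls"
  then obtain j e where y: "y = (j, e)" "0 < j" "j < Suc (length zs)" using lab by blast
  have nx: "Im (x j) > 0" "x j ~= z" using ward_pt_up[OF up dist y(3)] ward_pt_neq[OF up dist y(2,3)] by (auto simp: x_def)
  have "Im z > 0" using up by simp
  note pv = pair_expectation_vertex[OF this nx(1,2)]
  have jx: "jet1 e (ward_a z) (x j) = jet_a z zs y" "jet1 e (ward_b z) (x j) = jet_b z zs y"
   by (simp_all add: y x_def jet_a_def[OF up dist] jet_b_def[OF up dist])
  show "C V1 y = - jet_a z zs y & C V2 y = jet_b z zs y & rate_total z zs V y = jet_b z zs y + jet_a z zs y / (z - cnj z) & mean_total z zs b y = \<i> * of_real b * jet_b z zs y"
  proof (intro conjI)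
   show "C V1 y = - jet_a z zs y" "C V2 y = jet_b z zs y" using y pv jx by (simp_all add: C_def v x0)
   show "rate_total z zs V y = jet_b z zs y + jet_a z zs y / (z - cnj z)" unfolding v y(1) by (rule rate_total_vertex[OF up dist y(2,3)])
   show "mean_total z zs b y = \<i> * of_real b * jet_b z zs y" unfolding y(1) by (rule mean_total_entry(1)[OF up dist y(2,3)])
  qed
  fix y' assume "y' : set_mset P Un snd ` set ls"
  then obtain j' e' where y': "y' = (j', e')" "0 < j'" "j' < Suc (length zs)" using lab by blast
  show "rate_total z zs y y' = - jet_a z zs y * jet_a z zs y'" unfolding y(1) y'(1) by (rule rate_total_entry[OF up dist y(2,3) y'(2,3)])
 qed (use ab zz rg in simp_all)
 thus ?thesis unfolding x_def[symmetric] str cov mean gauss_deriv_lie_parts P_def[symmetric] site_exps_Cons ls_def[symmetric] v(1)[symmetric]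
   rate_total_def[OF up dist, folded x_def, abs_def] mean_total_def[OF up dist, folded x_def, abs_def] by (simp add: v)
qed

text \<open>Differentiating the exponential twice brings down two first derivatives or one second
  derivative. Against a single Wick term this is \<open>two_point_wirt\<close>; general strings
  follow by multilinearity after merging Hs, whose nodes stay off a neighbourhood of z.\<close>

lemma normal_second_derivative:
 fixes Hs :: "functional list" and al p z :: complex and b :: real
 assumes Hs: "list_all2 (%F x. F : wick_span {x}) Hs xs" and xs: "distinct xs" "z ~: set xs" and z: "Im z > 0" "p ~= z"
 defines "f \<equiv> %Hs u. corr (normal_field b al {#} p id_chart u # Hs)"
 shows "smooth (f Hs) z & (dz ^^ 2) (f Hs) z =
  al\<^sup>2 * corr (normal_field b al {#(1, 0), (1, 0)#} p id_chart z # Hs) + al * corr (normal_field b al {#(2, 0)#} p id_chart z # Hs)"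
proof -
 define g where "g Hs = al\<^sup>2 * corr (normal_field b al {#(1, 0), (1, 0)#} p id_chart z # Hs) + al * corr (normal_field b al {#(2, 0)#} p id_chart z # Hs)" for Hs
 have gz: "good_chart p id_chart z" by (rule id_good[OF z])
 define good where "good f c \<longleftrightarrow> smooth f z & (dz ^^ 2) f z = c" for f c
 have good_add: "good (%u. f u + f' u) (c + c')" if "good f c" "good f' c'" for f f' c c'
 proof -
  have s: "smooth f z" "smooth f' z" using that by (simp_all add: good_def)
  show ?thesis using that unfolding good_def dz_wirt wirt_pow_add[OF s] by (simp add: smooth.add[OF s])
 qed
 have good_scale: "good (%u. k * f u) (k * c)" if "good f c" for f c k
 proof -
  have s: "smooth f z" using that by (simp add: good_def)
  show ?thesis using that unfolding good_def dz_wirt wirt_pow_scale[OF s] by (simp add: smooth_scale[OF s])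
 qed
 have good_cong: "good f c" if "good f' c" "near z (%u. f u = f' u)" for f f' c
 proof -
  have "near z (%u. f' u = f u)" using that(2) by eventually_elim simp
  from smooth.cong[OF _ this] that(1) show ?thesis unfolding good_def dz_wirt wirt_pow_cong[OF that(2)] by blast
 qed
 have trm: "good (%u. corr [normal_field b al {#} p id_chart u, wick_term Q lq]) (g [wick_term Q lq])"
  if v: "valid_term (- {z}) Q lq" for Q lq
 proof -
  let ?t = "%D. two_point b p id_chart z Q lq al D 0 {#}"
  have ok: "near z (%u. near_ok p id_chart z Q lq u)" by (rule near_ok_eventually[OF gz]) (insert v, simp add: id_chart_def)
  note ok0 = eventually_at_self[OF ok]
  have w1: "near z (%u. wirt1 (- \<i>) (?t {#}) u = al * ?t {#(1, 0)#} u)" using ok by eventually_elim (simp add: two_point_wirt bump_def)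
  have "wirt1 (- \<i>) (wirt1 (- \<i>) (?t {#})) z = al * (al * ?t {#(1, 0), (1, 0)#} z + ?t {#(2, 0)#} z)"
   unfolding wirt_cong[OF w1] wirt_scale[OF two_point_smooth[OF ok0]] by (simp add: two_point_wirt[OF ok0] bump_def numeral_2_eq_2)
  moreover have "smooth (?t {#}) z" by (rule two_point_smooth[OF ok0])
  ultimately show ?thesis unfolding good_def dz_wirt g_def corr_normal_one[where z = z] by (simp add: numeral_2_eq_2 power2_eq_square algebra_simps)
 qed
 have merged: "good (%u. corr [normal_field b al {#} p id_chart u, H]) (g [H])" if "H : wick_span (- {z})" for H using that
 proof induction
  case (tm P ls)
  thus ?case by (rule trm)
 next
  case (add F G)
  have "corr [N, %M. F M + G M] = corr [N, F] + corr [N, G]" if "N : all_span" for N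
   using corr_add[of "[N]" "[]" F G] that wick_span_all[OF add(1)] wick_span_all[OF add(2)] by simp
  thus ?case using good_add[OF add(3,4)] by (simp add: normal_field_all g_def algebra_simps)
 next
  case (scale F k)
  have "corr [N, %M. k * F M] = k * corr [N, F]" for N using corr_scale[of "[N]" k F "[]"] by simp
  thus ?case using good_scale[OF scale(2), of k] by (simp add: g_def algebra_simps)
 qed
 have "length Hs = length xs --> good (f Hs) (g Hs)" if "list_all2 (%F V. F : term_span V) Hs (map (%x. valid_term {x}) xs)" for Hs using that
 proof (induction rule: multilinear_induct)
  case (base ts)
  have ts: "list_all2 (%(P, ls) S. valid_term S P ls) ts (map (%x. {x}) xs)" using base unfolding list_all2_map2 by (rule list_all2_mono) auto
  have dis: "disjoint_sets_list (map (%x. {x}) xs)" using xs by (auto simp: disjoint_sets_list_def nth_eq_iff_index_eq)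
  obtain H where H: "H : wick_span (\<Union>(set (map (%x. {x}) xs)))"
   "!!A. A : wick_span (- set xs) ==> corr (A # term_list ts) = corr [A, H]" using merge_rest[OF ts dis, of "- set xs" 0] by auto
  have "wick_span S <= wick_span T" if "S <= T" for S T
  proof
   fix F assume "F : wick_span S"
   have "valid_factor S q ==> valid_factor T q" for q using \<open>S <= T\<close> by (cases q) auto
   thus "F : wick_span T" by (intro term_span_mono[OF _ \<open>F : wick_span S\<close>]) (auto simp: valid_term_def)
  qed note mono = this
  have "H : wick_span (- {z})" using H(1) mono[of "\<Union>(set (map (%x. {x}) xs))" "- {z}"] xs by auto
  have N: "normal_field b al D p id_chart u : wick_span (- set xs)" if "Im u > 0" "u ~: set xs" for u D
  proof -
   have "chart_at id_chart u" using id_good[OF that(1), of "cnj u"] upper_neq_cnj[of u u] that(1) by (auto simp: good_chart_def)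
   from normal_field_in_span[OF this, of b al D p] show ?thesis using mono[of "{u}" "- set xs"] that by (auto simp: id_chart_def)
  qed
  have "open ({u. Im u > 0} \<inter> - set xs)" by (intro open_Int open_halfspace_Im_gt open_Compl finite_imp_closed) simp
  from eventually_nhds_in_open[OF this, of z] have "near z (%u. f (term_list ts) u = corr [normal_field b al {#} p id_chart u, H])"
   unfolding f_def using z xs by (auto elim!: eventually_mono intro!: H(2) N)
  moreover have "g (term_list ts) = g [H]" using z xs by (simp add: g_def H(2) N)
  ultimately show ?case using good_cong[OF merged[OF \<open>H : wick_span (- {z})\<close>]] by simp
 next
  case (add As F G Bs)
  have all: "set As <= all_span" "set Bs <= all_span" "F : all_span" "G : all_span"
   using span_list_all[OF add(1)] span_list_all[OF add(2)] by auto
  have "corr (N # As @ (%M. F M + G M) # Bs) = corr (N # As @ F # Bs) + corr (N # As @ G # Bs)" if "N : all_span" for N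
   using corr_add[of "N # As" Bs F G] that all by simp
  thus ?case using add(3,4) good_add[of "f (As @ F # Bs)" "g (As @ F # Bs)" "f (As @ G # Bs)" "g (As @ G # Bs)"]
   by (simp add: f_def g_def normal_field_all algebra_simps)
 next
  case (scale As F c Bs)
  have "corr (N # As @ (%M. c * F M) # Bs) = c * corr (N # As @ F # Bs)" for N using corr_scale[of "N # As" c F Bs] by simp
  thus ?case using scale(2) good_scale[of "f (As @ F # Bs)" "g (As @ F # Bs)" c] by (simp add: f_def g_def algebra_simps)
 qed
 from this[of Hs] show ?thesis using Hs by (simp add: list_all2_map2 list_all2_lengthD good_def g_def f_def)
qed

section \<open>Dependence on germs of charts and evaluation of Lie derivatives\<close>

lemma germ_chart_at:
 assumes "near z (%u. par c u = par c' u & lg c u = lg c' u)" "chart_at c z"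
 shows "chart_at c' z"
proof -
 have e: "near z (%u. par c u = par c' u)" "near z (%u. lg c u = lg c' u)" using assms(1) by (auto elim: eventually_mono)
 have "near z (%u. exp (lg c u) = deriv (par c) u)" using assms(2) by (simp add: chart_at_def)
 moreover have "near z (%u. near u (%u. par c u = par c' u))" using e(1) by (simp add: eventually_eventually)
 ultimately have "near z (%u. exp (lg c' u) = deriv (par c') u)" using e(2) by eventually_elim (simp add: deriv_cong_ev)
 thus ?thesis using assms(2) eventually_at_self[OF e(1)] analytic_at_cong[OF e(1) refl] analytic_at_cong[OF e(2) refl] by (simp add: chart_at_def)
qed

lemma germ_good_chart:
 assumes "near z (%u. par c u = par c' u & lg c u = lg c' u)" "good_chart p c z"
 shows "good_chart p c' z"
proof -
 obtain s where "near z (%u. (p - par c u)\<^sup>2 = (p - u)\<^sup>2 - s)" using assms(2) by (auto simp: good_chart_def)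
 with assms(1) have "near z (%u. (p - par c' u)\<^sup>2 = (p - u)\<^sup>2 - s)" by eventually_elim simp
 thus ?thesis using germ_chart_at[OF assms(1)] assms(2) eventually_at_self[OF assms(1)] unfolding good_chart_def by auto
qed

text \<open>An arbitrary flow is known to agree with the explicit one only near each node.
  Correlations of normal-ordered fields involve derivatives at the node, hence only germs of the
  chart data.\<close>

lemma germ_two_point:
 assumes g: "near z (%u. par c u = par c' u & lg c u = lg c' u)"
 shows "two_point b p c z Q lq al D 0 {#} z = two_point b p c' z Q lq al D 0 {#} z"
proof -
 have "near (z, z) (%w. reg_green p c w = reg_green p c' w)"
  using eventually_fst_nhds[OF g, of z] eventually_snd_nhds[OF g, of z] by eventually_elim (simp add: reg_green_def)
 hence r: "reg_jet p c d e (z, z) = reg_jet p c' d e (z, z)" for d e unfolding reg_jet_def by (rule jet2_cong)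
 have m: "mean_jet b c d z = mean_jet b c' d z" for d unfolding mean_jet_def by (rule jet_cong) (use g in \<open>eventually_elim, simp\<close>)
 have pe: "pair_expectation (factor_at c d z) q = pair_expectation (factor_at c' d z) q" for d q
 proof -
  obtain l n h v where q: "q = Factor l n h v" by (cases q)
  have "near z (%u. (dz ^^ l) ((dzbar ^^ n) (%v. of_real (green (par c u) (h v)))) v = (dz ^^ l) ((dzbar ^^ n) (%v. of_real (green (par c' u) (h v)))) v)"
   using g by eventually_elim simp
  from jet_cong[OF this, of "%h. h" d] show ?thesis by (simp add: q factor_at_def jet_def dz_wirt dzbar_wirt)
 qed
 show ?thesis unfolding two_point_def
 proof (rule gauss_cong[OF symm_two_cov symm_two_cov])
  fix x y show "two_cov p c z z x y = two_cov p c' z z x y" by (cases x; cases y) (simp_all add: r pe)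
  show "two_mean b c z z x = two_mean b c' z z x" by (cases x) (simp_all add: m)
 qed
qed

lemma germ_comb_corr:
 "near z (%u. par c u = par c' u & lg c u = lg c' u) ==> comb_corr b L p c z Q lq = comb_corr b L p c' z Q lq"
 unfolding comb_corr_def by (intro arg_cong[of _ _ sum_list] map_cong refl) (auto simp: germ_two_point)

text \<open>One position is replaced at a time by \<open>corr_replace\<close>, starting from the
  left, while the other positions keep their distinct nodes.\<close>

lemma corr_list_replace:
 assumes len: "length As = length xs" "length Bs = length xs" and xs: "distinct xs"
  and AB: "!!i. i < length xs ==> As ! i : wick_span {xs ! i} & Bs ! i : wick_span {xs ! i} &
   (ALL P ls. valid_term (- {xs ! i}) P ls --> corr [As ! i, wick_term P ls] = corr [Bs ! i, wick_term P ls])"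
 shows "corr As = corr Bs"
proof -
 have "k <= length xs --> corr (take k Bs @ drop k As) = corr As" for k
 proof (induction k)
  case (Suc k)
  show ?case
  proof
   assume k: "Suc k <= length xs"
   define Hs where "Hs = take k Bs @ drop (Suc k) As"
   define ys where "ys = take k xs @ drop (Suc k) xs"
   have xsk: "xs = take k xs @ xs ! k # drop (Suc k) xs" using k by (intro id_take_nth_drop) simp
   have lk: "length (take k Bs) = k" using k len by simp
   have dys: "distinct (take k xs @ xs ! k # drop (Suc k) xs)" using xs by (subst (asm) xsk)
   have "corr (take k Hs @ As ! k # drop k Hs) = corr (take k Hs @ Bs ! k # drop k Hs)"
   proof (rule corr_replace[where Ss = "map (%x. {x}) ys" and x = "xs ! k"])
    show "list_all2 (%F S. F : wick_span S) Hs (map (%x. {x}) ys)"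
     unfolding Hs_def ys_def list_all2_conv_all_nth using AB k len by (auto simp: nth_append)
    have "distinct ys" using dys by (auto simp: ys_def)
    thus "disjoint_sets_list (map (%x. {x}) ys)" by (auto simp: disjoint_sets_list_def nth_eq_iff_index_eq)
    show "xs ! k ~: S" if "S : set (map (%x. {x}) ys)" for S using that dys by (auto simp: ys_def)
    show "k <= length Hs" using lk by (simp add: Hs_def)
   qed (use AB[of k] k in auto)
   moreover have "take k Hs @ As ! k # drop k Hs = take k Bs @ drop k As" using lk k len by (simp add: Hs_def Cons_nth_drop_Suc)
   moreover have "take k Hs @ Bs ! k # drop k Hs = take (Suc k) Bs @ drop (Suc k) As" using lk k len by (simp add: Hs_def take_Suc_conv_app_nth)
   ultimately show "corr (take (Suc k) Bs @ drop (Suc k) As) = corr As" using Suc k by simp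
  qed
 qed simp
 from this[of "length xs"] show ?thesis using len by simp
qed

fun expand_combs :: "normal_comb list => (complex * monomials) list" where
 "expand_combs [] = [(1, [])]"
| "expand_combs (L # Ls) = concat (map (%(k, al, D). map (%(c, ms). (k * c, (al, D) # ms)) (expand_combs Ls)) L)"

lemma length_expand: "(c, ms) : set (expand_combs Ls) ==> length ms = length Ls" by (induction Ls arbitrary: c ms) auto

lemma corr_expand:
 assumes "set As <= all_span"
 shows "corr (As @ map (%i. comb_field b (Ls ! i) (p i) (c i) (x i)) [0..<length Ls]) =
  (SUM (k, ms)<-expand_combs Ls. k * corr (As @ map (%i. normal_field b (fst (ms ! i)) (snd (ms ! i)) (p i) (c i) (x i)) [0..<length ms]))"
 using assms
proof (induction Ls arbitrary: As p c x)
 case (Cons L Ls)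
 let ?p = "%i. p (Suc i)" and ?c = "%i. c (Suc i)" and ?x = "%i. x (Suc i)"
 let ?N = "%ms. map (%i. normal_field b (fst (ms ! i)) (snd (ms ! i)) (?p i) (?c i) (?x i)) [0..<length ms]"
 have "corr (As @ map (%i. comb_field b ((L # Ls) ! i) (p i) (c i) (x i)) [0..<length (L # Ls)]) =
   corr (As @ comb_field b L (p 0) (c 0) (x 0) # map (%i. comb_field b (Ls ! i) (?p i) (?c i) (?x i)) [0..<length Ls])"
  by (simp add: upt_Suc_map comp_def del: upt_Suc)
 also have "\<dots> = (SUM (k, al, D)<-L. k * corr (As @ normal_field b al D (p 0) (c 0) (x 0) # map (%i. comb_field b (Ls ! i) (?p i) (?c i) (?x i)) [0..<length Ls]))"
  by (rule corr_comb_field) (use Cons(2) in \<open>auto intro: comb_field_all\<close>)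
 also have "\<dots> = (SUM (k, al, D)<-L. k * (SUM (k', ms)<-expand_combs Ls. k' * corr (As @ normal_field b al D (p 0) (c 0) (x 0) # ?N ms)))"
 proof -
  have "corr (As @ normal_field b al D (p 0) (c 0) (x 0) # map (%i. comb_field b (Ls ! i) (?p i) (?c i) (?x i)) [0..<length Ls]) =
    (SUM (k', ms)<-expand_combs Ls. k' * corr (As @ normal_field b al D (p 0) (c 0) (x 0) # ?N ms))" for al D
   using Cons(1)[of "As @ [normal_field b al D (p 0) (c 0) (x 0)]" ?p ?c ?x] Cons(2) by (simp add: normal_field_all)
  thus ?thesis by simp
 qed
 also have "\<dots> = (SUM (k, ms)<-expand_combs (L # Ls). k * corr (As @ map (%i. normal_field b (fst (ms ! i)) (snd (ms ! i)) (p i) (c i) (x i)) [0..<length ms]))"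
 proof -
  have "k * (SUM (k', ms)<-E. k' * corr (As @ normal_field b al D (p 0) (c 0) (x 0) # ?N ms)) =
   (SUM (k, ms)<-map (%(c, ms). (k * c, (al, D) # ms)) E. k * corr (As @ map (%i. normal_field b (fst (ms ! i)) (snd (ms ! i)) (p i) (c i) (x i)) [0..<length ms]))"
   for k al D and E :: "(complex * monomials) list" by (induction E) (auto simp: upt_Suc_map comp_def distrib_left simp del: upt_Suc)
  thus ?thesis by (induction L) auto
 qed
 finally show ?case .
qed simp

text \<open>By uniqueness of flows only the derivative D along the explicit flow is needed.\<close>

lemma lie_corr_eval:
 fixes Xs :: "conf_field list" and ys ws :: "complex list"
 assumes k: "cmod k = 1" and len: "length Xs = length ys" "length Ls = length ys" "length Fs = length ws"
  and nf: "!!i. i < length ys ==> normal_form b (Xs ! i) (Ls ! i)"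
  and Fs: "!!i. i < length ws ==> Fs ! i : wick_span {ws ! i}"
  and pts: "distinct (ws @ ys)" "!!y. y : set ys ==> Im y > 0" "p ~: set ys"
  and D: "((%t. corr (Fs @ map (%i. comb_field b (Ls ! i) p (moved p (k * of_real t)) (ys ! i)) [0..<length Ls])) has_vector_derivative D) (at 0)"
 shows "lie_corr (%ze. k * (1 / (p - ze))) Fs (map2 (%X w. (X, id_chart, w)) Xs ys) = D"
proof -
 let ?v = "%ze. k * (1 / (p - ze))" and ?xs = "map2 (%X w. (X, id_chart, w)) Xs ys"
 let ?F = "%psi t. Fs @ map (%(X, c, z). X (flow_chart psi t c) z) ?xs"
 let ?C = "%t. corr (Fs @ map (%i. comb_field b (Ls ! i) p (moved p (k * of_real t)) (ys ! i)) [0..<length Ls])"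
 have nodes: "(%(X, c, z). par c z) ` set ?xs = set ys" using len(1) by (induction Xs ys rule: list_induct2) (auto simp: id_chart_def)
 have ev: "near 0 (%t. corr (?F psi t) = ?C t)" if fl: "local_flow ?v (set ys) psi" for psi
 proof -
  let ?h = "%t y. flow_map p (k * of_real t) y"
  have small: "near (0::real) (%t. small_time p (k * of_real t) y)" and cont: "isCont (%t::real. ?h t y) 0" if "y : set ys" for y
  proof -
   have yp: "y ~= p" using that pts by auto
   have "isCont (%t::real. 1 - 2 * (k * of_real t) / (p - y)\<^sup>2) 0" using yp by (intro continuous_intros) auto
   moreover have "open (- \<real>\<^sub>\<le>\<^sub>0 :: complex set)" by auto
   ultimately have "near (0::real) (%t. 1 - 2 * (k * of_real t) / (p - y)\<^sup>2 : - \<real>\<^sub>\<le>\<^sub>0)"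
    by (intro near_isCont[where f = "%t::real. 1 - 2 * (k * of_real t) / (p - y)\<^sup>2"] eventually_nhds_in_open) auto
   thus "near (0::real) (%t. small_time p (k * of_real t) y)" by eventually_elim (simp add: small_time_def yp)
   have "isCont (%s. flow_map p s y) (k * of_real 0)" using flow_map_deriv(2)[of p 0 y] yp by (auto intro: DERIV_isCont)
   thus "isCont (%t::real. ?h t y) 0" by (rule isCont_o2[rotated]) (intro continuous_intros)
  qed
  \<comment> \<open>Conditions 1 to 5 for small t: the flow is the explicit one near each node, the
    explicit formula stays off its cut, and the moved nodes remain in the half-plane, away from ws
    and mutually distinct.\<close>
  have 1: "near 0 (%t. ALL y:set ys. near y (%u. psi t u = ?h t u))" by (intro eventually_ball_finite ballI flow_unique(1)[OF fl _ k]) auto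
  have 2: "near (0::real) (%t. ALL y:set ys. small_time p (k * of_real t) y)" by (intro eventually_ball_finite ballI small) auto
  have 3: "near (0::real) (%t. ALL y:set ys. Im (?h t y) > 0)"
  proof (intro eventually_ball_finite ballI)
   fix y assume y: "y : set ys"
   have "near (0::real) (%t. ?h t y : {w. Im w > 0})"
    by (rule near_isCont[OF cont[OF y] eventually_nhds_in_open[OF open_halfspace_Im_gt]]) (use pts y in simp)
   thus "near (0::real) (%t. Im (?h t y) > 0)" by simp
  qed simp
  have 4: "near (0::real) (%t. ALL y:set ys. ?h t y : - set ws)"
  proof (intro eventually_ball_finite ballI)
   fix y assume y: "y : set ys"
   show "near (0::real) (%t. ?h t y : - set ws)"
    by (rule near_isCont[OF cont[OF y] eventually_nhds_in_open]) (insert pts y, auto intro!: open_Compl finite_imp_closed)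
  qed simp
  have 5: "near (0::real) (%t. ALL y:set ys. ALL y':set ys. y ~= y' --> ?h t y - ?h t y' : - {0})"
  proof (intro eventually_ball_finite ballI)
   fix y y' assume y: "y : set ys" "y' : set ys"
   show "near (0::real) (%t. y ~= y' --> ?h t y - ?h t y' : - {0})"
   proof (cases "y = y'")
    case False
    have "near (0::real) (%t. ?h t y - ?h t y' : - {0})"
     by (rule near_isCont[where f = "%t::real. ?h t y - ?h t y'", OF isCont_diff[OF cont[OF y(1)] cont[OF y(2)]] eventually_nhds_in_open]) (use False in auto)
    thus ?thesis by eventually_elim simp
   qed simp
  qed simp_all
  show ?thesis using 1 2 3 4 5
  proof eventually_elim
   case (elim t)
   let ?s = "k * of_real t" and ?c = "flow_chart psi t id_chart"
   let ?B = "map (%i. comb_field b (Ls ! i) p (moved p ?s) (ys ! i)) [0..<length Ls]"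
   let ?W = "ws @ map (?h t) ys"
   have germ: "near y (%u. par ?c u = par (moved p ?s) u & lg ?c u = lg (moved p ?s) u)" if y: "y : set ys" for y
   proof -
    have e: "near y (%u. psi t u = ?h t u)" using elim(1) y by blast
    hence "near y (%u. near u (%u. psi t u = ?h t u))" by (simp add: eventually_eventually)
    moreover have "near y (%u. small_time p ?s u)" using small_time_nhds elim(2) y by blast
    ultimately show ?thesis using e
    proof eventually_elim
     case (elim u)
     have d: "deriv (psi t) u = exp (flow_log p ?s u)" using DERIV_imp_deriv[OF flow_map_deriv(1)[OF elim(2)]] elim(1) by (simp add: deriv_cong_ev)
     have nz: "1 - 2 * ?s / (p - u)\<^sup>2 ~= 0" using elim(2) by (auto simp: small_time_def)
     \<comment> \<open>\<open>flow_chart\<close> takes the principal logarithm of the derivative.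
       Since \<open>flow_log\<close> is minus half a principal logarithm, its imaginary part lies in
       the strip where Ln inverts exp, so both charts carry the same branch.\<close>
     have "- pi < Im (flow_log p ?s u)" "Im (flow_log p ?s u) <= pi"
      using mpi_less_Im_Ln[OF nz] Im_Ln_le_pi[OF nz] pi_gt_zero by (simp_all add: flow_log_def)
     hence "Ln (exp (flow_log p ?s u)) = flow_log p ?s u" by (rule Ln_exp)
     thus ?case using elim(3) d by (simp add: flow_chart_def moved_def id_chart_def)
    qed
   qed
   have good: "good_chart p (moved p ?s) y" "par (moved p ?s) y = ?h t y" if "y : set ys" for y
    using moved_good elim(2,3) that by (auto simp: moved_def)
   have "corr (?F psi t) = corr (Fs @ ?B)"
   proof (rule corr_list_replace[where xs = "?W"])
    show "length (?F psi t) = length ?W" "length (Fs @ ?B) = length ?W" using len by simp_all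
    have "inj_on (?h t) (set ys)" using elim(5) by (auto simp: inj_on_def)
    thus "distinct ?W" using pts(1) elim(4) by (auto simp: distinct_map)
    fix i assume i: "i < length ?W"
    show "(?F psi t) ! i : wick_span {?W ! i} & (Fs @ ?B) ! i : wick_span {?W ! i} &
     (ALL P ls. valid_term (- {?W ! i}) P ls --> corr [(?F psi t) ! i, wick_term P ls] = corr [(Fs @ ?B) ! i, wick_term P ls])"
    proof (cases "i < length ws")
     case True
     thus ?thesis using Fs len by (simp add: nth_append)
    next
     case False
     define j where "j = i - length ws"
     have j: "j < length ys" using i False by (simp add: j_def)
     let ?y = "ys ! j"
     have y: "?y : set ys" using j by simp
     note gc = good[OF y]
     have g': "near ?y (%u. par (moved p ?s) u = par ?c u & lg (moved p ?s) u = lg ?c u)" using germ[OF y] by eventually_elim simp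
     have c': "good_chart p ?c ?y" "par ?c ?y = ?h t ?y" using germ_good_chart[OF g' gc(1)] eventually_at_self[OF g'] gc(2) by auto
     have "chart_at ?c ?y" using c' by (simp add: good_chart_def)
     hence "(Xs ! j) ?c ?y : wick_span {par ?c ?y}" using nf[OF j] unfolding normal_form_def by blast
     hence "(Xs ! j) ?c ?y : wick_span {?h t ?y}" unfolding c'(2) .
     moreover have "comb_field b (Ls ! j) p (moved p ?s) ?y : wick_span {?h t ?y}"
      using comb_field_in_span[of "moved p ?s" ?y] gc by (auto simp: good_chart_def)
     moreover have "corr [(Xs ! j) ?c ?y, wick_term P ls] = corr [comb_field b (Ls ! j) p (moved p ?s) ?y, wick_term P ls]"
      if "valid_term (- {?h t ?y}) P ls" for P ls
      using nf[OF j] c' that germ_comb_corr[OF g', of b "Ls ! j" p P ls] by (simp add: normal_form_def corr_comb_field_one)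
     ultimately show ?thesis using False len j by (simp add: nth_append j_def)
    qed
   qed
   thus ?case by simp
  qed
 qed
 have D': "((%t. corr (?F psi t)) has_vector_derivative D) (at 0)" if "local_flow ?v (set ys) psi" for psi
  using has_derivative_cong_nhds[OF ev[OF that]] D unfolding has_vector_derivative_def by blast
 have ex: "local_flow ?v (set ys) (%t. flow_map p (k * of_real t))" by (rule flow_exists) (use pts k in auto)
 show ?thesis unfolding lie_corr_def nodes by (rule the_equality) (use D' ex vector_derivative_unique_at in blast)+
qed

lemma has_vector_derivative_sum_list:
 fixes F :: "'b => real => complex"
 assumes "!!x. x : set xs ==> (F x has_vector_derivative F' x) (at t)"
 shows "((%t. SUM x<-xs. F x t) has_vector_derivative (SUM x<-xs. F' x)) (at t)"
 using assms by (induction xs) (auto intro!: has_vector_derivative_add)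

lemma dz2_sum_list:
 assumes "!!x. x : set xs ==> smooth (F x) z & (dz ^^ 2) (F x) z = F' x"
 shows "smooth (%u. SUM x<-xs. F x u) z & (dz ^^ 2) (%u. SUM x<-xs. F x u) z = (SUM x<-xs. F' x)" using assms
proof (induction xs)
 case Nil
 have "(dz ^^ 2) (%u. 0 * 0) z = 0 * (dz ^^ 2) (%u. 0) z" unfolding dz_wirt by (rule wirt_pow_scale) (rule smooth.const)
 thus ?case by (simp add: smooth.const)
next
 case (Cons x xs)
 have 1: "smooth (F x) z" "(dz ^^ 2) (F x) z = F' x" using Cons(2) by auto
 have 2: "smooth (%u. SUM x<-xs. F x u) z" "(dz ^^ 2) (%u. SUM x<-xs. F x u) z = (SUM x<-xs. F' x)" using Cons(1) Cons(2) by auto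
 have e: "(%u. SUM x<-x # xs. F x u) = (%u. F x u + (SUM x<-xs. F x u))" by simp
 show ?case unfolding e using 1 2 smooth.add[OF 1(1) 2(1)] wirt_pow_add[OF 1(1) 2(1), of 2 "- \<i>" "%h. h"] by (simp add: dz_wirt)
qed

lemma lie_parts_sum_list:
 "lie_parts (%ka. SUM x<-xs. k x * f x ka) (%ka. SUM x<-xs. k x * g x ka) = (SUM x<-xs. k x * lie_parts (f x) (g x))"
 by (induction xs) (simp_all add: lie_parts_def field_simps)

lemma vertex_normal_form: "normal_form b (vertex b al) [(1, al, {#})]" unfolding normal_form_def
proof (intro conjI allI impI)
 \<comment> \<open>This part concerns every chart, whereas \<open>vertex_normal\<close> speaks of
   good charts only; membership is therefore read off the definition of the vertex field.\<close>
 fix c z assume c: "chart_at c z"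
 define k where "k = exp (- 2 * al * of_real b * of_real (Im (lg c z))) * of_real (conf_radius c z) powr (al\<^sup>2)"
 have "wick_exp al (Factor 0 0 (par c) z) : functionals {par c z}" using c chart_at_deriv[OF c] by (intro functionals.exp) (auto simp: chart_at_def)
 hence "(%M. k * wick_exp al (Factor 0 0 (par c) z) M) : functionals {par c z}" by (rule functionals.scale)
 thus "vertex b al c z : wick_span {par c z}" unfolding functionals_eq_wick_span k_def vertex_def[abs_def] .
next
 fix p c z Q lq assume "good_chart p c z"
 thus "corr [vertex b al c z, wick_term Q lq] = comb_corr b [(1, al, {#})] p c z Q lq"
  by (simp add: vertex_normal comb_corr_def corr_normal_one[where z = z])
qed

theorem proposition10p4:
  fixes a b :: real and z :: complex and Xs :: "conf_field list" and zs :: "complex list"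
  assumes "2 * a * (a + b) = 1"
    and "set Xs \<subseteq> ope_family b"
    and "length zs = length Xs"
    and "distinct (z # zs)"
    and "\<forall>u \<in> set (z # zs). Im u > 0"
  shows "1 / (2 * (of_real a)\<^sup>2) *
      (dz ^^ 2) (\<lambda>u. corr (vertex b (\<i> * of_real a) id_chart u
                            # map2 (\<lambda>X w. X id_chart w) Xs zs)) z =
    lie_plus_corr (\<lambda>\<zeta>. 1 / (z - \<zeta>)) [vertex b (\<i> * of_real a) id_chart z]
      (map2 (\<lambda>X w. (X, id_chart, w)) Xs zs) +
    lie_minus_corr (\<lambda>\<zeta>. 1 / (cnj z - \<zeta>)) []
      ((vertex b (\<i> * of_real a), id_chart, z) # map2 (\<lambda>X w. (X, id_chart, w)) Xs zs)"
proof -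
 define al where "al = \<i> * complex_of_real a"
 define n where "n = length zs"
 have up: "Im u > 0" if "u : set (z # zs)" for u using assms(5) that by blast
 have zp: "Im z > 0" by (rule up) simp
 have a0: "a ~= 0" using assms(1) by auto
 \<comment> \<open>The reflected point lies outside the half-plane. So it is an admissible pole for
   all nodes including z, and it also serves as the parameter p of the identity chart.\<close>
 have cz: "cnj z ~: set (z # zs)" using upper_neq_cnj[of _ z] up zp by fastforce
 have "ALL X:set Xs. EX L. normal_form b X L" using assms(2) ope_family_normal_form by blast
 then obtain L where L: "!!X. X : set Xs ==> normal_form b X (L X)" by metis
 define Ls where "Ls = map L Xs"
 have len: "length Xs = n" "length Ls = n" "length zs = n" using assms(3) by (simp_all add: n_def Ls_def)
 have nf: "normal_form b (Xs ! i) (Ls ! i)" if "i < n" for i using L that len by (simp add: Ls_def)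
 define x where "x = ward_pt z zs"
 have x: "x 0 = z" "!!i. x (Suc i) = zs ! i" using assms(4,5) by (simp_all add: x_def ward_pt_def)
 have chart: "chart_at id_chart u" if "Im u > 0" for u using id_good[OF that, of "cnj u"] upper_neq_cnj[of u u] that by (auto simp: good_chart_def)
 let ?N = "%D u. normal_field b al D (cnj z) id_chart u"
 let ?E = "expand_combs Ls"
 let ?R = "%ms. map (%i. normal_field b (fst (ms ! i)) (snd (ms ! i)) (cnj z) id_chart (zs ! i)) [0..<length ms]"
 let ?vs = "map2 (%X w. X id_chart w) Xs zs" and ?xs = "map2 (%X w. (X, id_chart, w)) Xs zs"
 let ?K = "map (%i. comb_field b (Ls ! i) (cnj z) id_chart (zs ! i)) [0..<length Ls]"
 let ?V = "vertex b al id_chart"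
 have vert: "?V u = ?N {#} u" if "Im u > 0" for u by (rule vertex_normal[OF id_good[OF that]]) (use upper_neq_cnj[of u z] that zp in auto)
 have lms: "length (snd e) = n" if "e : set ?E" for e using length_expand[of "fst e" "snd e"] that len by simp
 let ?Q = "%u e. ?N {#} u # ?R (snd e)"
 define M where "M e = (al, {#}) # snd e" for e :: "complex * monomials"

 define W where "W e = al\<^sup>2 * corr (?N {#(1, 0), (1, 0)#} z # ?R (snd e)) + al * corr (?N {#(2, 0)#} z # ?R (snd e))" for e :: "complex * monomials"
 have lhs: "(dz ^^ 2) (%u. corr (?V u # ?vs)) z = (SUM e<-?E. fst e * W e)"
 proof -
  have "open ({u. Im u > 0} \<inter> - set zs)" by (intro open_Int open_halfspace_Im_gt open_Compl finite_imp_closed) simp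
  from eventually_nhds_in_open[OF this, of z] zp assms(4)
  have "near z (%u. Im u > 0 & u ~: set zs)" by (auto elim: eventually_mono)
  \<comment> \<open>The fields are replaced by normal forms for all u near z, since the identity is
    going to be differentiated in u.\<close>
  hence "near z (%u. corr (?V u # ?vs) = (SUM e<-?E. fst e * corr (?Q u e)))"
  proof eventually_elim
   case (elim u)
   have "corr (?V u # ?vs) =
    corr (?N {#} u # ?K)"
   proof (rule corr_list_replace[where xs = "u # zs"])
    fix i assume i: "i < length (u # zs)"
    show "(?V u # ?vs) ! i : wick_span {(u # zs) ! i} &
     (?N {#} u # ?K) ! i : wick_span {(u # zs) ! i} &
     (ALL P ls. valid_term (- {(u # zs) ! i}) P ls --> corr [(?V u # ?vs) ! i, wick_term P ls]
      = corr [(?N {#} u # ?K) ! i, wick_term P ls])"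
    proof (cases i)
     case 0
     thus ?thesis using vert[of u] elim normal_field_in_span[OF chart[of u], of b al "{#}" "cnj z"] by (simp add: id_chart_def)
    next
     case (Suc j)
     hence j: "j < n" "zs ! j : set zs" using i len by auto
     hence w: "Im (zs ! j) > 0" "zs ! j ~= cnj z" using up cz by auto
     have g: "good_chart (cnj z) id_chart (zs ! j)" by (rule id_good) (use w in auto)
     have p: "par id_chart (zs ! j) = zs ! j" by (simp add: id_chart_def)
     have "(Xs ! j) id_chart (zs ! j) : wick_span {zs ! j}" using nf[OF j(1)] chart[OF w(1)] p unfolding normal_form_def by metis
     moreover have "comb_field b (Ls ! j) (cnj z) id_chart (zs ! j) : wick_span {zs ! j}" using comb_field_in_span[OF chart[OF w(1)]] p by metis
     moreover have "corr [(Xs ! j) id_chart (zs ! j), wick_term P ls] = corr [comb_field b (Ls ! j) (cnj z) id_chart (zs ! j), wick_term P ls]"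
      if "valid_term (- {zs ! j}) P ls" for P ls using nf[OF j(1)] g that p unfolding normal_form_def corr_comb_field_one by metis
     ultimately show ?thesis using Suc j len by simp
    qed
   qed (use len elim assms(4) in simp_all)
   also have "\<dots> = (SUM e<-?E. fst e * corr (?Q u e))"
    using corr_expand[of "[?N {#} u]" b Ls "%_. cnj z" "%_. id_chart" "%i. zs ! i"] by (simp add: normal_field_all case_prod_unfold)
   finally show ?case .
  qed
  hence "(dz ^^ 2) (%u. corr (?V u # ?vs)) z = (dz ^^ 2) (%u. SUM e<-?E. fst e * corr (?Q u e)) z" unfolding dz_wirt by (rule wirt_pow_cong)
  also have "\<dots> = (SUM e<-?E. fst e * W e)"
  proof (rule dz2_sum_list[THEN conjunct2])
   fix e assume e: "e : set ?E"
   have "list_all2 (%F w. F : wick_span {w}) (?R (snd e)) zs"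
    unfolding list_all2_conv_all_nth using lms[OF e] len up normal_field_in_span[OF chart] by (auto simp: id_chart_def)
   from normal_second_derivative[OF this _ _ zp, where p = "cnj z" and b = b and al = al]
   have sW: "smooth (%u. corr (?Q u e)) z" "(dz ^^ 2) (%u. corr (?Q u e)) z = W e" using assms(4) cz by (simp_all add: W_def)
   show "smooth (%u. fst e * corr (?Q u e)) z & (dz ^^ 2) (%u. fst e * corr (?Q u e)) z = fst e * W e"
    using smooth_scale[OF sW(1), of "fst e"] wirt_pow_scale[OF sW(1), of 2 "- \<i>" "%h. h" "fst e"] sW(2) unfolding dz_wirt by simp
  qed
  finally show ?thesis .
 qed

 define S where "S p k e = gauss_deriv (site_cov p k x 0) (site_mean b p k x 0) (site_labels (M e)) (site_exps (M e)) (site_rate p k x) (site_mean_rate b p k x)" for p k e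
 let ?X = "%e. lie_parts (%ka. S (plus_p z) (plus_k ka) e) (%ka. S (%_. cnj z) (%_. ka) e)"
 \<comment> \<open>Used twice below: with site 0 frozen for the first Lie derivative and with all
   sites moving for the second.\<close>
 have der: "((%t. SUM e<-?E. fst e * corr (site_string b p k x t (M e))) has_vector_derivative (SUM e<-?E. fst e * S p k e)) (at 0)"
  if p: "!!i. i < Suc n ==> x i ~= p i" for p k
 proof (rule has_vector_derivative_sum_list)
  fix e assume e: "e : set ?E"
  have l: "length (M e) = Suc n" using lms[OF e] by (simp add: M_def)
  have "((%t. corr (site_string b p k x t (M e))) has_vector_derivative S p k e) (at 0)" unfolding S_def
  proof (rule site_derivative)
   fix i assume i: "i < length (M e)"
   show "x i ~= p i & Im (x i) > 0" using p ward_pt_up[OF assms(5,4), of i] i l len by (simp add: x_def)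
   fix j assume "j < length (M e)" "i ~= j"
   thus "x i ~= x j" using ward_pt_eq[OF assms(5,4), of i j] i l len by (simp add: x_def)
  qed
  thus "((%t. fst e * corr (site_string b p k x t (M e))) has_vector_derivative fst e * S p k e) (at 0)" by (rule has_vector_derivative_mult_right)
 qed
 have string: "site_string b p k x t (M e) = normal_field b al {#} (p 0) (site_chart p k t 0) z #
   map (%i. normal_field b (fst (snd e ! i)) (snd (snd e ! i)) (p (Suc i)) (site_chart p k t (Suc i)) (zs ! i)) [0..<length (snd e)]" for p k t e
  by (simp add: site_string_def M_def upt_Suc_map x comp_def del: upt_Suc)

 \<comment> \<open>The vertex field stays among the functionals that are not acted upon; as site 0
   with speed 0 it keeps the identity chart.\<close>
 have plus: "lie_corr (%ze. ka * (1 / (z - ze))) [?V z] ?xs = (SUM e<-?E. fst e * S (plus_p z) (plus_k ka) e)"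
  if ka: "cmod ka = 1" for ka
 proof (rule lie_corr_eval[OF ka, where Ls = Ls and ws = "[z]" and b = b])
  show "length Xs = length zs" "length Ls = length zs" "length [?V z] = length [z]" using len by simp_all
  show "normal_form b (Xs ! i) (Ls ! i)" if "i < length zs" for i using nf that len by simp
  show "[?V z] ! i : wick_span {[z] ! i}" if "i < length [z]" for i
   using that vert[OF zp] normal_field_in_span[OF chart[OF zp], of b al "{#}" "cnj z"] by (simp add: id_chart_def)
  show "distinct ([z] @ zs)" "z ~: set zs" using assms(4) by simp_all
  show "Im y > 0" if "y : set zs" for y using up that by simp
  have "corr ([?V z] @ map (%i. comb_field b (Ls ! i) z (moved z (ka * of_real t)) (zs ! i)) [0..<length Ls]) =
   (SUM e<-?E. fst e * corr (site_string b (plus_p z) (plus_k ka) x t (M e)))" for t :: real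
   using corr_expand[of "[?N {#} z]" b Ls "%_. z" "%_. moved z (ka * of_real t)" "%i. zs ! i"] by (simp add: normal_field_all case_prod_unfold string vert[OF zp] site_chart_def plus_p_def plus_k_def moved_0)
  moreover have "x i ~= plus_p z i" if "i < Suc n" for i
   using that ward_pt_neq(1)[OF assms(5,4), of i] cz x(1) by (cases "i = 0") (auto simp: plus_p_def x_def n_def)
  ultimately show "((%t. corr ([?V z] @ map (%i. comb_field b (Ls ! i) z (moved z (ka * of_real t)) (zs ! i)) [0..<length Ls]))
   has_vector_derivative (SUM e<-?E. fst e * S (plus_p z) (plus_k ka) e)) (at 0)" using der[of "plus_p z" "plus_k ka"] by simp
 qed

 \<comment> \<open>Here the vertex field is moved as well, and it enters the expansion as a normal
   form with a single term.\<close>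
 have minus: "lie_corr (%ze. ka * (1 / (cnj z - ze))) [] ((vertex b al, id_chart, z) # ?xs) = (SUM e<-?E. fst e * S (%_. cnj z) (%_. ka) e)"
  if ka: "cmod ka = 1" for ka
 proof -
  let ?Ls = "[(1, al, {#})] # Ls"
  have "lie_corr (%ze. ka * (1 / (cnj z - ze))) [] (map2 (%X w. (X, id_chart, w)) (vertex b al # Xs) (z # zs)) = (SUM e<-?E. fst e * S (%_. cnj z) (%_. ka) e)"
  proof (rule lie_corr_eval[OF ka, where Ls = ?Ls and ws = "[]" and b = b])
   show "length (vertex b al # Xs) = length (z # zs)" "length ?Ls = length (z # zs)" using len by simp_all
   show "normal_form b ((vertex b al # Xs) ! i) (?Ls ! i)" if "i < length (z # zs)" for i using nf that len vertex_normal_form by (cases i) simp_all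
   show "distinct ([] @ z # zs)" "cnj z ~: set (z # zs)" using assms(4) cz by simp_all
   show "Im y > 0" if "y : set (z # zs)" for y using up that .
   have "corr ([] @ map (%i. comb_field b (?Ls ! i) (cnj z) (moved (cnj z) (ka * of_real t)) ((z # zs) ! i)) [0..<length ?Ls]) =
    (SUM e<-?E. fst e * corr (site_string b (%_. cnj z) (%_. ka) x t (M e)))" for t :: real
   proof -
    have e: "expand_combs ?Ls = map (%e. (fst e, M e)) ?E" by (simp add: M_def case_prod_unfold)
    have s: "site_string b (%_. cnj z) (%_. ka) x t ms = map (%i. normal_field b (fst (ms ! i)) (snd (ms ! i)) (cnj z) (moved (cnj z) (ka * of_real t)) ((z # zs) ! i)) [0..<length ms]" for ms
     using assms(4,5) by (simp add: site_string_def site_chart_def x_def ward_pt_def)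
    show ?thesis using corr_expand[of "[]" b ?Ls "%_. cnj z" "%_. moved (cnj z) (ka * of_real t)" "%i. (z # zs) ! i"]
     unfolding e s by (simp add: comp_def del: expand_combs.simps)
   qed
   moreover have "x i ~= cnj z" if "i < Suc n" for i using that cz assms(4,5) len nth_mem[of i "z # zs"] by (auto simp: x_def ward_pt_def)
   ultimately show "((%t. corr ([] @ map (%i. comb_field b (?Ls ! i) (cnj z) (moved (cnj z) (ka * of_real t)) ((z # zs) ! i)) [0..<length ?Ls]))
    has_vector_derivative (SUM e<-?E. fst e * S (%_. cnj z) (%_. ka) e)) (at 0)" using der[of "%_. cnj z" "%_. ka"] by simp
  qed simp_all
  thus ?thesis by simp
 qed

 \<comment> \<open>Speeds 1 and i give the Lie derivatives along v and i v, from which both parts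
   are formed.\<close>
 have "lie_plus_corr (%ze. 1 / (z - ze)) [?V z] ?xs +
   lie_minus_corr (%ze. 1 / (cnj z - ze)) [] ((vertex b al, id_chart, z) # ?xs)
  = lie_parts (%ka. SUM e<-?E. fst e * S (plus_p z) (plus_k ka) e) (%ka. SUM e<-?E. fst e * S (%_. cnj z) (%_. ka) e)"
  using plus[of 1] plus[of \<i>] minus[of 1] minus[of \<i>] by (simp add: lie_plus_corr_def lie_minus_corr_def lie_parts_def)
 also have "\<dots> = (SUM e<-?E. fst e * ?X e)" by (rule lie_parts_sum_list)
 also have "\<dots> = (SUM e<-?E. 1 / (2 * (of_real a)\<^sup>2) * (fst e * W e))"
 proof (intro arg_cong[of _ _ sum_list] map_cong refl)
  fix e assume e: "e : set ?E"
  have st: "?N D z # ?R (snd e) = site_string b (%_. cnj z) (%_. 0) x 0 ((al, D) # snd e)" for D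
   by (simp add: site_string_def upt_Suc_map x comp_def del: upt_Suc)
  have "W e = 2 * (of_real a)\<^sup>2 * ?X e"
   unfolding W_def st S_def M_def unfolding x_def al_def by (rule ward_sites[OF assms(5,4,1)]) (use lms[OF e] len in simp)
  thus "fst e * ?X e = 1 / (2 * (of_real a)\<^sup>2) * (fst e * W e)" using a0 by simp
 qed
 also have "\<dots> = 1 / (2 * (of_real a)\<^sup>2) * (SUM e<-?E. fst e * W e)" by (rule sum_list_const_mult)
 finally show ?thesis unfolding lhs[symmetric] al_def by simp
qed

end
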